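(* Let $(M,g^\epsilon)$ be a sequence of $n$-dimensional simply-connected Riemannian manifolds with metrics $\{g^\epsilon\}\subset W^{1,p}_{\rm loc}(M;\mathrm{Sym}^2T^*M)$ converging strongly in $W^{1,p}_{\rm loc}$ for $p>n$, and let $g$ be the $W^{1,p}_{\rm loc}$ limit of $\{g^\epsilon\}$. Suppose that there exists a family $\{f^\epsilon\}$ of corresponding isometric immersions of $(M,g^\epsilon)$ into $\mathbb{R}^{n+k}$, converging weakly in $W^{2,p}_{\rm loc}(M;\mathbb{R}^{n+k})$, with second fundamental forms $\{B^\epsilon\}$ and normal connections $\{\nabla^{\perp,\epsilon}\}$. Then, after passing to subsequences, $\{f^\epsilon\}$ converges weakly in $W^{2,p}_{\rm loc}$ to an isometric immersion $\bar f$ of $(M,g)$. Moreover, the second fundamental form $\overline B$ and normal connection $\overline{\nabla^\perp}$ of the immersion $\bar f$ coincide with the corresponding subsequential weak $L^p_{\rm loc}$-limits of $\{B^\epsilon\}$ and $\{\nabla^{\perp,\epsilon}\}$.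
   Context: The underlying manifold $M$ is fixed; only the metric varies, and the limit $g$ is a Riemannian metric on $M$. An isometric immersion $f:(M,g)\to\mathbb{R}^{n+k}$ has everywhere injective differential with $df(X)\cdot df(Y)=g(X,Y)$. With $\overline\nabla$ the flat Euclidean connection and $\nabla$ the Levi-Civita connection of the metric on $M$ (tangent bundle identified with its image), the second fundamental form is $B(X,Y)=\overline\nabla_XY-\nabla_XY$, valued in the normal bundle, and the normal connection $\nabla^\perp_X\xi$ is the normal component of $\overline\nabla_X\xi$ for normal fields $\xi$. $L^p_{\rm loc}$ limits of connections refer to connection coefficients. *)

theory Defs
  imports "HOL-Analysis.Analysis"
begin

section \<open>Functions of class $C^k$ and test functions\<close>

primrec Ck_on :: "nat \<Rightarrow> 'a::euclidean_space set \<Rightarrow> ('a \<Rightarrow> 'b::real_normed_vector) \<Rightarrow> bool" where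
  "Ck_on 0 S f \<longleftrightarrow> continuous_on S f"
| "Ck_on (Suc k) S f \<longleftrightarrow> (\<forall>x\<in>S. f differentiable (at x)) \<and>
     (\<forall>v. Ck_on k S (\<lambda>x. frechet_derivative f (at x) v))"

definition smooth_on :: "'a::euclidean_space set \<Rightarrow> ('a \<Rightarrow> 'b::real_normed_vector) \<Rightarrow> bool" where
  "smooth_on S f \<longleftrightarrow> (\<forall>k. Ck_on k S f)"

definition test_function :: "(real^'n) set \<Rightarrow> (real^'n \<Rightarrow> real) \<Rightarrow> bool" where
  "test_function \<Omega> \<phi> \<longleftrightarrow> smooth_on UNIV \<phi> \<and> (\<exists>K. compact K \<and> K \<subseteq> \<Omega> \<and> (\<forall>x. x \<notin> K \<longrightarrow> \<phi> x = 0))"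


section \<open>Local Lebesgue and Sobolev spaces on open subsets of Euclidean space\<close>

definition Lp_on :: "real \<Rightarrow> (real^'n) set \<Rightarrow> (real^'n \<Rightarrow> 'b::euclidean_space) \<Rightarrow> bool" where
  "Lp_on p K f \<longleftrightarrow> set_borel_measurable lebesgue K f \<and>
     set_integrable lebesgue K (\<lambda>x. norm (f x) powr p)"

definition Lp_loc :: "real \<Rightarrow> (real^'n) set \<Rightarrow> (real^'n \<Rightarrow> 'b::euclidean_space) \<Rightarrow> bool" where
  "Lp_loc p \<Omega> f \<longleftrightarrow> (\<forall>K. compact K \<and> K \<subseteq> \<Omega> \<longrightarrow> Lp_on p K f)"

definition has_weak_pderiv ::
  "(real^'n) set \<Rightarrow> 'n \<Rightarrow> (real^'n \<Rightarrow> 'b::euclidean_space) \<Rightarrow> (real^'n \<Rightarrow> 'b) \<Rightarrow> bool" where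
  "has_weak_pderiv \<Omega> i f h \<longleftrightarrow> Lp_loc 1 \<Omega> f \<and> Lp_loc 1 \<Omega> h \<and>
     (\<forall>\<phi>. test_function \<Omega> \<phi> \<longrightarrow>
        (LINT x:\<Omega>|lebesgue. frechet_derivative \<phi> (at x) (axis i 1) *\<^sub>R f x) =
        - (LINT x:\<Omega>|lebesgue. \<phi> x *\<^sub>R h x))"

(* Weak derivatives are unique only up to null sets; every notion below that uses the chosen
   representative depends on its almost-everywhere class only. *)
definition weak_pderiv ::
  "(real^'n) set \<Rightarrow> 'n \<Rightarrow> (real^'n \<Rightarrow> 'b::euclidean_space) \<Rightarrow> real^'n \<Rightarrow> 'b" where
  "weak_pderiv \<Omega> i f = (SOME h. has_weak_pderiv \<Omega> i f h)"

primrec weak_pderivs ::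
  "(real^'n) set \<Rightarrow> 'n list \<Rightarrow> (real^'n \<Rightarrow> 'b::euclidean_space) \<Rightarrow> real^'n \<Rightarrow> 'b" where
  "weak_pderivs \<Omega> [] f = f"
| "weak_pderivs \<Omega> (i # is) f = weak_pderiv \<Omega> i (weak_pderivs \<Omega> is f)"

definition sobolev_loc ::
  "nat \<Rightarrow> real \<Rightarrow> (real^'n) set \<Rightarrow> (real^'n \<Rightarrow> 'b::euclidean_space) \<Rightarrow> bool" where
  "sobolev_loc k p \<Omega> f \<longleftrightarrow>
     (\<forall>is. length is < k \<longrightarrow> (\<forall>i. \<exists>h. has_weak_pderiv \<Omega> i (weak_pderivs \<Omega> is f) h)) \<and>
     (\<forall>is. length is \<le> k \<longrightarrow> Lp_loc p \<Omega> (weak_pderivs \<Omega> is f))"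

(* In the notions of convergence below, finitely many members of the sequence may lie outside the
   space; this is only needed for sequences that are defined from some index on. *)
definition strong_conv_sobolev_loc ::
  "nat \<Rightarrow> real \<Rightarrow> (real^'n) set \<Rightarrow> (nat \<Rightarrow> real^'n \<Rightarrow> 'b::euclidean_space) \<Rightarrow> (real^'n \<Rightarrow> 'b) \<Rightarrow> bool"
  where
  "strong_conv_sobolev_loc k p \<Omega> f f0 \<longleftrightarrow>
     (\<forall>\<^sub>F j in sequentially. sobolev_loc k p \<Omega> (f j)) \<and> sobolev_loc k p \<Omega> f0 \<and>
     (\<forall>is K. length is \<le> k \<and> compact K \<and> K \<subseteq> \<Omega> \<longrightarrow>
        (\<lambda>j. LINT x:K|lebesgue. norm (weak_pderivs \<Omega> is (f j) x - weak_pderivs \<Omega> is f0 x) powr p)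
          \<longlonglongrightarrow> 0)"

(* The dual of L^p(K), 1 < p < infinity, is L^q(K) with q = p / (p - 1). *)
definition weak_conv_Lp_loc ::
  "real \<Rightarrow> (real^'n) set \<Rightarrow> (nat \<Rightarrow> real^'n \<Rightarrow> 'b::euclidean_space) \<Rightarrow> (real^'n \<Rightarrow> 'b) \<Rightarrow> bool" where
  "weak_conv_Lp_loc p \<Omega> f f0 \<longleftrightarrow>
     (\<forall>\<^sub>F j in sequentially. Lp_loc p \<Omega> (f j)) \<and> Lp_loc p \<Omega> f0 \<and>
     (\<forall>K \<psi>. compact K \<and> K \<subseteq> \<Omega> \<and> Lp_on (p / (p - 1)) K \<psi> \<longrightarrow>
        (\<lambda>j. LINT x:K|lebesgue. f j x \<bullet> \<psi> x) \<longlonglongrightarrow> (LINT x:K|lebesgue. f0 x \<bullet> \<psi> x))"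

definition weak_conv_sobolev_loc ::
  "nat \<Rightarrow> real \<Rightarrow> (real^'n) set \<Rightarrow> (nat \<Rightarrow> real^'n \<Rightarrow> 'b::euclidean_space) \<Rightarrow> (real^'n \<Rightarrow> 'b) \<Rightarrow> bool"
  where
  "weak_conv_sobolev_loc k p \<Omega> f f0 \<longleftrightarrow>
     (\<forall>\<^sub>F j in sequentially. sobolev_loc k p \<Omega> (f j)) \<and> sobolev_loc k p \<Omega> f0 \<and>
     (\<forall>is. length is \<le> k \<longrightarrow>
        weak_conv_Lp_loc p \<Omega> (\<lambda>j. weak_pderivs \<Omega> is (f j)) (weak_pderivs \<Omega> is f0))"


section \<open>Smooth manifolds\<close>

text \<open>The manifold is the whole type \<open>'m\<close>, with the smooth structure given by an atlas. A chart
  is a pair of its domain and its coordinate map.\<close>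

type_synonym ('m, 'n) chart = "'m set \<times> ('m \<Rightarrow> real^'n)"

abbreviation chart_dom :: "('m, 'n::finite) chart \<Rightarrow> 'm set" where
  "chart_dom c \<equiv> fst c"

abbreviation chart_map :: "('m, 'n::finite) chart \<Rightarrow> 'm \<Rightarrow> real^'n" where
  "chart_map c \<equiv> snd c"

definition chart_im :: "('m, 'n::finite) chart \<Rightarrow> (real^'n) set" where
  "chart_im c = chart_map c ` chart_dom c"

definition chart_inv :: "('m, 'n::finite) chart \<Rightarrow> real^'n \<Rightarrow> 'm" where
  "chart_inv c = inv_into (chart_dom c) (chart_map c)"

definition smooth_atlas :: "('m::topological_space, 'n::finite) chart set \<Rightarrow> bool" where
  "smooth_atlas A \<longleftrightarrow>
     (\<Union>c\<in>A. chart_dom c) = UNIV \<and>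
     (\<forall>c\<in>A. open (chart_dom c) \<and> open (chart_im c) \<and>
        homeomorphism (chart_dom c) (chart_im c) (chart_map c) (chart_inv c)) \<and>
     (\<forall>c\<in>A. \<forall>c'\<in>A. smooth_on (chart_map c ` (chart_dom c \<inter> chart_dom c'))
        (chart_map c' \<circ> chart_inv c))"

definition in_chart :: "('m, 'n::finite) chart \<Rightarrow> ('m \<Rightarrow> 'b) \<Rightarrow> real^'n \<Rightarrow> 'b" where
  "in_chart c f = f \<circ> chart_inv c"


section \<open>Riemannian metrics and isometric immersions\<close>

text \<open>A covariant 2-tensor field is given by its coefficient matrices in the charts, subject to the
  transformation law.\<close>

type_synonym ('m, 'n) tensor2 = "('m, 'n) chart \<Rightarrow> real^'n \<Rightarrow> real^'n^'n"

definition tensor_field2 :: "('m, 'n::finite) chart set \<Rightarrow> ('m, 'n) tensor2 \<Rightarrow> bool" where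
  "tensor_field2 A g \<longleftrightarrow>
     (\<forall>c\<in>A. \<forall>c'\<in>A. \<forall>m \<in> chart_dom c \<inter> chart_dom c'.
        let D = frechet_derivative (chart_map c' \<circ> chart_inv c) (at (chart_map c m)) in
        \<forall>u v. u \<bullet> (g c (chart_map c m) *v v) = D u \<bullet> (g c' (chart_map c' m) *v D v))"

(* For p > n, a metric of class W^{1,p}_loc has a unique continuous representative;
   metrics are identified with it, so positivity is required at every point. *)
definition riemannian_metric :: "('m, 'n::finite) chart set \<Rightarrow> ('m, 'n) tensor2 \<Rightarrow> bool" where
  "riemannian_metric A g \<longleftrightarrow> tensor_field2 A g \<and>
     (\<forall>c\<in>A. continuous_on (chart_im c) (g c) \<and>
        (\<forall>x\<in>chart_im c. transpose (g c x) = g c x \<and> (\<forall>v. v \<noteq> 0 \<longrightarrow> v \<bullet> (g c x *v v) > 0)))"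

abbreviation differential :: "(real^'n \<Rightarrow> real^'d) \<Rightarrow> real^'n \<Rightarrow> real^'n \<Rightarrow> real^'d" where
  "differential F x \<equiv> frechet_derivative F (at x)"

(* Maps of class W^{2,p}_loc with p > n are likewise identified with their C^1 representative. *)
definition isometric_immersion ::
  "('m, 'n::finite) chart set \<Rightarrow> ('m, 'n) tensor2 \<Rightarrow> ('m \<Rightarrow> real^'d) \<Rightarrow> bool" where
  "isometric_immersion A g f \<longleftrightarrow>
     (\<forall>c\<in>A. Ck_on 1 (chart_im c) (in_chart c f) \<and>
        (\<forall>x\<in>chart_im c. inj (differential (in_chart c f) x) \<and>
           (\<forall>u v. differential (in_chart c f) x u \<bullet> differential (in_chart c f) x v
                  = u \<bullet> (g c x *v v))))"


section \<open>Connections and second fundamental form in coordinates\<close>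

text \<open>Throughout, \<open>\<Omega>\<close> is the image of a chart (or an open subset of it), \<open>G\<close> the coefficient
  matrix of the metric, \<open>F\<close> the immersion read in the chart, and \<open>X\<close>, \<open>Y\<close> vector fields read in the
  chart. Derivatives are weak.\<close>

definition flat_conn ::
  "(real^'n) set \<Rightarrow> (real^'n \<Rightarrow> real^'n) \<Rightarrow> (real^'n \<Rightarrow> 'b::euclidean_space) \<Rightarrow> real^'n \<Rightarrow> 'b" where
  "flat_conn \<Omega> X V x = (\<Sum>i\<in>UNIV. X x $ i *\<^sub>R weak_pderiv \<Omega> i V x)"

definition christoffel ::
  "(real^'n) set \<Rightarrow> (real^'n \<Rightarrow> real^'n^'n) \<Rightarrow> 'n \<Rightarrow> 'n \<Rightarrow> 'n \<Rightarrow> real^'n \<Rightarrow> real" where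
  "christoffel \<Omega> G k i j x = 1 / 2 * (\<Sum>l\<in>UNIV. matrix_inv (G x) $ k $ l *
     (weak_pderiv \<Omega> i G x $ j $ l + weak_pderiv \<Omega> j G x $ i $ l - weak_pderiv \<Omega> l G x $ i $ j))"

definition levi_civita ::
  "(real^'n) set \<Rightarrow> (real^'n \<Rightarrow> real^'n^'n) \<Rightarrow> (real^'n \<Rightarrow> real^'n) \<Rightarrow> (real^'n \<Rightarrow> real^'n)
     \<Rightarrow> real^'n \<Rightarrow> real^'n" where
  "levi_civita \<Omega> G X Y x = flat_conn \<Omega> X Y x +
     (\<chi> k. \<Sum>i\<in>UNIV. \<Sum>j\<in>UNIV. christoffel \<Omega> G k i j x * X x $ i * Y x $ j)"

definition second_fundamental_form ::
  "(real^'n) set \<Rightarrow> (real^'n \<Rightarrow> real^'n^'n) \<Rightarrow> (real^'n \<Rightarrow> real^'d) \<Rightarrow>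
     (real^'n \<Rightarrow> real^'n) \<Rightarrow> (real^'n \<Rightarrow> real^'n) \<Rightarrow> real^'n \<Rightarrow> real^'d" where
  "second_fundamental_form \<Omega> G F X Y x =
     flat_conn \<Omega> X (\<lambda>y. differential F y (Y y)) x - differential F x (levi_civita \<Omega> G X Y x)"

abbreviation coord_field :: "'n \<Rightarrow> real^'n \<Rightarrow> real^'n" where
  "coord_field i \<equiv> \<lambda>_. axis i 1"

definition normal_space :: "(real^'n \<Rightarrow> real^'d) \<Rightarrow> real^'n \<Rightarrow> (real^'d) set" where
  "normal_space F x = orthogonal_comp (range (differential F x))"

definition normal_component :: "(real^'n \<Rightarrow> real^'d) \<Rightarrow> real^'n \<Rightarrow> real^'d \<Rightarrow> real^'d" where
  "normal_component F x v = (THE w. w \<in> normal_space F x \<and> v - w \<in> range (differential F x))"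

definition normal_conn ::
  "(real^'n) set \<Rightarrow> (real^'n \<Rightarrow> real^'d) \<Rightarrow> (real^'n \<Rightarrow> real^'n) \<Rightarrow> (real^'n \<Rightarrow> real^'d)
     \<Rightarrow> real^'n \<Rightarrow> real^'d" where
  "normal_conn \<Omega> F X \<xi> x = normal_component F x (flat_conn \<Omega> X \<xi> x)"

text \<open>Frames \<open>\<nu> 0, \<dots>, \<nu> (k - 1)\<close> of the normal bundle over an open set \<open>V\<close>, of class
  $W^{1,p}_{\rm loc}$ and continuous; they need not be orthonormal.\<close>

definition normal_frame ::
  "real \<Rightarrow> nat \<Rightarrow> (real^'n) set \<Rightarrow> (real^'n \<Rightarrow> real^'d) \<Rightarrow> (nat \<Rightarrow> real^'n \<Rightarrow> real^'d) \<Rightarrow> bool" where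
  "normal_frame p k V F \<nu> \<longleftrightarrow>
     (\<forall>\<alpha><k. continuous_on V (\<nu> \<alpha>) \<and> sobolev_loc 1 p V (\<nu> \<alpha>)) \<and>
     (\<forall>x\<in>V. inj_on (\<lambda>\<alpha>. \<nu> \<alpha> x) {..<k} \<and> independent ((\<lambda>\<alpha>. \<nu> \<alpha> x) ` {..<k}) \<and>
        span ((\<lambda>\<alpha>. \<nu> \<alpha> x) ` {..<k}) = normal_space F x)"

(* The coefficients kappa of the normal connection in the frame nu, determined by
   nabla^perp_i nu_alpha = (SUM beta. kappa_{i alpha}^beta nu_beta). *)
definition normal_conn_coeff ::
  "nat \<Rightarrow> (real^'n) set \<Rightarrow> (real^'n \<Rightarrow> real^'d) \<Rightarrow> (nat \<Rightarrow> real^'n \<Rightarrow> real^'d) \<Rightarrow>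
     'n \<Rightarrow> nat \<Rightarrow> nat \<Rightarrow> real^'n \<Rightarrow> real" where
  "normal_conn_coeff k V F \<nu> i \<alpha> \<beta> x =
     representation ((\<lambda>\<gamma>. \<nu> \<gamma> x) ` {..<k}) (normal_conn V F (coord_field i) (\<nu> \<alpha>) x) (\<nu> \<beta> x)"


section \<open>Convergence on the manifold\<close>

definition sobolev_loc_map ::
  "nat \<Rightarrow> real \<Rightarrow> ('m, 'n::finite) chart set \<Rightarrow> ('m \<Rightarrow> real^'d) \<Rightarrow> bool" where
  "sobolev_loc_map k p A f \<longleftrightarrow> (\<forall>c\<in>A. sobolev_loc k p (chart_im c) (in_chart c f))"

definition weak_conv_sobolev_loc_map ::
  "nat \<Rightarrow> real \<Rightarrow> ('m, 'n::finite) chart set \<Rightarrow> (nat \<Rightarrow> 'm \<Rightarrow> real^'d) \<Rightarrow> ('m \<Rightarrow> real^'d) \<Rightarrow> bool" where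
  "weak_conv_sobolev_loc_map k p A f f0 \<longleftrightarrow>
     (\<forall>c\<in>A. weak_conv_sobolev_loc k p (chart_im c) (\<lambda>j. in_chart c (f j)) (in_chart c f0))"

definition sobolev_loc_tensor2 ::
  "nat \<Rightarrow> real \<Rightarrow> ('m, 'n::finite) chart set \<Rightarrow> ('m, 'n) tensor2 \<Rightarrow> bool" where
  "sobolev_loc_tensor2 k p A g \<longleftrightarrow> (\<forall>c\<in>A. sobolev_loc k p (chart_im c) (g c))"

definition strong_conv_sobolev_loc_tensor2 ::
  "nat \<Rightarrow> real \<Rightarrow> ('m, 'n::finite) chart set \<Rightarrow> (nat \<Rightarrow> ('m, 'n) tensor2) \<Rightarrow> ('m, 'n) tensor2 \<Rightarrow> bool"
  where
  "strong_conv_sobolev_loc_tensor2 k p A g g0 \<longleftrightarrow>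
     (\<forall>c\<in>A. strong_conv_sobolev_loc k p (chart_im c) (\<lambda>j. g j c) (g0 c))"

definition weak_conv_second_fundamental_forms ::
  "real \<Rightarrow> ('m, 'n::finite) chart set \<Rightarrow> (nat \<Rightarrow> ('m, 'n) tensor2) \<Rightarrow> (nat \<Rightarrow> 'm \<Rightarrow> real^'d) \<Rightarrow>
     ('m, 'n) tensor2 \<Rightarrow> ('m \<Rightarrow> real^'d) \<Rightarrow> bool" where
  "weak_conv_second_fundamental_forms p A g f g0 f0 \<longleftrightarrow>
     (\<forall>c\<in>A. \<forall>a b. weak_conv_Lp_loc p (chart_im c)
        (\<lambda>j. second_fundamental_form (chart_im c) (g j c) (in_chart c (f j))
               (coord_field a) (coord_field b))
        (second_fundamental_form (chart_im c) (g0 c) (in_chart c f0)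
               (coord_field a) (coord_field b)))"

text \<open>The normal bundles vary with the immersion, and connection coefficients depend on the frame.
  Normal frames of \<open>f j\<close> are therefore compared with a normal frame of \<open>f0\<close> to which they converge
  weakly in $W^{1,p}_{\rm loc}$: such frames exist near every point, and for all such frames the
  connection coefficients converge weakly in $L^p_{\rm loc}$ to those of \<open>f0\<close>. Near a given point,
  frames may be available from some index on only.\<close>

definition converging_normal_frames ::
  "real \<Rightarrow> nat \<Rightarrow> (real^'n) set \<Rightarrow> (nat \<Rightarrow> real^'n \<Rightarrow> real^'d) \<Rightarrow> (real^'n \<Rightarrow> real^'d) \<Rightarrow>
     (nat \<Rightarrow> nat \<Rightarrow> real^'n \<Rightarrow> real^'d) \<Rightarrow> (nat \<Rightarrow> real^'n \<Rightarrow> real^'d) \<Rightarrow> bool" where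
  "converging_normal_frames p k V F F0 \<nu> \<nu>0 \<longleftrightarrow>
     (\<forall>\<^sub>F j in sequentially. normal_frame p k V (F j) (\<nu> j)) \<and> normal_frame p k V F0 \<nu>0 \<and>
     (\<forall>\<alpha><k. weak_conv_sobolev_loc 1 p V (\<lambda>j. \<nu> j \<alpha>) (\<nu>0 \<alpha>))"

definition weak_conv_normal_conns ::
  "real \<Rightarrow> nat \<Rightarrow> ('m, 'n::finite) chart set \<Rightarrow> (nat \<Rightarrow> 'm \<Rightarrow> real^'d) \<Rightarrow> ('m \<Rightarrow> real^'d) \<Rightarrow> bool" where
  "weak_conv_normal_conns p k A f f0 \<longleftrightarrow>
     (\<forall>c\<in>A.
        (\<forall>x\<in>chart_im c. \<exists>V \<nu> \<nu>0. open V \<and> x \<in> V \<and> V \<subseteq> chart_im c \<and>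
           converging_normal_frames p k V (\<lambda>j. in_chart c (f j)) (in_chart c f0) \<nu> \<nu>0) \<and>
        (\<forall>V \<nu> \<nu>0. open V \<and> V \<subseteq> chart_im c \<and>
           converging_normal_frames p k V (\<lambda>j. in_chart c (f j)) (in_chart c f0) \<nu> \<nu>0 \<longrightarrow>
           (\<forall>a. \<forall>\<alpha><k. \<forall>\<beta><k. weak_conv_Lp_loc p V
              (\<lambda>j. normal_conn_coeff k V (in_chart c (f j)) (\<nu> j) a \<alpha> \<beta>)
              (normal_conn_coeff k V (in_chart c f0) \<nu>0 a \<alpha> \<beta>))))"

end

theory Submission
  imports Defs
begin

text \<open>Everything happens in one chart, and no subsequence has to be extracted: weak convergence already
  forces the limit. A weakly convergent sequence in $L^p$ is bounded there. For \<open>p > n\<close>, Morrey's estimate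
  makes a sequence of continuous functions bounded in $W^{1,p}$ locally equicontinuous, so that the
  differentials of the immersions, being continuous and weakly convergent in $W^{1,p}$, converge locally
  uniformly. Hence the limit is an isometric immersion. The product of a weakly convergent sequence and a
  locally uniformly convergent one converges weakly to the product of the limits, and the second fundamental
  form and the normal connection coefficients are, up to factors that converge locally uniformly, linear
  in the second derivatives. Normal frames are rows of an adjugate matrix built from the differential and fixed
  complementary vectors; being polynomial in the differential, they are Sobolev functions by the
  product rule.\<close>

subsection \<open>Hoelder's inequality and uniform boundedness\<close>

text \<open>The weak limit in the hypothesis is determined up to null sets only, whereas an
  immersion needs pointwise derivatives. The limit map is therefore redefined as
  \<open>lim (\<lambda>j. f j m)\<close>, a formula that mentions no chart and so gives one map on
  the whole manifold. Weak derivatives are chosen by \<open>SOME\<close>; formulas that involve them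
  hold almost everywhere and are moved between representatives by uniqueness, which is the task of
  the fundamental lemma. The working notion is \<open>cw_conv\<close>: for p > n it is closed under
  products, so everything polynomial in the differential inherits it. Matrix inverses (of the metric
  and of frame matrices) are not polynomial; they enter only as locally uniformly convergent factors
  and are never differentiated. The strict inequality p > n acts through the integrability of
  s^(-n/p) near s = 0 in Morrey's estimate. Injectivity of a differential is not a closed condition;
  for the limit it is recovered from the positivity of \<open>g0\<close>.\<close>

lemma conj_exponent:
  assumes "1 < (p::real)"
  shows "1 < p / (p - 1)" "1 / p + 1 / (p / (p - 1)) = 1" "(p - 1) * (p / (p - 1)) = p"
  using assms by (auto simp: field_simps)

text \<open>The weights 1/p and 1/q are dropped, since this form only serves for integrability and
  for crude error bounds. The sharp weights are kept in the proof of Hoelder's inequality.\<close>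

lemma Youngs_conj:
  assumes "1 < (p::real)" "0 \<le> a" "0 \<le> b"
  shows "a * b \<le> a powr p + b powr (p / (p - 1))"
proof -
  have "a * b \<le> a powr p / p + b powr (p / (p - 1)) / (p / (p - 1))"
    using conj_exponent[OF assms(1)] assms by (intro Youngs_inequality) auto
  also have "\<dots> \<le> a powr p / 1 + b powr (p / (p - 1)) / 1"
    using conj_exponent(1)[OF assms(1)] assms by (intro add_mono divide_left_mono) auto
  finally show ?thesis by simp
qed

lemma integrable_Holder:
  fixes f g :: "'a \<Rightarrow> real"
  assumes p: "1 < p" and [measurable]: "f \<in> borel_measurable M" "g \<in> borel_measurable M"
    and f: "integrable M (\<lambda>x. \<bar>f x\<bar> powr p)" and g: "integrable M (\<lambda>x. \<bar>g x\<bar> powr (p / (p - 1)))"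
  shows "integrable M (\<lambda>x. f x * g x)"
proof (rule Bochner_Integration.integrable_bound)
  show "integrable M (\<lambda>x. \<bar>f x\<bar> powr p + \<bar>g x\<bar> powr (p / (p - 1)))"
    using f g by auto
  show "AE x in M. norm (f x * g x) \<le> norm (\<bar>f x\<bar> powr p + \<bar>g x\<bar> powr (p / (p - 1)))"
    using Youngs_conj[OF p, of "\<bar>f _\<bar>" "\<bar>g _\<bar>"] by (auto simp: abs_mult)
qed measurable

text \<open>Divided by their norms \<open>a\<close> and \<open>b\<close>, the functions satisfy
  Young's inequality pointwise, and its right side integrates to 1/p + 1/q = 1. If a norm vanishes
  this division is impossible, but then the product is 0 almost everywhere.\<close>

lemma Holder_inequality:
  fixes f g :: "'a \<Rightarrow> real"
  assumes p: "1 < p" and q: "q = p / (p - 1)"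
    and [measurable]: "f \<in> borel_measurable M" "g \<in> borel_measurable M"
    and f: "integrable M (\<lambda>x. \<bar>f x\<bar> powr p)" and g: "integrable M (\<lambda>x. \<bar>g x\<bar> powr q)"
  shows "(LINT x|M. \<bar>f x * g x\<bar>) \<le> (LINT x|M. \<bar>f x\<bar> powr p) powr (1 / p) * (LINT x|M. \<bar>g x\<bar> powr q) powr (1 / q)"
proof -
  note qq = conj_exponent[OF p, folded q]
  have q1: "1 < q" and pq: "1 / p + 1 / q = 1" by fact+
  define a where "a = (LINT x|M. \<bar>f x\<bar> powr p) powr (1 / p)"
  define b where "b = (LINT x|M. \<bar>g x\<bar> powr q) powr (1 / q)"
  have ap: "a powr p = (LINT x|M. \<bar>f x\<bar> powr p)" and bq: "b powr q = (LINT x|M. \<bar>g x\<bar> powr q)"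
    using p q1 by (auto simp: a_def b_def powr_powr)
  show ?thesis
  proof (cases "a = 0 \<or> b = 0")
    case True
    have "AE x in M. f x * g x = 0"
    proof (cases "a = 0")
      case True
      then have "(LINT x|M. \<bar>f x\<bar> powr p) = 0" using ap p by simp
      then have "AE x in M. \<bar>f x\<bar> powr p = 0"
        using f by (subst (asm) integral_nonneg_eq_0_iff_AE) auto
      then show ?thesis by auto
    next
      case False
      then have "(LINT x|M. \<bar>g x\<bar> powr q) = 0" using True bq q1 by simp
      then have "AE x in M. \<bar>g x\<bar> powr q = 0"
        using g by (subst (asm) integral_nonneg_eq_0_iff_AE) auto
      then show ?thesis by auto
    qed
    then have "(LINT x|M. \<bar>f x * g x\<bar>) = (LINT x|M. 0)"
      by (intro integral_cong_AE) auto
    then show ?thesis by simp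
  next
    case False
    then have ab: "a > 0" "b > 0" by (auto simp: a_def b_def)
    have "(LINT x|M. \<bar>f x * g x\<bar>) / (a * b) = (LINT x|M. (\<bar>f x\<bar> / a) * (\<bar>g x\<bar> / b))"
      by (simp add: abs_mult field_simps)
    also have "\<dots> \<le> (LINT x|M. \<bar>f x\<bar> powr p / a powr p / p + \<bar>g x\<bar> powr q / b powr q / q)"
    proof (rule integral_mono)
      have "integrable M (\<lambda>x. \<bar>f x * g x\<bar> / (a * b))"
        using integrable_Holder[of p f M g] p f g q by auto
      then show "integrable M (\<lambda>x. (\<bar>f x\<bar> / a) * (\<bar>g x\<bar> / b))"
        by (simp add: abs_mult field_simps)
      show "integrable M (\<lambda>x. \<bar>f x\<bar> powr p / a powr p / p + \<bar>g x\<bar> powr q / b powr q / q)"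
        using f g by auto
      fix x
      show "(\<bar>f x\<bar> / a) * (\<bar>g x\<bar> / b) \<le> \<bar>f x\<bar> powr p / a powr p / p + \<bar>g x\<bar> powr q / b powr q / q"
        using Youngs_inequality[OF p q1 pq, of "\<bar>f x\<bar> / a" "\<bar>g x\<bar> / b"] ab by (simp add: powr_divide)
    qed
    also have "\<dots> = a powr p / a powr p / p + b powr q / b powr q / q"
      using f g by (simp add: ap bq)
    also have "\<dots> = 1" using ab pq by simp
    finally show ?thesis using ab unfolding a_def[symmetric] b_def[symmetric] by (simp add: field_simps)
  qed
qed

text \<open>The integral of extended nonnegative functions commutes with the sum; a finite value
  forces the series to converge almost everywhere, and this is the premise that
  \<open>integrable_suminf\<close> asks for.\<close>

lemma integrable_suminf_nonneg:
  fixes f :: "nat \<Rightarrow> 'a \<Rightarrow> real"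
  assumes [measurable]: "\<And>i. integrable M (f i)" and nn: "\<And>i x. 0 \<le> f i x"
    and s: "summable (\<lambda>i. LINT x|M. f i x)"
  shows "AE x in M. summable (\<lambda>i. f i x)" "integrable M (\<lambda>x. \<Sum>i. f i x)"
proof -
  have [measurable]: "f i \<in> borel_measurable M" for i using assms(1) by auto
  have "(\<integral>\<^sup>+x. (\<Sum>i. ennreal (f i x)) \<partial>M) = (\<Sum>i. \<integral>\<^sup>+x. ennreal (f i x) \<partial>M)"
    by (rule nn_integral_suminf) auto
  also have "\<dots> = (\<Sum>i. ennreal (LINT x|M. f i x))"
    using nn assms(1) by (simp add: nn_integral_eq_integral)
  also have "\<dots> \<noteq> \<infinity>"
    using s nn by (subst suminf_ennreal2) auto
  finally have "AE x in M. (\<Sum>i. ennreal (f i x)) \<noteq> \<infinity>"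
    by (intro nn_integral_PInf_AE) auto
  then show ae: "AE x in M. summable (\<lambda>i. f i x)"
  proof (rule eventually_mono)
    fix x assume "(\<Sum>i. ennreal (f i x)) \<noteq> \<infinity>"
    then show "summable (\<lambda>i. f i x)"
      using nn summable_iff_suminf_neq_top[of "\<lambda>i. f i x"] by (metis infinity_ennreal_def)
  qed
  show "integrable M (\<lambda>x. \<Sum>i. f i x)"
    using assms ae by (intro integrable_suminf) auto
qed


text \<open>The gliding hump argument of Sokal: the signs of the humps are chosen one after the other so that
  the partial sums stay large when tested against the selected members of the sequence, and the
  later humps are too small to destroy this.\<close>

lemma Lp_uniform_boundedness:
  fixes h :: "nat \<Rightarrow> 'a \<Rightarrow> real"
  assumes p: "1 < p" and q: "q = p / (p - 1)"
    and [measurable]: "\<And>j. h j \<in> borel_measurable M"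
    and hp: "\<And>j. integrable M (\<lambda>x. \<bar>h j x\<bar> powr p)"
    and bdd: "\<And>\<psi>. \<psi> \<in> borel_measurable M \<Longrightarrow> integrable M (\<lambda>x. \<bar>\<psi> x\<bar> powr q) \<Longrightarrow>
      \<exists>B. \<forall>j. \<bar>LINT x|M. h j x * \<psi> x\<bar> \<le> B"
  shows "\<exists>C. \<forall>j. (LINT x|M. \<bar>h j x\<bar> powr p) \<le> C"
proof (rule ccontr)
  assume "\<not> ?thesis"
  then have "\<forall>C. \<exists>j. C < (LINT x|M. \<bar>h j x\<bar> powr p)" by (auto simp: not_le)
  \<comment> \<open>The growth rate 4 is chosen against the weights (1/3)^m of the humps below:
    their product (4/3)^m is unbounded.\<close>
  then have "\<forall>m. \<exists>j. (4 ^ m) powr p < (LINT x|M. \<bar>h j x\<bar> powr p)" for m by blast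
  then obtain s where s: "\<And>m. (4 ^ m) powr p < (LINT x|M. \<bar>h (s m) x\<bar> powr p)" by metis
  note qq = conj_exponent[OF p, folded q]
  have q1: "1 < q" and pq: "1 / p + 1 / q = 1" and pq': "(p - 1) * q = p" by fact+
  define H where "H m = h (s m)" for m
  have [measurable]: "H m \<in> borel_measurable M" for m by (simp add: H_def)
  have Hp: "integrable M (\<lambda>x. \<bar>H m x\<bar> powr p)" for m by (simp add: H_def hp)
  define n where "n m = (LINT x|M. \<bar>H m x\<bar> powr p) powr (1 / p)" for m
  have n4: "4 ^ m < n m" for m
  proof -
    have "((4 ^ m) powr p) powr (1 / p) < n m"
      unfolding n_def using s[of m] p by (intro powr_less_mono2) (auto simp: H_def)
    then show ?thesis using p by (simp add: powr_powr)
  qed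
  have n0: "0 < n m" for m using n4[of m] by (smt (verit) zero_less_power)
  have np: "n m powr p = (LINT x|M. \<bar>H m x\<bar> powr p)" for m
    using p by (simp add: n_def powr_powr)
  \<comment> \<open>The norming function of \<open>H m\<close>: its L^q norm is 1, and its pairing
    with \<open>H m\<close> is the L^p norm \<open>n m\<close>.\<close>
  define \<psi> where "\<psi> m x = sgn (H m x) * \<bar>H m x\<bar> powr (p - 1) / n m powr (p - 1)" for m x
  have [measurable]: "\<psi> m \<in> borel_measurable M" for m unfolding \<psi>_def by measurable
  have psiq: "\<bar>\<psi> m x\<bar> powr q = \<bar>H m x\<bar> powr p / n m powr p" for m x
    using p q1 n0[of m] by (auto simp: \<psi>_def abs_mult powr_divide powr_powr pq' abs_sgn_eq)
  have iq: "integrable M (\<lambda>x. \<bar>\<psi> m x\<bar> powr q)" for m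
    unfolding psiq using Hp by auto
  have iq1: "(LINT x|M. \<bar>\<psi> m x\<bar> powr q) = 1" for m
    unfolding psiq using n0[of m] by (simp flip: np)
  have Hpsi: "integrable M (\<lambda>x. H m x * \<psi> i x)" for m i
    using integrable_Holder[OF p, of "H m" M "\<psi> i"] Hp iq by (simp add: q)
  have Hpsi_le: "(LINT x|M. \<bar>H m x * \<psi> i x\<bar>) \<le> n m" for m i
    using Holder_inequality[OF p q _ _ Hp iq, of m i] by (simp add: iq1 n_def)
  have Hpsi_eq: "(LINT x|M. H m x * \<psi> m x) = n m" for m
  proof -
    have "H m x * \<psi> m x = \<bar>H m x\<bar> powr p / n m powr (p - 1)" for x
    proof (cases "H m x = 0")
      case False
      have "H m x * \<psi> m x = \<bar>H m x\<bar> * \<bar>H m x\<bar> powr (p - 1) / n m powr (p - 1)"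
        by (simp add: \<psi>_def abs_sgn)
      also have "\<bar>H m x\<bar> * \<bar>H m x\<bar> powr (p - 1) = \<bar>H m x\<bar> powr p"
        using False by (simp add: powr_mult_base)
      finally show ?thesis .
    qed (use p in \<open>simp add: \<psi>_def\<close>)
    then have "(LINT x|M. H m x * \<psi> m x) = n m powr p / n m powr (p - 1)" by (simp add: np)
    then show ?thesis using n0[of m] by (simp flip: powr_diff)
  qed
  define a where "a m i = (LINT x|M. H m x * \<psi> i x)" for m i
  have a_le: "\<bar>a m i\<bar> \<le> n m" for m i
    unfolding a_def by (rule order_trans[OF integral_abs_bound Hpsi_le])
  have amm: "a m m = n m" for m by (simp add: a_def Hpsi_eq)
  have "\<exists>c::nat \<Rightarrow> real. \<forall>m. \<bar>c m\<bar> = (1/3) ^ m \<and> (1/3) ^ m * n m \<le> \<bar>\<Sum>i\<le>m. c i * a m i\<bar>"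
  proof -
    \<comment> \<open>Each coefficient depends on all earlier ones, so the choice is made on lists:
      \<open>L m\<close> holds the first m coefficients, and every list extends its
      predecessor.\<close>
    have "\<exists>L::nat \<Rightarrow> real list. \<forall>m. length (L m) = m \<and> (\<exists>c. L (Suc m) = L m @ [c] \<and>
       \<bar>c\<bar> = (1/3) ^ m \<and> (1/3) ^ m * n m \<le> \<bar>(\<Sum>i<m. L m ! i * a m i) + c * a m m\<bar>)"
    proof (rule dependent_nat_choice[where P = "\<lambda>m L. length L = m"])
      fix L :: "real list" and m assume L: "length L = m"
      let ?S = "\<Sum>i<m. L ! i * a m i" and ?e = "(1/3::real) ^ m"
      \<comment> \<open>The sign is that of the sum so far, so the new term can only increase the
        absolute value.\<close>
      define c where "c = (if 0 \<le> ?S then ?e else - ?e)"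
      have "0 \<le> ?e * n m" using n0[of m] by simp
      then have "\<bar>c\<bar> = ?e \<and> ?e * n m \<le> \<bar>?S + c * a m m\<bar>"
        unfolding c_def amm by auto
      then show "\<exists>L'. length L' = Suc m \<and> (\<exists>c. L' = L @ [c] \<and>
         \<bar>c\<bar> = ?e \<and> ?e * n m \<le> \<bar>?S + c * a m m\<bar>)"
        using L by (intro exI[of _ "L @ [c]"]) auto
    qed auto
    then obtain L :: "nat \<Rightarrow> real list" where L: "\<And>m. length (L m) = m"
      and L': "\<And>m. \<exists>c. L (Suc m) = L m @ [c] \<and>
       \<bar>c\<bar> = (1/3) ^ m \<and> (1/3) ^ m * n m \<le> \<bar>(\<Sum>i<m. L m ! i * a m i) + c * a m m\<bar>" by blast
    define c where "c m = L (Suc m) ! m" for m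
    have Lc: "i < m \<Longrightarrow> L m ! i = c i" for i m
    proof (induction m)
      case (Suc m)
      show ?case
      proof (cases "i = m")
        case False
        then show ?thesis using Suc L'[of m] L[of m] by (auto simp: nth_append)
      qed (simp add: c_def)
    qed simp
    have "\<bar>c m\<bar> = (1/3) ^ m \<and> (1/3) ^ m * n m \<le> \<bar>\<Sum>i\<le>m. c i * a m i\<bar>" for m
    proof -
      obtain d where d: "L (Suc m) = L m @ [d]"
       "\<bar>d\<bar> = (1/3) ^ m" "(1/3) ^ m * n m \<le> \<bar>(\<Sum>i<m. L m ! i * a m i) + d * a m m\<bar>"
        using L' by blast
      have "d = c m" using d(1) L[of m] by (simp add: c_def nth_append)
      moreover have "(\<Sum>i<m. L m ! i * a m i) = (\<Sum>i<m. c i * a m i)"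
        using Lc by (intro sum.cong) auto
      ultimately show ?thesis using d by (simp flip: lessThan_Suc_atMost)
    qed
    then show ?thesis by blast
  qed
  then obtain c :: "nat \<Rightarrow> real" where c: "\<And>m. \<bar>c m\<bar> = (1/3) ^ m"
    and c_ge: "\<And>m. (1/3) ^ m * n m \<le> \<bar>\<Sum>i\<le>m. c i * a m i\<bar>" by blast
  \<comment> \<open>One integrable function that dominates all terms. Since ((1/2)^i)^q \<le>
    (1/2)^i, each (1/2)^i |\<psi> i| is at most S^(1/q), hence |c i \<psi> i| \<le> (2/3)^i S^(1/q).
    The series thus converges absolutely almost everywhere with sum in L^q, without Minkowski's
    inequality.\<close>
  define S where "S x = (\<Sum>i. (1/2) ^ i * \<bar>\<psi> i x\<bar> powr q)" for x
  have S: "AE x in M. summable (\<lambda>i. (1/2) ^ i * \<bar>\<psi> i x\<bar> powr q)" "integrable M S"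
    unfolding S_def by (rule integrable_suminf_nonneg; use iq in \<open>auto simp: iq1 summable_geometric\<close>)+
  have S': "(2/3) ^ i * S x powr (1 / q) \<ge> \<bar>c i * \<psi> i x\<bar>" and S0: "S x \<ge> 0"
    if "summable (\<lambda>i. (1/2) ^ i * \<bar>\<psi> i x\<bar> powr q)" for i x
  proof -
    have "((1/2) ^ i * \<bar>\<psi> i x\<bar>) powr q = ((1/2) ^ i) powr q * \<bar>\<psi> i x\<bar> powr q"
      by (simp add: powr_mult)
    also have "\<dots> \<le> (1/2) ^ i * \<bar>\<psi> i x\<bar> powr q"
      using q1 powr_mono'[of 1 q "(1/2)^i"] by (intro mult_right_mono) (auto simp: power_le_one)
    also have "\<dots> \<le> S x"
      unfolding S_def using sum_le_suminf[OF that, of "{i}"] by simp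
    finally have *: "((1/2) ^ i * \<bar>\<psi> i x\<bar>) powr q \<le> S x" .
    then show "S x \<ge> 0" using powr_ge_zero order_trans by blast
    have "(((1/2) ^ i * \<bar>\<psi> i x\<bar>) powr q) powr (1 / q) \<le> S x powr (1 / q)"
      using * q1 by (intro powr_mono2) auto
    then have "(1/2) ^ i * \<bar>\<psi> i x\<bar> \<le> S x powr (1 / q)"
      using q1 by (simp add: powr_powr)
    then have "(2/3) ^ i * ((1/2) ^ i * \<bar>\<psi> i x\<bar>) \<le> (2/3) ^ i * S x powr (1 / q)"
      by (intro mult_left_mono) auto
    moreover have "\<bar>c i * \<psi> i x\<bar> = (2/3) ^ i * ((1/2) ^ i * \<bar>\<psi> i x\<bar>)"
      by (simp add: abs_mult c flip: power_mult_distrib mult.assoc)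
    ultimately show "\<bar>c i * \<psi> i x\<bar> \<le> (2/3) ^ i * S x powr (1 / q)" by simp
  qed
  have geo: "summable (\<lambda>i. (2/3) ^ i * S x powr (1 / q))" for x
    by (intro summable_mult2 summable_geometric) auto
  have sumc: "summable (\<lambda>i. \<bar>c i * \<psi> i x\<bar>)"
    if "summable (\<lambda>i. (1/2) ^ i * \<bar>\<psi> i x\<bar> powr q)" for x
    using S'[OF that] by (intro summable_comparison_test'[OF geo]) auto
  define \<Psi> where "\<Psi> x = (\<Sum>i. c i * \<psi> i x)" for x
  have [measurable]: "\<Psi> \<in> borel_measurable M" unfolding \<Psi>_def by measurable
  have "integrable M (\<lambda>x. \<bar>\<Psi> x\<bar> powr q)"
  proof (rule Bochner_Integration.integrable_bound)
    show "integrable M (\<lambda>x. 3 powr q * S x)" using S by auto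
    show "AE x in M. norm (\<bar>\<Psi> x\<bar> powr q) \<le> norm (3 powr q * S x)"
      using S(1)
    proof (rule eventually_mono)
      fix x assume x: "summable (\<lambda>i. (1/2) ^ i * \<bar>\<psi> i x\<bar> powr q)"
      have "\<bar>\<Psi> x\<bar> \<le> (\<Sum>i. \<bar>c i * \<psi> i x\<bar>)"
        unfolding \<Psi>_def using sumc[OF x] by (rule summable_rabs)
      also have "\<dots> \<le> (\<Sum>i. (2/3) ^ i * S x powr (1 / q))"
        by (rule suminf_le) (use S'[OF x] sumc[OF x] geo in auto)
      also have "\<dots> = 3 * S x powr (1 / q)"
        by (subst suminf_mult2[symmetric]) (auto simp: suminf_geometric summable_geometric)
      finally have "\<bar>\<Psi> x\<bar> powr q \<le> (3 * S x powr (1 / q)) powr q"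
        using q1 by (intro powr_mono2) auto
      also have "\<dots> = 3 powr q * S x"
        using q1 S0[OF x] by (simp add: powr_mult powr_powr)
      finally show "norm (\<bar>\<Psi> x\<bar> powr q) \<le> norm (3 powr q * S x)" by simp
    qed
  qed measurable
  then obtain B where B: "\<And>j. \<bar>LINT x|M. h j x * \<Psi> x\<bar> \<le> B" using bdd[of \<Psi>] by auto
  have low: "(1/3) ^ m * n m / 2 \<le> \<bar>LINT x|M. H m x * \<Psi> x\<bar>" for m
  proof -
    have i1: "integrable M (\<lambda>x. c i * (H m x * \<psi> i x))" for i using Hpsi by auto
    have ae: "AE x in M. summable (\<lambda>i. norm (c i * (H m x * \<psi> i x)))"
      using S(1)
    proof (rule eventually_mono)
      fix x assume x: "summable (\<lambda>i. (1/2) ^ i * \<bar>\<psi> i x\<bar> powr q)"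
      show "summable (\<lambda>i. norm (c i * (H m x * \<psi> i x)))"
        using summable_mult[OF sumc[OF x], of "\<bar>H m x\<bar>"] by (simp add: abs_mult algebra_simps)
    qed
    have g3: "summable (\<lambda>i. (1/3::real) ^ i * n m)" by (intro summable_mult2 summable_geometric) auto
    have su: "summable (\<lambda>i. LINT x|M. norm (c i * (H m x * \<psi> i x)))"
    proof (rule summable_comparison_test'[OF g3])
      fix i
      have "(LINT x|M. norm (c i * (H m x * \<psi> i x))) = (1/3) ^ i * (LINT x|M. \<bar>H m x * \<psi> i x\<bar>)"
        by (simp add: abs_mult c)
      also have "\<dots> \<le> (1/3) ^ i * n m" by (intro mult_left_mono Hpsi_le) auto
      finally show "norm (LINT x|M. norm (c i * (H m x * \<psi> i x))) \<le> (1/3) ^ i * n m" by simp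
    qed
    have "(\<lambda>i. LINT x|M. c i * (H m x * \<psi> i x)) sums (LINT x|M. (\<Sum>i. c i * (H m x * \<psi> i x)))"
      by (rule sums_integral[OF i1 ae su])
    also have "(LINT x|M. (\<Sum>i. c i * (H m x * \<psi> i x))) = (LINT x|M. H m x * \<Psi> x)"
    proof (rule integral_cong_AE)
      show "AE x in M. (\<Sum>i. c i * (H m x * \<psi> i x)) = H m x * \<Psi> x"
        using S(1)
      proof (rule eventually_mono)
        fix x assume x: "summable (\<lambda>i. (1/2) ^ i * \<bar>\<psi> i x\<bar> powr q)"
        show "(\<Sum>i. c i * (H m x * \<psi> i x)) = H m x * \<Psi> x"
          unfolding \<Psi>_def using suminf_mult[OF summable_rabs_cancel[OF sumc[OF x]], of "H m x"]
          by (simp add: algebra_simps)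
      qed
    qed measurable
    finally have sums: "(\<lambda>i. c i * a m i) sums (LINT x|M. H m x * \<Psi> x)" by (simp add: a_def)
    have tail: "(\<lambda>i. c (i + Suc m) * a m (i + Suc m)) sums ((LINT x|M. H m x * \<Psi> x) - (\<Sum>i<Suc m. c i * a m i))"
      using sums_split_initial_segment[OF sums, of "Suc m"] by simp
    have t_le: "norm (c (i + Suc m) * a m (i + Suc m)) \<le> (1/3) ^ i * ((1/3) ^ Suc m * n m)" for i
    proof -
      have "norm (c (i + Suc m) * a m (i + Suc m)) = (1/3) ^ (i + Suc m) * \<bar>a m (i + Suc m)\<bar>"
        by (simp only: real_norm_def abs_mult c)
      also have "\<dots> \<le> (1/3) ^ (i + Suc m) * n m" by (intro mult_left_mono a_le) auto
      finally show ?thesis by (simp only: power_add mult.assoc)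
    qed
    have gs: "(\<lambda>i. (1/3) ^ i * ((1/3) ^ Suc m * n m)) sums (1 / (1 - 1/3) * ((1/3) ^ Suc m * n m))"
      by (intro sums_mult2 geometric_sums) auto
    \<comment> \<open>Later humps also pair with \<open>H m\<close> to at most \<open>n m\<close>.
      As 1 / (1 - 1/3) * 1/3 = 1/2, the tail eats at most half of the lower bound for the partial
      sum.\<close>
    have "norm ((LINT x|M. H m x * \<Psi> x) - (\<Sum>i<Suc m. c i * a m i)) \<le> 1 / (1 - 1/3) * ((1/3) ^ Suc m * n m)"
      using norm_suminf_le[OF t_le sums_summable[OF gs]]
      unfolding sums_unique[OF gs, symmetric] sums_unique[OF tail, symmetric] .
    also have "\<dots> = (1/3) ^ m * n m / 2" by simp
    finally show ?thesis using c_ge[of m] by (simp only: lessThan_Suc_atMost real_norm_def)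
  qed
  have "(4/3) ^ m \<le> 2 * B" for m :: nat
  proof -
    have "(4/3::real) ^ m = (1/3) ^ m * 4 ^ m" by (simp flip: power_mult_distrib)
    also have "\<dots> \<le> (1/3) ^ m * n m" using n4[of m] by (intro mult_left_mono) auto
    also have "\<dots> \<le> 2 * B" using low[of m] B[of "s m"] by (simp add: H_def)
    finally show ?thesis .
  qed
  moreover obtain m where "2 * B < (4/3::real) ^ m"
    using real_arch_pow[of "4/3" "2 * B"] by auto
  ultimately show False by (meson not_less)
qed

section \<open>Lebesgue spaces over measurable and compact sets\<close>

lemma compact_lebesgue [measurable, simp]: "compact K \<Longrightarrow> K \<in> sets lebesgue"
  for K :: "'a::euclidean_space set"
  by (simp add: borel_compact)

lemma set_integral_lebesgue_on:
  fixes f :: "'a::euclidean_space \<Rightarrow> 'b::{banach, second_countable_topology}"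
  assumes "K \<in> sets lebesgue"
  shows "(LINT x:K|lebesgue. f x) = (LINT x|lebesgue_on K. f x)"
  using assms by (simp add: set_lebesgue_integral_def integral_restrict_space)

lemma set_integrable_lebesgue_on:
  fixes f :: "'a::euclidean_space \<Rightarrow> 'b::{banach, second_countable_topology}"
  assumes "K \<in> sets lebesgue"
  shows "set_integrable lebesgue K f \<longleftrightarrow> integrable (lebesgue_on K) f"
  using assms by (simp add: set_integrable_def integrable_restrict_space)

lemma AE_lebesgue_on:
  assumes "K \<in> sets lebesgue"
  shows "(AE x in lebesgue_on K. P x) \<longleftrightarrow> (AE x in lebesgue. x \<in> K \<longrightarrow> P x)"
  using assms by (simp add: AE_restrict_space_iff)

lemma Lp_on_iff:
  assumes "K \<in> sets lebesgue"
  shows "Lp_on p K f \<longleftrightarrow> f \<in> borel_measurable (lebesgue_on K) \<and>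
    integrable (lebesgue_on K) (\<lambda>x. norm (f x) powr p)"
  using assms by (simp add: Lp_on_def set_integrable_lebesgue_on set_borel_measurable_def
      borel_measurable_restrict_space_iff)

lemma Lp_on_dominated:
  assumes K: "K \<in> sets lebesgue" and p: "0 \<le> p" and g: "Lp_on p K g"
    and f: "f \<in> borel_measurable (lebesgue_on K)"
    and le: "AE x in lebesgue. x \<in> K \<longrightarrow> norm (f x) \<le> norm (g x)"
  shows "Lp_on p K f"
  unfolding Lp_on_iff[OF K]
proof (rule conjI[OF f], rule Bochner_Integration.integrable_bound)
  show "integrable (lebesgue_on K) (\<lambda>x. norm (g x) powr p)" using g by (simp add: Lp_on_iff[OF K])
  show "AE x in lebesgue_on K. norm (norm (f x) powr p) \<le> norm (norm (g x) powr p)"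
    unfolding AE_lebesgue_on[OF K] using le
    by (rule eventually_mono) (use p in \<open>auto intro: powr_mono2\<close>)
qed (use f in measurable)

lemma measurable_lebesgue_on_cong_AE:
  fixes f :: "'a::euclidean_space \<Rightarrow> 'b::euclidean_space"
  assumes K: "K \<in> sets lebesgue" and f: "f \<in> borel_measurable (lebesgue_on K)"
    and eq: "AE x in lebesgue. x \<in> K \<longrightarrow> f x = g x"
  shows "g \<in> borel_measurable (lebesgue_on K)"
proof -
  have "(\<lambda>x. if x \<in> K then f x else 0) \<in> borel_measurable lebesgue"
    using f K by (simp add: borel_measurable_if)
  then have "(\<lambda>x. if x \<in> K then g x else 0) \<in> borel_measurable lebesgue"
    by (rule borel_measurable_AE) (use eq in \<open>auto elim!: eventually_mono\<close>)
  then show ?thesis using K by (simp add: borel_measurable_if)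
qed

lemma Lp_on_cong_AE:
  assumes K: "K \<in> sets lebesgue" and f: "Lp_on p K f" and eq: "AE x in lebesgue. x \<in> K \<longrightarrow> f x = g x"
  shows "Lp_on p K g"
proof -
  have g: "g \<in> borel_measurable (lebesgue_on K)"
    using f measurable_lebesgue_on_cong_AE[OF K _ eq] by (simp add: Lp_on_iff[OF K])
  have "integrable (lebesgue_on K) (\<lambda>x. norm (g x) powr p) \<longleftrightarrow>
      integrable (lebesgue_on K) (\<lambda>x. norm (f x) powr p)"
  proof (rule integrable_cong_AE)
    show "AE x in lebesgue_on K. norm (g x) powr p = norm (f x) powr p"
      unfolding AE_lebesgue_on[OF K] using eq by (rule eventually_mono) auto
  qed (use g f in \<open>auto simp: Lp_on_iff[OF K]\<close>)
  then show ?thesis using f g by (simp add: Lp_on_iff[OF K])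
qed

lemma Lp_on_subset:
  assumes "Lp_on p K f" "L \<subseteq> K" and K: "K \<in> sets lebesgue" and L: "L \<in> sets lebesgue"
  shows "Lp_on p L f"
proof -
  have "set_integrable lebesgue L (\<lambda>x. norm (f x) powr p)"
    using assms by (auto simp: Lp_on_def intro: set_integrable_subset)
  moreover have "f \<in> borel_measurable (lebesgue_on L)"
    using assms(1) by (intro measurable_restrict_mono[OF _ assms(2)]) (simp add: Lp_on_iff[OF K])
  ultimately show ?thesis by (simp add: Lp_on_iff[OF L] set_integrable_lebesgue_on[OF L])
qed

text \<open>The sum is at most the number of terms times the largest one. This crude constant needs
  no convexity and so covers all exponents p \<ge> 0.\<close>

lemma sum_powr_le:
  fixes a :: "'i \<Rightarrow> real"
  assumes "finite I" "\<And>i. i \<in> I \<Longrightarrow> 0 \<le> a i" "0 \<le> p"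
  shows "(\<Sum>i\<in>I. a i) powr p \<le> real (card I) powr p * (\<Sum>i\<in>I. a i powr p)"
proof (cases "I = {}")
  case False
  define m where "m = Max (a ` I)"
  have m: "a i \<le> m" if "i \<in> I" for i using assms that by (auto simp: m_def)
  have "m \<in> a ` I" unfolding m_def using assms False by (intro Max_in) auto
  then obtain i where i: "i \<in> I" "m = a i" by blast
  have "(\<Sum>i\<in>I. a i) \<le> real (card I) * m" using sum_bounded_above[of I a m] m by simp
  then have "(\<Sum>i\<in>I. a i) powr p \<le> (real (card I) * m) powr p"
    using assms by (intro powr_mono2 sum_nonneg) auto
  also have "\<dots> = real (card I) powr p * a i powr p" using i assms by (simp add: powr_mult)
  also have "\<dots> \<le> real (card I) powr p * (\<Sum>i\<in>I. a i powr p)"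
    using assms i member_le_sum[of i I "\<lambda>i. a i powr p"] by (intro mult_left_mono) auto
  finally show ?thesis .
qed simp

lemma Lp_on_add:
  assumes K: "K \<in> sets lebesgue" and p: "0 \<le> p" and f: "Lp_on p K f" and g: "Lp_on p K g"
  shows "Lp_on p K (\<lambda>x. f x + g x)"
  unfolding Lp_on_iff[OF K]
proof (rule conjI, goal_cases)
  case 1
  show "(\<lambda>x. f x + g x) \<in> borel_measurable (lebesgue_on K)"
    using f g by (auto simp: Lp_on_iff[OF K])
next
  case 2
  show ?case
  proof (rule Bochner_Integration.integrable_bound)
  show "integrable (lebesgue_on K) (\<lambda>x. 2 powr p * (norm (f x) powr p + norm (g x) powr p))"
    using f g by (auto simp: Lp_on_iff[OF K])
  have "norm (f x + g x) powr p \<le> 2 powr p * (norm (f x) powr p + norm (g x) powr p)" for x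
  proof -
    have "norm (f x + g x) powr p \<le> (norm (f x) + norm (g x)) powr p"
      using p by (intro powr_mono2 norm_triangle_ineq) auto
    also have "\<dots> \<le> 2 powr p * (norm (f x) powr p + norm (g x) powr p)"
      using sum_powr_le[of "{True,False}" "\<lambda>b. if b then norm (f x) else norm (g x)" p] p by simp
    finally show ?thesis .
  qed
  then show "AE x in lebesgue_on K. norm (norm (f x + g x) powr p) \<le>
      norm (2 powr p * (norm (f x) powr p + norm (g x) powr p))"
    by (intro AE_I2) (auto intro: order_trans[OF _ abs_ge_self])
  qed (use f g in \<open>auto simp: Lp_on_iff[OF K]\<close>)
qed

lemma Lp_on_scaleR:
  assumes K: "K \<in> sets lebesgue" and f: "Lp_on p K f"
  shows "Lp_on p K (\<lambda>x. c *\<^sub>R f x)"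
  using f by (auto simp: Lp_on_iff[OF K] powr_mult)

lemma Lp_on_bounded_scaleR:
  assumes K: "K \<in> sets lebesgue" and p: "0 \<le> p" and f: "Lp_on p K f"
    and g: "g \<in> borel_measurable (lebesgue_on K)" and le: "\<And>x. x \<in> K \<Longrightarrow> norm (g x) \<le> C"
  shows "Lp_on p K (\<lambda>x. f x *\<^sub>R g x)"
proof (rule Lp_on_dominated[OF K p])
  show "Lp_on p K (\<lambda>x. \<bar>C\<bar> *\<^sub>R f x)" using Lp_on_scaleR[OF K f] .
  show "AE x in lebesgue. x \<in> K \<longrightarrow> norm (f x *\<^sub>R g x) \<le> norm (\<bar>C\<bar> *\<^sub>R f x)"
  proof (intro AE_I2 impI)
    fix x assume "x \<in> K"
    then have "norm (g x) \<le> \<bar>C\<bar>" using le by fastforce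
    then show "norm (f x *\<^sub>R g x) \<le> norm (\<bar>C\<bar> *\<^sub>R f x)"
      using mult_right_mono[of "norm (g x)" "\<bar>C\<bar>" "norm (f x)"] by (simp add: mult.commute)
  qed
qed (use f g in \<open>auto simp: Lp_on_iff[OF K]\<close>)

lemma Lp_on_linear:
  fixes L :: "'b::euclidean_space \<Rightarrow> 'c::euclidean_space"
  assumes K: "K \<in> sets lebesgue" and p: "0 \<le> p" and f: "Lp_on p K f" and L: "linear L"
  shows "Lp_on p K (\<lambda>x. L (f x))"
proof -
  have bl: "bounded_linear L" using L by (simp add: linear_linear)
  then obtain B where B: "\<And>x. norm (L x) \<le> norm x * B" "B \<ge> 0"
    using bounded_linear.nonneg_bounded by blast
  show ?thesis
  proof (rule Lp_on_dominated[OF K p])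
    show "Lp_on p K (\<lambda>x. B *\<^sub>R f x)" using Lp_on_scaleR[OF K f] .
    have "L \<in> borel_measurable borel"
      using bl by (intro borel_measurable_continuous_onI linear_continuous_on)
    then show "(\<lambda>x. L (f x)) \<in> borel_measurable (lebesgue_on K)"
      using f by (auto simp: Lp_on_iff[OF K] intro: measurable_compose)
  qed (use B in \<open>auto simp: mult.commute\<close>)
qed

lemma finite_measure_lebesgue_on_compact:
  fixes K :: "'a::euclidean_space set"
  shows "compact K \<Longrightarrow> finite_measure (lebesgue_on K)"
  by (rule finite_measure_lebesgue_on) (simp add: lmeasurable_compact)

lemma Lp_on_bounded:
  assumes K: "compact K"
    and f: "f \<in> borel_measurable (lebesgue_on K)" and le: "\<And>x. x \<in> K \<Longrightarrow> norm (f x) \<le> C"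
    and p: "0 \<le> p"
  shows "Lp_on p K f"
proof -
  interpret finite_measure "lebesgue_on K" using K by (rule finite_measure_lebesgue_on_compact)
  have "norm (norm (f x) powr p) \<le> \<bar>C\<bar> powr p" if "x \<in> K" for x
    using le[OF that] p by (auto intro!: powr_mono2)
  then have "integrable (lebesgue_on K) (\<lambda>x. norm (f x) powr p)"
    using f by (intro integrable_const_bound[where B = "\<bar>C\<bar> powr p"]) auto
  then show ?thesis using f K by (simp add: Lp_on_iff)
qed

lemma Lp_on_continuous:
  assumes K: "compact K" and f: "continuous_on K f" and p: "0 \<le> p"
  shows "Lp_on p K f"
proof -
  have "bounded (f ` K)" using K f by (simp add: compact_continuous_image compact_imp_bounded)
  then obtain C where "\<And>x. x \<in> K \<Longrightarrow> norm (f x) \<le> C" by (auto simp: bounded_iff)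
  then show ?thesis
    using K f p by (intro Lp_on_bounded continuous_imp_measurable_on_sets_lebesgue) auto
qed

text \<open>For a \<ge> 0 one has a^r \<le> 1 + a^p, and the constant 1 is integrable because a
  compact set has finite measure.\<close>

lemma Lp_on_exponent_mono:
  assumes K: "compact K" and f: "Lp_on p K f" and r: "0 \<le> r" "r \<le> p"
  shows "Lp_on r K f"
proof -
  interpret finite_measure "lebesgue_on K" using K by (rule finite_measure_lebesgue_on_compact)
  have le: "a powr r \<le> 1 + a powr p" if "a \<ge> 0" for a
  proof (cases "a \<le> 1")
    case True
    then show ?thesis using that r powr_le1[of r a] by (smt (verit) powr_ge_zero)
  next
    case False
    then show ?thesis using powr_mono[of r p a] r by linarith
  qed
  have "integrable (lebesgue_on K) (\<lambda>x. norm (f x) powr r)"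
  proof (rule Bochner_Integration.integrable_bound)
    show "integrable (lebesgue_on K) (\<lambda>x. 1 + norm (f x) powr p)"
      using f by (auto simp: Lp_on_iff[OF compact_lebesgue[OF K]])
    show "AE x in lebesgue_on K. norm (norm (f x) powr r) \<le> norm (1 + norm (f x) powr p)"
      using le by (intro AE_I2) (auto intro: order_trans[OF _ abs_ge_self])
  qed (use f K in \<open>auto simp: Lp_on_iff\<close>)
  then show ?thesis using f by (simp add: Lp_on_iff[OF compact_lebesgue[OF K]])
qed

lemma Lp_on_1_iff:
  assumes K: "K \<in> sets lebesgue"
  shows "Lp_on 1 K f \<longleftrightarrow> integrable (lebesgue_on K) f"
  using borel_measurable_integrable[of "lebesgue_on K" f]
  by (auto simp: Lp_on_iff[OF K] integrable_norm_iff)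

lemma Lp_on_Holder:
  assumes K: "K \<in> sets lebesgue" and p: "1 < p" and f: "Lp_on p K f" and g: "Lp_on (p / (p - 1)) K g"
  shows "integrable (lebesgue_on K) (\<lambda>x. norm (f x) * norm (g x))"
    and "integrable (lebesgue_on K) (\<lambda>x. f x \<bullet> g x)"
    and "(LINT x|lebesgue_on K. norm (f x) * norm (g x)) \<le>
      (LINT x|lebesgue_on K. norm (f x) powr p) powr (1 / p) *
      (LINT x|lebesgue_on K. norm (g x) powr (p / (p - 1))) powr (1 / (p / (p - 1)))"
proof -
  have m[measurable]: "f \<in> borel_measurable (lebesgue_on K)" "g \<in> borel_measurable (lebesgue_on K)"
    using f g by (auto simp: Lp_on_iff[OF K])
  show i: "integrable (lebesgue_on K) (\<lambda>x. norm (f x) * norm (g x))"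
    by (rule integrable_Holder[OF p]) (use f g in \<open>auto simp: Lp_on_iff[OF K]\<close>)
  show "integrable (lebesgue_on K) (\<lambda>x. f x \<bullet> g x)"
    by (rule Bochner_Integration.integrable_bound[OF i])
      (auto intro: order_trans[OF Cauchy_Schwarz_ineq2])
  show "(LINT x|lebesgue_on K. norm (f x) * norm (g x)) \<le>
      (LINT x|lebesgue_on K. norm (f x) powr p) powr (1 / p) *
      (LINT x|lebesgue_on K. norm (g x) powr (p / (p - 1))) powr (1 / (p / (p - 1)))"
    using Holder_inequality[OF p refl, of "\<lambda>x. norm (f x)" "lebesgue_on K" "\<lambda>x. norm (g x)"] f g
    by (auto simp: Lp_on_iff[OF K])
qed


subsection \<open>Weak convergence in $L^p_{\rm loc}$\<close>

text \<open>Convergent pairings are bounded, so uniform boundedness applies, one coordinate at a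
  time because it is stated for real functions. The shift by \<open>J\<close> discards the finitely
  many members that may lie outside L^p.\<close>

lemma weak_conv_Lp_loc_bounded:
  assumes p: "1 < p" and wc: "weak_conv_Lp_loc p \<Omega> f f0" and K: "compact K" "K \<subseteq> \<Omega>"
  shows "\<exists>C. \<forall>\<^sub>F j in sequentially. Lp_on p K (f j) \<and> (LINT x|lebesgue_on K. norm (f j x) powr p) \<le> C"
proof -
  have Ks: "K \<in> sets lebesgue" using K by simp
  note iff = Lp_on_iff[OF Ks]
  obtain J where J: "\<And>j. j \<ge> J \<Longrightarrow> Lp_on p K (f j)"
    using wc K by (auto simp: weak_conv_Lp_loc_def eventually_sequentially Lp_loc_def)
  define h where "h b j x = f (j + J) x \<bullet> b" for b j x
  have Lh: "Lp_on p K (h b j)" for b j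
    unfolding h_def
    using Lp_on_linear[OF Ks _ J[of "j + J"], of "\<lambda>y. y \<bullet> b"] p
    by (simp add: linear_iff inner_add_left)
  have "\<exists>C. \<forall>j. (LINT x|lebesgue_on K. \<bar>h b j x\<bar> powr p) \<le> C" for b
  proof (rule Lp_uniform_boundedness[OF p refl])
    show "h b j \<in> borel_measurable (lebesgue_on K)" "integrable (lebesgue_on K) (\<lambda>x. \<bar>h b j x\<bar> powr p)" for j
      using Lh[of b j] by (auto simp: iff)
    fix \<psi> :: "real^'a \<Rightarrow> real"
    assume \<psi>: "\<psi> \<in> borel_measurable (lebesgue_on K)"
      "integrable (lebesgue_on K) (\<lambda>x. \<bar>\<psi> x\<bar> powr (p / (p - 1)))"
    then have "Lp_on (p / (p - 1)) K (\<lambda>x. \<psi> x *\<^sub>R b)"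
      using Lp_on_linear[OF Ks, of "p / (p - 1)" \<psi> "\<lambda>y. y *\<^sub>R b"] p
      by (simp add: iff linear_iff scaleR_add_left)
    then have "(\<lambda>j. LINT x|lebesgue_on K. f j x \<bullet> \<psi> x *\<^sub>R b) \<longlonglongrightarrow>
        (LINT x|lebesgue_on K. f0 x \<bullet> \<psi> x *\<^sub>R b)"
      using wc K unfolding weak_conv_Lp_loc_def set_integral_lebesgue_on[OF Ks, symmetric] by blast
    then have "Bseq (\<lambda>j. LINT x|lebesgue_on K. f j x \<bullet> \<psi> x *\<^sub>R b)"
      by (intro convergent_imp_Bseq convergentI)
    then obtain B where "\<And>j. norm (LINT x|lebesgue_on K. f j x \<bullet> \<psi> x *\<^sub>R b) \<le> B"
      unfolding Bseq_def by blast
    then show "\<exists>B. \<forall>j. \<bar>LINT x|lebesgue_on K. h b j x * \<psi> x\<bar> \<le> B"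
      by (intro exI[of _ B]) (simp add: h_def mult.commute)
  qed
  then obtain C where C: "\<And>b j. (LINT x|lebesgue_on K. \<bar>h b j x\<bar> powr p) \<le> C b" by metis
  let ?D = "real (card (Basis :: 'b set)) powr p"
  have "(LINT x|lebesgue_on K. norm (f j x) powr p) \<le> ?D * (\<Sum>b\<in>Basis. C b)" if j: "j \<ge> J" for j
  proof -
    have hj: "h b (j - J) x = f j x \<bullet> b" for b x using j by (simp add: h_def)
    have i: "integrable (lebesgue_on K) (\<lambda>x. \<bar>f j x \<bullet> b\<bar> powr p)" for b
      using Lh[of b "j - J"] by (simp add: iff hj)
    have "(LINT x|lebesgue_on K. norm (f j x) powr p) \<le>
        (LINT x|lebesgue_on K. ?D * (\<Sum>b\<in>Basis. \<bar>f j x \<bullet> b\<bar> powr p))"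
    proof (rule integral_mono)
      show "integrable (lebesgue_on K) (\<lambda>x. norm (f j x) powr p)" using J[OF j] by (simp add: iff)
      show "integrable (lebesgue_on K) (\<lambda>x. ?D * (\<Sum>b\<in>Basis. \<bar>f j x \<bullet> b\<bar> powr p))"
        using i by auto
      fix x
      have "norm (f j x) powr p \<le> (\<Sum>b\<in>Basis. \<bar>f j x \<bullet> b\<bar>) powr p"
        using p by (intro powr_mono2 norm_le_l1) auto
      also have "\<dots> \<le> ?D * (\<Sum>b\<in>Basis. \<bar>f j x \<bullet> b\<bar> powr p)"
        using p by (intro sum_powr_le) auto
      finally show "norm (f j x) powr p \<le> ?D * (\<Sum>b\<in>Basis. \<bar>f j x \<bullet> b\<bar> powr p)" .
    qed
    also have "\<dots> = ?D * (\<Sum>b\<in>Basis. LINT x|lebesgue_on K. \<bar>f j x \<bullet> b\<bar> powr p)"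
      using i by (simp add: Bochner_Integration.integral_sum)
    also have "\<dots> \<le> ?D * (\<Sum>b\<in>Basis. C b)"
      using C[of _ "j - J"] by (intro mult_left_mono sum_mono) (auto simp: hj)
    finally show ?thesis .
  qed
  then show ?thesis
    unfolding eventually_sequentially using J by blast
qed

lemma Lp_loc_subset: "Lp_loc p \<Omega> f \<Longrightarrow> V \<subseteq> \<Omega> \<Longrightarrow> Lp_loc p V f"
  by (auto simp: Lp_loc_def)

lemma Lp_loc_cong_AE:
  assumes "Lp_loc p \<Omega> f" "AE x in lebesgue. x \<in> \<Omega> \<longrightarrow> f x = g x"
  shows "Lp_loc p \<Omega> g"
  unfolding Lp_loc_def
proof (intro allI impI)
  fix K assume K: "compact K \<and> K \<subseteq> \<Omega>"
  show "Lp_on p K g"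
  proof (rule Lp_on_cong_AE)
    show "Lp_on p K f" "K \<in> sets lebesgue" using assms(1) K by (auto simp: Lp_loc_def)
    show "AE x in lebesgue. x \<in> K \<longrightarrow> f x = g x"
      using assms(2) K by (auto elim!: eventually_mono)
  qed
qed

lemma Lp_loc_linear:
  fixes L :: "'b::euclidean_space \<Rightarrow> 'c::euclidean_space"
  assumes "Lp_loc p \<Omega> f" "0 \<le> p" "linear L"
  shows "Lp_loc p \<Omega> (\<lambda>x. L (f x))"
  using assms by (auto simp: Lp_loc_def intro: Lp_on_linear[where L = L])

lemma Lp_loc_add:
  assumes "Lp_loc p \<Omega> f" "Lp_loc p \<Omega> g" "0 \<le> p"
  shows "Lp_loc p \<Omega> (\<lambda>x. f x + g x)"
  using assms by (auto simp: Lp_loc_def intro!: Lp_on_add)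

lemma Lp_loc_continuous:
  assumes "continuous_on \<Omega> f" "0 \<le> p"
  shows "Lp_loc p \<Omega> f"
  using assms by (auto simp: Lp_loc_def intro!: Lp_on_continuous intro: continuous_on_subset)

lemma Lp_on_scaleR_continuous:
  assumes K: "compact K" and f: "Lp_on p K f" and g: "continuous_on K g" and p: "0 \<le> p"
  shows "Lp_on p K (\<lambda>x. f x *\<^sub>R g x)"
proof -
  have "bounded (g ` K)" using K g by (simp add: compact_continuous_image compact_imp_bounded)
  then obtain C where "\<And>x. x \<in> K \<Longrightarrow> norm (g x) \<le> C" by (auto simp: bounded_iff)
  then show ?thesis
    using K f g p by (intro Lp_on_bounded_scaleR continuous_imp_measurable_on_sets_lebesgue) auto
qed

lemma Lp_on_inner_continuous:
  assumes K: "compact K" and f: "Lp_on p K f" and g: "continuous_on K g" and p: "0 \<le> p"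
  shows "Lp_on p K (\<lambda>x. g x \<bullet> f x)"
proof -
  have "bounded (g ` K)" using K g by (simp add: compact_continuous_image compact_imp_bounded)
  then obtain C where C: "\<And>x. x \<in> K \<Longrightarrow> norm (g x) \<le> C" by (auto simp: bounded_iff)
  have Ks: "K \<in> sets lebesgue" using K by simp
  show ?thesis
  proof (rule Lp_on_dominated[OF Ks p Lp_on_scaleR[OF Ks f, of "\<bar>C\<bar>"]])
    have "g \<in> borel_measurable (lebesgue_on K)"
      using g K by (intro continuous_imp_measurable_on_sets_lebesgue) auto
    then show "(\<lambda>x. g x \<bullet> f x) \<in> borel_measurable (lebesgue_on K)"
      using f by (auto simp: Lp_on_iff[OF Ks])
    show "AE x in lebesgue. x \<in> K \<longrightarrow> norm (g x \<bullet> f x) \<le> norm (\<bar>C\<bar> *\<^sub>R f x)"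
    proof (intro AE_I2 impI)
      fix x assume "x \<in> K"
      then have "norm (g x) \<le> \<bar>C\<bar>" using C by fastforce
      then have "norm (g x) * norm (f x) \<le> \<bar>C\<bar> * norm (f x)" by (rule mult_right_mono) simp
      then show "norm (g x \<bullet> f x) \<le> norm (\<bar>C\<bar> *\<^sub>R f x)"
        using Cauchy_Schwarz_ineq2[of "g x" "f x"] by simp
    qed
  qed
qed

lemma Lp_loc_scaleR_continuous:
  assumes "Lp_loc p \<Omega> f" "continuous_on \<Omega> g" "0 \<le> p"
  shows "Lp_loc p \<Omega> (\<lambda>x. f x *\<^sub>R g x)"
  using assms by (auto simp: Lp_loc_def intro!: Lp_on_scaleR_continuous intro: continuous_on_subset)

lemma weak_conv_Lp_loc_subset:
  "weak_conv_Lp_loc p \<Omega> f f0 \<Longrightarrow> V \<subseteq> \<Omega> \<Longrightarrow> weak_conv_Lp_loc p V f f0"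
  by (auto simp: weak_conv_Lp_loc_def intro: Lp_loc_subset elim!: eventually_mono)

lemma set_integral_cong_AE':
  fixes f g :: "'a::euclidean_space \<Rightarrow> real"
  assumes K: "K \<in> sets lebesgue" and f: "f \<in> borel_measurable (lebesgue_on K)"
    and eq: "AE x in lebesgue. x \<in> K \<longrightarrow> f x = g x"
  shows "(LINT x:K|lebesgue. f x) = (LINT x:K|lebesgue. g x)"
  unfolding set_integral_lebesgue_on[OF K]
  by (rule integral_cong_AE)
    (use f eq measurable_lebesgue_on_cong_AE[OF K f eq] in \<open>auto simp: AE_lebesgue_on[OF K]\<close>)

lemma integral_inner_cong_AE:
  assumes K: "K \<in> sets lebesgue" and f: "Lp_on p K f" and \<psi>: "Lp_on q K \<psi>"
    and eq: "AE x in lebesgue. x \<in> K \<longrightarrow> f x = g x"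
  shows "(LINT x:K|lebesgue. f x \<bullet> \<psi> x) = (LINT x:K|lebesgue. g x \<bullet> \<psi> x)"
proof (rule set_integral_cong_AE'[OF K])
  show "(\<lambda>x. f x \<bullet> \<psi> x) \<in> borel_measurable (lebesgue_on K)"
    using f \<psi> by (auto simp: Lp_on_iff[OF K])
  show "AE x in lebesgue. x \<in> K \<longrightarrow> f x \<bullet> \<psi> x = g x \<bullet> \<psi> x"
    using eq by (rule eventually_mono) auto
qed

text \<open>Allows a weak derivative picked by \<open>SOME\<close> to be exchanged for an explicit
  or a continuous representative.\<close>

lemma weak_conv_Lp_loc_cong_AE:
  assumes wc: "weak_conv_Lp_loc p \<Omega> f f0"
    and eq: "\<forall>\<^sub>F j in sequentially. AE x in lebesgue. x \<in> \<Omega> \<longrightarrow> f j x = g j x"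
    and eq0: "AE x in lebesgue. x \<in> \<Omega> \<longrightarrow> f0 x = g0 x"
  shows "weak_conv_Lp_loc p \<Omega> g g0"
  unfolding weak_conv_Lp_loc_def
proof (intro conjI allI impI)
  have f: "\<forall>\<^sub>F j in sequentially. Lp_loc p \<Omega> (f j)" and f0: "Lp_loc p \<Omega> f0"
    using wc by (auto simp: weak_conv_Lp_loc_def)
  show "\<forall>\<^sub>F j in sequentially. Lp_loc p \<Omega> (g j)"
    using f eq by eventually_elim (rule Lp_loc_cong_AE)
  show "Lp_loc p \<Omega> g0" using f0 eq0 by (rule Lp_loc_cong_AE)
  fix K and \<psi> :: "real^'a \<Rightarrow> 'b"
  assume *: "compact K \<and> K \<subseteq> \<Omega> \<and> Lp_on (p / (p - 1)) K \<psi>"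
  have sub: "AE x in lebesgue. x \<in> K \<longrightarrow> f x = (g x :: 'b)"
    if "AE x in lebesgue. x \<in> \<Omega> \<longrightarrow> f x = g x" for f g
    using that * by (auto elim!: eventually_mono)
  have "(\<lambda>j. LINT x:K|lebesgue. f j x \<bullet> \<psi> x) \<longlonglongrightarrow> (LINT x:K|lebesgue. f0 x \<bullet> \<psi> x)"
    using wc * by (auto simp: weak_conv_Lp_loc_def)
  moreover have "(LINT x:K|lebesgue. f0 x \<bullet> \<psi> x) = (LINT x:K|lebesgue. g0 x \<bullet> \<psi> x)"
    using * f0 by (intro integral_inner_cong_AE[OF _ _ _ sub[OF eq0]]) (auto simp: Lp_loc_def)
  moreover have "\<forall>\<^sub>F j in sequentially.
      (LINT x:K|lebesgue. f j x \<bullet> \<psi> x) = (LINT x:K|lebesgue. g j x \<bullet> \<psi> x)"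
    using f eq
  proof eventually_elim
    case (elim j)
    then show ?case
      using * by (intro integral_inner_cong_AE[OF _ _ _ sub[OF elim(2)]]) (auto simp: Lp_loc_def)
  qed
  ultimately show "(\<lambda>j. LINT x:K|lebesgue. g j x \<bullet> \<psi> x) \<longlonglongrightarrow> (LINT x:K|lebesgue. g0 x \<bullet> \<psi> x)"
    by (simp add: tendsto_cong)
qed

lemma weak_conv_Lp_loc_const: "Lp_loc p \<Omega> f \<Longrightarrow> weak_conv_Lp_loc p \<Omega> (\<lambda>_. f) f"
  by (auto simp: weak_conv_Lp_loc_def)

lemma weak_conv_Lp_loc_linear:
  fixes L :: "'b::euclidean_space \<Rightarrow> 'c::euclidean_space"
  assumes p: "1 < p" and wc: "weak_conv_Lp_loc p \<Omega> f f0" and L: "linear L"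
  shows "weak_conv_Lp_loc p \<Omega> (\<lambda>j x. L (f j x)) (\<lambda>x. L (f0 x))"
  unfolding weak_conv_Lp_loc_def
proof (intro conjI allI impI)
  show "\<forall>\<^sub>F j in sequentially. Lp_loc p \<Omega> (\<lambda>x. L (f j x))" "Lp_loc p \<Omega> (\<lambda>x. L (f0 x))"
    using wc p L by (auto simp: weak_conv_Lp_loc_def intro: Lp_loc_linear[where L = L] elim!: eventually_mono)
  fix K and \<psi> :: "real^'a \<Rightarrow> 'c"
  assume *: "compact K \<and> K \<subseteq> \<Omega> \<and> Lp_on (p / (p - 1)) K \<psi>"
  then have "Lp_on (p / (p - 1)) K (\<lambda>x. adjoint L (\<psi> x))"
    using p L by (intro Lp_on_linear[where L = "adjoint L"] adjoint_linear) auto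
  then have "(\<lambda>j. LINT x:K|lebesgue. f j x \<bullet> adjoint L (\<psi> x)) \<longlonglongrightarrow> (LINT x:K|lebesgue. f0 x \<bullet> adjoint L (\<psi> x))"
    using wc * by (auto simp: weak_conv_Lp_loc_def)
  then show "(\<lambda>j. LINT x:K|lebesgue. L (f j x) \<bullet> \<psi> x) \<longlonglongrightarrow> (LINT x:K|lebesgue. L (f0 x) \<bullet> \<psi> x)"
    by (simp add: adjoint_works[OF L])
qed

lemma weak_conv_Lp_loc_add:
  assumes p: "1 < p" and f: "weak_conv_Lp_loc p \<Omega> f f0" and g: "weak_conv_Lp_loc p \<Omega> g g0"
  shows "weak_conv_Lp_loc p \<Omega> (\<lambda>j x. f j x + g j x) (\<lambda>x. f0 x + g0 x)"
  unfolding weak_conv_Lp_loc_def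
proof (intro conjI allI impI)
  have ev: "\<forall>\<^sub>F j in sequentially. Lp_loc p \<Omega> (f j)" "\<forall>\<^sub>F j in sequentially. Lp_loc p \<Omega> (g j)"
    and L0: "Lp_loc p \<Omega> f0" "Lp_loc p \<Omega> g0"
    using f g by (auto simp: weak_conv_Lp_loc_def)
  show "\<forall>\<^sub>F j in sequentially. Lp_loc p \<Omega> (\<lambda>x. f j x + g j x)"
    using ev by eventually_elim (use p in \<open>auto intro: Lp_loc_add\<close>)
  show "Lp_loc p \<Omega> (\<lambda>x. f0 x + g0 x)" using L0 p by (auto intro: Lp_loc_add)
  fix K and \<psi> :: "real^'a \<Rightarrow> 'b"
  assume *: "compact K \<and> K \<subseteq> \<Omega> \<and> Lp_on (p / (p - 1)) K \<psi>"
  then have K: "K \<in> sets lebesgue" by simp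
  have split: "(LINT x:K|lebesgue. (u x + v x) \<bullet> \<psi> x) =
      (LINT x:K|lebesgue. u x \<bullet> \<psi> x) + (LINT x:K|lebesgue. v x \<bullet> \<psi> x)"
    if "Lp_loc p \<Omega> u" "Lp_loc p \<Omega> v" for u v
    unfolding inner_add_left using that * K
    by (intro set_integral_add) (auto simp: set_integrable_lebesgue_on Lp_loc_def intro!: Lp_on_Holder(2)[OF _ p])
  have "(\<lambda>j. (LINT x:K|lebesgue. f j x \<bullet> \<psi> x) + (LINT x:K|lebesgue. g j x \<bullet> \<psi> x)) \<longlonglongrightarrow>
     (LINT x:K|lebesgue. (f0 x + g0 x) \<bullet> \<psi> x)"
    unfolding split[OF L0] using f g * by (intro tendsto_add) (auto simp: weak_conv_Lp_loc_def)
  moreover have "\<forall>\<^sub>F j in sequentially. (LINT x:K|lebesgue. (f j x + g j x) \<bullet> \<psi> x) =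
      (LINT x:K|lebesgue. f j x \<bullet> \<psi> x) + (LINT x:K|lebesgue. g j x \<bullet> \<psi> x)"
    using ev by eventually_elim (rule split)
  ultimately show "(\<lambda>j. LINT x:K|lebesgue. (f j x + g j x) \<bullet> \<psi> x) \<longlonglongrightarrow>
     (LINT x:K|lebesgue. (f0 x + g0 x) \<bullet> \<psi> x)"
    by (simp add: tendsto_cong)
qed

lemma weak_conv_Lp_loc_sum:
  assumes p: "1 < p" and I: "finite I" and f: "\<And>i. i \<in> I \<Longrightarrow> weak_conv_Lp_loc p \<Omega> (f i) (f0 i)"
  shows "weak_conv_Lp_loc p \<Omega> (\<lambda>j x. \<Sum>i\<in>I. f i j x) (\<lambda>x. \<Sum>i\<in>I. f0 i x)"
  using I f
proof (induction I rule: finite_induct)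
  case empty
  have "Lp_loc p \<Omega> (\<lambda>x. 0)" using p by (intro Lp_loc_continuous) auto
  then show ?case using weak_conv_Lp_loc_const by simp
next
  case (insert i I)
  then show ?case using weak_conv_Lp_loc_add[OF p, of \<Omega> "f i" "f0 i"] by simp
qed

text \<open>The difference of the products is h_j (c_j - c0) + (h_j - h0) c0. The second part tends
  to 0 because \<open>c0\<close>, bounded on \<open>K\<close>, can be moved to the test function
  without leaving L^q. The first is small because weak convergence bounds the L^p norms of the
  h_j.\<close>

lemma weak_conv_Lp_loc_scaleR_uniform:
  assumes p: "1 < p" and h: "weak_conv_Lp_loc p \<Omega> h h0"
    and c: "\<forall>\<^sub>F j in sequentially. continuous_on \<Omega> (c j)" and c0: "continuous_on \<Omega> c0"
    and u: "\<And>K. compact K \<Longrightarrow> K \<subseteq> \<Omega> \<Longrightarrow> uniform_limit K c c0 sequentially"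
  shows "weak_conv_Lp_loc p \<Omega> (\<lambda>j x. h j x *\<^sub>R c j x) (\<lambda>x. h0 x *\<^sub>R c0 x)"
  unfolding weak_conv_Lp_loc_def
proof (intro conjI allI impI)
  have ev: "\<forall>\<^sub>F j in sequentially. Lp_loc p \<Omega> (h j)" and L0: "Lp_loc p \<Omega> h0"
    using h by (auto simp: weak_conv_Lp_loc_def)
  show "\<forall>\<^sub>F j in sequentially. Lp_loc p \<Omega> (\<lambda>x. h j x *\<^sub>R c j x)"
    using ev c by eventually_elim (use p in \<open>auto intro: Lp_loc_scaleR_continuous\<close>)
  show "Lp_loc p \<Omega> (\<lambda>x. h0 x *\<^sub>R c0 x)" using L0 c0 p by (auto intro: Lp_loc_scaleR_continuous)
  fix K and \<psi> :: "real^'a \<Rightarrow> 'b"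
  let ?q = "p / (p - 1)"
  assume *: "compact K \<and> K \<subseteq> \<Omega> \<and> Lp_on ?q K \<psi>"
  then have K: "compact K" "K \<subseteq> \<Omega>" and \<psi>: "Lp_on ?q K \<psi>" by auto
  have Ks: "K \<in> sets lebesgue" using K by simp
  have q0: "0 \<le> ?q" using p by simp
  have c0K: "continuous_on K c0" using c0 K continuous_on_subset by blast
  have cpsi: "Lp_on ?q K (\<lambda>x. c x \<bullet> \<psi> x)" if "continuous_on K c" for c
    using Lp_on_inner_continuous[OF K(1) \<psi> that q0] .
  obtain C where C: "\<forall>\<^sub>F j in sequentially. Lp_on p K (h j) \<and> (LINT x|lebesgue_on K. norm (h j x) powr p) \<le> C"
    using weak_conv_Lp_loc_bounded[OF p h K] by blast
  define D where "D = (LINT x|lebesgue_on K. norm (\<psi> x) powr ?q)"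
  have D0: "D \<ge> 0" unfolding D_def by simp
  have lim1: "(\<lambda>j. LINT x:K|lebesgue. h j x \<bullet> (c0 x \<bullet> \<psi> x)) \<longlonglongrightarrow> (LINT x:K|lebesgue. h0 x \<bullet> (c0 x \<bullet> \<psi> x))"
    using h K cpsi[OF c0K] by (auto simp: weak_conv_Lp_loc_def)
  have "(\<lambda>j. (LINT x:K|lebesgue. (h j x *\<^sub>R c j x) \<bullet> \<psi> x) - (LINT x:K|lebesgue. h j x \<bullet> (c0 x \<bullet> \<psi> x))) \<longlonglongrightarrow> 0"
  proof (rule tendstoI)
    fix e :: real assume e: "e > 0"
    \<comment> \<open>Young's inequality bounds the error by d (|C| + D). The added 1 keeps the
      denominator positive.\<close>
    define d where "d = e / (2 * (\<bar>C\<bar> + D + 1))"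
    have d: "d > 0" using e D0 by (simp add: d_def)
    have "\<forall>\<^sub>F j in sequentially. \<forall>x\<in>K. dist (c j x) (c0 x) < d"
      using uniform_limitD[OF u[OF K] d] .
    then show "\<forall>\<^sub>F j in sequentially. dist ((LINT x:K|lebesgue. (h j x *\<^sub>R c j x) \<bullet> \<psi> x) -
        (LINT x:K|lebesgue. h j x \<bullet> (c0 x \<bullet> \<psi> x))) 0 < e"
      using C c
    proof eventually_elim
      case (elim j)
      have cj: "continuous_on K (c j)" using elim K continuous_on_subset by blast
      have hj: "Lp_on p K (h j)" using elim by simp
      have i1: "integrable (lebesgue_on K) (\<lambda>x. h j x \<bullet> (c j x \<bullet> \<psi> x))"
        and i2: "integrable (lebesgue_on K) (\<lambda>x. h j x \<bullet> (c0 x \<bullet> \<psi> x))"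
        using Lp_on_Holder(2)[OF Ks p hj] cpsi[OF cj] cpsi[OF c0K] by auto
      have i3: "integrable (lebesgue_on K) (\<lambda>x. d * (norm (h j x) powr p + norm (\<psi> x) powr ?q))"
        using hj \<psi> by (auto simp: Lp_on_iff[OF Ks])
      have "(LINT x:K|lebesgue. (h j x *\<^sub>R c j x) \<bullet> \<psi> x) - (LINT x:K|lebesgue. h j x \<bullet> (c0 x \<bullet> \<psi> x))
          = (LINT x|lebesgue_on K. h j x * ((c j x - c0 x) \<bullet> \<psi> x))"
        unfolding set_integral_lebesgue_on[OF Ks] using i1 i2
        by (simp add: inner_diff_left right_diff_distrib)
      also have "norm \<dots> \<le> (LINT x|lebesgue_on K. d * (norm (h j x) powr p + norm (\<psi> x) powr ?q))"
      proof (rule Bochner_Integration.integral_norm_bound_integral[OF _ i3])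
        show "integrable (lebesgue_on K) (\<lambda>x. h j x * ((c j x - c0 x) \<bullet> \<psi> x))"
          using Bochner_Integration.integrable_diff[OF i1 i2] by (simp add: inner_diff_left right_diff_distrib)
        fix x assume "x \<in> space (lebesgue_on K)"
        then have "x \<in> K" by simp
        then have "norm (c j x - c0 x) \<le> d" using elim by (force simp: dist_norm)
        then have "\<bar>(c j x - c0 x) \<bullet> \<psi> x\<bar> \<le> d * norm (\<psi> x)"
          using Cauchy_Schwarz_ineq2[of "c j x - c0 x" "\<psi> x"] by (meson mult_right_mono norm_ge_zero order_trans)
        then have "norm (h j x * ((c j x - c0 x) \<bullet> \<psi> x)) \<le> \<bar>h j x\<bar> * (d * norm (\<psi> x))"
          by (simp add: abs_mult mult_left_mono)
        also have "\<dots> = d * (norm (h j x) * norm (\<psi> x))" by simp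
        also have "\<dots> \<le> d * (norm (h j x) powr p + norm (\<psi> x) powr ?q)"
          using d p by (intro mult_left_mono Youngs_conj) auto
        finally show "norm (h j x * ((c j x - c0 x) \<bullet> \<psi> x)) \<le> d * (norm (h j x) powr p + norm (\<psi> x) powr ?q)" .
      qed
      also have "\<dots> = d * ((LINT x|lebesgue_on K. norm (h j x) powr p) + D)"
        using hj \<psi> by (simp add: Lp_on_iff[OF Ks] D_def)
      also have "\<dots> \<le> d * (\<bar>C\<bar> + D)" using elim d by (intro mult_left_mono) auto
      also have "\<dots> < e" using e D0 by (simp add: d_def field_simps add_nonneg_pos)
      finally show ?case by simp
    qed
  qed
  from tendsto_add[OF this lim1]
  show "(\<lambda>j. LINT x:K|lebesgue. (h j x *\<^sub>R c j x) \<bullet> \<psi> x) \<longlonglongrightarrow> (LINT x:K|lebesgue. (h0 x *\<^sub>R c0 x) \<bullet> \<psi> x)"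
    by simp
qed

lemma strong_imp_weak_conv_Lp_loc:
  assumes p: "1 < p" and ev: "\<forall>\<^sub>F j in sequentially. Lp_loc p \<Omega> (f j)" and f0: "Lp_loc p \<Omega> f0"
    and s: "\<And>K. compact K \<Longrightarrow> K \<subseteq> \<Omega> \<Longrightarrow> (\<lambda>j. LINT x:K|lebesgue. norm (f j x - f0 x) powr p) \<longlonglongrightarrow> 0"
  shows "weak_conv_Lp_loc p \<Omega> f f0"
  unfolding weak_conv_Lp_loc_def
proof (intro conjI allI impI ev f0)
  fix K and \<psi> :: "real^'a \<Rightarrow> 'b"
  let ?q = "p / (p - 1)"
  assume *: "compact K \<and> K \<subseteq> \<Omega> \<and> Lp_on ?q K \<psi>"
  then have K: "compact K" "K \<subseteq> \<Omega>" and \<psi>: "Lp_on ?q K \<psi>" by auto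
  have Ks: "K \<in> sets lebesgue" using K by simp
  define D where "D = (LINT x|lebesgue_on K. norm (\<psi> x) powr ?q) powr (1 / ?q)"
  have "((\<lambda>j. (LINT x:K|lebesgue. norm (f j x - f0 x) powr p) powr (1 / p) * D)) \<longlonglongrightarrow> 0 powr (1 / p) * D"
    using s[OF K] p by (intro tendsto_mult tendsto_powr' tendsto_const) (auto intro!: always_eventually simp: set_lebesgue_integral_def)
  then have lim: "((\<lambda>j. (LINT x:K|lebesgue. norm (f j x - f0 x) powr p) powr (1 / p) * D)) \<longlonglongrightarrow> 0" by simp
  have "(\<lambda>j. (LINT x:K|lebesgue. f j x \<bullet> \<psi> x) - (LINT x:K|lebesgue. f0 x \<bullet> \<psi> x)) \<longlonglongrightarrow> 0"
  proof (rule Lim_null_comparison[OF _ lim])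
    show "\<forall>\<^sub>F j in sequentially. norm ((LINT x:K|lebesgue. f j x \<bullet> \<psi> x) - (LINT x:K|lebesgue. f0 x \<bullet> \<psi> x)) \<le>
       (LINT x:K|lebesgue. norm (f j x - f0 x) powr p) powr (1 / p) * D"
      using ev
    proof eventually_elim
      case (elim j)
      have L: "Lp_on p K (f j)" "Lp_on p K f0" using elim f0 K by (auto simp: Lp_loc_def)
      have Ld: "Lp_on p K (\<lambda>x. f j x - f0 x)"
        using Lp_on_add[OF Ks _ L(1) Lp_on_scaleR[OF Ks L(2), of "-1"]] p by simp
      have "(LINT x:K|lebesgue. f j x \<bullet> \<psi> x) - (LINT x:K|lebesgue. f0 x \<bullet> \<psi> x) =
          (LINT x|lebesgue_on K. (f j x - f0 x) \<bullet> \<psi> x)"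
        unfolding set_integral_lebesgue_on[OF Ks]
        using Lp_on_Holder(2)[OF Ks p L(1) \<psi>] Lp_on_Holder(2)[OF Ks p L(2) \<psi>] by (simp add: inner_diff_left)
      also have "norm \<dots> \<le> (LINT x|lebesgue_on K. norm (f j x - f0 x) * norm (\<psi> x))"
        using Lp_on_Holder(1,2)[OF Ks p Ld \<psi>]
        by (intro Bochner_Integration.integral_norm_bound_integral) (auto intro: Cauchy_Schwarz_ineq2)
      also have "\<dots> \<le> (LINT x:K|lebesgue. norm (f j x - f0 x) powr p) powr (1 / p) * D"
        using Lp_on_Holder(3)[OF Ks p Ld \<psi>] by (simp add: D_def set_integral_lebesgue_on[OF Ks])
      finally show ?case .
    qed
  qed
  then show "(\<lambda>j. LINT x:K|lebesgue. f j x \<bullet> \<psi> x) \<longlonglongrightarrow> (LINT x:K|lebesgue. f0 x \<bullet> \<psi> x)"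
    by (simp add: LIM_zero_iff)
qed

subsection \<open>Smooth functions and test functions\<close>

lemma Ck_on_UNIV_SucI:
  assumes "\<And>x. (f has_derivative f' x) (at x)" "\<And>v. Ck_on k UNIV (\<lambda>x. f' x v)"
  shows "Ck_on (Suc k) UNIV f"
  using assms frechet_derivative_at[OF assms(1)] by (auto simp: differentiable_def)

lemma Ck_on_SucD:
  assumes "Ck_on (Suc k) S f"
  shows "Ck_on k S f"
  using assms
proof (induction k arbitrary: f)
  case 0
  then show ?case
    by (auto intro!: continuous_at_imp_continuous_on simp: differentiable_imp_continuous_within)
next
  case (Suc k)
  then show ?case by auto
qed

lemma Ck_on_le: "k \<le> m \<Longrightarrow> Ck_on m S f \<Longrightarrow> Ck_on k S f"
  by (induction m) (auto simp del: Ck_on.simps simp: le_Suc_eq dest: Ck_on_SucD)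

lemma smooth_has_derivative:
  assumes "smooth_on UNIV f"
  shows "(f has_derivative frechet_derivative f (at x)) (at x)"
  using assms[unfolded smooth_on_def, rule_format, of "Suc 0"]
  by (simp flip: frechet_derivative_works)

lemma smooth_frechet_derivative:
  "smooth_on UNIV f \<Longrightarrow> smooth_on UNIV (\<lambda>x. frechet_derivative f (at x) v)"
  by (rule smooth_on_def[THEN iffD2], intro allI, drule smooth_on_def[THEN iffD1])
    (drule_tac x = "Suc k" in spec, simp)

lemma smooth_imp_continuous: "smooth_on UNIV f \<Longrightarrow> continuous_on UNIV f"
  by (drule smooth_on_def[THEN iffD1], drule spec[of _ 0], simp)

lemma Ck_on_const: "Ck_on k UNIV (\<lambda>x. c)"
proof (induction k arbitrary: c)
  case (Suc k)
  show ?case by (rule Ck_on_UNIV_SucI[where f' = "\<lambda>x v. 0"]) (auto intro: Suc)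
qed simp

lemma Ck_on_bounded_linear:
  assumes "bounded_linear f"
  shows "Ck_on k UNIV f"
proof (cases k)
  case 0
  then show ?thesis using assms by (simp add: linear_continuous_on)
next
  case (Suc m)
  show ?thesis unfolding Suc
    by (rule Ck_on_UNIV_SucI[where f' = "\<lambda>x. f"])
      (auto intro: Ck_on_const bounded_linear_imp_has_derivative assms)
qed

lemma Ck_on_add:
  assumes "Ck_on k UNIV f" "Ck_on k UNIV g"
  shows "Ck_on k UNIV (\<lambda>x. f x + g x)"
  using assms
proof (induction k arbitrary: f g)
  case 0
  then show ?case by (auto intro: continuous_on_add)
next
  case (Suc k)
  show ?case
  proof (rule Ck_on_UNIV_SucI)
    show "((\<lambda>x. f x + g x) has_derivative (\<lambda>v. frechet_derivative f (at x) v + frechet_derivative g (at x) v)) (at x)" for x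
      using Suc.prems by (intro has_derivative_add) (auto simp flip: frechet_derivative_works)
    show "Ck_on k UNIV (\<lambda>x. frechet_derivative f (at x) v + frechet_derivative g (at x) v)" for v
      using Suc by simp
  qed
qed

lemma Ck_on_mult:
  fixes f g :: "'a::euclidean_space \<Rightarrow> real"
  assumes "Ck_on k UNIV f" "Ck_on k UNIV g"
  shows "Ck_on k UNIV (\<lambda>x. f x * g x)"
  using assms
proof (induction k arbitrary: f g)
  case 0
  then show ?case by (auto intro: continuous_on_mult)
next
  case (Suc k)
  show ?case
  proof (rule Ck_on_UNIV_SucI)
    show "((\<lambda>x. f x * g x) has_derivative (\<lambda>v. f x * frechet_derivative g (at x) v + frechet_derivative f (at x) v * g x)) (at x)" for x
      using Suc.prems by (intro has_derivative_mult) (auto simp flip: frechet_derivative_works)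
    show "Ck_on k UNIV (\<lambda>x. f x * frechet_derivative g (at x) v + frechet_derivative f (at x) v * g x)" for v
      using Suc.prems by (intro Ck_on_add Suc.IH Ck_on_SucD[OF Suc.prems(1)] Ck_on_SucD[OF Suc.prems(2)]) auto
  qed
qed

lemma Ck_on_inverse:
  fixes f :: "'a::euclidean_space \<Rightarrow> real"
  assumes "Ck_on k UNIV f" "\<And>x. f x \<noteq> 0"
  shows "Ck_on k UNIV (\<lambda>x. inverse (f x))"
  using assms(1)
proof (induction k)
  case 0
  then show ?case using assms(2) by (auto intro: continuous_on_inverse)
next
  case (Suc k)
  show ?case
  proof (rule Ck_on_UNIV_SucI)
    show "((\<lambda>x. inverse (f x)) has_derivative (\<lambda>v. (inverse (f x) * inverse (f x)) * (- 1 * frechet_derivative f (at x) v))) (at x)" for x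
    proof -
      have "(f has_derivative frechet_derivative f (at x)) (at x)"
        using Suc.prems by (simp flip: frechet_derivative_works)
      from Deriv.has_derivative_inverse[OF assms(2) this] show ?thesis by (simp add: algebra_simps)
    qed
    have "Ck_on k UNIV (\<lambda>x. inverse (f x))" using Suc Ck_on_SucD by blast
    then show "Ck_on k UNIV (\<lambda>x. (inverse (f x) * inverse (f x)) * (- 1 * frechet_derivative f (at x) v))" for v
      using Suc.prems by (intro Ck_on_mult Ck_on_const) auto
  qed
qed

lemma Ck_on_real_polynomial_function: "real_polynomial_function f \<Longrightarrow> Ck_on k UNIV f"
  by (induction rule: real_polynomial_function.induct)
    (auto intro: Ck_on_bounded_linear Ck_on_const Ck_on_add Ck_on_mult)

text \<open>The function t^(-m) exp(-1/t), extended by 0. The derivative of a member of this family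
  is a combination of the members m + 1 and m + 2, so carrying the exponent along lets smoothness
  follow by induction on the order with m arbitrary.\<close>

definition flat_exp :: "nat \<Rightarrow> real \<Rightarrow> real" where
  "flat_exp m t = (if t > 0 then inverse t ^ m * exp (- inverse t) else 0)"

lemma flat_exp_pos: "t > 0 \<Longrightarrow> flat_exp m t > 0" and flat_exp_nonpos: "t \<le> 0 \<Longrightarrow> flat_exp m t = 0"
  and flat_exp_nonneg: "flat_exp m t \<ge> 0"
  by (auto simp: flat_exp_def)

lemma flat_exp_has_derivative:
  "(flat_exp m has_real_derivative flat_exp (m + 2) t - m * flat_exp (m + 1) t) (at t)"
proof -
  consider "t > 0" | "t < 0" | "t = 0" by linarith
  then show ?thesis
  proof cases
    case 1
    have "((\<lambda>t. inverse t ^ m * exp (- inverse t)) has_real_derivative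
        flat_exp (m + 2) t - m * flat_exp (m + 1) t) (at t)"
      using 1
      apply (cases m)
       apply (auto intro!: derivative_eq_intros simp: flat_exp_def field_simps power2_eq_square)
      subgoal for n by (cases n) auto
      done
    then show ?thesis
      by (rule has_field_derivative_transform_within_open[of _ _ _ "{0<..}"])
        (use 1 in \<open>auto simp: flat_exp_def\<close>)
  next
    case 2
    have "((\<lambda>t. 0) has_real_derivative 0) (at t)" by simp
    then have "(flat_exp m has_real_derivative 0) (at t)"
      by (rule has_field_derivative_transform_within_open[of _ _ _ "{..<0}"])
        (use 2 in \<open>auto simp: flat_exp_def\<close>)
    then show ?thesis using 2 by (simp add: flat_exp_def)
  next
    case 3
    \<comment> \<open>The right difference quotient at 0 is (1/h)^(m+1) exp(-1/h), which tends to 0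
      because exponentials beat powers. The left one is constantly 0.\<close>
    have "((\<lambda>x. inverse x ^ (m + 1) / exp (inverse x)) \<longlongrightarrow> 0) (at_right (0::real))"
      by (rule filterlim_compose[OF tendsto_power_div_exp_0 filterlim_inverse_at_top_right])
    then have "((\<lambda>h. (flat_exp m (0 + h) - flat_exp m 0) / h) \<longlongrightarrow> 0) (at_right 0)"
      by (rule Lim_transform_eventually)
        (auto simp: eventually_at_right_field flat_exp_def exp_minus field_simps intro!: exI[of _ 1])
    moreover have "((\<lambda>h. (flat_exp m (0 + h) - flat_exp m 0) / h) \<longlongrightarrow> 0) (at_left 0)"
      by (rule tendsto_eventually)
        (auto simp: eventually_at_left_field flat_exp_def intro!: exI[of _ "-1"])
    ultimately have "((\<lambda>h. (flat_exp m (0 + h) - flat_exp m 0) / h) \<longlongrightarrow> 0) (at 0)"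
      by (simp add: filterlim_split_at)
    then show ?thesis using 3 by (simp add: DERIV_def flat_exp_def)
  qed
qed

lemma Ck_on_flat_exp:
  assumes "Ck_on k UNIV u"
  shows "Ck_on k UNIV (\<lambda>x. flat_exp m (u x))"
  using assms
proof (induction k arbitrary: m)
  case 0
  have "continuous_on UNIV (flat_exp m)"
    using flat_exp_has_derivative by (meson DERIV_isCont continuous_at_imp_continuous_on)
  then show ?case using 0 continuous_on_compose2[of UNIV "flat_exp m" UNIV u] by simp
next
  case (Suc k)
  show ?case
  proof (rule Ck_on_UNIV_SucI)
    have "(u has_derivative frechet_derivative u (at x)) (at x)" for x
      using Suc.prems by (auto simp flip: frechet_derivative_works)
    then show "((\<lambda>x. flat_exp m (u x)) has_derivative (\<lambda>v. frechet_derivative u (at x) v *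
        (flat_exp (m + 2) (u x) + (- real m) * flat_exp (m + 1) (u x)))) (at x)" for x
      using DERIV_compose_FDERIV[OF flat_exp_has_derivative, of u "frechet_derivative u (at x)" x UNIV m] by simp
    show "Ck_on k UNIV (\<lambda>x. frechet_derivative u (at x) v *
        (flat_exp (m + 2) (u x) + (- real m) * flat_exp (m + 1) (u x)))" for v
      using Suc.prems Ck_on_SucD[OF Suc.prems]
      by (intro Ck_on_mult Ck_on_add Suc.IH Ck_on_const) auto
  qed
qed

lemma smooth_const: "smooth_on UNIV (\<lambda>x. c)"
  by (simp add: smooth_on_def Ck_on_const del: Ck_on.simps)

lemma smooth_add: "smooth_on UNIV f \<Longrightarrow> smooth_on UNIV g \<Longrightarrow> smooth_on UNIV (\<lambda>x. f x + g x)"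
  by (simp add: smooth_on_def Ck_on_add del: Ck_on.simps)

lemma smooth_mult:
  fixes f g :: "'a::euclidean_space \<Rightarrow> real"
  shows "smooth_on UNIV f \<Longrightarrow> smooth_on UNIV g \<Longrightarrow> smooth_on UNIV (\<lambda>x. f x * g x)"
  by (simp add: smooth_on_def Ck_on_mult del: Ck_on.simps)

lemma smooth_inverse:
  fixes f :: "'a::euclidean_space \<Rightarrow> real"
  shows "smooth_on UNIV f \<Longrightarrow> (\<And>x. f x \<noteq> 0) \<Longrightarrow> smooth_on UNIV (\<lambda>x. inverse (f x))"
  by (simp add: smooth_on_def Ck_on_inverse del: Ck_on.simps)

lemma smooth_flat_exp: "smooth_on UNIV u \<Longrightarrow> smooth_on UNIV (\<lambda>x. flat_exp m (u x))"
  by (simp add: smooth_on_def Ck_on_flat_exp del: Ck_on.simps)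

lemma smooth_polynomial: "real_polynomial_function f \<Longrightarrow> smooth_on UNIV f"
  by (simp add: smooth_on_def Ck_on_real_polynomial_function del: Ck_on.simps)

lemma smooth_sum:
  "finite I \<Longrightarrow> (\<And>i. i \<in> I \<Longrightarrow> smooth_on UNIV (f i)) \<Longrightarrow> smooth_on UNIV (\<lambda>x. \<Sum>i\<in>I. f i x)"
  by (induction I rule: finite_induct) (auto intro: smooth_const smooth_add)

text \<open>Test functions without the smoothness. Tents around compact sets and products with
  Sobolev functions are only continuous, yet they have to be integrated against.\<close>

definition Cc :: "(real^'n) set \<Rightarrow> (real^'n \<Rightarrow> real) \<Rightarrow> bool" where
  "Cc \<Omega> \<zeta> \<longleftrightarrow> continuous_on UNIV \<zeta> \<and> (\<exists>K. compact K \<and> K \<subseteq> \<Omega> \<and> (\<forall>x. x \<notin> K \<longrightarrow> \<zeta> x = 0))"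

lemma test_function_imp_Cc: "test_function \<Omega> \<phi> \<Longrightarrow> Cc \<Omega> \<phi>"
  by (auto simp: test_function_def Cc_def intro: smooth_imp_continuous)

lemma test_function_mono: "test_function V \<phi> \<Longrightarrow> V \<subseteq> \<Omega> \<Longrightarrow> test_function \<Omega> \<phi>"
  by (auto simp: test_function_def)

lemma frechet_derivative_eq_0:
  assumes "open U" "x \<in> U" "\<And>y. y \<in> U \<Longrightarrow> f y = c"
  shows "frechet_derivative f (at x) = (\<lambda>v. 0)"
proof -
  have "(f has_derivative (\<lambda>v. 0)) (at x)"
    by (rule has_derivative_transform_within_open[of "\<lambda>_. c" _ _ _ U]) (use assms in auto)
  then show ?thesis using frechet_derivative_at by metis
qed

lemma test_function_partial:
  assumes "test_function \<Omega> \<phi>"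
  shows "test_function \<Omega> (\<lambda>x. frechet_derivative \<phi> (at x) v)"
proof -
  obtain K where K: "compact K" "K \<subseteq> \<Omega>" "\<And>x. x \<notin> K \<Longrightarrow> \<phi> x = 0" and s: "smooth_on UNIV \<phi>"
    using assms by (auto simp: test_function_def)
  have "frechet_derivative \<phi> (at x) v = 0" if "x \<notin> K" for x
    using frechet_derivative_eq_0[of "- K" x \<phi> 0] K that by (simp add: compact_imp_closed open_Compl)
  then show ?thesis
    unfolding test_function_def using K s smooth_frechet_derivative by blast
qed

lemma test_function_mult:
  assumes "test_function \<Omega> \<phi>" "smooth_on UNIV \<psi>"
  shows "test_function \<Omega> (\<lambda>x. \<phi> x * \<psi> x)"
proof -
  obtain K where "compact K" "K \<subseteq> \<Omega>" "\<And>x. x \<notin> K \<Longrightarrow> \<phi> x = 0" "smooth_on UNIV \<phi>"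
    using assms by (auto simp: test_function_def)
  then show ?thesis
    using assms(2) by (auto simp: test_function_def intro!: smooth_mult exI[of _ K])
qed

text \<open>The squared norm enters, not the norm, so the argument of \<open>flat_exp\<close> is a
  polynomial and there is no singularity at the centre.\<close>

lemma smooth_bump: "smooth_on UNIV (\<lambda>y. flat_exp m (1 - (y - x) \<bullet> (y - x) / s\<^sup>2))"
proof (rule smooth_flat_exp, rule smooth_polynomial)
  have "(\<lambda>y. 1 - (y - x) \<bullet> (y - x) / s\<^sup>2) =
     (\<lambda>y. 1 + (- inverse (s\<^sup>2)) * (\<Sum>b\<in>Basis. ((y \<bullet> b) + - (x \<bullet> b)) * ((y \<bullet> b) + - (x \<bullet> b))))"
    by (rule ext) (subst euclidean_inner, simp add: inner_diff_left divide_inverse mult.commute)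
  moreover have "real_polynomial_function (\<lambda>y. 1 + (- inverse (s\<^sup>2)) *
      (\<Sum>b\<in>Basis. ((y \<bullet> b) + - (x \<bullet> b)) * ((y \<bullet> b) + - (x \<bullet> b))))"
    by (intro real_polynomial_function.intros real_polynomial_function_sum) (auto intro: bounded_linear_inner_left)
  ultimately show "real_polynomial_function (\<lambda>y. 1 - (y - x) \<bullet> (y - x) / s\<^sup>2)" by simp
qed

lemma bump_eq_0: "s > 0 \<Longrightarrow> y \<notin> cball x s \<Longrightarrow> flat_exp m (1 - (y - x) \<bullet> (y - x) / s\<^sup>2) = 0"
  and bump_pos: "s > 0 \<Longrightarrow> y \<in> ball x s \<Longrightarrow> flat_exp m (1 - (y - x) \<bullet> (y - x) / s\<^sup>2) > 0"
proof -
  assume s: "s > 0"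
  show "flat_exp m (1 - (y - x) \<bullet> (y - x) / s\<^sup>2) = 0" if "y \<notin> cball x s"
  proof (rule flat_exp_nonpos)
    have "s\<^sup>2 \<le> (norm (y - x))\<^sup>2"
      using that s by (intro power_mono) (auto simp: dist_norm norm_minus_commute)
    then show "1 - (y - x) \<bullet> (y - x) / s\<^sup>2 \<le> 0" using s by (simp add: power2_norm_eq_inner field_simps)
  qed
  show "flat_exp m (1 - (y - x) \<bullet> (y - x) / s\<^sup>2) > 0" if "y \<in> ball x s"
  proof (rule flat_exp_pos)
    have "(norm (y - x))\<^sup>2 < s\<^sup>2"
      using that s by (intro power_strict_mono) (auto simp: dist_norm norm_minus_commute)
    then show "1 - (y - x) \<bullet> (y - x) / s\<^sup>2 > 0" using s by (simp add: power2_norm_eq_inner field_simps)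
  qed
qed

lemma test_function_bump:
  fixes x :: "real^'n"
  assumes "s > 0" "cball x s \<subseteq> \<Omega>"
  shows "test_function \<Omega> (\<lambda>y. flat_exp m (1 - (y - x) \<bullet> (y - x) / s\<^sup>2))"
  unfolding test_function_def
proof (intro conjI exI[of _ "cball x s"] allI impI)
  show "smooth_on UNIV (\<lambda>y. flat_exp m (1 - (y - x) \<bullet> (y - x) / s\<^sup>2))" by (rule smooth_bump)
qed (use assms bump_eq_0 in auto)

text \<open>A finite sum \<open>w\<close> of bumps around points of \<open>K\<close> satisfies w
  \<ge> c > 0 on \<open>K\<close>. The quotient a / (a + b), where a and b are
  \<open>flat_exp 0\<close> at w and at c - w, is 1 where w \<ge> c and 0 where w = 0. Its
  denominator never vanishes, as w and c - w cannot both be nonpositive.\<close>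

lemma smooth_cutoff:
  fixes K :: "(real^'n) set"
  assumes \<Omega>: "open \<Omega>" and K: "compact K" "K \<subseteq> \<Omega>"
  obtains \<eta> where "test_function \<Omega> \<eta>" "\<And>x. x \<in> K \<Longrightarrow> \<eta> x = 1" "\<And>x. 0 \<le> \<eta> x \<and> \<eta> x \<le> 1"
proof -
  have "\<forall>x\<in>K. \<exists>e>0. cball x e \<subseteq> \<Omega>" using \<Omega> K by (meson open_contains_cball subsetD)
  then obtain e where e: "\<And>x. x \<in> K \<Longrightarrow> e x > 0" "\<And>x. x \<in> K \<Longrightarrow> cball x (e x) \<subseteq> \<Omega>" by metis
  have "K \<subseteq> (\<Union>x\<in>K. ball x (e x))" using e by force
  then obtain D where D: "D \<subseteq> K" "finite D" "K \<subseteq> (\<Union>x\<in>D. ball x (e x))"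
    using compactE_image[OF K(1), of K "\<lambda>x. ball x (e x)"] by (metis open_ball)
  define w where "w y = (\<Sum>x\<in>D. flat_exp 0 (1 - (y - x) \<bullet> (y - x) / (e x)\<^sup>2))" for y
  have w0: "w y \<ge> 0" for y unfolding w_def by (intro sum_nonneg flat_exp_nonneg)
  have wpos: "w y > 0" if y: "y \<in> K" for y
  proof -
    obtain x where x: "x \<in> D" "y \<in> ball x (e x)" using D y by blast
    then have "flat_exp 0 (1 - (y - x) \<bullet> (y - x) / (e x)\<^sup>2) > 0" using D e by (intro bump_pos) auto
    then show ?thesis unfolding w_def using x D by (intro sum_pos2[of D x] flat_exp_nonneg) auto
  qed
  have ws: "smooth_on UNIV w"
    unfolding w_def[abs_def] using D(2) by (intro smooth_sum smooth_bump) auto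
  have "\<exists>c>0. \<forall>y\<in>K. c \<le> w y"
  proof (cases "K = {}")
    case False
    have "continuous_on K w" using smooth_imp_continuous[OF ws] continuous_on_subset by blast
    then show ?thesis using continuous_attains_inf[OF K(1) False] wpos by blast
  qed (auto intro: exI[of _ 1])
  then obtain c where c: "c > 0" "\<And>y. y \<in> K \<Longrightarrow> c \<le> w y" by blast
  define d where "d y = flat_exp 0 (w y) + flat_exp 0 (c + - 1 * w y)" for y
  define \<eta> where "\<eta> y = flat_exp 0 (w y) * inverse (d y)" for y
  have d: "d y > 0" for y
    using c w0[of y] flat_exp_pos[of "w y" 0] flat_exp_pos[of "c - w y" 0]
      flat_exp_nonneg[of 0 "w y"] flat_exp_nonneg[of 0 "c - w y"]
    unfolding d_def by (cases "w y = 0") (auto simp: add_nonneg_pos add_pos_nonneg)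
  have "smooth_on UNIV \<eta>"
    unfolding \<eta>_def d_def using d[unfolded d_def]
    by (intro smooth_mult smooth_inverse smooth_add smooth_flat_exp smooth_const ws) (metis less_irrefl)
  moreover have "\<eta> y = 0" if "y \<notin> (\<Union>x\<in>D. cball x (e x))" for y
  proof -
    have "flat_exp 0 (1 - (y - x) \<bullet> (y - x) / (e x)\<^sup>2) = 0" if "x \<in> D" for x
      using that \<open>y \<notin> _\<close> e D by (intro bump_eq_0) auto
    then show ?thesis by (simp add: \<eta>_def w_def flat_exp_nonpos)
  qed
  moreover have "compact (\<Union>x\<in>D. cball x (e x))" using D by auto
  moreover have "(\<Union>x\<in>D. cball x (e x)) \<subseteq> \<Omega>" using D e by blast
  ultimately have "test_function \<Omega> \<eta>" unfolding test_function_def by blast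
  moreover have "\<eta> x = 1" if "x \<in> K" for x
  proof -
    have "flat_exp 0 (c + - 1 * w x) = 0" using c(2)[OF that] by (intro flat_exp_nonpos) simp
    then show ?thesis unfolding \<eta>_def using d[of x] by (simp add: d_def)
  qed
  moreover have "0 \<le> \<eta> x \<and> \<eta> x \<le> 1" for x
    using d[of x] flat_exp_nonneg[of 0 "w x"] flat_exp_nonneg[of 0 "c + - 1 * w x"]
    by (simp add: \<eta>_def d_def field_simps)
  ultimately show ?thesis using that by blast
qed

text \<open>A polynomial approximation on a compact set, from the Stone-Weierstrass theorem, is
  multiplied by a cutoff. The set \<open>K'\<close> is fixed before \<epsilon>, so one integral over
  \<open>K'\<close> controls the errors of all the approximations.\<close>

lemma test_function_dense:
  assumes \<Omega>: "open \<Omega>" and K: "compact K" "K \<subseteq> \<Omega>" and \<zeta>: "continuous_on UNIV \<zeta>" "\<And>x. x \<notin> K \<Longrightarrow> \<zeta> x = 0"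
  obtains K' where "compact K'" "K' \<subseteq> \<Omega>" "K \<subseteq> K'"
    "\<And>\<epsilon>. \<epsilon> > 0 \<Longrightarrow> \<exists>\<phi>. test_function \<Omega> \<phi> \<and> (\<forall>x. \<bar>\<phi> x - \<zeta> x\<bar> \<le> \<epsilon>) \<and> (\<forall>x. x \<notin> K' \<longrightarrow> \<phi> x = 0)"
proof -
  obtain \<eta> where \<eta>: "test_function \<Omega> \<eta>" "\<And>x. x \<in> K \<Longrightarrow> \<eta> x = 1" "\<And>x. 0 \<le> \<eta> x \<and> \<eta> x \<le> 1"
    using smooth_cutoff[OF \<Omega> K] by metis
  then obtain K1 where K1: "compact K1" "K1 \<subseteq> \<Omega>" "\<And>x. x \<notin> K1 \<Longrightarrow> \<eta> x = 0"
    by (auto simp: test_function_def)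
  show ?thesis
  proof (rule that[of "K \<union> K1"])
    fix \<epsilon> :: real assume "\<epsilon> > 0"
    moreover have "compact (K \<union> K1)" using K K1 by auto
    ultimately obtain g where g: "real_polynomial_function g" "\<And>x. x \<in> K \<union> K1 \<Longrightarrow> \<bar>\<zeta> x - g x\<bar> < \<epsilon>"
      using Stone_Weierstrass_real_polynomial_function[of "K \<union> K1" \<zeta> \<epsilon>] continuous_on_subset[OF \<zeta>(1)] by blast
    have "\<bar>\<eta> x * g x - \<zeta> x\<bar> \<le> \<epsilon>" for x
    proof (cases "x \<in> K \<union> K1")
      case True
      have "\<eta> x * g x - \<zeta> x = \<eta> x * (g x - \<zeta> x)"
        using \<eta>(2) \<zeta>(2) by (cases "x \<in> K") (auto simp: algebra_simps)
      then have "\<bar>\<eta> x * g x - \<zeta> x\<bar> = \<bar>\<eta> x\<bar> * \<bar>g x - \<zeta> x\<bar>" by (simp add: abs_mult)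
      also have "\<dots> \<le> 1 * \<epsilon>" using \<eta>(3)[of x] g(2)[OF True] by (intro mult_mono) auto
      finally show ?thesis by simp
    next
      case False
      then show ?thesis using K1 \<zeta> \<open>\<epsilon> > 0\<close> by simp
    qed
    then show "\<exists>\<phi>. test_function \<Omega> \<phi> \<and> (\<forall>x. \<bar>\<phi> x - \<zeta> x\<bar> \<le> \<epsilon>) \<and> (\<forall>x. x \<notin> K \<union> K1 \<longrightarrow> \<phi> x = 0)"
      using test_function_mult[OF \<eta>(1) smooth_polynomial[OF g(1)]] K1 by (intro exI[of _ "\<lambda>x. \<eta> x * g x"]) auto
  qed (use K K1 in auto)
qed

subsection \<open>The fundamental lemma of the calculus of variations\<close>

lemma Cc_scaleR_integrable:
  fixes h :: "real^'n \<Rightarrow> 'b::euclidean_space"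
  assumes \<zeta>: "Cc \<Omega> \<zeta>" and h: "Lp_loc 1 \<Omega> h"
  shows "integrable lebesgue (\<lambda>x. \<zeta> x *\<^sub>R h x)"
proof -
  obtain K where K: "compact K" "K \<subseteq> \<Omega>" "\<And>x. x \<notin> K \<Longrightarrow> \<zeta> x = 0" and c: "continuous_on UNIV \<zeta>"
    using \<zeta> by (auto simp: Cc_def)
  have Ks: "K \<in> sets lebesgue" using K by simp
  have hK: "Lp_on 1 K h" using h K by (auto simp: Lp_loc_def)
  have c': "continuous_on K \<zeta>" using c continuous_on_subset by blast
  have "bounded (\<zeta> ` K)" using K c' by (simp add: compact_continuous_image compact_imp_bounded)
  then obtain C where C: "\<And>x. x \<in> K \<Longrightarrow> norm (\<zeta> x) \<le> C" by (auto simp: bounded_iff)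
  have m: "\<zeta> \<in> borel_measurable (lebesgue_on K)"
    using c' K by (intro continuous_imp_measurable_on_sets_lebesgue) auto
  have "integrable (lebesgue_on K) (\<lambda>x. \<zeta> x *\<^sub>R h x)"
  proof (rule Bochner_Integration.integrable_bound)
    show "integrable (lebesgue_on K) (\<lambda>x. C * norm (h x))"
      using hK by (auto simp: Lp_on_1_iff[OF Ks])
    show "(\<lambda>x. \<zeta> x *\<^sub>R h x) \<in> borel_measurable (lebesgue_on K)"
      using m hK by (auto simp: Lp_on_iff[OF Ks])
    show "AE x in lebesgue_on K. norm (\<zeta> x *\<^sub>R h x) \<le> norm (C * norm (h x))"
    proof (rule AE_I2)
      fix x assume "x \<in> space (lebesgue_on K)"
      then have "norm (\<zeta> x) \<le> \<bar>C\<bar>" using C by fastforce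
      then show "norm (\<zeta> x *\<^sub>R h x) \<le> norm (C * norm (h x))"
        by (simp add: abs_mult mult_right_mono)
    qed
  qed
  then have "integrable lebesgue (\<lambda>x. indicator K x *\<^sub>R (\<zeta> x *\<^sub>R h x))"
    using K by (simp add: integrable_restrict_space)
  moreover have "indicator K x *\<^sub>R (\<zeta> x *\<^sub>R h x) = \<zeta> x *\<^sub>R h x" for x
    using K(3)[of x] by (cases "x \<in> K") auto
  ultimately show ?thesis by (simp only:)
qed

lemma Cc_set_integral:
  fixes h :: "real^'n \<Rightarrow> 'b::euclidean_space"
  assumes "Cc \<Omega> \<zeta>"
  shows "(LINT x:\<Omega>|lebesgue. \<zeta> x *\<^sub>R h x) = (LINT x|lebesgue. \<zeta> x *\<^sub>R h x)"
proof -
  have "\<zeta> x = 0" if "x \<notin> \<Omega>" for x using assms that by (auto simp: Cc_def)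
  then have "indicator \<Omega> x *\<^sub>R (\<zeta> x *\<^sub>R h x) = \<zeta> x *\<^sub>R h x" for x
    by (cases "x \<in> \<Omega>") auto
  then show ?thesis by (simp only: set_lebesgue_integral_def)
qed

lemma has_weak_pderiv_iff:
  "has_weak_pderiv \<Omega> i f h \<longleftrightarrow> Lp_loc 1 \<Omega> f \<and> Lp_loc 1 \<Omega> h \<and>
     (\<forall>\<phi>. test_function \<Omega> \<phi> \<longrightarrow>
        (LINT x|lebesgue. frechet_derivative \<phi> (at x) (axis i 1) *\<^sub>R f x) =
        - (LINT x|lebesgue. \<phi> x *\<^sub>R h x))"
proof -
  have "(LINT x:\<Omega>|lebesgue. frechet_derivative \<phi> (at x) (axis i 1) *\<^sub>R f x) =
      (LINT x|lebesgue. frechet_derivative \<phi> (at x) (axis i 1) *\<^sub>R f x)"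
    "(LINT x:\<Omega>|lebesgue. \<phi> x *\<^sub>R h x) = (LINT x|lebesgue. \<phi> x *\<^sub>R h x)"
    if "test_function \<Omega> \<phi>" for \<phi>
    using that by (auto intro!: Cc_set_integral test_function_imp_Cc test_function_partial)
  then show ?thesis unfolding has_weak_pderiv_def by auto
qed

lemma integral_Cc_eq_0:
  fixes h :: "real^'n \<Rightarrow> 'b::euclidean_space"
  assumes \<Omega>: "open \<Omega>" and h: "Lp_loc 1 \<Omega> h"
    and eq: "\<And>\<phi>. test_function \<Omega> \<phi> \<Longrightarrow> (LINT x|lebesgue. \<phi> x *\<^sub>R h x) = 0"
    and \<zeta>: "Cc \<Omega> \<zeta>"
  shows "(LINT x|lebesgue. \<zeta> x *\<^sub>R h x) = 0"
proof (rule ccontr)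
  assume ne: "(LINT x|lebesgue. \<zeta> x *\<^sub>R h x) \<noteq> 0" (is "?I \<noteq> 0")
  obtain K where K: "compact K" "K \<subseteq> \<Omega>" "\<And>x. x \<notin> K \<Longrightarrow> \<zeta> x = 0" and c: "continuous_on UNIV \<zeta>"
    using \<zeta> by (auto simp: Cc_def)
  obtain K' where K': "compact K'" "K' \<subseteq> \<Omega>" "K \<subseteq> K'"
    and dense: "\<And>\<epsilon>. \<epsilon> > 0 \<Longrightarrow> \<exists>\<phi>. test_function \<Omega> \<phi> \<and> (\<forall>x. \<bar>\<phi> x - \<zeta> x\<bar> \<le> \<epsilon>) \<and> (\<forall>x. x \<notin> K' \<longrightarrow> \<phi> x = 0)"
    by (rule test_function_dense[OF \<Omega> K(1,2) c]) (use K(3) in blast)+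
  have hK: "integrable (lebesgue_on K') h"
    using h K' by (auto simp: Lp_loc_def Lp_on_1_iff)
  then have hK1: "integrable lebesgue (\<lambda>x. indicator K' x * norm (h x))"
    using integrable_restrict_space[THEN iffD1, OF _ integrable_norm[OF hK]] K' by simp
  define B where "B = (LINT x|lebesgue. indicator K' x * norm (h x))"
  have B0: "B \<ge> 0" unfolding B_def by (rule integral_nonneg_AE) auto
  \<comment> \<open>Replacing \<zeta> by a test function moves the integral by at most \<epsilon> B,
    which is at most half of its norm; but test functions give 0.\<close>
  define \<epsilon> where "\<epsilon> = norm ?I / (2 * (B + 1))"
  have e: "\<epsilon> > 0" using ne B0 by (simp add: \<epsilon>_def)
  then obtain \<phi> where \<phi>: "test_function \<Omega> \<phi>" "\<And>x. \<bar>\<phi> x - \<zeta> x\<bar> \<le> \<epsilon>" "\<And>x. x \<notin> K' \<Longrightarrow> \<phi> x = 0"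
    using dense by metis
  have i1: "integrable lebesgue (\<lambda>x. \<zeta> x *\<^sub>R h x)" "integrable lebesgue (\<lambda>x. \<phi> x *\<^sub>R h x)"
    using Cc_scaleR_integrable[OF \<zeta> h] Cc_scaleR_integrable[OF test_function_imp_Cc[OF \<phi>(1)] h] by auto
  have "?I = (LINT x|lebesgue. (\<zeta> x - \<phi> x) *\<^sub>R h x)"
    using i1 eq[OF \<phi>(1)] by (simp add: scaleR_diff_left)
  also have "norm \<dots> \<le> (LINT x|lebesgue. \<epsilon> * (indicator K' x * norm (h x)))"
  proof (rule Bochner_Integration.integral_norm_bound_integral)
    show "integrable lebesgue (\<lambda>x. (\<zeta> x - \<phi> x) *\<^sub>R h x)"
      using Bochner_Integration.integrable_diff[OF i1] by (simp add: scaleR_diff_left)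
    show "integrable lebesgue (\<lambda>x. \<epsilon> * (indicator K' x * norm (h x)))" using hK1 by simp
    fix x
    show "norm ((\<zeta> x - \<phi> x) *\<^sub>R h x) \<le> \<epsilon> * (indicator K' x * norm (h x))"
    proof (cases "x \<in> K'")
      case True
      then show ?thesis using \<phi>(2)[of x] by (auto simp: abs_minus_commute intro: mult_right_mono)
    next
      case False
      then have "x \<notin> K" using K' by blast
      then show ?thesis using K(3) \<phi>(3) False by simp
    qed
  qed
  also have "\<dots> = \<epsilon> * B" using hK1 by (simp add: B_def)
  also have "\<dots> \<le> norm ?I / 2"
    using B0 e mult_left_mono[of B "B + 1" \<epsilon>] by (simp add: \<epsilon>_def field_simps)
  finally show False using ne by simp
qed

lemma compact_neighbourhood:
  fixes K :: "'a::euclidean_space set"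
  assumes "compact K" "open \<Omega>" "K \<subseteq> \<Omega>"
  obtains e where "e > 0" "compact (\<Union>x\<in>K. cball x e)" "(\<Union>x\<in>K. cball x e) \<subseteq> \<Omega>"
proof -
  obtain e where e: "e > 0" "(\<Union>x\<in>K. cball x e) \<subseteq> \<Omega>"
    using compact_subset_open_imp_cball_epsilon_subset[OF assms] by blast
  have "(\<Union>x\<in>K. cball x e) = (\<Union>x\<in>K. \<Union>y\<in>cball 0 e. {x + y})"
  proof (intro set_eqI iffI)
    fix z assume "z \<in> (\<Union>x\<in>K. cball x e)"
    then obtain x where "x \<in> K" "norm (z - x) \<le> e" by (auto simp: dist_norm norm_minus_commute)
    then show "z \<in> (\<Union>x\<in>K. \<Union>y\<in>cball 0 e. {x + y})"
      by (intro UN_I[of x] UN_I[of "z - x"]) auto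
  next
    fix z assume "z \<in> (\<Union>x\<in>K. \<Union>y\<in>cball 0 e. {x + y})"
    then obtain x y where "x \<in> K" "norm y \<le> e" "z = x + y" by auto
    then show "z \<in> (\<Union>x\<in>K. cball x e)" by (intro UN_I[of x]) (auto simp: dist_norm)
  qed
  then show ?thesis using that e compact_sums'[OF assms(1) compact_cball[of 0 e]] by simp
qed

text \<open>The indicator of \<open>K\<close> is the limit of tents that are 1 on \<open>K\<close>,
  linear in the distance to \<open>K\<close>, and 0 from distance e / (m + 1) on. All of them live
  in one compact neighbourhood \<open>K1\<close> inside \<Omega>, where the norm of \<open>h\<close>
  is an integrable bound.\<close>

lemma integral_compact_eq_0:
  fixes h :: "real^'n \<Rightarrow> 'b::euclidean_space"
  assumes \<Omega>: "open \<Omega>" and h: "Lp_loc 1 \<Omega> h"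
    and eq: "\<And>\<phi>. test_function \<Omega> \<phi> \<Longrightarrow> (LINT x|lebesgue. \<phi> x *\<^sub>R h x) = 0"
    and K: "compact K" "K \<subseteq> \<Omega>"
  shows "(LINT x|lebesgue. indicator K x *\<^sub>R h x) = 0"
proof (cases "K = {}")
  case False
  obtain e where e: "e > 0" "compact (\<Union>x\<in>K. cball x e)" "(\<Union>x\<in>K. cball x e) \<subseteq> \<Omega>"
    using compact_neighbourhood[OF K(1) \<Omega> K(2)] by blast
  define K1 where "K1 = (\<Union>x\<in>K. cball x e)"
  have K1: "compact K1" and K1\<Omega>: "K1 \<subseteq> \<Omega>" using e by (simp_all add: K1_def)
  define \<zeta> where "\<zeta> m x = max 0 (1 - real (Suc m) * infdist x K / e)" for m x
  have z_c: "continuous_on UNIV (\<zeta> m)" for m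
    unfolding \<zeta>_def using e(1) by (intro continuous_intros) auto
  have z_K: "\<zeta> m x = 0" if "x \<notin> K1" for m x
  proof -
    have "infdist x K > e"
    proof (rule ccontr)
      assume "\<not> infdist x K > e"
      moreover obtain y where "y \<in> K" "infdist x K = dist x y"
        using infdist_attains_inf[of K x] K False compact_imp_closed by blast
      ultimately have "x \<in> K1" unfolding K1_def by (intro UN_I[of y]) (auto simp: dist_commute)
      with that show False by simp
    qed
    then have "e \<le> real (Suc m) * infdist x K"
      using e mult_mono[of 1 "real (Suc m)" e "infdist x K"] by simp
    then show ?thesis using e by (simp add: \<zeta>_def field_simps)
  qed
  have Cc: "Cc \<Omega> (\<zeta> m)" for m
    unfolding Cc_def using z_c z_K K1 K1\<Omega> by (intro conjI exI[of _ K1]) auto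
  have hK: "integrable (lebesgue_on K1) h"
    using h K1 K1\<Omega> by (auto simp: Lp_loc_def Lp_on_1_iff)
  have hK1: "integrable lebesgue (\<lambda>x. indicator K1 x *\<^sub>R norm (h x))"
    using integrable_restrict_space[THEN iffD1, OF _ integrable_norm[OF hK]] K1 by simp
  have "(\<lambda>m. LINT x|lebesgue. \<zeta> m x *\<^sub>R h x) \<longlonglongrightarrow> (LINT x|lebesgue. indicator K x *\<^sub>R h x)"
  proof (rule integral_dominated_convergence[OF _ _ hK1])
    show "(\<lambda>x. \<zeta> m x *\<^sub>R h x) \<in> borel_measurable lebesgue" for m
      using Cc_scaleR_integrable[OF Cc h] by (rule borel_measurable_integrable)
    have "integrable (lebesgue_on K) h"
      using h K by (auto simp: Lp_loc_def Lp_on_1_iff)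
    then show "(\<lambda>x. indicator K x *\<^sub>R h x) \<in> borel_measurable lebesgue"
      using K by (simp add: integrable_restrict_space borel_measurable_integrable)
    show "AE x in lebesgue. norm (\<zeta> m x *\<^sub>R h x) \<le> indicator K1 x *\<^sub>R norm (h x)" for m
    proof (rule AE_I2)
      fix x
      have "\<bar>\<zeta> m x\<bar> \<le> 1" using e infdist_nonneg[of x K] by (simp add: \<zeta>_def)
      then show "norm (\<zeta> m x *\<^sub>R h x) \<le> indicator K1 x *\<^sub>R norm (h x)"
        using z_K[of x m] mult_right_mono[of "\<bar>\<zeta> m x\<bar>" 1 "norm (h x)"] by (cases "x \<in> K1") auto
    qed
    show "AE x in lebesgue. (\<lambda>m. \<zeta> m x *\<^sub>R h x) \<longlonglongrightarrow> indicator K x *\<^sub>R h x"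
    proof (rule AE_I2)
      fix x
      have "(\<lambda>m. \<zeta> m x) \<longlonglongrightarrow> indicator K x"
      proof (cases "x \<in> K")
        case True
        then show ?thesis by (simp add: \<zeta>_def)
      next
        case False
        then have d: "infdist x K > 0"
          using K \<open>K \<noteq> {}\<close> infdist_pos_not_in_closed compact_imp_closed by blast
        obtain N where N: "e < real N * infdist x K" using ex_less_of_nat_mult[OF d] by blast
        have "\<zeta> m x = 0" if "m \<ge> N" for m
        proof -
          have "real N * infdist x K \<le> real (Suc m) * infdist x K"
            using that d by (intro mult_right_mono) auto
          then show ?thesis using N e by (simp add: \<zeta>_def field_simps)
        qed
        then have "\<forall>\<^sub>F m in sequentially. \<zeta> m x = 0" by (auto simp: eventually_sequentially)
        then show ?thesis using False by (auto intro: tendsto_eventually)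
      qed
      then show "(\<lambda>m. \<zeta> m x *\<^sub>R h x) \<longlonglongrightarrow> indicator K x *\<^sub>R h x" by (intro tendsto_intros)
    qed
  qed
  then show ?thesis
    using integral_Cc_eq_0[OF \<Omega> h eq Cc] by (simp add: LIMSEQ_const_iff)
qed simp

text \<open>Up to a null set, the set where \<open>h\<close> is positive is a countable union of
  compact sets. A positive function with vanishing integral over a compact set forces that set to be
  null.\<close>

lemma AE_nonpos_of_integral_compact:
  fixes h :: "'a::euclidean_space \<Rightarrow> real"
  assumes C: "compact C" and h: "integrable (lebesgue_on C) h"
    and eq: "\<And>K. compact K \<Longrightarrow> K \<subseteq> C \<Longrightarrow> (LINT x|lebesgue. indicator K x *\<^sub>R h x) = 0"
  shows "AE x in lebesgue. x \<in> C \<longrightarrow> h x \<le> 0"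
proof -
  have hC: "integrable lebesgue (\<lambda>x. indicator C x *\<^sub>R h x)"
    using C h by (simp add: integrable_restrict_space)
  define S where "S = {x. indicator C x *\<^sub>R h x > 0}"
  have "(\<lambda>x. indicator C x *\<^sub>R h x) \<in> borel_measurable lebesgue" using hC by simp
  then have "S \<in> sets lebesgue" unfolding S_def by (simp add: borel_measurable_iff_greater)
  then obtain F T where F: "fsigma F" "T \<in> null_sets lebesgue" "F \<union> T = S"
    using lebesgue_set_almost_fsigma by metis
  then obtain G :: "nat \<Rightarrow> 'a set" where "range G \<subseteq> Collect compact" and G2: "F = \<Union> (range G)"
    using fsigma_Union_compact by metis
  then have G: "\<And>n. compact (G n)" "F = (\<Union>n. G n)" by auto
  have SC': "x \<in> C \<and> h x > 0" if "x \<in> S" for x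
    using that by (cases "x \<in> C") (auto simp: S_def)
  then have SC: "S \<subseteq> C" "\<And>x. x \<in> S \<Longrightarrow> h x > 0" by auto
  have "G n \<in> null_sets lebesgue" for n
  proof -
    have Gn: "G n \<subseteq> S" using G F by blast
    have "set_integrable lebesgue (G n) h"
      using h C G Gn SC by (intro set_integrable_subset[of lebesgue C h "G n"]) (auto simp: set_integrable_lebesgue_on)
    then have i: "integrable lebesgue (\<lambda>x. indicator (G n) x *\<^sub>R h x)" by (simp add: set_integrable_def)
    have "(LINT x|lebesgue. indicator (G n) x *\<^sub>R h x) = 0"
      using eq G Gn SC by blast
    then have "AE x in lebesgue. indicator (G n) x *\<^sub>R h x = 0"
      using i SC(2) Gn by (subst (asm) integral_nonneg_eq_0_iff_AE) (auto simp: indicator_def less_imp_le subset_iff)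
    then have "AE x in lebesgue. x \<notin> G n"
      by (rule eventually_mono) (use SC(2) Gn in \<open>force simp: indicator_def\<close>)
    then show ?thesis using G by (intro AE_iff_null_sets[THEN iffD2]) auto
  qed
  then have "F \<in> null_sets lebesgue" unfolding G by (intro null_sets_UN) auto
  then have "S \<in> null_sets lebesgue" using F by (metis null_sets.Un)
  then have "AE x in lebesgue. x \<notin> S" by (rule AE_not_in)
  then show ?thesis by (rule eventually_mono) (auto simp: S_def)
qed

text \<open>Vanishing integrals pass from test functions to continuous functions by uniform
  approximation and from these to indicators of compact sets. The latter detect the sign of each
  coordinate of \<open>h\<close> and of its negative on an exhaustion of \<Omega>.\<close>

theorem fundamental_lemma_variations:
  fixes h :: "real^'n \<Rightarrow> 'b::euclidean_space"
  assumes \<Omega>: "open \<Omega>" and h: "Lp_loc 1 \<Omega> h"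
    and eq: "\<And>\<phi>. test_function \<Omega> \<phi> \<Longrightarrow> (LINT x|lebesgue. \<phi> x *\<^sub>R h x) = 0"
  shows "AE x in lebesgue. x \<in> \<Omega> \<longrightarrow> h x = 0"
proof -
  obtain C :: "nat \<Rightarrow> (real^'n) set" where C: "\<And>n. compact (C n)" "\<And>n. C n \<subseteq> \<Omega>" "\<Union> (range C) = \<Omega>"
    using open_Union_compact_subsets[OF \<Omega>] by metis
  have "AE x in lebesgue. x \<in> C n \<longrightarrow> h x \<bullet> b = 0" for n b
  proof -
    have hC: "integrable (lebesgue_on (C n)) h"
      using h C by (auto simp: Lp_loc_def Lp_on_1_iff)
    have 0: "(LINT x|lebesgue. indicator K x *\<^sub>R (h x \<bullet> b)) = 0" if K: "compact K" "K \<subseteq> C n" for K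
    proof -
      have K': "K \<subseteq> \<Omega>" using K C by blast
      then have "integrable (lebesgue_on K) h"
        using h K by (auto simp: Lp_loc_def Lp_on_1_iff)
      then have "integrable lebesgue (\<lambda>x. indicator K x *\<^sub>R h x)"
        using K by (simp add: integrable_restrict_space)
      then have "(LINT x|lebesgue. (indicator K x *\<^sub>R h x) \<bullet> b) = (LINT x|lebesgue. indicator K x *\<^sub>R h x) \<bullet> b"
        by (rule integral_inner_left)
      then show ?thesis
        using integral_compact_eq_0[OF \<Omega> h eq K(1) K'] by simp
    qed
    have "AE x in lebesgue. x \<in> C n \<longrightarrow> h x \<bullet> b \<le> 0"
      using AE_nonpos_of_integral_compact[OF C(1), of n "\<lambda>x. h x \<bullet> b"] hC 0 by simp
    moreover have "AE x in lebesgue. x \<in> C n \<longrightarrow> - (h x \<bullet> b) \<le> 0"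
      using AE_nonpos_of_integral_compact[OF C(1), of n "\<lambda>x. - (h x \<bullet> b)"] hC 0 by simp
    ultimately show ?thesis by eventually_elim auto
  qed
  then have "AE x in lebesgue. \<forall>n. \<forall>b\<in>Basis. x \<in> C n \<longrightarrow> h x \<bullet> b = 0"
    unfolding AE_all_countable by (intro allI AE_finite_allI[OF finite_Basis]) auto
  then show ?thesis
    by (rule eventually_mono) (use C(3) euclidean_all_zero_iff in blast)
qed

section \<open>Calculus of weak derivatives: uniqueness, locality and linearity\<close>

lemma has_weak_pderiv_unique:
  assumes \<Omega>: "open \<Omega>" and "has_weak_pderiv \<Omega> i f h" "has_weak_pderiv \<Omega> i f h'"
  shows "AE x in lebesgue. x \<in> \<Omega> \<longrightarrow> h x = h' x"
proof -
  have L: "Lp_loc 1 \<Omega> h" "Lp_loc 1 \<Omega> h'" using assms by (auto simp: has_weak_pderiv_iff)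
  have Ld: "Lp_loc 1 \<Omega> (\<lambda>x. h x - h' x)"
    using Lp_loc_add[OF L(1) Lp_loc_linear[OF L(2), of "\<lambda>x. - x"]] by (simp add: linear_iff)
  have "AE x in lebesgue. x \<in> \<Omega> \<longrightarrow> h x - h' x = 0"
  proof (rule fundamental_lemma_variations[OF \<Omega> Ld])
    fix \<phi> assume \<phi>: "test_function \<Omega> \<phi>"
    then show "(LINT x|lebesgue. \<phi> x *\<^sub>R (h x - h' x)) = 0"
      using assms(2,3) Cc_scaleR_integrable[OF test_function_imp_Cc[OF \<phi>] L(1)]
        Cc_scaleR_integrable[OF test_function_imp_Cc[OF \<phi>] L(2)]
      by (auto simp: scaleR_diff_right has_weak_pderiv_iff)
  qed
  then show ?thesis by simp
qed

lemma has_weak_pderiv_cong_AE: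
  assumes h: "has_weak_pderiv \<Omega> i f h" and f: "AE x in lebesgue. x \<in> \<Omega> \<longrightarrow> f x = f' x"
    and h': "AE x in lebesgue. x \<in> \<Omega> \<longrightarrow> h x = h' x"
  shows "has_weak_pderiv \<Omega> i f' h'"
  unfolding has_weak_pderiv_iff
proof (intro conjI allI impI)
  have L: "Lp_loc 1 \<Omega> f" "Lp_loc 1 \<Omega> h" using h by (auto simp: has_weak_pderiv_iff)
  show L': "Lp_loc 1 \<Omega> f'" "Lp_loc 1 \<Omega> h'"
    using L(1) f L(2) h' by (auto intro: Lp_loc_cong_AE[of _ _ f] Lp_loc_cong_AE[of _ _ h])
  have cong: "(LINT x|lebesgue. \<zeta> x *\<^sub>R u x) = (LINT x|lebesgue. \<zeta> x *\<^sub>R u' x)"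
    if "Cc \<Omega> \<zeta>" "Lp_loc 1 \<Omega> u" "Lp_loc 1 \<Omega> u'" "AE x in lebesgue. x \<in> \<Omega> \<longrightarrow> u x = u' x"
    for \<zeta> and u u' :: "real^'a \<Rightarrow> 'b"
  proof (rule integral_cong_AE)
    have "\<zeta> x = 0" if "x \<notin> \<Omega>" for x using \<open>Cc \<Omega> \<zeta>\<close> that by (auto simp: Cc_def)
    then show "AE x in lebesgue. \<zeta> x *\<^sub>R u x = \<zeta> x *\<^sub>R u' x"
      using that(4) by (auto elim!: eventually_mono)
  qed (use Cc_scaleR_integrable that in \<open>auto intro: borel_measurable_integrable\<close>)
  fix \<phi> assume \<phi>: "test_function \<Omega> \<phi>"
  show "(LINT x|lebesgue. frechet_derivative \<phi> (at x) (axis i 1) *\<^sub>R f' x) =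
        - (LINT x|lebesgue. \<phi> x *\<^sub>R h' x)"
    unfolding cong[OF test_function_imp_Cc[OF test_function_partial[OF \<phi>]] L(1) L'(1) f, symmetric]
      cong[OF test_function_imp_Cc[OF \<phi>] L(2) L'(2) h', symmetric]
    using h \<phi> unfolding has_weak_pderiv_iff by blast
qed

text \<open>A genuine equation, not only one almost everywhere: the predicates under
  \<open>SOME\<close> coincide, so the same representative is chosen for both functions.\<close>

lemma weak_pderiv_cong_AE:
  assumes "AE x in lebesgue. x \<in> \<Omega> \<longrightarrow> f x = f' x"
  shows "weak_pderiv \<Omega> i f = weak_pderiv \<Omega> i f'"
proof -
  have "has_weak_pderiv \<Omega> i f = has_weak_pderiv \<Omega> i f'"
    using assms by (intro ext iffI) (auto elim!: has_weak_pderiv_cong_AE eventually_mono)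
  then show ?thesis by (simp add: weak_pderiv_def)
qed

lemma has_weak_pderiv_weak_pderiv:
  "has_weak_pderiv \<Omega> i f h \<Longrightarrow> has_weak_pderiv \<Omega> i f (weak_pderiv \<Omega> i f)"
  unfolding weak_pderiv_def using someI[of "has_weak_pderiv \<Omega> i f" h] by simp

lemma weak_pderiv_eq_AE:
  assumes "open \<Omega>" "has_weak_pderiv \<Omega> i f h"
  shows "AE x in lebesgue. x \<in> \<Omega> \<longrightarrow> weak_pderiv \<Omega> i f x = h x"
  using has_weak_pderiv_unique[OF assms(1) has_weak_pderiv_weak_pderiv[OF assms(2)] assms(2)] .

lemma has_weak_pderiv_subset:
  assumes "has_weak_pderiv \<Omega> i f h" "V \<subseteq> \<Omega>"
  shows "has_weak_pderiv V i f h"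
  unfolding has_weak_pderiv_iff
proof (intro conjI allI impI)
  show "Lp_loc 1 V f" "Lp_loc 1 V h"
    using assms by (auto simp: has_weak_pderiv_iff intro: Lp_loc_subset)
  fix \<phi> assume "test_function V \<phi>"
  then have "test_function \<Omega> \<phi>" using assms(2) by (rule test_function_mono)
  then show "(LINT x|lebesgue. frechet_derivative \<phi> (at x) (axis i 1) *\<^sub>R f x) =
        - (LINT x|lebesgue. \<phi> x *\<^sub>R h x)"
    using assms(1) by (auto simp: has_weak_pderiv_iff)
qed

lemma has_weak_pderiv_linear:
  fixes L :: "'b::euclidean_space \<Rightarrow> 'c::euclidean_space"
  assumes "has_weak_pderiv \<Omega> i f h" and L: "linear L"
  shows "has_weak_pderiv \<Omega> i (\<lambda>x. L (f x)) (\<lambda>x. L (h x))"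
  unfolding has_weak_pderiv_iff
proof (intro conjI allI impI)
  have Lp: "Lp_loc 1 \<Omega> f" "Lp_loc 1 \<Omega> h" using assms by (auto simp: has_weak_pderiv_iff)
  then show "Lp_loc 1 \<Omega> (\<lambda>x. L (f x))" "Lp_loc 1 \<Omega> (\<lambda>x. L (h x))" 
    using L by (auto intro: Lp_loc_linear[where L = L])
  have bl: "bounded_linear L" using L by (simp add: linear_linear)
  have int: "(LINT x|lebesgue. \<zeta> x *\<^sub>R L (u x)) = L (LINT x|lebesgue. \<zeta> x *\<^sub>R u x)"
    if "Cc \<Omega> \<zeta>" "Lp_loc 1 \<Omega> u" for \<zeta> and u :: "real^'a \<Rightarrow> 'b"
    using integral_bounded_linear[OF bl Cc_scaleR_integrable[OF that]]
    by (simp add: linear_scale[OF L])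
  fix \<phi> assume \<phi>: "test_function \<Omega> \<phi>"
  have eq: "(LINT x|lebesgue. frechet_derivative \<phi> (at x) (axis i 1) *\<^sub>R f x) =
        - (LINT x|lebesgue. \<phi> x *\<^sub>R h x)"
    using assms \<phi> by (auto simp: has_weak_pderiv_iff)
  show "(LINT x|lebesgue. frechet_derivative \<phi> (at x) (axis i 1) *\<^sub>R L (f x)) =
        - (LINT x|lebesgue. \<phi> x *\<^sub>R L (h x))"
    unfolding int[OF test_function_imp_Cc[OF test_function_partial[OF \<phi>]] Lp(1)]
      int[OF test_function_imp_Cc[OF \<phi>] Lp(2)] eq by (simp add: linear_neg[OF L])
qed

lemma has_weak_pderiv_add:
  assumes "has_weak_pderiv \<Omega> i f h" "has_weak_pderiv \<Omega> i f' h'"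
  shows "has_weak_pderiv \<Omega> i (\<lambda>x. f x + f' x) (\<lambda>x. h x + h' x)"
  unfolding has_weak_pderiv_iff
proof (intro conjI allI impI)
  have Lp: "Lp_loc 1 \<Omega> f" "Lp_loc 1 \<Omega> h" "Lp_loc 1 \<Omega> f'" "Lp_loc 1 \<Omega> h'"
    using assms by (auto simp: has_weak_pderiv_iff)
  show "Lp_loc 1 \<Omega> (\<lambda>x. f x + f' x)" "Lp_loc 1 \<Omega> (\<lambda>x. h x + h' x)"
    using Lp by (auto intro: Lp_loc_add)
  fix \<phi> assume \<phi>: "test_function \<Omega> \<phi>"
  note i = Cc_scaleR_integrable[OF test_function_imp_Cc[OF \<phi>]]
    Cc_scaleR_integrable[OF test_function_imp_Cc[OF test_function_partial[OF \<phi>]]]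
  show "(LINT x|lebesgue. frechet_derivative \<phi> (at x) (axis i 1) *\<^sub>R (f x + f' x)) =
        - (LINT x|lebesgue. \<phi> x *\<^sub>R (h x + h' x))"
    using assms \<phi> by (simp add: scaleR_add_right i Lp has_weak_pderiv_iff)
qed

subsection \<open>Integration by parts for functions of class $C^1$\<close>

lemma integral_translate:
  fixes f :: "'a::euclidean_space \<Rightarrow> 'b::{banach, second_countable_topology}"
  assumes f: "f \<in> borel_measurable borel"
  shows "(LINT x|lebesgue. f (x + c)) = (LINT x|lebesgue. f x)"
proof -
  have fc: "(\<lambda>x. f (c + x)) \<in> borel_measurable borel" using f by measurable
  have "(LINT x|lebesgue. f x) = (LINT x|distr lborel borel ((+) c). f x)"
    using f by (simp add: integral_completion lborel_distr_plus)
  also have "\<dots> = (LINT x|lborel. f (c + x))" using f by (subst integral_distr) auto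
  also have "\<dots> = (LINT x|lebesgue. f (x + c))" using fc by (simp add: integral_completion add.commute)
  finally show ?thesis by simp
qed

lemma integrable_compact_support:
  fixes f :: "real^'n \<Rightarrow> 'b::euclidean_space"
  assumes f: "continuous_on UNIV f" and K: "compact K" "\<And>x. x \<notin> K \<Longrightarrow> f x = 0"
  shows "integrable lebesgue f"
proof -
  have "Lp_on 1 K f" using K f by (intro Lp_on_continuous) (auto intro: continuous_on_subset)
  then have "integrable lebesgue (\<lambda>x. indicator K x *\<^sub>R f x)"
    using K(1) by (simp add: Lp_on_1_iff integrable_restrict_space)
  moreover have "indicator K x *\<^sub>R f x = f x" for x using K(2)[of x] by (cases "x \<in> K") auto
  ultimately show ?thesis by (simp only:)
qed

lemma norm_diff_le_of_derivative:
  fixes f :: "'a::real_normed_vector \<Rightarrow> 'b::real_normed_vector"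
  assumes d: "\<And>s. 0 \<le> s \<Longrightarrow> s \<le> 1 \<Longrightarrow> (f has_derivative f' (x + s *\<^sub>R v)) (at (x + s *\<^sub>R v))"
    and le: "\<And>s. 0 \<le> s \<Longrightarrow> s \<le> 1 \<Longrightarrow> norm (f' (x + s *\<^sub>R v) v) \<le> B"
  shows "norm (f (x + v) - f x) \<le> B"
proof -
  let ?g = "\<lambda>s::real. f (x + s *\<^sub>R v)"
  have g: "(?g has_vector_derivative f' (x + s *\<^sub>R v) v) (at s)" if "0 \<le> s" "s \<le> 1" for s
  proof -
    have "((\<lambda>s. x + s *\<^sub>R v) has_derivative (\<lambda>h. h *\<^sub>R v)) (at s)"
      by (auto intro!: derivative_eq_intros)
    from diff_chain_at[OF this d[OF that]]
    have "(?g has_derivative (\<lambda>h. f' (x + s *\<^sub>R v) (h *\<^sub>R v))) (at s)" by (simp add: o_def)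
    moreover have "linear (f' (x + s *\<^sub>R v))" using d[OF that] has_derivative_linear by blast
    ultimately show ?thesis by (simp add: has_vector_derivative_def linear_scale)
  qed
  have "norm (?g 1 - ?g 0) \<le> B * 1 - B * 0"
  proof (rule differentiable_bound_general[where f' = "\<lambda>s. f' (x + s *\<^sub>R v) v" and \<phi>' = "\<lambda>_. B"])
    show "continuous_on {0..1} ?g"
    proof (rule continuous_at_imp_continuous_on, rule ballI)
      fix s :: real assume "s \<in> {0..1}"
      then show "isCont ?g s" using g[of s] has_vector_derivative_continuous by auto
    qed
    show "(?g has_vector_derivative f' (x + s *\<^sub>R v) v) (at s)" if "0 < s" "s < 1" for s
      using g that by simp
    show "((*) B has_vector_derivative B) (at s)" for s
      unfolding has_real_derivative_iff_has_vector_derivative[symmetric] by (auto intro!: derivative_eq_intros)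
  qed (use le in \<open>auto intro!: continuous_intros\<close>)
  then show ?thesis by simp
qed

text \<open>By translation invariance every difference quotient in the direction \<open>e\<close>
  has integral 0. They converge to the derivative and are dominated by the supremum of its norm on a
  fixed ball, so no iterated integrals are required.\<close>

lemma integral_derivative_eq_0:
  fixes w :: "real^'n \<Rightarrow> 'b::euclidean_space"
  assumes w: "\<And>x. (w has_derivative w' x) (at x)" and c: "continuous_on UNIV (\<lambda>x. w' x e)"
    and K: "compact K" "\<And>x. x \<notin> K \<Longrightarrow> w x = 0"
  shows "(LINT x|lebesgue. w' x e) = 0"
proof -
  have wc: "continuous_on UNIV w" using w has_derivative_continuous_on by blast
  have w'K: "w' x e = 0" if "x \<notin> K" for x
  proof -
    have "frechet_derivative w (at x) = (\<lambda>v. 0)"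
      by (rule frechet_derivative_eq_0[of "- K"]) (use that K in \<open>auto simp: compact_imp_closed open_Compl\<close>)
    then show ?thesis using frechet_derivative_at[OF w] by metis
  qed
  obtain R where R: "\<And>x. x \<in> K \<Longrightarrow> norm x \<le> R"
    using K(1) compact_imp_bounded bounded_iff by metis
  \<comment> \<open>The steps \<open>t m\<close> below are at most 1, so this ball contains the
    supports of all the difference quotients.\<close>
  let ?C = "cball (0::real^'n) (R + norm e)"
  have "compact ((\<lambda>x. w' x e) ` K)" using K c by (intro compact_continuous_image) (auto intro: continuous_on_subset)
  then obtain B0 where B0: "\<And>x. x \<in> K \<Longrightarrow> norm (w' x e) \<le> B0"
    using compact_imp_bounded bounded_iff by (metis imageI)
  define B where "B = max B0 0"
  have B: "norm (w' x e) \<le> B" for x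
    using B0[of x] w'K[of x] by (cases "x \<in> K") (auto simp: B_def)
  define t where "t m = 1 / real (Suc m)" for m
  have t: "0 < t m" "t m \<le> 1" for m by (auto simp: t_def)
  define Q where "Q m x = (w (x + t m *\<^sub>R e) - w x) /\<^sub>R t m" for m x
  have wm: "w \<in> borel_measurable borel" using wc by (rule borel_measurable_continuous_onI)
  have wi: "integrable lebesgue w" by (rule integrable_compact_support[OF wc K])
  have w'i: "integrable lebesgue (\<lambda>x. w' x e)" by (rule integrable_compact_support[OF c K(1) w'K])
  have wti: "integrable lebesgue (\<lambda>x. w (x + a))" for a
  proof (rule integrable_compact_support[of _ "(\<lambda>x. x - a) ` K"])
    show "continuous_on UNIV (\<lambda>x. w (x + a))"
      using continuous_on_compose2[OF wc, of UNIV "\<lambda>x. x + a"] by (simp add: continuous_on_add)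
    show "compact ((\<lambda>x. x - a) ` K)" using K by (intro compact_continuous_image continuous_intros)
    show "w (x + a) = 0" if "x \<notin> (\<lambda>x. x - a) ` K" for x
      using K(2)[of "x + a"] that by (metis add_diff_cancel image_eqI)
  qed
  have Q_int: "(LINT x|lebesgue. Q m x) = 0" for m
    unfolding Q_def using wi wti integral_translate[OF wm] by simp
  have "(\<lambda>m. LINT x|lebesgue. Q m x) \<longlonglongrightarrow> (LINT x|lebesgue. w' x e)"
  proof (rule integral_dominated_convergence)
    show "integrable lebesgue (\<lambda>x. B * indicator ?C x)" using lmeasurable_cball[of "0::real^'n" "R + norm e"]
      by (intro integrable_mult_right integrable_real_indicator) (auto simp: fmeasurable_def)
    show "Q m \<in> borel_measurable lebesgue" for m unfolding Q_def using wi wti by auto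
    show "AE x in lebesgue. norm (Q m x) \<le> B * indicator ?C x" for m
    proof (rule AE_I2)
      fix x
      have "norm (w (x + t m *\<^sub>R e) - w x) \<le> t m * B"
      proof (rule norm_diff_le_of_derivative[OF w])
        fix s
        have "linear (w' (x + s *\<^sub>R t m *\<^sub>R e))" using w has_derivative_linear by blast
        then have "w' (x + s *\<^sub>R t m *\<^sub>R e) (t m *\<^sub>R e) = t m *\<^sub>R w' (x + s *\<^sub>R t m *\<^sub>R e) e"
          by (simp add: linear_scale)
        then show "norm (w' (x + s *\<^sub>R t m *\<^sub>R e) (t m *\<^sub>R e)) \<le> t m * B"
          using B t[of m] by (simp add: mult_left_mono)
      qed
      moreover have "norm (Q m x) = norm (w (x + t m *\<^sub>R e) - w x) / t m"
        using t[of m] by (simp add: Q_def divide_inverse mult.commute)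
      ultimately have le: "norm (Q m x) \<le> B" using t[of m] by (simp add: pos_divide_le_eq mult.commute)
      show "norm (Q m x) \<le> B * indicator ?C x"
      proof (cases "x \<in> ?C")
        case False
        then have "norm x > R + norm e" by simp
        moreover have "norm x - norm (t m *\<^sub>R e) \<le> norm (x + t m *\<^sub>R e)" by (rule norm_diff_ineq)
        moreover have "norm (t m *\<^sub>R e) \<le> norm e" using t[of m] by (simp add: mult_left_le_one_le)
        ultimately have "norm x > R" "norm (x + t m *\<^sub>R e) > R" using norm_ge_zero[of e] by linarith+
        then have "x \<notin> K" "x + t m *\<^sub>R e \<notin> K" using R by force+
        then have "Q m x = 0" using K(2) by (simp add: Q_def)
        then show ?thesis by (simp add: B_def)
      qed (use le in simp)
    qed
    show "AE x in lebesgue. (\<lambda>m. Q m x) \<longlonglongrightarrow> w' x e"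
    proof (rule AE_I2)
      fix x
      have "((\<lambda>s. x + s *\<^sub>R e) has_derivative (\<lambda>h. h *\<^sub>R e)) (at 0)"
        by (auto intro!: derivative_eq_intros)
      from diff_chain_at[OF this, of w "w' x"] w
      have "((\<lambda>s. w (x + s *\<^sub>R e)) has_derivative (\<lambda>h. w' x (h *\<^sub>R e))) (at 0)" by (simp add: o_def)
      moreover have "linear (w' x)" using w has_derivative_linear by blast
      ultimately have "((\<lambda>s. w (x + s *\<^sub>R e)) has_vector_derivative w' x e) (at 0)"
        by (simp add: has_vector_derivative_def linear_scale)
      then have "((\<lambda>s. norm (w (x + s *\<^sub>R e) - w x - s *\<^sub>R w' x e) / \<bar>s\<bar>) \<longlongrightarrow> 0) (at 0)"
        by (simp add: has_vector_derivative_def has_derivative_at)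
      moreover have "\<forall>\<^sub>F s in at 0. norm (w (x + s *\<^sub>R e) - w x - s *\<^sub>R w' x e) / \<bar>s\<bar> =
          norm ((w (x + s *\<^sub>R e) - w x) /\<^sub>R s - w' x e)"
      proof -
        have "norm (a - s *\<^sub>R b) / \<bar>s\<bar> = norm (a /\<^sub>R s - b)" if "s \<noteq> 0" for a b :: 'b and s
        proof -
          have "a /\<^sub>R s - b = (a - s *\<^sub>R b) /\<^sub>R s" using that by (simp add: scaleR_diff_right)
          then show ?thesis by (simp add: divide_inverse mult.commute)
        qed
        then show ?thesis by (auto simp: eventually_at intro!: exI[of _ 1])
      qed
      ultimately have "((\<lambda>s. norm ((w (x + s *\<^sub>R e) - w x) /\<^sub>R s - w' x e)) \<longlongrightarrow> 0) (at 0)"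
        by (rule Lim_transform_eventually)
      then have "((\<lambda>s. (w (x + s *\<^sub>R e) - w x) /\<^sub>R s) \<longlongrightarrow> w' x e) (at 0)"
        by (rule LIM_zero_cancel[OF tendsto_norm_zero_cancel])
      moreover have "filterlim t (at 0) sequentially"
      proof -
        have "t \<longlonglongrightarrow> 0"
          unfolding t_def using LIMSEQ_Suc[OF lim_1_over_n[where 'a = real]] by simp
        then show ?thesis unfolding filterlim_at using t(1) by (auto simp: less_imp_neq[symmetric])
      qed
      ultimately show "(\<lambda>m. Q m x) \<longlonglongrightarrow> w' x e"
        unfolding Q_def by (rule filterlim_compose)
    qed
  qed (use w'i in auto)
  then show ?thesis by (simp add: Q_int LIMSEQ_const_iff)
qed

text \<open>The product of \<open>u\<close> with a test function is of class C^1 on the whole space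
  although nothing is known about \<open>u\<close> outside \<Omega>: the open sets \<Omega> and the
  complement of the support cover everything. Its derivative has integral 0.\<close>

lemma has_weak_pderiv_C1:
  fixes u :: "real^'n \<Rightarrow> 'b::euclidean_space"
  assumes \<Omega>: "open \<Omega>" and u: "Ck_on 1 \<Omega> u"
  shows "has_weak_pderiv \<Omega> i u (\<lambda>x. frechet_derivative u (at x) (axis i 1))"
  unfolding has_weak_pderiv_iff
proof (intro conjI allI impI)
  have ud: "(u has_derivative frechet_derivative u (at x)) (at x)" if "x \<in> \<Omega>" for x
    using u that by (simp flip: frechet_derivative_works)
  have uc: "continuous_on \<Omega> u" using Ck_on_SucD[of 0 \<Omega> u] u by simp
  have u'c: "continuous_on \<Omega> (\<lambda>x. frechet_derivative u (at x) v)" for v using u by simp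
  show L: "Lp_loc 1 \<Omega> u" "Lp_loc 1 \<Omega> (\<lambda>x. frechet_derivative u (at x) (axis i 1))"
    using uc u'c by (auto intro: Lp_loc_continuous)
  fix \<phi> assume \<phi>: "test_function \<Omega> \<phi>"
  then obtain K where K: "compact K" "K \<subseteq> \<Omega>" "\<And>x. x \<notin> K \<Longrightarrow> \<phi> x = 0" and s: "smooth_on UNIV \<phi>"
    by (auto simp: test_function_def)
  have \<phi>d: "(\<phi> has_derivative frechet_derivative \<phi> (at x)) (at x)" for x
    using s by (rule smooth_has_derivative)
  have \<phi>'K: "frechet_derivative \<phi> (at x) v = 0" if "x \<notin> K" for x v
    using frechet_derivative_eq_0[of "- K" x \<phi> 0] K that by (simp add: compact_imp_closed open_Compl)
  define w' where "w' x v = \<phi> x *\<^sub>R frechet_derivative u (at x) v + frechet_derivative \<phi> (at x) v *\<^sub>R u x" for x v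
  have "(LINT x|lebesgue. w' x (axis i 1)) = 0"
  proof (rule integral_derivative_eq_0[OF _ _ K(1)])
    show "((\<lambda>x. \<phi> x *\<^sub>R u x) has_derivative w' x) (at x)" for x
    proof (cases "x \<in> K")
      case True
      then show ?thesis unfolding w'_def using K ud by (intro has_derivative_scaleR \<phi>d) auto
    next
      case False
      have "((\<lambda>x. \<phi> x *\<^sub>R u x) has_derivative (\<lambda>v. 0)) (at x)"
        by (rule has_derivative_transform_within_open[of "\<lambda>_. 0" _ _ _ "- K"])
          (use False K in \<open>auto simp: compact_imp_closed open_Compl\<close>)
      moreover have "w' x = (\<lambda>v. 0)" using False K \<phi>'K by (auto simp: w'_def)
      ultimately show ?thesis by simp
    qed
    have "continuous_on (\<Omega> \<union> - K) (\<lambda>x. w' x (axis i 1))"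
    proof (rule continuous_on_open_Un[OF \<Omega>])
      show "open (- K)" using K by (simp add: compact_imp_closed open_Compl)
      show "continuous_on \<Omega> (\<lambda>x. w' x (axis i 1))"
        unfolding w'_def using smooth_imp_continuous[OF s] smooth_imp_continuous[OF smooth_frechet_derivative[OF s]]
        by (intro continuous_intros uc u'c) (auto intro: continuous_on_subset)
      have "continuous_on (- K) (\<lambda>x. 0 :: 'b)" by simp
      then show "continuous_on (- K) (\<lambda>x. w' x (axis i 1))"
        by (rule continuous_on_cong[THEN iffD1, rotated 2]) (use K \<phi>'K in \<open>auto simp: w'_def\<close>)
    qed
    moreover have "\<Omega> \<union> - K = UNIV" using K by auto
    ultimately show "continuous_on UNIV (\<lambda>x. w' x (axis i 1))" by simp
  qed (use K in simp)
  moreover have "(LINT x|lebesgue. w' x (axis i 1)) =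
      (LINT x|lebesgue. \<phi> x *\<^sub>R frechet_derivative u (at x) (axis i 1)) +
      (LINT x|lebesgue. frechet_derivative \<phi> (at x) (axis i 1) *\<^sub>R u x)"
    unfolding w'_def
    by (intro Bochner_Integration.integral_add Cc_scaleR_integrable[OF _ L(1)] Cc_scaleR_integrable[OF _ L(2)]
        test_function_imp_Cc test_function_partial \<phi>)
  ultimately show "(LINT x|lebesgue. frechet_derivative \<phi> (at x) (axis i 1) *\<^sub>R u x) =
        - (LINT x|lebesgue. \<phi> x *\<^sub>R frechet_derivative u (at x) (axis i 1))"
    by (simp add: eq_neg_iff_add_eq_0 add.commute)
qed

subsection \<open>The product rule\<close>

text \<open>The mean over the segment from x to x + v. A difference of a smooth function along a
  coordinate direction is such a mean of its partial derivative, which is how weak derivatives and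
  difference quotients are related.\<close>

definition line_avg :: "'a::euclidean_space \<Rightarrow> ('a \<Rightarrow> real) \<Rightarrow> 'a \<Rightarrow> real" where
  "line_avg v \<zeta> x = integral {0..1} (\<lambda>s. \<zeta> (x + s *\<^sub>R v))"

lemma continuous_on_line:
  fixes \<zeta> :: "'a::real_normed_vector \<Rightarrow> 'b::topological_space"
  shows "continuous_on UNIV \<zeta> \<Longrightarrow> continuous_on S (\<lambda>s::real. \<zeta> (x + s *\<^sub>R v))"
  by (rule continuous_on_compose2[of UNIV \<zeta>]) (auto intro!: continuous_intros)

lemma line_avg_integrable:
  fixes \<zeta> :: "'a::real_normed_vector \<Rightarrow> real"
  shows "continuous_on UNIV \<zeta> \<Longrightarrow> (\<lambda>s::real. \<zeta> (x + s *\<^sub>R v)) integrable_on {0..1}"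
  by (intro integrable_continuous_real continuous_on_line)

lemma continuous_on_line_avg:
  assumes "continuous_on UNIV \<zeta>"
  shows "continuous_on UNIV (line_avg v \<zeta>)"
proof -
  have "continuous_on (UNIV \<times> cbox 0 (1::real)) (\<lambda>(x, s). \<zeta> (x + s *\<^sub>R v))"
    unfolding split_beta by (rule continuous_on_compose2[OF assms]) (auto intro!: continuous_intros)
  from integral_continuous_on_param[OF this] show ?thesis by (simp add: line_avg_def[abs_def])
qed

lemma line_avg_has_derivative:
  fixes \<zeta> :: "'a::euclidean_space \<Rightarrow> real"
  assumes d: "\<And>x. (\<zeta> has_derivative \<zeta>' x) (at x)" and c: "\<And>v. continuous_on UNIV (\<lambda>x. \<zeta>' x v)"
  shows "(line_avg e \<zeta> has_derivative (\<lambda>v. line_avg e (\<lambda>y. \<zeta>' y v) x)) (at x)"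
proof -
  have bl: "bounded_linear (\<zeta>' x)" for x using d has_derivative_bounded_linear by blast
  have \<zeta>c: "continuous_on UNIV \<zeta>" using d has_derivative_continuous_on by blast
  define D where "D x s = Blinfun (\<zeta>' (x + s *\<^sub>R e))" for x :: 'a and s :: real
  have D: "blinfun_apply (D x s) = \<zeta>' (x + s *\<^sub>R e)" for x s
    unfolding D_def by (rule bounded_linear_Blinfun_apply[OF bl])
  have Dc: "continuous_on (UNIV \<times> cbox 0 1) (\<lambda>(x, s). D x s)"
    unfolding split_beta
  proof (rule continuous_on_blinfun_componentwise)
    fix b :: 'a
    show "continuous_on (UNIV \<times> cbox 0 1) (\<lambda>y. blinfun_apply (D (fst y) (snd y)) b)"
      unfolding D by (rule continuous_on_compose2[OF c]) (auto intro!: continuous_intros)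
  qed
  have "((\<lambda>x. integral (cbox 0 1) (\<lambda>s. \<zeta> (x + s *\<^sub>R e))) has_derivative
      blinfun_apply (integral (cbox 0 1) (D x))) (at x within UNIV)"
  proof (rule leibniz_rule)
    fix x :: 'a and s :: real
    have "((\<lambda>x. x + s *\<^sub>R e) has_derivative (\<lambda>h. h)) (at x)" by (auto intro!: derivative_eq_intros)
    from diff_chain_at[OF this d]
    show "((\<lambda>x. \<zeta> (x + s *\<^sub>R e)) has_derivative blinfun_apply (D x s)) (at x within UNIV)"
      by (simp add: o_def D)
  qed (use Dc line_avg_integrable[OF \<zeta>c] in auto)
  moreover have "blinfun_apply (integral (cbox 0 1) (D x)) = (\<lambda>v. line_avg e (\<lambda>y. \<zeta>' y v) x)"
  proof (rule ext)
    fix v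
    have "continuous_on {0..1} (D x)"
      using continuous_on_compose2[OF Dc, of "{0..1}" "\<lambda>s. (x, s)"] by (auto simp: continuous_on_Pair)
    then have "D x integrable_on {0..1}" by (rule integrable_continuous_real)
    then show "blinfun_apply (integral (cbox 0 1) (D x)) v = line_avg e (\<lambda>y. \<zeta>' y v) x"
      by (simp add: line_avg_def blinfun_apply_integral D)
  qed
  ultimately show ?thesis by (simp add: line_avg_def[abs_def])
qed

lemma Ck_on_line_avg:
  assumes "Ck_on k UNIV \<zeta>"
  shows "Ck_on k UNIV (line_avg e \<zeta>)"
  using assms
proof (induction k arbitrary: \<zeta>)
  case 0
  then show ?case by (simp add: continuous_on_line_avg)
next
  case (Suc k)
  show ?case
  proof (rule Ck_on_UNIV_SucI)
    have d: "(\<zeta> has_derivative frechet_derivative \<zeta> (at x)) (at x)" for x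
      using Suc.prems by (auto simp flip: frechet_derivative_works)
    have c: "continuous_on UNIV (\<lambda>x. frechet_derivative \<zeta> (at x) v)" for v
      using Ck_on_le[of 0 k UNIV "\<lambda>x. frechet_derivative \<zeta> (at x) v"] Suc.prems by simp
    show "(line_avg e \<zeta> has_derivative (\<lambda>v. line_avg e (\<lambda>y. frechet_derivative \<zeta> (at y) v) x)) (at x)" for x
      by (rule line_avg_has_derivative[OF d c])
    show "Ck_on k UNIV (\<lambda>x. line_avg e (\<lambda>y. frechet_derivative \<zeta> (at y) v) x)" for v
      using Suc by simp
  qed
qed

lemma line_avg_FTC:
  assumes "smooth_on UNIV \<zeta>"
  shows "\<tau> * line_avg (\<tau> *\<^sub>R e) (\<lambda>y. frechet_derivative \<zeta> (at y) e) x = \<zeta> (x + \<tau> *\<^sub>R e) - \<zeta> x"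
    and "frechet_derivative (line_avg v \<zeta>) (at x) e = line_avg v (\<lambda>y. frechet_derivative \<zeta> (at y) e) x"
proof -
  have c: "continuous_on UNIV (\<lambda>x. frechet_derivative \<zeta> (at x) v)" for v
    using assms by (intro smooth_imp_continuous smooth_frechet_derivative)
  show "frechet_derivative (line_avg v \<zeta>) (at x) e = line_avg v (\<lambda>y. frechet_derivative \<zeta> (at y) e) x"
    using frechet_derivative_at[OF line_avg_has_derivative[OF smooth_has_derivative[OF assms] c]] by metis
  have "integral {0..1} (\<lambda>s. \<tau> * frechet_derivative \<zeta> (at (x + s *\<^sub>R \<tau> *\<^sub>R e)) e) =
      \<zeta> (x + 1 *\<^sub>R \<tau> *\<^sub>R e) - \<zeta> (x + 0 *\<^sub>R \<tau> *\<^sub>R e)"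
  proof (rule integral_unique, rule fundamental_theorem_of_calculus)
    fix s :: real
    have "((\<lambda>s. x + s *\<^sub>R \<tau> *\<^sub>R e) has_derivative (\<lambda>h. h *\<^sub>R \<tau> *\<^sub>R e)) (at s)"
      by (auto intro!: derivative_eq_intros)
    from diff_chain_at[OF this smooth_has_derivative[OF assms]]
    have "((\<lambda>s. \<zeta> (x + s *\<^sub>R \<tau> *\<^sub>R e)) has_derivative
        (\<lambda>h. frechet_derivative \<zeta> (at (x + s *\<^sub>R \<tau> *\<^sub>R e)) (h *\<^sub>R \<tau> *\<^sub>R e))) (at s)"
      by (simp add: o_def)
    moreover have l: "linear (frechet_derivative \<zeta> (at (x + s *\<^sub>R \<tau> *\<^sub>R e)))"
      using smooth_has_derivative[OF assms] has_derivative_linear by blast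
    ultimately show "((\<lambda>s. \<zeta> (x + s *\<^sub>R \<tau> *\<^sub>R e)) has_vector_derivative
        \<tau> * frechet_derivative \<zeta> (at (x + s *\<^sub>R \<tau> *\<^sub>R e)) e) (at s within {0..1})"
      by - (rule has_vector_derivative_at_within, simp add: has_vector_derivative_def linear_scale[OF l[unfolded scaleR_scaleR]] mult.assoc)
  qed simp
  then show "\<tau> * line_avg (\<tau> *\<^sub>R e) (\<lambda>y. frechet_derivative \<zeta> (at y) e) x = \<zeta> (x + \<tau> *\<^sub>R e) - \<zeta> x"
    by (simp add: line_avg_def)
qed

lemma line_avg_dist:
  assumes \<zeta>: "continuous_on UNIV \<zeta>" and le: "\<And>s. 0 \<le> s \<Longrightarrow> s \<le> 1 \<Longrightarrow> \<bar>\<zeta> (x + s *\<^sub>R e) - c\<bar> \<le> \<epsilon>"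
  shows "\<bar>line_avg e \<zeta> x - c\<bar> \<le> \<epsilon>"
proof -
  have i: "(\<lambda>s. \<zeta> (x + s *\<^sub>R e) - c) integrable_on {0..1}"
    using line_avg_integrable[OF \<zeta>] by (intro integrable_diff) auto
  have "line_avg e \<zeta> x - c = integral {0..1} (\<lambda>s. \<zeta> (x + s *\<^sub>R e) - c)"
    unfolding line_avg_def using line_avg_integrable[OF \<zeta>] by (subst integral_diff) auto
  also have "norm \<dots> \<le> integral {0..1} (\<lambda>s::real. \<epsilon>)"
    by (rule integral_norm_bound_integral[OF i]) (use le in auto)
  finally show ?thesis by simp
qed

lemma compact_segments:
  fixes K :: "'a::euclidean_space set"
  assumes "compact K"
  shows "compact ((\<lambda>(x, s). x - s *\<^sub>R e) ` (K \<times> {0..1::real}))"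
proof (rule compact_continuous_image)
  show "continuous_on (K \<times> {0..1::real}) (\<lambda>(x, s). x - s *\<^sub>R e)"
    unfolding split_beta by (intro continuous_intros)
  show "compact (K \<times> {0..1::real})" using assms by (intro compact_Times compact_Icc)
qed

lemma line_avg_support:
  assumes K: "\<And>x. x \<notin> K \<Longrightarrow> \<zeta> x = 0" and x: "x \<notin> (\<lambda>(x, s). x - s *\<^sub>R e) ` (K \<times> {0..1::real})"
  shows "line_avg e \<zeta> x = 0"
proof -
  have "\<zeta> (x + s *\<^sub>R e) = 0" if "s \<in> {0..1}" for s
  proof (rule K)
    show "x + s *\<^sub>R e \<notin> K"
    proof
      assume "x + s *\<^sub>R e \<in> K"
      then have "(x + s *\<^sub>R e) - s *\<^sub>R e \<in> (\<lambda>(x, s). x - s *\<^sub>R e) ` (K \<times> {0..1::real})"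
        using that by (intro image_eqI[of _ _ "(x + s *\<^sub>R e, s)"]) auto
      with x show False by simp
    qed
  qed
  then have "line_avg e \<zeta> x = integral {0..1} (\<lambda>s::real. 0)"
    unfolding line_avg_def by (intro Henstock_Kurzweil_Integration.integral_cong) auto
  then show ?thesis by simp
qed


text \<open>The averaged functions may vary with m, because the discrete product rule leaves one
  factor translated by the current step.\<close>

lemma line_avg_integral_tendsto:
  fixes e :: "real^'n"
  assumes \<zeta>: "\<And>m. continuous_on UNIV (\<zeta> m)" and B: "\<And>m x. \<bar>\<zeta> m x\<bar> \<le> B" and h: "integrable lebesgue h"
    and lim: "\<And>x \<epsilon>. \<epsilon> > 0 \<Longrightarrow> \<forall>\<^sub>F m in sequentially. \<forall>s\<in>{0..1}. \<bar>\<zeta> m (x + s *\<^sub>R t m *\<^sub>R e) - z x\<bar> \<le> \<epsilon>"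
  shows "(\<lambda>m. LINT x|lebesgue. line_avg (t m *\<^sub>R e) (\<zeta> m) x * h x) \<longlonglongrightarrow> (LINT x|lebesgue. z x * h x)"
proof -
  have ptw: "(\<lambda>m. line_avg (t m *\<^sub>R e) (\<zeta> m) x) \<longlonglongrightarrow> z x" for x
  proof (rule tendstoI)
    fix \<epsilon> :: real assume "\<epsilon> > 0"
    then have "\<forall>\<^sub>F m in sequentially. \<forall>s\<in>{0..1}. \<bar>\<zeta> m (x + s *\<^sub>R t m *\<^sub>R e) - z x\<bar> \<le> \<epsilon> / 2"
      by (intro lim) simp
    then show "\<forall>\<^sub>F m in sequentially. dist (line_avg (t m *\<^sub>R e) (\<zeta> m) x) (z x) < \<epsilon>"
    proof eventually_elim
      case (elim m)
      have "\<bar>line_avg (t m *\<^sub>R e) (\<zeta> m) x - z x\<bar> \<le> \<epsilon> / 2"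
        by (rule line_avg_dist[OF \<zeta>]) (use elim in auto)
      then show ?case using \<open>\<epsilon> > 0\<close> by (simp add: dist_real_def)
    qed
  qed
  have m: "line_avg (t m *\<^sub>R e) (\<zeta> m) \<in> borel_measurable lebesgue" for m
    using continuous_on_line_avg[OF \<zeta>] by (intro measurable_completion) (auto intro: borel_measurable_continuous_onI)
  have zm: "z \<in> borel_measurable lebesgue"
    by (rule borel_measurable_LIMSEQ_real[OF ptw m])
  have le: "\<bar>line_avg (t m *\<^sub>R e) (\<zeta> m) x\<bar> \<le> B" for m x
    using line_avg_dist[OF \<zeta>, where c = 0] B by simp
  show ?thesis
  proof (rule integral_dominated_convergence)
    show "integrable lebesgue (\<lambda>x. B * \<bar>h x\<bar>)" using h by auto
    show "AE x in lebesgue. norm (line_avg (t m *\<^sub>R e) (\<zeta> m) x * h x) \<le> B * \<bar>h x\<bar>" for m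
      using le by (intro AE_I2) (auto simp: abs_mult mult_right_mono)
    show "AE x in lebesgue. (\<lambda>m. line_avg (t m *\<^sub>R e) (\<zeta> m) x * h x) \<longlonglongrightarrow> z x * h x"
      using ptw by (intro AE_I2 tendsto_intros)
  qed (use zm m h in auto)
qed

text \<open>A global setting for the product rule: the function is defined and continuous
  everywhere, so that translation never leaves a domain, and its weak derivative is integrable over
  the whole space.\<close>

definition Cc_pderiv :: "'n \<Rightarrow> (real^'n \<Rightarrow> real) \<Rightarrow> (real^'n \<Rightarrow> real) \<Rightarrow> bool" where
  "Cc_pderiv i u h \<longleftrightarrow> Cc UNIV u \<and> integrable lebesgue h \<and>
     (\<forall>\<phi>. test_function UNIV \<phi> \<longrightarrow> (LINT x|lebesgue. frechet_derivative \<phi> (at x) (axis i 1) * u x) =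
        - (LINT x|lebesgue. \<phi> x * h x))"

lemma Cc_bounded:
  assumes "Cc \<Omega> u"
  obtains B where "B \<ge> 0" "\<And>x. \<bar>u x\<bar> \<le> B"
proof -
  obtain K where K: "compact K" "\<And>x. x \<notin> K \<Longrightarrow> u x = 0" and c: "continuous_on UNIV u"
    using assms by (auto simp: Cc_def)
  have "compact (u ` K)" using K c by (intro compact_continuous_image) (auto intro: continuous_on_subset)
  then obtain B where B: "\<And>x. x \<in> K \<Longrightarrow> \<bar>u x\<bar> \<le> B"
    using compact_imp_bounded bounded_iff by (metis imageI real_norm_def)
  show ?thesis
  proof (rule that[of "max B 0"])
    show "\<bar>u x\<bar> \<le> max B 0" for x using B[of x] K(2)[of x] by (cases "x \<in> K") auto
  qed simp
qed

lemma Cc_mult: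
  assumes "Cc \<Omega> u" "continuous_on UNIV v"
  shows "Cc \<Omega> (\<lambda>x. u x * v x)"
proof -
  obtain K where K: "compact K" "K \<subseteq> \<Omega>" "\<And>x. x \<notin> K \<Longrightarrow> u x = 0" and c: "continuous_on UNIV u"
    using assms by (auto simp: Cc_def)
  then show ?thesis unfolding Cc_def using assms(2) by (auto intro!: continuous_on_mult exI[of _ K])
qed

lemma Cc_integrable: "Cc \<Omega> u \<Longrightarrow> integrable lebesgue u"
  using integrable_compact_support[of u] by (auto simp: Cc_def)

lemma Cc_translate:
  assumes "Cc UNIV u"
  shows "Cc UNIV (\<lambda>x. u (x + a))"
proof -
  obtain K where K: "compact K" "\<And>x. x \<notin> K \<Longrightarrow> u x = 0" and c: "continuous_on UNIV u"
    using assms by (auto simp: Cc_def)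
  have "continuous_on UNIV (\<lambda>x. u (x + a))"
    using continuous_on_compose2[OF c, of UNIV "\<lambda>x. x + a"] by (simp add: continuous_on_add)
  moreover have "compact ((\<lambda>x. x - a) ` K)" using K by (intro compact_continuous_image continuous_intros)
  moreover have "u (x + a) = 0" if "x \<notin> (\<lambda>x. x - a) ` K" for x
    using K(2)[of "x + a"] that by (metis add_diff_cancel image_eqI)
  ultimately show ?thesis unfolding Cc_def by blast
qed

lemma Cc_mult_integrable:
  assumes f: "Cc \<Omega> f" and g: "integrable lebesgue g"
  shows "integrable lebesgue (\<lambda>x. f x * g x)"
proof -
  obtain B where B: "B \<ge> 0" "\<And>x. \<bar>f x\<bar> \<le> B" using Cc_bounded[OF f] by blast
  show ?thesis
  proof (rule Bochner_Integration.integrable_bound)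
    show "integrable lebesgue (\<lambda>x. B * \<bar>g x\<bar>)" using g by auto
    show "(\<lambda>x. f x * g x) \<in> borel_measurable lebesgue" using Cc_integrable[OF f] g by auto
    show "AE x in lebesgue. norm (f x * g x) \<le> norm (B * \<bar>g x\<bar>)"
      using B by (intro AE_I2) (auto simp: abs_mult mult_right_mono)
  qed
qed

lemma Cc_line_avg:
  assumes "Cc UNIV \<zeta>"
  shows "Cc UNIV (line_avg v \<zeta>)"
proof -
  obtain K where K: "compact K" "\<And>x. x \<notin> K \<Longrightarrow> \<zeta> x = 0" and c: "continuous_on UNIV \<zeta>"
    using assms by (auto simp: Cc_def)
  show ?thesis
    unfolding Cc_def using compact_segments[OF K(1), of v] line_avg_support[of K \<zeta>] K(2) continuous_on_line_avg[OF c]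
    by blast
qed

lemma Cc_imp_test_function: "Cc \<Omega> \<phi> \<Longrightarrow> smooth_on UNIV \<phi> \<Longrightarrow> test_function \<Omega> \<phi>"
  by (auto simp: Cc_def test_function_def)

lemma integral_Cc_difference:
  assumes \<phi>: "Cc UNIV \<phi>" and w: "Cc UNIV w"
  shows "(LINT x|lebesgue. \<phi> x * (w x - w (x - a))) = - (LINT x|lebesgue. (\<phi> (x + a) - \<phi> x) * w x)"
proof -
  have wa: "Cc UNIV (\<lambda>x. w (x - a))" using Cc_translate[OF w, of "- a"] by simp
  have c: "continuous_on UNIV \<phi>" "continuous_on UNIV (\<lambda>x. w (x - a))" using \<phi> wa by (auto simp: Cc_def)
  have "(\<lambda>x. \<phi> x * w (x - a)) \<in> borel_measurable borel"
    using c by (intro borel_measurable_continuous_onI continuous_on_mult)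
  from integral_translate[OF this, of a]
  have "(LINT x|lebesgue. \<phi> x * w (x - a)) = (LINT x|lebesgue. \<phi> (x + a) * w x)" by simp
  moreover note Cc_mult_integrable[OF \<phi> Cc_integrable[OF w]] Cc_mult_integrable[OF \<phi> Cc_integrable[OF wa]]
    Cc_mult_integrable[OF Cc_translate[OF \<phi>, of a] Cc_integrable[OF w]]
  ultimately show ?thesis by (simp add: left_diff_distrib right_diff_distrib)
qed

text \<open>The weak form of the fundamental theorem of calculus. The difference of \<open>u\<close>
  is moved to \<phi>, where it becomes \<tau> times the partial derivative of the segment mean of
  \<phi>; this mean is itself a test function, so the weak derivative of \<open>u\<close> may be
  applied to it.\<close>

lemma Cc_pderiv_difference_test:
  assumes u: "Cc_pderiv i u h" and \<phi>: "test_function UNIV \<phi>"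
  shows "(LINT x|lebesgue. \<phi> x * (u x - u (x - \<tau> *\<^sub>R axis i 1))) =
    \<tau> * (LINT x|lebesgue. line_avg (\<tau> *\<^sub>R axis i 1) \<phi> x * h x)"
proof -
  let ?e = "axis i (1::real)"
  have s: "smooth_on UNIV \<phi>" and \<phi>c: "Cc UNIV \<phi>" using \<phi> test_function_imp_Cc by (auto simp: test_function_def)
  have "smooth_on UNIV (line_avg (\<tau> *\<^sub>R ?e) \<phi>)" using s Ck_on_line_avg by (auto simp: smooth_on_def)
  then have avg: "test_function UNIV (line_avg (\<tau> *\<^sub>R ?e) \<phi>)" by (rule Cc_imp_test_function[OF Cc_line_avg[OF \<phi>c]])
  have "(LINT x|lebesgue. \<phi> x * (u x - u (x - \<tau> *\<^sub>R ?e))) =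
      - (LINT x|lebesgue. (\<phi> (x + \<tau> *\<^sub>R ?e) - \<phi> x) * u x)"
    using u by (intro integral_Cc_difference \<phi>c) (simp add: Cc_pderiv_def)
  also have "\<dots> = - (\<tau> * (LINT x|lebesgue. frechet_derivative (line_avg (\<tau> *\<^sub>R ?e) \<phi>) (at x) ?e * u x))"
    unfolding line_avg_FTC(1)[OF s, symmetric] line_avg_FTC(2)[OF s] by (simp add: mult.assoc)
  also have "\<dots> = \<tau> * (LINT x|lebesgue. line_avg (\<tau> *\<^sub>R ?e) \<phi> x * h x)"
    using u avg by (simp add: Cc_pderiv_def)
  finally show ?thesis .
qed

lemma integral_mult_diff_le:
  fixes f g d :: "'a \<Rightarrow> real"
  assumes "integrable M (\<lambda>x. f x * d x)" "integrable M (\<lambda>x. g x * d x)" "integrable M d" "\<And>x. \<bar>f x - g x\<bar> \<le> \<epsilon>"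
  shows "\<bar>(LINT x|M. f x * d x) - (LINT x|M. g x * d x)\<bar> \<le> \<epsilon> * (LINT x|M. \<bar>d x\<bar>)"
proof -
  have i: "integrable M (\<lambda>x. f x * d x - g x * d x)" using assms by simp
  have "\<bar>LINT x|M. f x * d x - g x * d x\<bar> \<le> (LINT x|M. \<bar>f x * d x - g x * d x\<bar>)"
    by (rule integral_abs_bound)
  also have "\<dots> \<le> (LINT x|M. \<epsilon> * \<bar>d x\<bar>)"
  proof (rule integral_mono)
    show "\<bar>f x * d x - g x * d x\<bar> \<le> \<epsilon> * \<bar>d x\<bar>" for x
      unfolding left_diff_distrib[symmetric] abs_mult using assms(4) by (intro mult_right_mono) auto
  qed (use assms i in auto)
  finally show ?thesis using assms by simp
qed

text \<open>No derivative of \<zeta> occurs on either side, so both sides are continuous in \<zeta>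
  for the supremum norm. The identity therefore extends from test functions by density.\<close>

lemma Cc_pderiv_difference:
  assumes u: "Cc_pderiv i u h" and \<zeta>: "Cc UNIV \<zeta>"
  shows "(LINT x|lebesgue. \<zeta> x * (u x - u (x - \<tau> *\<^sub>R axis i 1))) =
    \<tau> * (LINT x|lebesgue. line_avg (\<tau> *\<^sub>R axis i 1) \<zeta> x * h x)" (is "?L \<zeta> = ?R \<zeta>")
proof (rule ccontr)
  assume ne: "?L \<zeta> \<noteq> ?R \<zeta>"
  let ?v = "\<tau> *\<^sub>R axis i (1::real)" and ?d = "\<lambda>x. u x - u (x - \<tau> *\<^sub>R axis i 1)"
  obtain K where K: "compact K" "\<And>x. x \<notin> K \<Longrightarrow> \<zeta> x = 0" and c: "continuous_on UNIV \<zeta>"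
    using \<zeta> by (auto simp: Cc_def)
  have uc: "Cc UNIV u" and h: "integrable lebesgue h" using u by (auto simp: Cc_pderiv_def)
  have d: "integrable lebesgue ?d"
    using Cc_integrable[OF uc] Cc_integrable[OF Cc_translate[OF uc, of "- ?v"]] by simp
  define M where "M = (LINT x|lebesgue. \<bar>?d x\<bar>) + \<bar>\<tau>\<bar> * (LINT x|lebesgue. \<bar>h x\<bar>)"
  have M0: "M \<ge> 0" unfolding M_def by (intro add_nonneg_nonneg mult_nonneg_nonneg) auto
  define \<epsilon> where "\<epsilon> = \<bar>?L \<zeta> - ?R \<zeta>\<bar> / (2 * (M + 1))"
  have e: "\<epsilon> > 0" using ne M0 by (simp add: \<epsilon>_def)
  obtain K' where "compact K'"
    and dense: "\<And>\<epsilon>. \<epsilon> > 0 \<Longrightarrow> \<exists>\<phi>. test_function UNIV \<phi> \<and> (\<forall>x. \<bar>\<phi> x - \<zeta> x\<bar> \<le> \<epsilon>) \<and> (\<forall>x. x \<notin> K' \<longrightarrow> \<phi> x = 0)"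
    by (rule test_function_dense[OF open_UNIV K(1) subset_UNIV c]) (use K(2) in blast)+
  obtain \<phi> where \<phi>: "test_function UNIV \<phi>" "\<And>x. \<bar>\<phi> x - \<zeta> x\<bar> \<le> \<epsilon>" using dense[OF e] by blast
  have \<phi>c: "Cc UNIV \<phi>" using \<phi>(1) by (rule test_function_imp_Cc)
  have \<phi>c': "continuous_on UNIV \<phi>" using \<phi>c by (simp add: Cc_def)
  have 1: "\<bar>?L \<zeta> - ?L \<phi>\<bar> \<le> \<epsilon> * (LINT x|lebesgue. \<bar>?d x\<bar>)"
    using \<phi>(2) by (intro integral_mult_diff_le Cc_mult_integrable[OF \<zeta> d] Cc_mult_integrable[OF \<phi>c d] d)
      (simp add: abs_minus_commute)
  have "\<bar>line_avg ?v \<zeta> x - line_avg ?v \<phi> x\<bar> \<le> \<epsilon>" for x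
  proof -
    have "line_avg ?v \<zeta> x - line_avg ?v \<phi> x = line_avg ?v (\<lambda>x. \<zeta> x - \<phi> x) x"
      unfolding line_avg_def
      by (rule Henstock_Kurzweil_Integration.integral_diff[OF line_avg_integrable[OF c]
          line_avg_integrable[OF \<phi>c'], symmetric])
    then show ?thesis
      using line_avg_dist[of "\<lambda>x. \<zeta> x - \<phi> x" x ?v 0 \<epsilon>] \<phi>(2) c \<phi>c'
      by (simp add: continuous_on_diff abs_minus_commute)
  qed
  then have "\<bar>(LINT x|lebesgue. line_avg ?v \<zeta> x * h x) - (LINT x|lebesgue. line_avg ?v \<phi> x * h x)\<bar> \<le>
      \<epsilon> * (LINT x|lebesgue. \<bar>h x\<bar>)"
    by (intro integral_mult_diff_le Cc_mult_integrable[OF Cc_line_avg h] \<zeta> \<phi>c h)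
  then have 2: "\<bar>?R \<zeta> - ?R \<phi>\<bar> \<le> \<bar>\<tau>\<bar> * (\<epsilon> * (LINT x|lebesgue. \<bar>h x\<bar>))"
    unfolding right_diff_distrib[symmetric] abs_mult by (intro mult_left_mono) auto
  have "\<bar>?L \<zeta> - ?R \<zeta>\<bar> \<le> \<epsilon> * M"
    using 1 2 Cc_pderiv_difference_test[OF u \<phi>(1), of \<tau>] unfolding M_def
    by (simp add: distrib_left mult.left_commute)
  also have "\<dots> \<le> \<bar>?L \<zeta> - ?R \<zeta>\<bar> / 2"
    using M0 e mult_left_mono[of M "M + 1" \<epsilon>] by (simp add: \<epsilon>_def field_simps)
  finally show False using ne by simp
qed

text \<open>Difference quotients obey a discrete product rule, and they may be tested against the merely
  continuous functions \<open>\<phi> u\<close> and \<open>\<phi> v\<close>.\<close>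

lemma Cc_pderiv_mult:
  fixes u v :: "real^'n \<Rightarrow> real"
  assumes u: "Cc_pderiv i u h" and v: "Cc_pderiv i v k" and \<phi>: "test_function UNIV \<phi>"
  shows "(LINT x|lebesgue. frechet_derivative \<phi> (at x) (axis i 1) * (u x * v x)) =
    - (LINT x|lebesgue. \<phi> x * (u x * k x + v x * h x))"
proof -
  let ?e = "axis i (1::real)" and ?d\<phi> = "\<lambda>x. frechet_derivative \<phi> (at x) (axis i 1)"
  have \<phi>c: "Cc UNIV \<phi>" and \<phi>s: "smooth_on UNIV \<phi>"
    using \<phi> test_function_imp_Cc by (auto simp: test_function_def)
  have d\<phi>c: "Cc UNIV ?d\<phi>" using \<phi> by (intro test_function_imp_Cc test_function_partial)
  have uc: "Cc UNIV u" and vc: "Cc UNIV v" and hk: "integrable lebesgue h" "integrable lebesgue k"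
    using u v by (auto simp: Cc_pderiv_def)
  have cont: "continuous_on UNIV \<phi>" "continuous_on UNIV u" "continuous_on UNIV v" "continuous_on UNIV ?d\<phi>"
    using \<phi>c uc vc d\<phi>c by (auto simp: Cc_def)
  define t where "t m = 1 / real (Suc m)" for m
  have t: "0 < t m" for m by (simp add: t_def)
  have tlim: "t \<longlonglongrightarrow> 0" unfolding t_def using LIMSEQ_Suc[OF lim_1_over_n] by simp
  \<comment> \<open>A pair of points is used so that one statement covers both functions of the
    point on the segment and products with a factor taken at that point shifted back by one
    step.\<close>
  have close: "\<forall>\<^sub>F m in sequentially. \<forall>s\<in>{0..1}. \<bar>F (x + s *\<^sub>R t m *\<^sub>R ?e, x + s *\<^sub>R t m *\<^sub>R ?e - t m *\<^sub>R ?e) - F (x, x)\<bar> \<le> \<epsilon>"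
    if F: "continuous_on UNIV F" and \<epsilon>: "\<epsilon> > 0" for F :: "(real^'n) \<times> (real^'n) \<Rightarrow> real" and x \<epsilon>
  proof -
    have "isCont F (x, x)" using F by (simp add: continuous_on_eq_continuous_at)
    then obtain \<delta> where \<delta>: "\<delta> > 0" "\<And>y. dist y (x, x) < \<delta> \<Longrightarrow> \<bar>F y - F (x, x)\<bar> < \<epsilon>"
      using \<epsilon> unfolding continuous_at_eps_delta by (metis dist_real_def)
    have "\<forall>\<^sub>F m in sequentially. t m < \<delta> / 2" using order_tendstoD(2)[OF tlim, of "\<delta> / 2"] \<delta> by simp
    then show ?thesis
    proof (eventually_elim, intro ballI)
      fix m s assume m: "t m < \<delta> / 2" and s: "s \<in> {0..1::real}"
      have 1: "norm (s *\<^sub>R t m *\<^sub>R ?e) \<le> t m" using s t[of m] by (simp add: mult_left_le_one_le)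
      have "s *\<^sub>R t m *\<^sub>R ?e - t m *\<^sub>R ?e = (s - 1) *\<^sub>R t m *\<^sub>R ?e" by (simp add: algebra_simps)
      then have 2: "norm (s *\<^sub>R t m *\<^sub>R ?e - t m *\<^sub>R ?e) \<le> t m"
        using s t[of m] by (simp add: abs_mult mult_left_le_one_le)
      have "dist (x + s *\<^sub>R t m *\<^sub>R ?e, x + s *\<^sub>R t m *\<^sub>R ?e - t m *\<^sub>R ?e) (x, x) \<le>
          norm (s *\<^sub>R t m *\<^sub>R ?e) + norm (s *\<^sub>R t m *\<^sub>R ?e - t m *\<^sub>R ?e)"
        using norm_Pair_le[of "s *\<^sub>R t m *\<^sub>R ?e" "s *\<^sub>R t m *\<^sub>R ?e - t m *\<^sub>R ?e"]
        by (simp add: dist_norm add_diff_eq[symmetric])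
      also have "\<dots> < \<delta>" using 1 2 m by simp
      finally show "\<bar>F (x + s *\<^sub>R t m *\<^sub>R ?e, x + s *\<^sub>R t m *\<^sub>R ?e - t m *\<^sub>R ?e) - F (x, x)\<bar> \<le> \<epsilon>"
        using \<delta>(2) by fastforce
    qed
  qed
  have comp: "continuous_on UNIV (\<lambda>y. f (fst y))" "continuous_on UNIV (\<lambda>y. f (snd y))"
    if "continuous_on UNIV f" for f :: "real^'n \<Rightarrow> real"
    by (rule continuous_on_compose2[OF that]; auto intro!: continuous_intros)+
  obtain B1 where B1: "B1 \<ge> 0" "\<And>x. \<bar>\<phi> x\<bar> \<le> B1" using Cc_bounded[OF \<phi>c] by blast
  obtain B2 where B2: "B2 \<ge> 0" "\<And>x. \<bar>u x\<bar> \<le> B2" using Cc_bounded[OF uc] by blast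
  obtain B3 where B3: "B3 \<ge> 0" "\<And>x. \<bar>v x\<bar> \<le> B3" using Cc_bounded[OF vc] by blast
  obtain B4 where B4: "\<And>x. \<bar>?d\<phi> x\<bar> \<le> B4" using Cc_bounded[OF d\<phi>c] by blast
  note B = B1 B2 B3 B4
  let ?w = "\<lambda>x. u x * v x"
  have wc: "Cc UNIV ?w" using Cc_mult[OF uc cont(3)] .
  have tc: "continuous_on UNIV (\<lambda>x. u (x - t m *\<^sub>R ?e))" "continuous_on UNIV (\<lambda>x. v (x - t m *\<^sub>R ?e))" for m
    using Cc_translate[OF uc, of "- t m *\<^sub>R ?e"] Cc_translate[OF vc, of "- t m *\<^sub>R ?e"] by (auto simp: Cc_def)
  have \<phi>uc: "Cc UNIV (\<lambda>x. \<phi> x * u x)" and \<phi>vc: "Cc UNIV (\<lambda>x. \<phi> x * v (x - t m *\<^sub>R ?e))" for m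
    using Cc_mult[OF \<phi>c cont(2)] Cc_mult[OF \<phi>c tc(2)] by auto
  \<comment> \<open>This difference quotient is evaluated twice, by moving the difference to \<phi>
    and by splitting the difference of the product; the two limits are the two sides of the
    claim.\<close>
  define I where "I m = (LINT x|lebesgue. \<phi> x * (?w x - ?w (x - t m *\<^sub>R ?e))) / t m" for m
  have I1: "I m = - (LINT x|lebesgue. line_avg (t m *\<^sub>R ?e) ?d\<phi> x * ?w x)" for m
    using t[of m] unfolding I_def integral_Cc_difference[OF \<phi>c wc] line_avg_FTC(1)[OF \<phi>s, symmetric]
    by (simp add: mult.assoc)
  have L1: "I \<longlonglongrightarrow> - (LINT x|lebesgue. ?d\<phi> x * ?w x)"
    unfolding I1
  proof (intro tendsto_minus line_avg_integral_tendsto)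
    show "\<forall>\<^sub>F m in sequentially. \<forall>s\<in>{0..1}. \<bar>?d\<phi> (x + s *\<^sub>R t m *\<^sub>R ?e) - ?d\<phi> x\<bar> \<le> \<epsilon>"
      if "\<epsilon> > 0" for x \<epsilon>
      using close[OF comp(1)[OF cont(4)] that] by simp
  qed (use cont B Cc_integrable[OF wc] in auto)
  have I2: "I m = (LINT x|lebesgue. line_avg (t m *\<^sub>R ?e) (\<lambda>x. \<phi> x * u x) x * k x) +
      (LINT x|lebesgue. line_avg (t m *\<^sub>R ?e) (\<lambda>x. \<phi> x * v (x - t m *\<^sub>R ?e)) x * h x)" for m
  proof -
    have i: "integrable lebesgue (\<lambda>x. (\<phi> x * u x) * (v x - v (x - t m *\<^sub>R ?e)))"
       "integrable lebesgue (\<lambda>x. (\<phi> x * v (x - t m *\<^sub>R ?e)) * (u x - u (x - t m *\<^sub>R ?e)))"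
      by (rule Cc_integrable[OF Cc_mult[OF \<phi>uc continuous_on_diff[OF cont(3) tc(2)]]])
        (rule Cc_integrable[OF Cc_mult[OF \<phi>vc continuous_on_diff[OF cont(2) tc(1)]]])
    have "(LINT x|lebesgue. \<phi> x * (?w x - ?w (x - t m *\<^sub>R ?e))) =
       (LINT x|lebesgue. (\<phi> x * u x) * (v x - v (x - t m *\<^sub>R ?e)) +
          (\<phi> x * v (x - t m *\<^sub>R ?e)) * (u x - u (x - t m *\<^sub>R ?e)))"
      by (simp add: algebra_simps)
    also have "\<dots> = t m * (LINT x|lebesgue. line_avg (t m *\<^sub>R ?e) (\<lambda>x. \<phi> x * u x) x * k x) +
       t m * (LINT x|lebesgue. line_avg (t m *\<^sub>R ?e) (\<lambda>x. \<phi> x * v (x - t m *\<^sub>R ?e)) x * h x)"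
      unfolding Bochner_Integration.integral_add[OF i]
        Cc_pderiv_difference[OF v \<phi>uc] Cc_pderiv_difference[OF u \<phi>vc] ..
    finally show ?thesis using t[of m] by (simp add: I_def field_simps)
  qed
  have L2: "I \<longlonglongrightarrow> (LINT x|lebesgue. (\<phi> x * u x) * k x) + (LINT x|lebesgue. (\<phi> x * v x) * h x)"
    unfolding I2
  proof (intro tendsto_add line_avg_integral_tendsto hk)
    show "\<forall>\<^sub>F m in sequentially. \<forall>s\<in>{0..1}. \<bar>\<phi> (x + s *\<^sub>R t m *\<^sub>R ?e) * u (x + s *\<^sub>R t m *\<^sub>R ?e) - \<phi> x * u x\<bar> \<le> \<epsilon>"
      if "\<epsilon> > 0" for x \<epsilon>
      using close[OF comp(1)[OF continuous_on_mult[OF cont(1,2)]] that] by simp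
    show "\<forall>\<^sub>F m in sequentially. \<forall>s\<in>{0..1}. \<bar>\<phi> (x + s *\<^sub>R t m *\<^sub>R ?e) * v (x + s *\<^sub>R t m *\<^sub>R ?e - t m *\<^sub>R ?e) - \<phi> x * v x\<bar> \<le> \<epsilon>"
      if "\<epsilon> > 0" for x \<epsilon>
      using close[OF continuous_on_mult[OF comp(1)[OF cont(1)] comp(2)[OF cont(3)]] that] by simp
    show "\<bar>\<phi> x * u x\<bar> \<le> B1 * B2" "\<bar>\<phi> x * v (x - t m *\<^sub>R ?e)\<bar> \<le> B1 * B3" for m x
      unfolding abs_mult using B by (auto intro!: mult_mono)
  qed (use \<phi>uc \<phi>vc in \<open>auto simp: Cc_def\<close>)
  have "(LINT x|lebesgue. \<phi> x * (u x * k x + v x * h x)) =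
    (LINT x|lebesgue. (\<phi> x * u x) * k x) + (LINT x|lebesgue. (\<phi> x * v x) * h x)"
    using Cc_mult_integrable[OF \<phi>uc hk(2)] Cc_mult_integrable[OF Cc_mult[OF \<phi>c cont(3)] hk(1)]
    by (simp add: distrib_left mult.assoc)
  then show ?thesis using LIMSEQ_unique[OF L1 L2] by simp
qed

text \<open>With a smooth factor the product rule needs no approximation, since \<eta> \<phi> is a
  test function on \<Omega>. This carries a local function into the global setting of
  \<open>Cc_pderiv\<close>.\<close>

lemma cutoff_Cc_pderiv:
  fixes u :: "real^'n \<Rightarrow> real"
  assumes \<Omega>: "open \<Omega>" and u: "has_weak_pderiv \<Omega> i u h" and c: "continuous_on \<Omega> u" and \<eta>: "test_function \<Omega> \<eta>"
  shows "Cc_pderiv i (\<lambda>x. \<eta> x * u x) (\<lambda>x. \<eta> x * h x + frechet_derivative \<eta> (at x) (axis i 1) * u x)"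
proof -
  let ?e = "axis i (1::real)"
  obtain K where K: "compact K" "K \<subseteq> \<Omega>" "\<And>x. x \<notin> K \<Longrightarrow> \<eta> x = 0" and s: "smooth_on UNIV \<eta>"
    using \<eta> by (auto simp: test_function_def)
  have L: "Lp_loc 1 \<Omega> u" "Lp_loc 1 \<Omega> h" using u by (auto simp: has_weak_pderiv_iff)
  have \<eta>c: "Cc \<Omega> \<eta>" "Cc \<Omega> (\<lambda>x. frechet_derivative \<eta> (at x) ?e)"
    using \<eta> by (auto intro: test_function_imp_Cc test_function_partial)
  have int: "integrable lebesgue (\<lambda>x. \<zeta> x * f x)" if "Cc \<Omega> \<zeta>" "Lp_loc 1 \<Omega> f" for \<zeta> f
    using Cc_scaleR_integrable[OF that] by simp
  have "continuous_on (\<Omega> \<union> - K) (\<lambda>x. \<eta> x * u x)"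
  proof (rule continuous_on_open_Un[OF \<Omega>])
    show "open (- K)" using K by (simp add: compact_imp_closed open_Compl)
    show "continuous_on \<Omega> (\<lambda>x. \<eta> x * u x)"
      using smooth_imp_continuous[OF s] c by (intro continuous_intros) (auto intro: continuous_on_subset)
    have "continuous_on (- K) (\<lambda>x. 0 :: real)" by simp
    then show "continuous_on (- K) (\<lambda>x. \<eta> x * u x)"
      by (rule continuous_on_cong[THEN iffD1, rotated 2]) (use K in auto)
  qed
  moreover have "\<Omega> \<union> - K = UNIV" using K by auto
  ultimately have 1: "Cc UNIV (\<lambda>x. \<eta> x * u x)" unfolding Cc_def using K by (auto intro!: exI[of _ K])
  show ?thesis
    unfolding Cc_pderiv_def
  proof (intro conjI 1 allI impI)
    show "integrable lebesgue (\<lambda>x. \<eta> x * h x + frechet_derivative \<eta> (at x) ?e * u x)"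
      using int[OF \<eta>c(1) L(2)] int[OF \<eta>c(2) L(1)] by simp
    fix \<phi> :: "real^'n \<Rightarrow> real" assume \<phi>: "test_function UNIV \<phi>"
    then have \<phi>s: "smooth_on UNIV \<phi>" by (simp add: test_function_def)
    have \<eta>\<phi>: "test_function \<Omega> (\<lambda>x. \<eta> x * \<phi> x)" using \<eta> \<phi>s by (rule test_function_mult)
    have d\<phi>c: "continuous_on UNIV \<phi>" "continuous_on UNIV (\<lambda>x. frechet_derivative \<phi> (at x) ?e)"
      using \<phi>s by (auto intro: smooth_imp_continuous smooth_frechet_derivative)
    have fd: "frechet_derivative (\<lambda>x. \<eta> x * \<phi> x) (at x) ?e =
        \<eta> x * frechet_derivative \<phi> (at x) ?e + frechet_derivative \<eta> (at x) ?e * \<phi> x" for x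
      using frechet_derivative_at[OF has_derivative_mult[OF smooth_has_derivative[OF s] smooth_has_derivative[OF \<phi>s]], of x]
      by metis
    have i: "integrable lebesgue (\<lambda>x. \<eta> x * frechet_derivative \<phi> (at x) ?e * u x)"
       "integrable lebesgue (\<lambda>x. frechet_derivative \<eta> (at x) ?e * \<phi> x * u x)"
       "integrable lebesgue (\<lambda>x. \<eta> x * \<phi> x * h x)"
      using int[OF Cc_mult[OF \<eta>c(1) d\<phi>c(2)] L(1)] int[OF Cc_mult[OF \<eta>c(2) d\<phi>c(1)] L(1)]
        int[OF Cc_mult[OF \<eta>c(1) d\<phi>c(1)] L(2)] by auto
    have "(LINT x|lebesgue. frechet_derivative (\<lambda>x. \<eta> x * \<phi> x) (at x) ?e * u x) = - (LINT x|lebesgue. (\<eta> x * \<phi> x) * h x)"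
      using u \<eta>\<phi> by (auto simp: has_weak_pderiv_iff)
    then have "(LINT x|lebesgue. \<eta> x * frechet_derivative \<phi> (at x) ?e * u x) +
        (LINT x|lebesgue. frechet_derivative \<eta> (at x) ?e * \<phi> x * u x) = - (LINT x|lebesgue. \<eta> x * \<phi> x * h x)"
      unfolding fd distrib_right using i by simp
    moreover have "(LINT x|lebesgue. \<phi> x * (\<eta> x * h x + frechet_derivative \<eta> (at x) ?e * u x)) =
      (LINT x|lebesgue. \<eta> x * \<phi> x * h x) + (LINT x|lebesgue. frechet_derivative \<eta> (at x) ?e * \<phi> x * u x)"
      using Bochner_Integration.integral_add[OF i(3,2)] by (simp add: algebra_simps)
    ultimately show "(LINT x|lebesgue. frechet_derivative \<phi> (at x) ?e * (\<eta> x * u x)) =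
       - (LINT x|lebesgue. \<phi> x * (\<eta> x * h x + frechet_derivative \<eta> (at x) ?e * u x))"
      by (simp add: algebra_simps)
  qed
qed

text \<open>A cutoff \<eta> equal to 1 on the support of \<phi> reduces the claim to the compactly
  supported functions \<eta> u and \<eta> v, which the test function cannot distinguish from u and
  v.\<close>

theorem has_weak_pderiv_mult:
  fixes u v :: "real^'n \<Rightarrow> real"
  assumes \<Omega>: "open \<Omega>" and u: "has_weak_pderiv \<Omega> i u h" "continuous_on \<Omega> u"
    and v: "has_weak_pderiv \<Omega> i v k" "continuous_on \<Omega> v"
  shows "has_weak_pderiv \<Omega> i (\<lambda>x. u x * v x) (\<lambda>x. u x * k x + v x * h x)"
  unfolding has_weak_pderiv_iff
proof (intro conjI allI impI)
  have L: "Lp_loc 1 \<Omega> h" "Lp_loc 1 \<Omega> k" using u v by (auto simp: has_weak_pderiv_iff)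
  show "Lp_loc 1 \<Omega> (\<lambda>x. u x * v x)" using u v by (intro Lp_loc_continuous continuous_on_mult) auto
  show "Lp_loc 1 \<Omega> (\<lambda>x. u x * k x + v x * h x)"
    using Lp_loc_add[OF Lp_loc_scaleR_continuous[OF L(2) u(2)] Lp_loc_scaleR_continuous[OF L(1) v(2)]]
    by (simp add: mult.commute)
  fix \<phi> assume \<phi>: "test_function \<Omega> \<phi>"
  then obtain K where K: "compact K" "K \<subseteq> \<Omega>" "\<And>x. x \<notin> K \<Longrightarrow> \<phi> x = 0" and s: "smooth_on UNIV \<phi>"
    by (auto simp: test_function_def)
  obtain \<eta> where \<eta>: "test_function \<Omega> \<eta>" "\<And>x. x \<in> K \<Longrightarrow> \<eta> x = 1" "\<And>x. 0 \<le> \<eta> x \<and> \<eta> x \<le> 1"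
    using smooth_cutoff[OF \<Omega> K(1,2)] by metis
  \<comment> \<open>On \<open>K\<close> the cutoff attains its maximum 1, so its derivative vanishes
    there, at boundary points of \<open>K\<close> as well.\<close>
  have \<eta>': "frechet_derivative \<eta> (at x) (axis i 1) = 0" if "x \<in> K" for x
  proof -
    have "(\<eta> has_derivative frechet_derivative \<eta> (at x)) (at x)"
      using \<eta>(1) by (intro smooth_has_derivative) (simp add: test_function_def)
    then have "frechet_derivative \<eta> (at x) = (\<lambda>v. 0)"
      by (rule differential_zero_maxmin[OF UNIV_I open_UNIV]) (use \<eta> that in auto)
    then show ?thesis by simp
  qed
  have \<phi>': "frechet_derivative \<phi> (at x) v = 0" if "x \<notin> K" for x v
    using frechet_derivative_eq_0[of "- K" x \<phi> 0] K that by (simp add: compact_imp_closed open_Compl)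
  have "(LINT x|lebesgue. frechet_derivative \<phi> (at x) (axis i 1) * (u x * v x)) =
     (LINT x|lebesgue. frechet_derivative \<phi> (at x) (axis i 1) * ((\<eta> x * u x) * (\<eta> x * v x)))"
  proof (rule Bochner_Integration.integral_cong[OF refl])
    fix x
    show "frechet_derivative \<phi> (at x) (axis i 1) * (u x * v x) =
       frechet_derivative \<phi> (at x) (axis i 1) * ((\<eta> x * u x) * (\<eta> x * v x))"
      using \<eta>(2)[of x] \<phi>'[of x] by (cases "x \<in> K") auto
  qed
  also have "\<dots> = - (LINT x|lebesgue. \<phi> x * ((\<eta> x * u x) * (\<eta> x * k x + frechet_derivative \<eta> (at x) (axis i 1) * v x) +
      (\<eta> x * v x) * (\<eta> x * h x + frechet_derivative \<eta> (at x) (axis i 1) * u x)))"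
    by (rule Cc_pderiv_mult[OF cutoff_Cc_pderiv[OF \<Omega> u \<eta>(1)] cutoff_Cc_pderiv[OF \<Omega> v \<eta>(1)]
        test_function_mono[OF \<phi> subset_UNIV]])
  also have "(LINT x|lebesgue. \<phi> x * ((\<eta> x * u x) * (\<eta> x * k x + frechet_derivative \<eta> (at x) (axis i 1) * v x) +
      (\<eta> x * v x) * (\<eta> x * h x + frechet_derivative \<eta> (at x) (axis i 1) * u x))) =
      (LINT x|lebesgue. \<phi> x * (u x * k x + v x * h x))"
  proof (rule Bochner_Integration.integral_cong[OF refl])
    fix x
    show "\<phi> x * ((\<eta> x * u x) * (\<eta> x * k x + frechet_derivative \<eta> (at x) (axis i 1) * v x) +
      (\<eta> x * v x) * (\<eta> x * h x + frechet_derivative \<eta> (at x) (axis i 1) * u x)) = \<phi> x * (u x * k x + v x * h x)"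
      using \<eta>(2)[of x] \<eta>'[of x] K(3)[of x] by (cases "x \<in> K") auto
  qed
  finally show "(LINT x|lebesgue. frechet_derivative \<phi> (at x) (axis i 1) *\<^sub>R (u x * v x)) =
      - (LINT x|lebesgue. \<phi> x *\<^sub>R (u x * k x + v x * h x))" by simp
qed

subsection \<open>Morrey's estimate and compactness\<close>

text \<open>Multiples of basis vectors by test functions belong to L^q on the support, so the
  difference of the two limits falls under the fundamental lemma.\<close>

lemma weak_conv_Lp_loc_unique:
  assumes \<Omega>: "open \<Omega>" and p: "1 < p" and a: "weak_conv_Lp_loc p \<Omega> f a" and b: "weak_conv_Lp_loc p \<Omega> f b"
  shows "AE x in lebesgue. x \<in> \<Omega> \<longrightarrow> a x = b x"
proof -
  have Lp: "Lp_loc p \<Omega> a" "Lp_loc p \<Omega> b" using a b by (auto simp: weak_conv_Lp_loc_def)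
  have Lpm: "Lp_loc p \<Omega> (\<lambda>x. - b x)" using Lp p by (intro Lp_loc_linear[where L = uminus]) (auto simp: linear_iff)
  have d: "Lp_loc p \<Omega> (\<lambda>x. a x - b x)" using Lp_loc_add[OF Lp(1) Lpm] p by simp
  have d1: "Lp_loc 1 \<Omega> (\<lambda>x. a x - b x)"
    using d p by (auto simp: Lp_loc_def intro: Lp_on_exponent_mono[of _ p])
  have "AE x in lebesgue. x \<in> \<Omega> \<longrightarrow> a x - b x = 0"
  proof (rule fundamental_lemma_variations[OF \<Omega> d1])
    fix \<phi> assume \<phi>: "test_function \<Omega> \<phi>"
    then obtain K where K: "compact K" "K \<subseteq> \<Omega>" "\<And>x. x \<notin> K \<Longrightarrow> \<phi> x = 0" and s: "smooth_on UNIV \<phi>"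
      by (auto simp: test_function_def)
    have int: "integrable lebesgue (\<lambda>x. \<phi> x *\<^sub>R (a x - b x))"
      by (rule Cc_scaleR_integrable[OF test_function_imp_Cc[OF \<phi>] d1])
    have Ks: "K \<in> sets lebesgue" using K by simp
    show "(LINT x|lebesgue. \<phi> x *\<^sub>R (a x - b x)) = 0"
    proof (rule euclidean_eqI)
      fix e :: 'b assume "e \<in> Basis"
      have \<psi>: "Lp_on (p / (p - 1)) K (\<lambda>x. \<phi> x *\<^sub>R e)"
        using K s p by (intro Lp_on_continuous continuous_intros continuous_on_subset[OF smooth_imp_continuous]) auto
      have "(LINT x:K|lebesgue. a x \<bullet> \<phi> x *\<^sub>R e) = (LINT x:K|lebesgue. b x \<bullet> \<phi> x *\<^sub>R e)"
        by (rule LIMSEQ_unique[of "\<lambda>j. LINT x:K|lebesgue. f j x \<bullet> \<phi> x *\<^sub>R e"])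
          (use a b K \<psi> in \<open>auto simp only: weak_conv_Lp_loc_def\<close>)
      moreover have "integrable (lebesgue_on K) (\<lambda>x. a x \<bullet> \<phi> x *\<^sub>R e)" "integrable (lebesgue_on K) (\<lambda>x. b x \<bullet> \<phi> x *\<^sub>R e)"
        using Lp K by (auto intro!: Lp_on_Holder(2)[OF Ks p _ \<psi>] simp: Lp_loc_def simp del: inner_scaleR_right)
      ultimately have "(LINT x|lebesgue_on K. (a x - b x) \<bullet> \<phi> x *\<^sub>R e) = 0"
        unfolding set_integral_lebesgue_on[OF Ks] inner_diff_left by simp
      then have "(LINT x|lebesgue. indicator K x *\<^sub>R ((a x - b x) \<bullet> \<phi> x *\<^sub>R e)) = 0"
        using Ks by (simp add: integral_restrict_space)
      moreover have "indicator K x *\<^sub>R ((a x - b x) \<bullet> \<phi> x *\<^sub>R e) = (\<phi> x *\<^sub>R (a x - b x)) \<bullet> e" for x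
        using K(3)[of x] by (cases "x \<in> K") auto
      ultimately have "(LINT x|lebesgue. (\<phi> x *\<^sub>R (a x - b x)) \<bullet> e) = 0" by (simp only:)
      then show "(LINT x|lebesgue. \<phi> x *\<^sub>R (a x - b x)) \<bullet> e = 0 \<bullet> e"
        using integral_inner_left[OF int, of e] by simp
    qed
  qed
  then show ?thesis by simp
qed

text \<open>The product of \<open>u j\<close> with the constant function 1, regarded as a weakly
  convergent sequence.\<close>

lemma uniform_imp_weak_conv_Lp_loc:
  fixes u :: "nat \<Rightarrow> real^'n \<Rightarrow> 'b::euclidean_space"
  assumes p: "1 < p" and c: "\<forall>\<^sub>F j in sequentially. continuous_on \<Omega> (u j)" and U: "continuous_on \<Omega> U"
    and lim: "\<And>K. compact K \<Longrightarrow> K \<subseteq> \<Omega> \<Longrightarrow> uniform_limit K u U sequentially"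
  shows "weak_conv_Lp_loc p \<Omega> u U"
proof -
  have "Lp_loc p \<Omega> (\<lambda>x. 1::real)" using p by (intro Lp_loc_continuous) auto
  from weak_conv_Lp_loc_scaleR_uniform[OF p weak_conv_Lp_loc_const[OF this] c U lim] show ?thesis by simp
qed

lemma continuous_on_local_uniform_limit:
  fixes u :: "nat \<Rightarrow> 'a::euclidean_space \<Rightarrow> 'b::euclidean_space"
  assumes \<Omega>: "open \<Omega>" and c: "\<forall>\<^sub>F j in sequentially. continuous_on \<Omega> (u j)"
    and lim: "\<And>K. compact K \<Longrightarrow> K \<subseteq> \<Omega> \<Longrightarrow> uniform_limit K u U sequentially"
  shows "continuous_on \<Omega> U"
proof (rule continuous_at_imp_continuous_on, rule ballI)
  fix x assume "x \<in> \<Omega>"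
  then obtain e where e: "e > 0" "cball x e \<subseteq> \<Omega>" using \<Omega> by (meson open_contains_cball)
  have "continuous_on (cball x e) U"
    by (rule uniform_limit_theorem[OF _ lim]) (use c e in \<open>auto elim!: eventually_mono intro: continuous_on_subset\<close>)
  then have "continuous_on (ball x e) U" by (rule continuous_on_subset) (rule ball_subset_cball)
  then show "isCont U x" using e by (simp add: continuous_on_eq_continuous_at)
qed

section \<open>Mollification and its dependence on the scale\<close>

definition moll_const :: "'n::finite itself \<Rightarrow> real" where
  "moll_const _ = (LINT y|lebesgue. flat_exp 0 (1 - y \<bullet> (y :: real^'n)))"

text \<open>The kernel is not normalized: as s tends to 0 the result tends to
  \<open>moll_const\<close> times \<open>u\<close>. All that matters about this constant is that it
  is positive and independent of x and s.\<close>

definition moll :: "real \<Rightarrow> (real^'n \<Rightarrow> 'b::euclidean_space) \<Rightarrow> real^'n \<Rightarrow> 'b" where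
  "moll s u x = (LINT y|lebesgue. (inverse s ^ CARD('n) * flat_exp 0 (1 - (y - x) \<bullet> (y - x) / s\<^sup>2)) *\<^sub>R u y)"

lemma flat_exp_0_le_1: "flat_exp 0 t \<le> 1"
  by (simp add: flat_exp_def)

lemma bump_Cc: "s > 0 \<Longrightarrow> Cc UNIV (\<lambda>y. flat_exp 0 (1 - (y - x) \<bullet> (y - x) / s\<^sup>2))"
  for x :: "real^'n"
  by (intro test_function_imp_Cc test_function_bump) auto

lemma bump_integral:
  fixes x :: "real^'n"
  assumes s: "s > 0"
  shows "(LINT y|lebesgue. inverse s ^ CARD('n) * flat_exp 0 (1 - (y - x) \<bullet> (y - x) / s\<^sup>2)) = moll_const TYPE('n)"
proof -
  let ?f = "\<lambda>y. flat_exp 0 (1 - (y - x) \<bullet> (y - x) / s\<^sup>2)"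
  have f: "?f \<in> borel_measurable borel"
    using smooth_imp_continuous[OF smooth_bump[of 0 x s]] by (rule borel_measurable_continuous_onI)
  have f1: "(\<lambda>y::real^'n. flat_exp 0 (1 - y \<bullet> y)) \<in> borel_measurable borel"
    using smooth_imp_continuous[OF smooth_bump[of 0 "0::real^'n" 1]] by (intro borel_measurable_continuous_onI) simp
  have "(LINT y|lebesgue. ?f y) = (LINT y|lborel. ?f y)" using f by (simp add: integral_completion)
  also have "\<dots> = (LINT y|density (distr lborel borel (\<lambda>y. x + s *\<^sub>R y)) (\<lambda>_. \<bar>s\<bar> ^ DIM(real^'n)). ?f y)"
    using s by (subst lborel_affine[of s x]) auto
  also have "\<dots> = (LINT y|distr lborel borel (\<lambda>y. x + s *\<^sub>R y). \<bar>s\<bar> ^ DIM(real^'n) * ?f y)"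
    using f by (subst integral_density) auto
  also have "\<dots> = (LINT y|lborel. \<bar>s\<bar> ^ DIM(real^'n) * ?f (x + s *\<^sub>R y))"
    using f by (subst integral_distr) auto
  also have "(\<lambda>y. ?f (x + s *\<^sub>R y)) = (\<lambda>y. flat_exp 0 (1 - y \<bullet> y))"
    using s by (auto simp: power2_eq_square)
  finally show ?thesis
    using s f1 by (simp add: moll_const_def integral_completion power_inverse)
qed

lemma moll_const_pos: "moll_const TYPE('n::finite) > 0"
proof -
  let ?f = "\<lambda>y::real^'n. flat_exp 0 (1 - y \<bullet> y)"
  have i: "integrable lebesgue ?f"
    using Cc_integrable[OF bump_Cc[of 1 "0::real^'n"]] by simp
  have "moll_const TYPE('n) \<noteq> 0"
  proof
    assume "moll_const TYPE('n) = 0"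
    then have "AE y in lebesgue. ?f y = 0"
      unfolding moll_const_def using i by (subst (asm) integral_nonneg_eq_0_iff_AE) (auto simp: flat_exp_nonneg)
    then have "AE y in lebesgue. y \<notin> ball (0::real^'n) 1"
    proof (rule eventually_mono)
      fix y :: "real^'n" assume "?f y = 0"
      then show "y \<notin> ball 0 1" using bump_pos[of 1 y 0 0] by auto
    qed
    then have "ball (0::real^'n) 1 \<in> null_sets lebesgue" by (simp add: AE_iff_null_sets)
    then show False using negligible_iff_null_sets open_not_negligible[of "ball (0::real^'n) 1"] by auto
  qed
  moreover have "moll_const TYPE('n) \<ge> 0"
    unfolding moll_const_def by (intro integral_nonneg_AE) (auto simp: flat_exp_nonneg)
  ultimately show ?thesis by linarith
qed

lemma bump_scaleR_integrable:
  fixes u :: "real^'n \<Rightarrow> 'b::euclidean_space"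
  assumes s: "s > 0" and u: "Lp_on 1 (cball x s) u"
  shows "integrable lebesgue (\<lambda>y. (c * flat_exp 0 (1 - (y - x) \<bullet> (y - x) / s\<^sup>2)) *\<^sub>R u y)"
proof -
  have L: "Lp_loc 1 (cball x s) u"
    using u unfolding Lp_loc_def by (auto intro: Lp_on_subset[OF u])
  have "Cc (cball x s) (\<lambda>y. flat_exp 0 (1 - (y - x) \<bullet> (y - x) / s\<^sup>2))"
    using s by (intro test_function_imp_Cc test_function_bump) auto
  from integrable_scaleR_right[OF Cc_scaleR_integrable[OF this L], of c] show ?thesis by simp
qed

lemma moll_tendsto:
  fixes u :: "real^'n \<Rightarrow> 'b::euclidean_space"
  assumes \<Omega>: "open \<Omega>" and u: "continuous_on \<Omega> u" and x: "x \<in> \<Omega>"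
  shows "((\<lambda>s. moll s u x) \<longlongrightarrow> moll_const TYPE('n) *\<^sub>R u x) (at_right 0)"
proof (rule tendstoI)
  let ?c = "moll_const TYPE('n)"
  fix \<epsilon> :: real assume \<epsilon>: "\<epsilon> > 0"
  define \<eta> where "\<eta> = \<epsilon> / (2 * ?c)"
  have \<eta>: "\<eta> > 0" using \<epsilon> moll_const_pos[where 'n='n] by (simp add: \<eta>_def)
  have "isCont u x" using \<Omega> u x by (simp add: continuous_on_eq_continuous_at)
  then obtain d1 where d1: "d1 > 0" "\<And>y. dist y x < d1 \<Longrightarrow> dist (u y) (u x) < \<eta>"
    using \<eta> unfolding continuous_at_eps_delta by blast
  obtain d2 where d2: "d2 > 0" "cball x d2 \<subseteq> \<Omega>" using \<Omega> x by (meson open_contains_cball)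
  have "dist (moll s u x) (?c *\<^sub>R u x) < \<epsilon>" if s: "0 < s" "s < min d1 d2" for s
  proof -
    let ?k = "\<lambda>y. inverse s ^ CARD('n) * flat_exp 0 (1 - (y - x) \<bullet> (y - x) / s\<^sup>2)"
    have k0: "?k y \<ge> 0" for y using s by (simp add: flat_exp_nonneg)
    have "cball x s \<subseteq> \<Omega>" using s d2 by force
    then have L: "Lp_on 1 (cball x s) u" using u by (intro Lp_on_continuous) (auto intro: continuous_on_subset)
    have ki: "integrable lebesgue ?k" using Cc_integrable[OF bump_Cc[OF s(1), of x]] by simp
    have i1: "integrable lebesgue (\<lambda>y. ?k y *\<^sub>R u y)" by (rule bump_scaleR_integrable[OF s(1) L])
    have i2: "integrable lebesgue (\<lambda>y. ?k y *\<^sub>R u x)" using ki by (rule integrable_scaleR_left)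
    have "moll s u x - ?c *\<^sub>R u x = (LINT y|lebesgue. ?k y *\<^sub>R (u y - u x))"
      unfolding moll_def bump_integral[OF s(1), of x, symmetric] using i1 ki
      by (simp add: scaleR_diff_right)
    also have "norm \<dots> \<le> (LINT y|lebesgue. \<eta> * ?k y)"
    proof (rule Bochner_Integration.integral_norm_bound_integral)
      show "integrable lebesgue (\<lambda>y. ?k y *\<^sub>R (u y - u x))"
        unfolding scaleR_diff_right using i1 i2 by (rule Bochner_Integration.integrable_diff)
      show "integrable lebesgue (\<lambda>y. \<eta> * ?k y)" using ki by simp
      fix y
      show "norm (?k y *\<^sub>R (u y - u x)) \<le> \<eta> * ?k y"
      proof (cases "y \<in> cball x s")
        case True
        then have "dist (u y) (u x) < \<eta>" using s by (intro d1(2)) (simp add: dist_commute)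
        then have "norm (u y - u x) * ?k y \<le> \<eta> * ?k y" using k0 by (intro mult_right_mono) (auto simp: dist_norm)
        then show ?thesis using k0[of y] by (simp add: mult.commute)
      next
        case False
        then show ?thesis using bump_eq_0[OF s(1), of y x 0] by simp
      qed
    qed
    also have "\<dots> = \<eta> * ?c" using ki bump_integral[OF s(1), of x] by simp
    also have "\<dots> < \<epsilon>" using \<epsilon> moll_const_pos[where 'n='n] by (simp add: \<eta>_def)
    finally show ?thesis by (simp add: dist_norm)
  qed
  then show "\<forall>\<^sub>F s in at_right 0. dist (moll s u x) (?c *\<^sub>R u x) < \<epsilon>"
    unfolding eventually_at_right_field using d1 d2 by (intro exI[of _ "min d1 d2"]) auto
qed

definition moll_kernel :: "real^'n \<Rightarrow> real \<Rightarrow> real^'n \<Rightarrow> real" where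
  "moll_kernel x s y = inverse s ^ CARD('n) * flat_exp 0 (1 - (y - x) \<bullet> (y - x) / s\<^sup>2)"

text \<open>The derivative of \<open>moll_kernel\<close> with respect to the scale s.\<close>

definition moll_kernel' :: "real^'n \<Rightarrow> real \<Rightarrow> real^'n \<Rightarrow> real" where
  "moll_kernel' x s y = inverse s ^ Suc CARD('n) *
     (2 * ((y - x) \<bullet> (y - x)) / s\<^sup>2 * flat_exp 2 (1 - (y - x) \<bullet> (y - x) / s\<^sup>2) -
      CARD('n) * flat_exp 0 (1 - (y - x) \<bullet> (y - x) / s\<^sup>2))"

text \<open>The i-th component of the kernel times (y - x) / s, the velocity with which dilation
  about x moves the point y. The kernel, transported by this dilation, obeys a continuity
  equation.\<close>

definition moll_field :: "real^'n \<Rightarrow> real \<Rightarrow> 'n \<Rightarrow> real^'n \<Rightarrow> real" where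
  "moll_field x s i y = flat_exp 0 (1 - (y - x) \<bullet> (y - x) / s\<^sup>2) * (inverse s ^ Suc CARD('n) * ((y - x) $ i))"

lemma moll_kernel_has_derivative:
  assumes s: "s > 0"
  shows "((\<lambda>s. moll_kernel x s y) has_real_derivative moll_kernel' x s y) (at s)"
proof -
  let ?n = "CARD('a)" and ?D = "(y - x) \<bullet> (y - x)"
  have "((\<lambda>s. 1 - ?D / s\<^sup>2) has_real_derivative 2 * ?D / s ^ 3) (at s)"
    using s by (auto intro!: derivative_eq_intros simp: field_simps power2_eq_square power3_eq_cube)
  from DERIV_chain2[OF flat_exp_has_derivative[of 0] this]
  have 1: "((\<lambda>s. flat_exp 0 (1 - ?D / s\<^sup>2)) has_real_derivative flat_exp 2 (1 - ?D / s\<^sup>2) * (2 * ?D / s ^ 3)) (at s)"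
    by (simp add: numeral_2_eq_2)
  have "((\<lambda>s. inverse s ^ ?n) has_real_derivative - real ?n * inverse s ^ Suc ?n) (at s)"
  proof -
    have "((\<lambda>s. inverse s ^ ?n) has_real_derivative real ?n * (inverse s ^ (?n - 1)) * (- (inverse s ^ 2))) (at s)"
      using s by (auto intro!: derivative_eq_intros simp: power2_eq_square)
    moreover have "inverse s ^ (?n - 1) * (inverse s ^ 2) = inverse s ^ Suc ?n"
      unfolding power_add[symmetric] by (simp add: Suc_le_eq)
    ultimately show ?thesis by (simp add: mult.assoc)
  qed
  from DERIV_mult[OF this 1] show ?thesis
    unfolding moll_kernel_def moll_kernel'_def
    by (rule DERIV_cong) (use s in \<open>simp add: field_simps power2_eq_square power3_eq_cube\<close>)
qed

lemma moll_field_test_function: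
  fixes x :: "real^'n"
  assumes "s > 0" "cball x s \<subseteq> \<Omega>"
  shows "test_function \<Omega> (moll_field x s i)"
proof -
  have "(\<lambda>y. inverse s ^ Suc CARD('n) * ((y - x) $ i)) = (\<lambda>y. inverse s ^ Suc CARD('n) * (y $ i + - (x $ i)))"
    by simp
  moreover have "real_polynomial_function (\<lambda>y. inverse s ^ Suc CARD('n) * (y $ i + - (x $ i)))"
    by (intro real_polynomial_function.intros bounded_linear_vec_nth)
  ultimately have "smooth_on UNIV (\<lambda>y. inverse s ^ Suc CARD('n) * ((y - x) $ i))"
    by (metis smooth_polynomial)
  from test_function_mult[OF test_function_bump[OF assms] this] show ?thesis
    by (simp add: moll_field_def[abs_def])
qed

text \<open>The derivative of the mollifier with respect to the scale is the divergence of \<open>moll_field\<close>, so the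
  mollification of \<open>u\<close> varies with the scale at a rate controlled by the weak gradient of \<open>u\<close>.\<close>

lemma moll_field_divergence:
  fixes x :: "real^'n"
  assumes s: "s > 0"
  shows "(\<Sum>i\<in>UNIV. frechet_derivative (moll_field x s i) (at y) (axis i 1)) = - moll_kernel' x s y"
proof -
  let ?D = "\<lambda>y. (y - x) \<bullet> (y - x)" and ?m = "inverse s ^ Suc CARD('n)"
  let ?w = "1 - ?D y / s\<^sup>2"
  have fd: "frechet_derivative (moll_field x s i) (at y) (axis i 1) =
     ?m * (flat_exp 0 ?w - 2 * ((y - x) $ i * (y - x) $ i) / s\<^sup>2 * flat_exp 2 ?w)" for i
  proof -
    have "((\<lambda>y. 1 - ?D y * inverse (s\<^sup>2)) has_derivative (\<lambda>v. - (2 * ((y - x) \<bullet> v) * inverse (s\<^sup>2)))) (at y)"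
      by (auto intro!: derivative_eq_intros simp: inner_commute)
    then have "((\<lambda>y. 1 - ?D y / s\<^sup>2) has_derivative (\<lambda>v. - (2 * ((y - x) \<bullet> v) / s\<^sup>2))) (at y)"
      by (simp only: divide_inverse)
    from DERIV_compose_FDERIV[OF flat_exp_has_derivative[of 0 ?w] this]
    have 1: "((\<lambda>y. flat_exp 0 (1 - ?D y / s\<^sup>2)) has_derivative (\<lambda>v. - (2 * ((y - x) \<bullet> v) / s\<^sup>2) * flat_exp 2 ?w)) (at y)"
      by (simp add: numeral_2_eq_2)
    have 2: "((\<lambda>y. ?m * ((y - x) $ i)) has_derivative (\<lambda>v. ?m * v $ i)) (at y)"
      by (auto intro!: derivative_eq_intros bounded_linear_imp_has_derivative bounded_linear_vec_nth)
    have "(moll_field x s i has_derivative (\<lambda>v. flat_exp 0 ?w * (?m * v $ i) +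
        (- (2 * ((y - x) \<bullet> v) / s\<^sup>2) * flat_exp 2 ?w) * (?m * ((y - x) $ i)))) (at y)"
      unfolding moll_field_def[abs_def] by (rule has_derivative_mult[OF 1 2])
    then have "frechet_derivative (moll_field x s i) (at y) = (\<lambda>v. flat_exp 0 ?w * (?m * v $ i) +
        (- (2 * ((y - x) \<bullet> v) / s\<^sup>2) * flat_exp 2 ?w) * (?m * ((y - x) $ i)))"
      by (rule frechet_derivative_at[symmetric])
    then have "frechet_derivative (moll_field x s i) (at y) (axis i 1) = flat_exp 0 ?w * ?m +
        (- (2 * ((y - x) $ i) / s\<^sup>2) * flat_exp 2 ?w) * (?m * ((y - x) $ i))"
      by (simp add: inner_axis)
    then show ?thesis by (simp add: algebra_simps)
  qed
  have "(\<Sum>i\<in>UNIV. (y - x) $ i * (y - x) $ i) = ?D y" by (simp add: inner_vec_def)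
  then have "(\<Sum>i\<in>UNIV. 2 * ((y - x) $ i * (y - x) $ i) / s\<^sup>2 * flat_exp 2 ?w) = 2 * ?D y / s\<^sup>2 * flat_exp 2 ?w"
    by (simp only: sum_distrib_left[symmetric] sum_distrib_right[symmetric] sum_divide_distrib[symmetric])
  then show ?thesis
    unfolding fd sum_distrib_left[symmetric] sum_subtractf moll_kernel'_def by (simp add: algebra_simps)
qed


lemma moll_kernel_eq_0:
  assumes "s > 0" "y \<notin> cball x s"
  shows "moll_kernel x s y = 0" "moll_kernel' x s y = 0"
  using bump_eq_0[OF assms] by (auto simp: moll_kernel_def moll_kernel'_def)

lemma moll_kernel'_continuous: "continuous_on ({0<..} \<times> UNIV) (\<lambda>(s, y). moll_kernel' x s y)"
proof -
  have fc: "continuous_on UNIV (flat_exp m)" for m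
    using flat_exp_has_derivative by (meson DERIV_isCont continuous_at_imp_continuous_on)
  have "continuous_on ({0<..} \<times> UNIV) (\<lambda>z. 1 - (snd z - x) \<bullet> (snd z - x) / (fst z)\<^sup>2)"
    by (intro continuous_intros) auto
  note c = continuous_on_compose2[OF fc this subset_UNIV]
  show ?thesis
    unfolding split_beta moll_kernel'_def by (intro continuous_intros c) auto
qed

lemma moll_kernel_continuous: "continuous_on UNIV (moll_kernel x s)"
  unfolding moll_kernel_def[abs_def] using smooth_imp_continuous[OF smooth_bump] by (intro continuous_intros)

text \<open>Differentiation in the scale is carried out on an integral over a fixed box; this
  identifies it with the Lebesgue integral over the whole space, where weak derivatives are
  tested.\<close>

lemma integral_cbox_support:
  fixes f :: "real^'n \<Rightarrow> 'b::euclidean_space"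
  assumes f: "continuous_on (cbox a b) f" and "\<And>y. y \<notin> cbox a b \<Longrightarrow> f y = 0"
  shows "integral (cbox a b) f = (LINT y|lebesgue. f y)"
proof -
  have "Lp_on 1 (cbox a b) f" using f by (intro Lp_on_continuous) auto
  then have i: "integrable (lebesgue_on (cbox a b)) f" by (simp add: Lp_on_1_iff)
  have "integral (cbox a b) f = (LINT y|lebesgue_on (cbox a b). f y)"
    using lebesgue_integral_eq_integral[OF i] by simp
  also have "\<dots> = (LINT y|lebesgue. indicator (cbox a b) y *\<^sub>R f y)" by (simp add: integral_restrict_space)
  also have "(\<lambda>y. indicator (cbox a b) y *\<^sub>R f y) = f"
  proof (rule ext)
    show "indicator (cbox a b) y *\<^sub>R f y = f y" for y using assms(2)[of y] by (cases "y \<in> cbox a b") auto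
  qed
  finally show ?thesis .
qed

lemma cball_subset_cube:
  fixes x :: "real^'n"
  assumes "s \<le> r"
  shows "cball x s \<subseteq> cbox (x - r *\<^sub>R One) (x + r *\<^sub>R One)"
proof
  fix y assume y: "y \<in> cball x s"
  show "y \<in> cbox (x - r *\<^sub>R One) (x + r *\<^sub>R One)"
    unfolding mem_box
  proof
    fix b :: "real^'n" assume b: "b \<in> Basis"
    have "\<bar>(y - x) \<bullet> b\<bar> \<le> norm (y - x)" using b by (rule Basis_le_norm)
    also have "\<dots> \<le> r" using y assms by (simp add: dist_norm norm_minus_commute)
    finally show "(x - r *\<^sub>R One) \<bullet> b \<le> y \<bullet> b \<and> y \<bullet> b \<le> (x + r *\<^sub>R One) \<bullet> b"
      using b by (simp add: inner_diff_left inner_add_left abs_le_iff)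
  qed
qed

text \<open>The field is bounded by s^(-n) and vanishes off the ball of radius s, whose volume is
  the constant \<open>unit_ball_vol\<close> times s^n. Hoelder's inequality gives the power s^(-n)
  (s^n)^(1 - 1/p) = s^(-n/p).\<close>

lemma moll_field_integral_bound:
  fixes x :: "real^'n" and h :: "real^'n \<Rightarrow> 'b::euclidean_space"
  assumes p: "1 < p" and s: "s > 0" and h: "Lp_on p (cball x s) h"
    and C: "(LINT y|lebesgue_on (cball x s). norm (h y) powr p) \<le> C"
  shows "norm (LINT y|lebesgue. moll_field x s i y *\<^sub>R h y) \<le>
    unit_ball_vol CARD('n) powr (1 - 1 / p) * C powr (1 / p) * s powr (- real CARD('n) / p)"
proof -
  let ?K = "cball x s" and ?n = "CARD('n)" and ?q = "p / (p - 1)"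
  note qq = conj_exponent[OF p]
  have K: "?K \<in> sets lebesgue" by simp
  have q0: "0 < ?q" using qq by linarith
  have q': "1 / ?q = 1 - 1 / p" using qq(2) by simp
  let ?g = "\<lambda>y :: real^'n. inverse s ^ ?n"
  have g: "Lp_on ?q ?K ?g" using q0 by (intro Lp_on_continuous) auto
  have hn: "Lp_on p ?K (\<lambda>y. norm (h y))" using h by (auto simp: Lp_on_iff[OF K])
  have Cp: "0 \<le> (LINT y|lebesgue_on ?K. norm (h y) powr p)" by (rule integral_nonneg_AE) auto
  have fle: "\<bar>moll_field x s i y\<bar> \<le> indicator ?K y * inverse s ^ ?n" for y
  proof (cases "y \<in> ?K")
    case True
    have "\<bar>(y - x) $ i\<bar> \<le> norm (y - x)" by (rule component_le_norm_cart)
    also have "\<dots> \<le> s" using True by (simp add: dist_norm norm_minus_commute)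
    finally have "inverse s ^ Suc ?n * \<bar>(y - x) $ i\<bar> \<le> inverse s ^ Suc ?n * s"
      using s by (intro mult_left_mono) auto
    also have "\<dots> = inverse s ^ ?n" using s by simp
    finally have "flat_exp 0 (1 - (y - x) \<bullet> (y - x) / s\<^sup>2) * (inverse s ^ Suc ?n * \<bar>(y - x) $ i\<bar>) \<le> 1 * inverse s ^ ?n"
      using s by (intro mult_mono flat_exp_0_le_1) auto
    then show ?thesis using True s flat_exp_nonneg[of 0 "1 - (y - x) \<bullet> (y - x) / s\<^sup>2"]
      by (simp add: moll_field_def abs_mult)
  next
    case False
    then show ?thesis using bump_eq_0[OF s, of y x 0] by (simp add: moll_field_def)
  qed
  have i1: "integrable (lebesgue_on ?K) (\<lambda>y. norm (h y) * norm (?g y))"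
    using Lp_on_Holder(1)[OF K p hn g] by simp
  have h1: "Lp_loc 1 ?K h"
    unfolding Lp_loc_def using p Lp_on_exponent_mono[OF _ h, of 1]
    by (auto intro!: Lp_on_subset[of 1 ?K h])
  have mi: "integrable lebesgue (\<lambda>y. moll_field x s i y *\<^sub>R h y)"
    using s by (intro Cc_scaleR_integrable[OF _ h1] test_function_imp_Cc moll_field_test_function) auto
  have i2: "integrable lebesgue (\<lambda>y. indicator ?K y *\<^sub>R (norm (h y) * norm (?g y)))"
    using integrable_restrict_space[THEN iffD1, OF _ i1] by simp
  have "norm (LINT y|lebesgue. moll_field x s i y *\<^sub>R h y) \<le> (LINT y|lebesgue. indicator ?K y *\<^sub>R (norm (h y) * norm (?g y)))"
  proof (rule Bochner_Integration.integral_norm_bound_integral[OF mi i2])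
    fix y
    have "norm (moll_field x s i y *\<^sub>R h y) \<le> (indicator ?K y * inverse s ^ ?n) * norm (h y)"
      unfolding norm_scaleR using fle[of y] by (intro mult_right_mono) auto
    then show "norm (moll_field x s i y *\<^sub>R h y) \<le> indicator ?K y *\<^sub>R (norm (h y) * norm (?g y))"
      using s by (simp add: mult_ac abs_mult)
  qed
  also have "\<dots> = (LINT y|lebesgue_on ?K. norm (h y) * norm (?g y))"
    by (simp only: integral_restrict_space sets.Int_space_eq2 K)
  also have "\<dots> \<le> (LINT y|lebesgue_on ?K. norm (h y) powr p) powr (1 / p) *
      (LINT y|lebesgue_on ?K. norm (?g y) powr ?q) powr (1 / ?q)"
    using Lp_on_Holder(3)[OF K p hn g] by (simp only: real_norm_def abs_norm_cancel)
  also have "\<dots> \<le> C powr (1 / p) * (LINT y|lebesgue_on ?K. norm (?g y) powr ?q) powr (1 / ?q)"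
    using C Cp p by (intro mult_right_mono powr_mono2) auto
  also have "(LINT y|lebesgue_on ?K. norm (?g y) powr ?q) = (inverse s ^ ?n) powr ?q * (unit_ball_vol ?n * s ^ ?n)"
    using s by (simp add: integral_restrict_space measure_restrict_space content_cball)
  also have "\<dots> powr (1 / ?q) = unit_ball_vol ?n powr (1 - 1 / p) * s powr (- real ?n / p)"
  proof -
    have "((inverse s ^ ?n) powr ?q * (unit_ball_vol ?n * s ^ ?n)) powr (1 / ?q) =
        ((inverse s ^ ?n) powr ?q) powr (1 / ?q) * (unit_ball_vol ?n powr (1 / ?q) * (s ^ ?n) powr (1 / ?q))"
      using s by (simp only: powr_mult)
    also have "\<dots> = s powr (- real ?n) * (unit_ball_vol ?n powr (1 / ?q) * s powr (?n * (1 - 1 / p)))"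
    proof -
      have "((inverse s ^ ?n) powr ?q) powr (1 / ?q) = inverse s ^ ?n"
        using q0 s p by (simp add: powr_powr)
      moreover have "\<dots> = s powr (- real ?n)" using s by (simp add: powr_minus powr_realpow power_inverse)
      moreover have "(s ^ ?n) powr (1 / ?q) = s powr (?n * (1 - 1 / p))"
        unfolding q' using s by (simp add: powr_realpow[symmetric] powr_powr)
      ultimately show ?thesis by (simp only:)
    qed
    also have "\<dots> = unit_ball_vol ?n powr (1 - 1 / p) * s powr (- real ?n + ?n * (1 - 1 / p))"
      unfolding q' powr_add by (simp only: mult_ac)
    also have "- real ?n + ?n * (1 - 1 / p) = - real ?n / p" by (simp add: algebra_simps)
    finally show ?thesis .
  qed
  finally show ?thesis by (simp add: mult_ac)
qed

text \<open>The mollification at x, as a function of the scale s, has a derivative of norm at most B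
  s^(-n/p). Since p > n this has the primitive (B / \<alpha>) s^\<alpha> with \<alpha> > 0, which
  stays bounded down to s = 0, where the mollification becomes \<open>moll_const\<close> times u
  x.\<close>

theorem morrey_estimate:
  fixes x :: "real^'n" and u :: "real^'n \<Rightarrow> 'b::euclidean_space"
  assumes p: "real CARD('n) < p" and \<Omega>: "open \<Omega>" and u: "continuous_on \<Omega> u"
    and wd: "\<And>i. has_weak_pderiv \<Omega> i u (h i)"
    and r: "r > 0" and cube: "cbox (x - r *\<^sub>R One) (x + r *\<^sub>R One) \<subseteq> \<Omega>"
    and h: "\<And>i. Lp_on p (cball x r) (h i)"
    and C: "\<And>i. (LINT y|lebesgue_on (cball x r). norm (h i y) powr p) \<le> C"
  defines "\<alpha> \<equiv> 1 - CARD('n) / p"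
  shows "norm (moll r u x - moll_const TYPE('n) *\<^sub>R u x) \<le>
    (CARD('n) * unit_ball_vol CARD('n) powr (1 - 1 / p) / \<alpha>) * C powr (1 / p) * r powr \<alpha>"
proof -
  let ?n = "CARD('n)" and ?Q = "cbox (x - r *\<^sub>R One) (x + r *\<^sub>R One)"
  have "1 \<le> real ?n" by (simp add: Suc_le_eq)
  then have p1: "1 < p" using p by linarith
  have \<alpha>: "0 < \<alpha>" using p p1 by (simp add: \<alpha>_def)
  define B where "B = ?n * unit_ball_vol ?n powr (1 - 1 / p) * C powr (1 / p)"
  have B0: "B \<ge> 0" by (simp add: B_def)
  have uQ: "continuous_on ?Q u" using u cube continuous_on_subset by blast
  have cb: "cball x s \<subseteq> ?Q" if "s \<le> r" for s using that by (rule cball_subset_cube)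
  \<comment> \<open>The cube contains the supports of the kernels for all s \<le> r, so the domain
    of integration does not depend on the scale.\<close>
  define G where "G s = integral ?Q (\<lambda>y. moll_kernel x s y *\<^sub>R u y)" for s
  have ku: "continuous_on ?Q (\<lambda>y. moll_kernel x s y *\<^sub>R u y)" for s
    using uQ moll_kernel_continuous continuous_on_subset by (intro continuous_intros) blast+
  have G: "G s = moll s u x" if "0 < s" "s \<le> r" for s
  proof -
    have "G s = (LINT y|lebesgue. moll_kernel x s y *\<^sub>R u y)"
      unfolding G_def
    proof (rule integral_cbox_support[OF ku])
      fix y assume "y \<notin> ?Q"
      then have "y \<notin> cball x s" using cb[OF that(2)] by blast
      then show "moll_kernel x s y *\<^sub>R u y = 0" using moll_kernel_eq_0(1)[OF that(1), of y x] by simp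
    qed
    then show ?thesis by (simp add: moll_def moll_kernel_def)
  qed
  have k'u: "continuous_on ({0<..} \<times> ?Q) (\<lambda>(s, y). moll_kernel' x s y *\<^sub>R u y)"
    unfolding split_beta
  proof (intro continuous_on_scaleR)
    show "continuous_on ({0<..} \<times> ?Q) (\<lambda>z. moll_kernel' x (fst z) (snd z))"
      using moll_kernel'_continuous[of x, unfolded split_beta] by (rule continuous_on_subset) auto
    show "continuous_on ({0<..} \<times> ?Q) (\<lambda>z. u (snd z))"
      by (rule continuous_on_compose2[OF uQ]) (auto intro!: continuous_intros)
  qed
  have G': "(G has_vector_derivative integral ?Q (\<lambda>y. moll_kernel' x s y *\<^sub>R u y)) (at s)" if "0 < s" for s
  proof -
    have "(G has_vector_derivative integral ?Q (\<lambda>y. moll_kernel' x s y *\<^sub>R u y)) (at s within {0<..})"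
      unfolding G_def
    proof (rule leibniz_rule_vector_derivative[OF _ _ k'u])
      fix s :: real and y assume "s \<in> {0<..}"
      then have "((\<lambda>s. moll_kernel x s y) has_real_derivative moll_kernel' x s y) (at s within {0<..})"
        using moll_kernel_has_derivative has_field_derivative_at_within by fastforce
      then show "((\<lambda>s. moll_kernel x s y *\<^sub>R u y) has_vector_derivative moll_kernel' x s y *\<^sub>R u y) (at s within {0<..})"
        by (auto intro!: derivative_eq_intros)
    qed (use that ku in \<open>auto intro: integrable_continuous\<close>)
    then show ?thesis using that by (simp add: at_within_open[of s "{0<..}"])
  qed
  have G'_le: "norm (integral ?Q (\<lambda>y. moll_kernel' x s y *\<^sub>R u y)) \<le> B * s powr (\<alpha> - 1)" if s: "0 < s" "s \<le> r" for s
  proof -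
    have sO: "cball x s \<subseteq> \<Omega>" using cb[OF s(2)] cube by blast
    have tf: "test_function \<Omega> (moll_field x s i)" for i using s(1) sO by (rule moll_field_test_function)
    have L: "Lp_loc 1 \<Omega> u" using wd by (auto simp: has_weak_pderiv_iff)
    have "continuous_on ?Q (\<lambda>y. moll_kernel' x s y *\<^sub>R u y)"
      using continuous_on_compose2[OF k'u, of ?Q "\<lambda>y. (s, y)"] s by (auto simp: continuous_on_Pair)
    then have "integral ?Q (\<lambda>y. moll_kernel' x s y *\<^sub>R u y) = (LINT y|lebesgue. moll_kernel' x s y *\<^sub>R u y)"
    proof (rule integral_cbox_support)
      fix y assume "y \<notin> ?Q"
      then have "y \<notin> cball x s" using cb[OF s(2)] by blast
      then show "moll_kernel' x s y *\<^sub>R u y = 0" using moll_kernel_eq_0(2)[OF s(1), of y x] by simp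
    qed
    \<comment> \<open>The scale derivative of the kernel is minus a divergence of test functions, so
      one derivative can be passed on to \<open>u\<close>.\<close>
    also have "\<dots> = (LINT y|lebesgue. - (\<Sum>i\<in>UNIV. frechet_derivative (moll_field x s i) (at y) (axis i 1) *\<^sub>R u y))"
      unfolding scaleR_sum_left[symmetric] moll_field_divergence[OF s(1)] by simp
    also have "\<dots> = - (\<Sum>i\<in>UNIV. LINT y|lebesgue. frechet_derivative (moll_field x s i) (at y) (axis i 1) *\<^sub>R u y)"
      by (subst integral_minus, subst Bochner_Integration.integral_sum)
        (auto intro!: Cc_scaleR_integrable[OF _ L] test_function_imp_Cc test_function_partial tf)
    also have "\<dots> = (\<Sum>i\<in>UNIV. LINT y|lebesgue. moll_field x s i y *\<^sub>R h i y)"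
      using wd tf by (simp add: has_weak_pderiv_iff sum_negf)
    also have "norm \<dots> \<le> (\<Sum>i\<in>(UNIV::'n set). unit_ball_vol ?n powr (1 - 1 / p) * C powr (1 / p) * s powr (- real ?n / p))"
    proof (rule sum_norm_le)
      fix i :: 'n
      have hs: "Lp_on p (cball x s) (h i)" using s by (intro Lp_on_subset[OF h]) auto
      have "(LINT y|lebesgue_on (cball x s). norm (h i y) powr p) \<le> (LINT y|lebesgue_on (cball x r). norm (h i y) powr p)"
      proof -
        have "integrable lebesgue (\<lambda>y. indicator (cball x t) y *\<^sub>R (norm (h i y) powr p))" if "Lp_on p (cball x t) (h i)" for t
          using that by (simp add: Lp_on_iff integrable_restrict_space)
        then show ?thesis
          using hs h[of i] s by (simp add: integral_restrict_space del: real_scaleR_def)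
            (intro integral_mono, auto simp: indicator_def)
      qed
      then have "(LINT y|lebesgue_on (cball x s). norm (h i y) powr p) \<le> C" using C[of i] by linarith
      then show "norm (LINT y|lebesgue. moll_field x s i y *\<^sub>R h i y) \<le>
          unit_ball_vol ?n powr (1 - 1 / p) * C powr (1 / p) * s powr (- real ?n / p)"
        by (rule moll_field_integral_bound[OF p1 s(1) hs])
    qed
    also have "\<dots> = B * s powr (\<alpha> - 1)" by (simp add: B_def \<alpha>_def)
    finally show ?thesis .
  qed
  have dist_G: "norm (G r - G s) \<le> B / \<alpha> * r powr \<alpha>" if s: "0 < s" "s < r" for s
  proof -
    have "norm (G r - G s) \<le> B / \<alpha> * r powr \<alpha> - B / \<alpha> * s powr \<alpha>"
    proof (rule differentiable_bound_general[OF s(2), where \<phi>' = "\<lambda>s. B * s powr (\<alpha> - 1)"])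
      show "continuous_on {s..r} G"
      proof (rule continuous_at_imp_continuous_on, rule ballI)
        fix t assume "t \<in> {s..r}"
        then show "isCont G t" using has_vector_derivative_continuous[OF G'[of t]] s by simp
      qed
      show "continuous_on {s..r} (\<lambda>s. B / \<alpha> * s powr \<alpha>)" using s by (intro continuous_intros) auto
      fix t assume t: "s < t" "t < r"
      show "((\<lambda>s. B / \<alpha> * s powr \<alpha>) has_vector_derivative B * t powr (\<alpha> - 1)) (at t)"
        unfolding has_real_derivative_iff_has_vector_derivative[symmetric]
        using s t \<alpha> by (auto intro!: derivative_eq_intros simp: powr_diff)
      show "(G has_vector_derivative integral ?Q (\<lambda>y. moll_kernel' x t y *\<^sub>R u y)) (at t)"
        using G' s t by simp
      show "norm (integral ?Q (\<lambda>y. moll_kernel' x t y *\<^sub>R u y)) \<le> B * t powr (\<alpha> - 1)"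
        using G'_le s t by simp
    qed
    also have "\<dots> \<le> B / \<alpha> * r powr \<alpha>" using B0 \<alpha> by simp
    finally show ?thesis .
  qed
  have "x \<in> \<Omega>" using cube cb[of 0] r by (auto simp: subset_iff)
  have lim: "((\<lambda>s. norm (moll r u x - moll s u x)) \<longlongrightarrow> norm (moll r u x - moll_const TYPE('n) *\<^sub>R u x)) (at_right 0)"
    using moll_tendsto[OF \<Omega> u \<open>x \<in> \<Omega>\<close>] by (intro tendsto_intros)
  have "norm (moll r u x - moll_const TYPE('n) *\<^sub>R u x) \<le> B / \<alpha> * r powr \<alpha>"
  proof (rule tendsto_upperbound[OF lim])
    show "\<forall>\<^sub>F s in at_right 0. norm (moll r u x - moll s u x) \<le> B / \<alpha> * r powr \<alpha>"
      unfolding eventually_at_right_field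
    proof (intro exI conjI allI impI)
      fix s assume "0 < s" "s < r"
      then show "norm (moll r u x - moll s u x) \<le> B / \<alpha> * r powr \<alpha>"
        using dist_G[of s] G[of r] G[of s] r by simp
    qed (use r in simp)
  qed simp
  then show ?thesis by (simp add: B_def)
qed

text \<open>The kernel depends on y - x only, so uniform continuity on one compact ball is enough.
  The margin 1 in its radius catches pairs of which just one point lies in the support, as their
  distance is below 1.\<close>

lemma bump_uniformly_continuous:
  assumes r: "r > 0" and \<epsilon>: "\<epsilon> > 0"
  obtains \<delta> where "\<delta> > 0" "\<And>x x' y :: real^'n. dist x x' < \<delta> \<Longrightarrow> \<bar>moll_kernel x r y - moll_kernel x' r y\<bar> < \<epsilon>"
proof -
  have c: "continuous_on UNIV (moll_kernel (0::real^'n) r)" by (rule moll_kernel_continuous)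
  have "uniformly_continuous_on (cball 0 (r + 1)) (moll_kernel (0::real^'n) r)"
    using c by (intro compact_uniformly_continuous) (auto intro: continuous_on_subset)
  then obtain d where d: "d > 0" "\<And>z z'. z \<in> cball 0 (r + 1) \<Longrightarrow> z' \<in> cball 0 (r + 1) \<Longrightarrow> dist z' z < d \<Longrightarrow>
      dist (moll_kernel (0::real^'n) r z') (moll_kernel 0 r z) < \<epsilon>"
    using \<epsilon> unfolding uniformly_continuous_on_def by metis
  have tr: "moll_kernel x r y = moll_kernel 0 r (y - x)" for x y :: "real^'n" by (simp add: moll_kernel_def)
  have main: "\<bar>moll_kernel 0 r z - moll_kernel 0 r z'\<bar> < \<epsilon>" if zz: "dist z z' < min d 1" for z z' :: "real^'n"
  proof (cases "z \<in> cball 0 r \<or> z' \<in> cball 0 r")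
    case True
    have "norm z \<le> norm z' + dist z z'" "norm z' \<le> norm z + dist z z'"
      using norm_triangle_sub[of z z'] norm_triangle_sub[of z' z] by (auto simp: dist_norm norm_minus_commute)
    then have "z \<in> cball 0 (r + 1)" "z' \<in> cball 0 (r + 1)" using True zz by auto
    then show ?thesis using d(2)[of z' z] zz by (simp add: dist_real_def)
  next
    case False
    then show ?thesis using moll_kernel_eq_0(1)[OF r, of z 0] moll_kernel_eq_0(1)[OF r, of z' 0] \<epsilon> by simp
  qed
  show ?thesis
  proof (rule that[of "min d 1"])
    fix x x' y :: "real^'n" assume "dist x x' < min d 1"
    then show "\<bar>moll_kernel x r y - moll_kernel x' r y\<bar> < \<epsilon>"
      unfolding tr[of x] tr[of x'] by (intro main) (simp add: dist_norm norm_minus_commute)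
  qed (use d in simp)
qed

lemma moll_eq: "moll s u x = (LINT y|lebesgue. moll_kernel x s y *\<^sub>R u y)"
  by (simp add: moll_def moll_kernel_def)

lemma moll_kernel_scaleR_integrable:
  fixes u :: "real^'n \<Rightarrow> 'b::euclidean_space"
  shows "s > 0 \<Longrightarrow> Lp_on 1 (cball x s) u \<Longrightarrow> integrable lebesgue (\<lambda>y. moll_kernel x s y *\<^sub>R u y)"
  unfolding moll_kernel_def by (rule bump_scaleR_integrable)

lemma moll_dist_le:
  fixes u :: "real^'n \<Rightarrow> 'b::euclidean_space"
  assumes r: "r > 0" and K: "compact K" "cball x r \<subseteq> K" "cball x' r \<subseteq> K" and u: "Lp_on 1 K u"
    and \<epsilon>: "\<And>y. \<bar>moll_kernel x r y - moll_kernel x' r y\<bar> \<le> \<epsilon>"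
  shows "norm (moll r u x - moll r u x') \<le> \<epsilon> * (LINT y|lebesgue_on K. norm (u y))"
proof -
  have Ks: "K \<in> sets lebesgue" using K by simp
  have i: "integrable lebesgue (\<lambda>y. moll_kernel x r y *\<^sub>R u y)" "integrable lebesgue (\<lambda>y. moll_kernel x' r y *\<^sub>R u y)"
    using r K by (auto intro!: moll_kernel_scaleR_integrable Lp_on_subset[OF u])
  have ui: "integrable lebesgue (\<lambda>y. indicator K y *\<^sub>R norm (u y))"
    using u integrable_norm[of "lebesgue_on K" u] K
    by (intro integrable_restrict_space[THEN iffD1]) (auto simp: Lp_on_1_iff[OF Ks] simp del: integrable_norm_iff)
  have "moll r u x - moll r u x' = (LINT y|lebesgue. (moll_kernel x r y - moll_kernel x' r y) *\<^sub>R u y)"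
    unfolding moll_eq scaleR_diff_left using i by simp
  also have "norm \<dots> \<le> (LINT y|lebesgue. \<epsilon> * (indicator K y *\<^sub>R norm (u y)))"
  proof (rule Bochner_Integration.integral_norm_bound_integral)
    show "integrable lebesgue (\<lambda>y. (moll_kernel x r y - moll_kernel x' r y) *\<^sub>R u y)"
      unfolding scaleR_diff_left using i by (rule Bochner_Integration.integrable_diff)
    show "integrable lebesgue (\<lambda>y. \<epsilon> * (indicator K y *\<^sub>R norm (u y)))" using ui by (rule integrable_mult_right)
    fix y
    show "norm ((moll_kernel x r y - moll_kernel x' r y) *\<^sub>R u y) \<le> \<epsilon> * (indicator K y *\<^sub>R norm (u y))"
    proof (cases "y \<in> K")
      case True
      then show ?thesis using \<epsilon>[of y] by (simp add: mult_right_mono)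
    next
      case False
      then have "y \<notin> cball x r" "y \<notin> cball x' r" using K by auto
      then show ?thesis using moll_kernel_eq_0(1)[OF r, of y x] moll_kernel_eq_0(1)[OF r, of y x'] False by simp
    qed
  qed
  also have "\<dots> = \<epsilon> * (LINT y|lebesgue_on K. norm (u y))"
    using K by (simp add: integral_restrict_space)
  finally show ?thesis .
qed

lemma weak_conv_Lp_locD:
  assumes "weak_conv_Lp_loc p \<Omega> f f0" "compact K" "K \<subseteq> \<Omega>" "Lp_on (p / (p - 1)) K \<psi>"
  shows "(\<lambda>j. LINT x:K|lebesgue. f j x \<bullet> \<psi> x) \<longlonglongrightarrow> (LINT x:K|lebesgue. f0 x \<bullet> \<psi> x)"
  using assms by (simp add: weak_conv_Lp_loc_def)

text \<open>For fixed x and r the kernel is continuous, hence an admissible test function in L^q on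
  the ball.\<close>

lemma moll_weak_conv:
  fixes u :: "nat \<Rightarrow> real^'n \<Rightarrow> 'b::euclidean_space"
  assumes p: "1 < p" and wc: "weak_conv_Lp_loc p \<Omega> u u0" and r: "r > 0" and x: "cball x r \<subseteq> \<Omega>"
  shows "(\<lambda>j. moll r (u j) x) \<longlonglongrightarrow> moll r u0 x"
proof -
  let ?K = "cball x r"
  have K: "?K \<in> sets lebesgue" by simp
  have L1: "Lp_on 1 ?K v" if "Lp_loc p \<Omega> v" for v :: "real^'n \<Rightarrow> 'b"
    by (rule Lp_on_exponent_mono[of ?K p]) (use that x p in \<open>auto simp: Lp_loc_def\<close>)
  have eq: "moll r v x \<bullet> b = (LINT y:?K|lebesgue. v y \<bullet> moll_kernel x r y *\<^sub>R b)" if "Lp_loc p \<Omega> v" for v :: "real^'n \<Rightarrow> 'b" and b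
  proof -
    have "moll r v x \<bullet> b = (LINT y|lebesgue. (moll_kernel x r y *\<^sub>R v y) \<bullet> b)"
      unfolding moll_eq by (rule integral_inner_left[symmetric]) (use moll_kernel_scaleR_integrable[OF r L1[OF that]] in auto)
    also have "(\<lambda>y. (moll_kernel x r y *\<^sub>R v y) \<bullet> b) = (\<lambda>y. indicator ?K y *\<^sub>R (v y \<bullet> moll_kernel x r y *\<^sub>R b))"
    proof (rule ext)
      fix y
      show "(moll_kernel x r y *\<^sub>R v y) \<bullet> b = indicator ?K y *\<^sub>R (v y \<bullet> moll_kernel x r y *\<^sub>R b)"
        using moll_kernel_eq_0(1)[OF r, of y x] by (cases "y \<in> ?K") auto
    qed
    finally show ?thesis by (simp add: set_lebesgue_integral_def)
  qed
  have ev: "\<forall>\<^sub>F j in sequentially. Lp_loc p \<Omega> (u j)" and u0: "Lp_loc p \<Omega> u0"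
    using wc by (auto simp: weak_conv_Lp_loc_def)
  show ?thesis
  proof (subst tendsto_componentwise_iff, rule ballI)
    fix b :: 'b assume "b \<in> Basis"
    have "Lp_on (p / (p - 1)) ?K (\<lambda>y. moll_kernel x r y *\<^sub>R b)"
      using p by (intro Lp_on_continuous continuous_intros continuous_on_subset[OF moll_kernel_continuous]) auto
    then have "(\<lambda>j. LINT y:?K|lebesgue. u j y \<bullet> moll_kernel x r y *\<^sub>R b) \<longlonglongrightarrow> (LINT y:?K|lebesgue. u0 y \<bullet> moll_kernel x r y *\<^sub>R b)"
      by (rule weak_conv_Lp_locD[OF wc compact_cball x])
    moreover have "\<forall>\<^sub>F j in sequentially. (LINT y:?K|lebesgue. u j y \<bullet> moll_kernel x r y *\<^sub>R b) = moll r (u j) x \<bullet> b"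
      using ev by eventually_elim (simp only: eq)
    ultimately show "(\<lambda>j. moll r (u j) x \<bullet> b) \<longlonglongrightarrow> moll r u0 x \<bullet> b"
      unfolding eq[OF u0] by (rule Lim_transform_eventually)
  qed
qed

section \<open>First order Sobolev spaces and local uniform convergence\<close>

lemma sobolev_locD:
  assumes "sobolev_loc 1 p \<Omega> u"
  shows "has_weak_pderiv \<Omega> i u (weak_pderiv \<Omega> i u)" "Lp_loc p \<Omega> u" "Lp_loc p \<Omega> (weak_pderiv \<Omega> i u)"
proof -
  have "\<exists>h. has_weak_pderiv \<Omega> i (weak_pderivs \<Omega> [] u) h"
    using assms unfolding sobolev_loc_def by (metis list.size(3) less_one)
  then show "has_weak_pderiv \<Omega> i u (weak_pderiv \<Omega> i u)" using has_weak_pderiv_weak_pderiv by auto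
  have "Lp_loc p \<Omega> (weak_pderivs \<Omega> [] u)" "Lp_loc p \<Omega> (weak_pderivs \<Omega> [i] u)"
    using assms unfolding sobolev_loc_def by (metis list.size(3) zero_le_one, metis length_Cons list.size(3) One_nat_def le_refl)
  then show "Lp_loc p \<Omega> u" "Lp_loc p \<Omega> (weak_pderiv \<Omega> i u)" by auto
qed

lemma sobolev_locI:
  assumes \<Omega>: "open \<Omega>" and u: "Lp_loc p \<Omega> u" and h: "\<And>i. has_weak_pderiv \<Omega> i u (h i)" "\<And>i. Lp_loc p \<Omega> (h i)"
  shows "sobolev_loc 1 p \<Omega> u"
  unfolding sobolev_loc_def
proof (intro conjI allI impI)
  fix "is" :: "'a list" and i assume "length is < 1"
  then show "\<exists>f. has_weak_pderiv \<Omega> i (weak_pderivs \<Omega> is u) f" using h(1) by auto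
next
  fix "is" :: "'a list" assume l: "length is \<le> 1"
  have "Lp_loc p \<Omega> (weak_pderiv \<Omega> i u)" for i
    using h(2)[of i] by (rule Lp_loc_cong_AE) (use weak_pderiv_eq_AE[OF \<Omega> h(1)[of i]] in \<open>auto elim!: eventually_mono\<close>)
  then show "Lp_loc p \<Omega> (weak_pderivs \<Omega> is u)"
    using l u by (cases "is") (auto simp: Suc_le_eq)
qed

lemma weak_conv_sobolev_locD:
  assumes "weak_conv_sobolev_loc 1 p \<Omega> u u0"
  shows "\<forall>\<^sub>F j in sequentially. sobolev_loc 1 p \<Omega> (u j)" "sobolev_loc 1 p \<Omega> u0"
    "weak_conv_Lp_loc p \<Omega> u u0" "weak_conv_Lp_loc p \<Omega> (\<lambda>j. weak_pderiv \<Omega> i (u j)) (weak_pderiv \<Omega> i u0)"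
proof -
  show "\<forall>\<^sub>F j in sequentially. sobolev_loc 1 p \<Omega> (u j)" "sobolev_loc 1 p \<Omega> u0"
    using assms by (auto simp: weak_conv_sobolev_loc_def)
  have *: "weak_conv_Lp_loc p \<Omega> (\<lambda>j. weak_pderivs \<Omega> is (u j)) (weak_pderivs \<Omega> is u0)" if "length is \<le> 1" for "is"
    using assms that by (auto simp: weak_conv_sobolev_loc_def)
  show "weak_conv_Lp_loc p \<Omega> u u0" using *[of "[]"] by simp
  show "weak_conv_Lp_loc p \<Omega> (\<lambda>j. weak_pderiv \<Omega> i (u j)) (weak_pderiv \<Omega> i u0)" using *[of "[i]"] by simp
qed

lemma weak_conv_sobolev_locI:
  assumes \<Omega>: "open \<Omega>" and u: "weak_conv_Lp_loc p \<Omega> u u0"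
    and h: "\<And>i. weak_conv_Lp_loc p \<Omega> (h i) (hl i)"
    and wd: "\<And>i. \<forall>\<^sub>F j in sequentially. has_weak_pderiv \<Omega> i (u j) (h i j)" "\<And>i. has_weak_pderiv \<Omega> i u0 (hl i)"
  shows "weak_conv_sobolev_loc 1 p \<Omega> u u0"
  unfolding weak_conv_sobolev_loc_def
proof (intro conjI allI impI)
  have L: "\<forall>\<^sub>F j in sequentially. Lp_loc p \<Omega> (h i j)" "Lp_loc p \<Omega> (hl i)" for i
    using h[of i] by (auto simp: weak_conv_Lp_loc_def)
  have Lu: "\<forall>\<^sub>F j in sequentially. Lp_loc p \<Omega> (u j)" "Lp_loc p \<Omega> u0"
    using u by (auto simp: weak_conv_Lp_loc_def)
  have "\<forall>\<^sub>F j in sequentially. \<forall>i. has_weak_pderiv \<Omega> i (u j) (h i j) \<and> Lp_loc p \<Omega> (h i j)"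
    using wd(1) L(1) by (intro eventually_all_finite eventually_conj) auto
  then show "\<forall>\<^sub>F j in sequentially. sobolev_loc 1 p \<Omega> (u j)"
    using Lu(1)
  proof eventually_elim
    case (elim j)
    then show ?case by (intro sobolev_locI[OF \<Omega>, where h = "\<lambda>i. h i j"]) auto
  qed
  show "sobolev_loc 1 p \<Omega> u0" using wd(2) L(2) Lu(2) by (intro sobolev_locI[OF \<Omega>, where h = hl]) auto
  fix "is" :: "'a list" assume l: "length is \<le> 1"
  have "weak_conv_Lp_loc p \<Omega> (\<lambda>j. weak_pderiv \<Omega> i (u j)) (weak_pderiv \<Omega> i u0)" for i
  proof (rule weak_conv_Lp_loc_cong_AE[OF h])
    show "\<forall>\<^sub>F j in sequentially. AE x in lebesgue. x \<in> \<Omega> \<longrightarrow> h i j x = weak_pderiv \<Omega> i (u j) x"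
      using wd(1)[of i]
    proof eventually_elim
      case (elim j)
      show ?case using weak_pderiv_eq_AE[OF \<Omega> elim] by (rule eventually_mono) auto
    qed
    show "AE x in lebesgue. x \<in> \<Omega> \<longrightarrow> hl i x = weak_pderiv \<Omega> i u0 x"
      using weak_pderiv_eq_AE[OF \<Omega> wd(2)[of i]] by (rule eventually_mono) auto
  qed
  then show "weak_conv_Lp_loc p \<Omega> (\<lambda>j. weak_pderivs \<Omega> is (u j)) (weak_pderivs \<Omega> is u0)"
    using l u by (cases "is") (auto simp: Suc_le_eq)
qed

text \<open>Proved by a Cauchy argument instead of the extraction of a subsequence. At a fixed small
  radius, \<open>u j\<close> is close to its mollification by Morrey's estimate, uniformly in j. The
  mollifications are equicontinuous because the L^1 norms are bounded, and they converge at every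
  point by weak convergence.\<close>

theorem sobolev_compactness:
  fixes u :: "nat \<Rightarrow> real^'n \<Rightarrow> 'b::euclidean_space"
  assumes p: "real CARD('n) < p" and \<Omega>: "open \<Omega>"
    and c: "\<forall>\<^sub>F j in sequentially. continuous_on \<Omega> (u j)" and wc: "weak_conv_sobolev_loc 1 p \<Omega> u u0"
  defines "U \<equiv> \<lambda>x. lim (\<lambda>j. u j x)"
  shows "\<And>K. compact K \<Longrightarrow> K \<subseteq> \<Omega> \<Longrightarrow> uniform_limit K u U sequentially"
    and "continuous_on \<Omega> U" and "AE x in lebesgue. x \<in> \<Omega> \<longrightarrow> U x = u0 x"
proof -
  let ?n = "CARD('n)" and ?c = "moll_const TYPE('n)"
  have "1 \<le> real ?n" by (simp add: Suc_le_eq)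
  then have p1: "1 < p" using p by linarith
  define \<alpha> where "\<alpha> = 1 - ?n / p"
  have \<alpha>: "0 < \<alpha>" using p p1 by (simp add: \<alpha>_def)
  have c0: "?c > 0" by (rule moll_const_pos)
  note wcD = weak_conv_sobolev_locD[OF wc]
  show lim: "uniform_limit K u U sequentially" if K: "compact K" "K \<subseteq> \<Omega>" for K
  proof -
    obtain e where e: "e > 0" "compact (\<Union>x\<in>K. cball x e)" "(\<Union>x\<in>K. cball x e) \<subseteq> \<Omega>"
      using compact_neighbourhood[OF K(1) \<Omega> K(2)] by blast
    have en: "e / ?n \<le> e"
      using divide_left_mono[of 1 "real ?n" e] e \<open>1 \<le> real ?n\<close> by simp
    define K1 where "K1 = (\<Union>x\<in>K. cball x e)"
    have K1: "compact K1" and K1\<Omega>: "K1 \<subseteq> \<Omega>" using e by (simp_all add: K1_def)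
    have K1s: "K1 \<in> sets lebesgue" using K1 by simp
    have "\<forall>i. \<exists>C. \<forall>\<^sub>F j in sequentially. Lp_on p K1 (weak_pderiv \<Omega> i (u j)) \<and>
        (LINT x|lebesgue_on K1. norm (weak_pderiv \<Omega> i (u j) x) powr p) \<le> C"
      by (intro allI weak_conv_Lp_loc_bounded[OF p1 wcD(4) K1 K1\<Omega>])
    from choice[OF this]
    obtain Ci where Ci: "\<And>i. \<forall>\<^sub>F j in sequentially. Lp_on p K1 (weak_pderiv \<Omega> i (u j)) \<and>
        (LINT x|lebesgue_on K1. norm (weak_pderiv \<Omega> i (u j) x) powr p) \<le> Ci i" by blast
    define C where "C = Max (range Ci)"
    have CiC: "Ci i \<le> C" for i by (simp add: C_def)
    obtain D where D: "\<forall>\<^sub>F j in sequentially. Lp_on p K1 (u j) \<and> (LINT x|lebesgue_on K1. norm (u j x) powr p) \<le> D"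
      using weak_conv_Lp_loc_bounded[OF p1 wcD(3) K1 K1\<Omega>] by blast
    \<comment> \<open>A bound for the L^1 norms, from a \<le> 1 + a^p integrated over
      \<open>K1\<close>. The added 1 makes it positive, since it is divided by below.\<close>
    define D1 where "D1 = measure (lebesgue_on K1) (space (lebesgue_on K1)) + \<bar>D\<bar> + 1"
    have D10: "D1 > 0" unfolding D1_def by (simp add: add_nonneg_pos)
    define M where "M = (?n * unit_ball_vol ?n powr (1 - 1 / p) / \<alpha>) * C powr (1 / p)"
    have M0: "M \<ge> 0" using \<alpha> by (simp add: M_def)
    \<comment> \<open>Regularity and bounds that hold from some index on, gathered so that all later
      estimates are uniform over these indices.\<close>
    define N where "N j \<longleftrightarrow> continuous_on \<Omega> (u j) \<and> sobolev_loc 1 p \<Omega> (u j) \<and>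
        (\<forall>i. Lp_on p K1 (weak_pderiv \<Omega> i (u j)) \<and> (LINT x|lebesgue_on K1. norm (weak_pderiv \<Omega> i (u j) x) powr p) \<le> Ci i) \<and>
        Lp_on p K1 (u j) \<and> (LINT x|lebesgue_on K1. norm (u j x) powr p) \<le> D" for j
    have N: "\<forall>\<^sub>F j in sequentially. N j"
      unfolding N_def by (intro eventually_conj c wcD(1) D eventually_all_finite Ci)
    have L1: "Lp_on 1 K1 (u j)" "(LINT x|lebesgue_on K1. norm (u j x)) \<le> D1" if "N j" for j
    proof -
      interpret finite_measure "lebesgue_on K1" using K1 by (rule finite_measure_lebesgue_on_compact)
      have Lj: "Lp_on p K1 (u j)" and Dj: "(LINT x|lebesgue_on K1. norm (u j x) powr p) \<le> D" using that by (auto simp: N_def)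
      show 1: "Lp_on 1 K1 (u j)" by (rule Lp_on_exponent_mono[OF K1 Lj]) (use p1 in auto)
      have "(LINT x|lebesgue_on K1. norm (u j x)) \<le> (LINT x|lebesgue_on K1. 1 + norm (u j x) powr p)"
      proof (rule integral_mono)
        show "integrable (lebesgue_on K1) (\<lambda>x. norm (u j x))" using 1 by (simp add: Lp_on_1_iff[OF K1s])
        show "integrable (lebesgue_on K1) (\<lambda>x. 1 + norm (u j x) powr p)" using Lj by (simp add: Lp_on_iff[OF K1s])
        show "norm (u j x) \<le> 1 + norm (u j x) powr p" for x
        proof (cases "norm (u j x) \<le> 1")
          case False
          then show ?thesis using powr_mono[of 1 p "norm (u j x)"] p1 by simp
        qed (use powr_ge_zero[of "norm (u j x)" p] in linarith)
      qed
      also have "\<dots> = measure (lebesgue_on K1) (space (lebesgue_on K1)) + (LINT x|lebesgue_on K1. norm (u j x) powr p)"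
        using Lj by (simp add: Lp_on_iff[OF K1s])
      also have "\<dots> \<le> D1" using Dj by (simp add: D1_def)
      finally show "(LINT x|lebesgue_on K1. norm (u j x)) \<le> D1" .
    qed
    have morrey: "norm (moll r (u j) x - ?c *\<^sub>R u j x) \<le> M * r powr \<alpha>"
      if r: "0 < r" "r \<le> e / ?n" and x: "x \<in> K" and j: "N j" for r x j
    proof -
      have "r \<le> e" using r en by linarith
      then have sub: "cball x r \<subseteq> K1" using x by (force simp: K1_def)
      \<comment> \<open>The norm is at most the sum of the n coordinates, so r \<le> e / n keeps the
        cube inside the ball of radius e.\<close>
      have "cbox (x - r *\<^sub>R One) (x + r *\<^sub>R One) \<subseteq> cball x e"
      proof
        fix y assume y: "y \<in> cbox (x - r *\<^sub>R One) (x + r *\<^sub>R One)"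
        have "norm (y - x) \<le> (\<Sum>b\<in>Basis. \<bar>(y - x) \<bullet> b\<bar>)" by (rule norm_le_l1)
        also have "\<dots> \<le> (\<Sum>b\<in>(Basis :: (real^'n) set). r)"
        proof (rule sum_mono)
          fix b :: "real^'n" assume "b \<in> Basis"
          then show "\<bar>(y - x) \<bullet> b\<bar> \<le> r"
            using y by (auto simp: mem_box inner_diff_left inner_add_left abs_le_iff)
        qed
        also have "\<dots> = ?n * r" by simp
        also have "\<dots> \<le> e" using r \<open>1 \<le> real ?n\<close> by (simp add: field_simps)
        finally show "y \<in> cball x e" by (simp add: dist_norm norm_minus_commute)
      qed
      then have cube: "cbox (x - r *\<^sub>R One) (x + r *\<^sub>R One) \<subseteq> \<Omega>" using x K1\<Omega> by (auto simp: K1_def)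
      have LK: "Lp_on p K1 (weak_pderiv \<Omega> i (u j))" for i using j by (simp add: N_def)
      have hp: "Lp_on p (cball x r) (weak_pderiv \<Omega> i (u j))" for i
        using sub K1s by (intro Lp_on_subset[OF LK]) auto
      have Cb: "(LINT y|lebesgue_on (cball x r). norm (weak_pderiv \<Omega> i (u j) y) powr p) \<le> C" for i
      proof -
        have "(LINT y|lebesgue_on (cball x r). norm (weak_pderiv \<Omega> i (u j) y) powr p) \<le>
            (LINT y|lebesgue_on K1. norm (weak_pderiv \<Omega> i (u j) y) powr p)"
        proof -
          have "integrable lebesgue (\<lambda>y. indicator (cball x r) y *\<^sub>R (norm (weak_pderiv \<Omega> i (u j) y) powr p))"
            using hp[of i] by (simp add: Lp_on_iff integrable_restrict_space)
          moreover have "integrable lebesgue (\<lambda>y. indicator K1 y *\<^sub>R (norm (weak_pderiv \<Omega> i (u j) y) powr p))"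
            using LK[of i] K1 by (simp add: Lp_on_iff integrable_restrict_space)
          ultimately have "(LINT y|lebesgue. indicator (cball x r) y *\<^sub>R (norm (weak_pderiv \<Omega> i (u j) y) powr p)) \<le>
              (LINT y|lebesgue. indicator K1 y *\<^sub>R (norm (weak_pderiv \<Omega> i (u j) y) powr p))"
            using sub by (intro integral_mono) (auto simp: indicator_def)
          then show ?thesis using K1 by (simp add: integral_restrict_space)
        qed
        also have "\<dots> \<le> Ci i" using j by (simp add: N_def)
        also have "\<dots> \<le> C" by (rule CiC)
        finally show ?thesis .
      qed
      have "sobolev_loc 1 p \<Omega> (u j)" and cj: "continuous_on \<Omega> (u j)" using j by (auto simp: N_def)
      then show ?thesis
        unfolding M_def \<alpha>_def
        using morrey_estimate[OF p \<Omega> cj sobolev_locD(1) r(1) cube hp Cb] by simp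
    qed
    have "uniformly_Cauchy_on K u"
    proof (rule uniformly_Cauchy_onI)
      fix \<epsilon> :: real assume \<epsilon>: "\<epsilon> > 0"
      \<comment> \<open>Five errors of at most \<epsilon>' each are added below, and their sum
        bounds \<open>moll_const\<close> times the distance that has to be less than
        \<epsilon>.\<close>
      define \<epsilon>' where "\<epsilon>' = ?c * \<epsilon> / 6"
      have \<epsilon>': "\<epsilon>' > 0" using \<epsilon> c0 by (simp add: \<epsilon>'_def)
      have "((\<lambda>r. M * r powr \<alpha>) \<longlongrightarrow> M * 0) (at_right 0)"
        using \<alpha> by (intro tendsto_intros tendsto_zero_powrI[where b = \<alpha>]) (auto simp: eventually_at_right_field intro: exI[of _ 1])
      then have "\<forall>\<^sub>F r in at_right 0. M * r powr \<alpha> < \<epsilon>'" using \<epsilon>' by (intro order_tendstoD(2)) auto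
      then obtain r0 where r0: "r0 > 0" "\<And>r. 0 < r \<Longrightarrow> r < r0 \<Longrightarrow> M * r powr \<alpha> < \<epsilon>'"
        unfolding eventually_at_right_field by blast
      define r where "r = min (r0 / 2) (e / ?n)"
      have r: "0 < r" "r < r0" "r \<le> e / ?n" using r0 e \<open>1 \<le> real ?n\<close> by (auto simp: r_def)
      have "r \<le> e" using r en by linarith
      then have sub: "cball x r \<subseteq> K1" if "x \<in> K" for x using that by (force simp: K1_def)
      obtain \<delta> where \<delta>: "\<delta> > 0" "\<And>x x' y :: real^'n. dist x x' < \<delta> \<Longrightarrow> \<bar>moll_kernel x r y - moll_kernel x' r y\<bar> < \<epsilon>' / D1"
        using bump_uniformly_continuous[OF r(1), of "\<epsilon>' / D1"] \<epsilon>' D10 by (metis divide_pos_pos)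
      have md: "norm (moll r (u j) x - moll r (u j) x') \<le> \<epsilon>'" if "x \<in> K" "x' \<in> K" "dist x x' < \<delta>" "N j" for x x' j
      proof -
        have "norm (moll r (u j) x - moll r (u j) x') \<le> \<epsilon>' / D1 * (LINT y|lebesgue_on K1. norm (u j y))"
          using \<delta>(2)[OF that(3)] by (intro moll_dist_le[OF r(1) K1 sub sub L1(1)] that less_imp_le) auto
        also have "\<dots> \<le> \<epsilon>' / D1 * D1" using L1(2)[OF that(4)] \<epsilon>' D10 by (intro mult_left_mono) auto
        finally show ?thesis using D10 by simp
      qed
      \<comment> \<open>Weak convergence gives convergence of the mollifications one point at a
        time; a finite \<delta>-net together with equicontinuity makes it uniform.\<close>
      have "K \<subseteq> (\<Union>x\<in>K. ball x \<delta>)" using \<delta> by force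
      then obtain X where X: "X \<subseteq> K" "finite X" "K \<subseteq> (\<Union>x\<in>X. ball x \<delta>)"
        using compactE_image[OF K(1), of K "\<lambda>x. ball x \<delta>"] by (metis open_ball)
      have "\<forall>\<^sub>F j in sequentially. \<forall>x\<in>X. dist (moll r (u j) x) (moll r u0 x) < \<epsilon>' / 2"
      proof (rule eventually_ball_finite[OF X(2)], rule ballI)
        fix x assume "x \<in> X"
        then have "cball x r \<subseteq> \<Omega>" using sub X K1\<Omega> by blast
        from moll_weak_conv[OF p1 wcD(3) r(1) this]
        show "\<forall>\<^sub>F j in sequentially. dist (moll r (u j) x) (moll r u0 x) < \<epsilon>' / 2" using \<epsilon>' by (intro tendstoD) auto
      qed
      then have "\<forall>\<^sub>F j in sequentially. N j \<and> (\<forall>x\<in>X. dist (moll r (u j) x) (moll r u0 x) < \<epsilon>' / 2)"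
        using N by eventually_elim auto
      then obtain J where J: "\<And>j. j \<ge> J \<Longrightarrow> N j" "\<And>j x. j \<ge> J \<Longrightarrow> x \<in> X \<Longrightarrow> dist (moll r (u j) x) (moll r u0 x) < \<epsilon>' / 2"
        unfolding eventually_sequentially by blast
      show "\<exists>J. \<forall>x\<in>K. \<forall>m\<ge>J. \<forall>n\<ge>J. dist (u m x) (u n x) < \<epsilon>"
      proof (intro exI ballI allI impI)
        fix x j l assume x: "x \<in> K" and jl: "j \<ge> J" "l \<ge> J"
        obtain z where z: "z \<in> X" "dist x z < \<delta>" using X(3) x by (force simp: dist_commute)
        then have zK: "z \<in> K" using X by blast
        have Mr: "M * r powr \<alpha> < \<epsilon>'" using r0 r by simp
        have 1: "norm (moll r (u j) x - ?c *\<^sub>R u j x) < \<epsilon>'" "norm (moll r (u l) x - ?c *\<^sub>R u l x) < \<epsilon>'"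
          using morrey[OF r(1,3) x J(1)[OF jl(1)]] morrey[OF r(1,3) x J(1)[OF jl(2)]] Mr by linarith+
        have 2: "norm (moll r (u j) x - moll r (u j) z) \<le> \<epsilon>'" "norm (moll r (u l) x - moll r (u l) z) \<le> \<epsilon>'"
          using md[OF x zK z(2)] J(1) jl by auto
        have 3: "dist (moll r (u j) z) (moll r (u l) z) < \<epsilon>'"
          using J(2)[OF jl(1) z(1)] J(2)[OF jl(2) z(1)] dist_triangle_half_l by blast
        have "?c *\<^sub>R u j x - ?c *\<^sub>R u l x = - (moll r (u j) x - ?c *\<^sub>R u j x) + (moll r (u l) x - ?c *\<^sub>R u l x) +
           (moll r (u j) x - moll r (u j) z) - (moll r (u l) x - moll r (u l) z) + (moll r (u j) z - moll r (u l) z)"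
          by simp
        also have "norm \<dots> \<le> norm (moll r (u j) x - ?c *\<^sub>R u j x) + norm (moll r (u l) x - ?c *\<^sub>R u l x) +
           norm (moll r (u j) x - moll r (u j) z) + norm (moll r (u l) x - moll r (u l) z) + norm (moll r (u j) z - moll r (u l) z)"
          by (intro norm_triangle_le norm_triangle_le_diff add_mono order_refl) (auto simp: norm_minus_commute)
        also have "\<dots> < 6 * \<epsilon>'" using 1 2 3 \<epsilon>' by (simp add: dist_norm)
        finally have "?c * norm (u j x - u l x) < ?c * \<epsilon>"
          using c0 by (simp add: \<epsilon>'_def flip: scaleR_diff_right)
        then show "dist (u j x) (u l x) < \<epsilon>" using c0 by (simp add: dist_norm)
      qed
    qed
    then have "uniformly_convergent_on K u" by (rule Cauchy_uniformly_convergent)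
    then show ?thesis by (simp add: uniformly_convergent_uniform_limit_iff U_def)
  qed
  show U: "continuous_on \<Omega> U" by (rule continuous_on_local_uniform_limit[OF \<Omega> c lim])
  show "AE x in lebesgue. x \<in> \<Omega> \<longrightarrow> U x = u0 x"
    by (rule weak_conv_Lp_loc_unique[OF \<Omega> p1 uniform_imp_weak_conv_Lp_loc[OF p1 c U lim] wcD(3)])
qed

subsection \<open>Weakly convergent sequences of continuous Sobolev functions\<close>

text \<open>The class in which the rest of the argument takes place. Continuity of the members and
  of the limit selects the representatives for which pointwise statements make sense, and for p > n
  locally uniform convergence follows.\<close>

definition cw_conv :: "real \<Rightarrow> (real^'n) set \<Rightarrow> (nat \<Rightarrow> real^'n \<Rightarrow> 'b::euclidean_space) \<Rightarrow> (real^'n \<Rightarrow> 'b) \<Rightarrow> bool" where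
  "cw_conv p \<Omega> u u0 \<longleftrightarrow> (\<forall>\<^sub>F j in sequentially. continuous_on \<Omega> (u j)) \<and> continuous_on \<Omega> u0 \<and>
     weak_conv_sobolev_loc 1 p \<Omega> u u0"

lemma continuous_AE_eq_imp_eq:
  fixes f g :: "'a::euclidean_space \<Rightarrow> 'b::real_normed_vector"
  assumes \<Omega>: "open \<Omega>" and f: "continuous_on \<Omega> f" and g: "continuous_on \<Omega> g"
    and eq: "AE x in lebesgue. x \<in> \<Omega> \<longrightarrow> f x = g x" and x: "x \<in> \<Omega>"
  shows "f x = g x"
proof (rule ccontr)
  assume ne: "f x \<noteq> g x"
  have "continuous_on \<Omega> (\<lambda>x. f x - g x)" using f g by (rule continuous_on_diff)
  then have op: "open (\<Omega> \<inter> (\<lambda>x. f x - g x) -` (- {0}))"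
    using \<Omega> by (rule continuous_open_preimage) auto
  have "AE x in lebesgue. x \<notin> \<Omega> \<inter> (\<lambda>x. f x - g x) -` (- {0})"
    using eq by (rule eventually_mono) auto
  then have "\<Omega> \<inter> (\<lambda>x. f x - g x) -` (- {0}) \<in> null_sets lebesgue"
    using op by (subst AE_iff_null_sets) auto
  moreover have "x \<in> \<Omega> \<inter> (\<lambda>x. f x - g x) -` (- {0})" using x ne by simp
  ultimately show False using open_not_negligible[OF op] by (auto simp only: negligible_iff_null_sets)
qed

lemma dim_exponent_gt_1: "real CARD('n::finite) < p \<Longrightarrow> 1 < p"
proof -
  have "1 \<le> real CARD('n)" by (simp add: Suc_le_eq)
  then show "real CARD('n) < p \<Longrightarrow> 1 < p" by linarith
qed

text \<open>The locally uniform limit agrees with \<open>u0\<close> almost everywhere, and both are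
  continuous, so they agree at every point of \<Omega>.\<close>

lemma cw_conv_uniform_limit:
  fixes u :: "nat \<Rightarrow> real^'n \<Rightarrow> 'b::euclidean_space"
  assumes p: "real CARD('n) < p" and \<Omega>: "open \<Omega>" and cw: "cw_conv p \<Omega> u u0"
    and K: "compact K" "K \<subseteq> \<Omega>"
  shows "uniform_limit K u u0 sequentially"
proof -
  have c: "\<forall>\<^sub>F j in sequentially. continuous_on \<Omega> (u j)" and c0: "continuous_on \<Omega> u0"
    and w: "weak_conv_sobolev_loc 1 p \<Omega> u u0" using cw by (auto simp: cw_conv_def)
  note sc = sobolev_compactness[OF p \<Omega> c w]
  have "lim (\<lambda>j. u j x) = u0 x" if "x \<in> \<Omega>" for x
    by (rule continuous_AE_eq_imp_eq[OF \<Omega> sc(2) c0 sc(3) that])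
  then have "uniform_limit K u u0 sequentially \<longleftrightarrow> uniform_limit K u (\<lambda>x. lim (\<lambda>j. u j x)) sequentially"
    using K by (intro uniform_limit_cong') auto
  then show ?thesis using sc(1)[OF K] by simp
qed

lemma cw_conv_weak_conv_pderiv:
  "cw_conv p \<Omega> u u0 \<Longrightarrow> weak_conv_Lp_loc p \<Omega> (\<lambda>j. weak_pderiv \<Omega> i (u j)) (weak_pderiv \<Omega> i u0)"
  by (rule weak_conv_sobolev_locD(4)) (simp add: cw_conv_def)

lemma cw_convD:
  assumes "cw_conv p \<Omega> u u0"
  shows "\<forall>\<^sub>F j in sequentially. continuous_on \<Omega> (u j)" "continuous_on \<Omega> u0"
    "weak_conv_sobolev_loc 1 p \<Omega> u u0" "\<forall>\<^sub>F j in sequentially. sobolev_loc 1 p \<Omega> (u j)"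
    "sobolev_loc 1 p \<Omega> u0" "weak_conv_Lp_loc p \<Omega> u u0"
    "\<forall>\<^sub>F j in sequentially. has_weak_pderiv \<Omega> i (u j) (weak_pderiv \<Omega> i (u j))"
    "has_weak_pderiv \<Omega> i u0 (weak_pderiv \<Omega> i u0)"
proof -
  show *: "\<forall>\<^sub>F j in sequentially. continuous_on \<Omega> (u j)" "continuous_on \<Omega> u0"
    "weak_conv_sobolev_loc 1 p \<Omega> u u0" using assms by (auto simp: cw_conv_def)
  show s: "\<forall>\<^sub>F j in sequentially. sobolev_loc 1 p \<Omega> (u j)" "sobolev_loc 1 p \<Omega> u0" "weak_conv_Lp_loc p \<Omega> u u0"
    using weak_conv_sobolev_locD[OF *(3)] by auto
  show "\<forall>\<^sub>F j in sequentially. has_weak_pderiv \<Omega> i (u j) (weak_pderiv \<Omega> i (u j))"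
    using s(1) by (rule eventually_mono) (rule sobolev_locD(1))
  show "has_weak_pderiv \<Omega> i u0 (weak_pderiv \<Omega> i u0)" using s(2) by (rule sobolev_locD(1))
qed

lemma cw_convI:
  assumes "open \<Omega>" "\<forall>\<^sub>F j in sequentially. continuous_on \<Omega> (u j)" "continuous_on \<Omega> u0"
    and "weak_conv_Lp_loc p \<Omega> u u0" "\<And>i. weak_conv_Lp_loc p \<Omega> (h i) (hl i)"
    and "\<And>i. \<forall>\<^sub>F j in sequentially. has_weak_pderiv \<Omega> i (u j) (h i j)" "\<And>i. has_weak_pderiv \<Omega> i u0 (hl i)"
  shows "cw_conv p \<Omega> u u0"
  unfolding cw_conv_def using assms by (intro conjI weak_conv_sobolev_locI[where h = h and hl = hl]) auto

lemma has_weak_pderiv_const: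
  assumes "open \<Omega>"
  shows "has_weak_pderiv \<Omega> i (\<lambda>x. c) (\<lambda>x. 0)"
proof -
  have "frechet_derivative (\<lambda>x. c) (at x) = (\<lambda>v. 0)" for x
    by (rule frechet_derivative_at[symmetric]) simp
  then show ?thesis using has_weak_pderiv_C1[OF assms, of "\<lambda>x. c" i] by simp
qed

lemma cw_conv_const:
  assumes "1 < p" "open \<Omega>"
  shows "cw_conv p \<Omega> (\<lambda>j x. c) (\<lambda>x. c)"
proof (rule cw_convI[OF assms(2), where h = "\<lambda>i j x. 0" and hl = "\<lambda>i x. 0"])
  show "weak_conv_Lp_loc p \<Omega> (\<lambda>j x. c) (\<lambda>x. c)" "weak_conv_Lp_loc p \<Omega> (\<lambda>j x. 0 :: 'b) (\<lambda>x. 0)"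
    using assms by (auto intro!: weak_conv_Lp_loc_const[OF Lp_loc_continuous[OF continuous_on_const]])
qed (use assms has_weak_pderiv_const in auto)

lemma cw_conv_linear:
  fixes L :: "'b::euclidean_space \<Rightarrow> 'c::euclidean_space"
  assumes p: "1 < p" and \<Omega>: "open \<Omega>" and u: "cw_conv p \<Omega> u u0" and L: "linear L"
  shows "cw_conv p \<Omega> (\<lambda>j x. L (u j x)) (\<lambda>x. L (u0 x))"
proof (rule cw_convI[OF \<Omega>, where h = "\<lambda>i j x. L (weak_pderiv \<Omega> i (u j) x)" and hl = "\<lambda>i x. L (weak_pderiv \<Omega> i u0 x)"])
  note D = cw_convD[OF u]
  have Lc: "continuous_on UNIV L" using L by (simp add: linear_continuous_on linear_linear)
  have comp: "continuous_on \<Omega> (\<lambda>x. L (f x))" if "continuous_on \<Omega> f" for f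
    by (rule continuous_on_compose2[OF Lc that]) simp
  show "\<forall>\<^sub>F j in sequentially. continuous_on \<Omega> (\<lambda>x. L (u j x))"
    using D(1) by (rule eventually_mono) (rule comp)
  show "continuous_on \<Omega> (\<lambda>x. L (u0 x))" using D(2) by (rule comp)
  show "weak_conv_Lp_loc p \<Omega> (\<lambda>j x. L (u j x)) (\<lambda>x. L (u0 x))"
    by (rule weak_conv_Lp_loc_linear[OF p D(6) L])
  show "weak_conv_Lp_loc p \<Omega> (\<lambda>j x. L (weak_pderiv \<Omega> i (u j) x)) (\<lambda>x. L (weak_pderiv \<Omega> i u0 x))" for i
    by (rule weak_conv_Lp_loc_linear[OF p cw_conv_weak_conv_pderiv[OF u] L])
  show "\<forall>\<^sub>F j in sequentially. has_weak_pderiv \<Omega> i (\<lambda>x. L (u j x)) (\<lambda>x. L (weak_pderiv \<Omega> i (u j) x))" for i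
    using D(7) by (rule eventually_mono) (rule has_weak_pderiv_linear[OF _ L])
  show "has_weak_pderiv \<Omega> i (\<lambda>x. L (u0 x)) (\<lambda>x. L (weak_pderiv \<Omega> i u0 x))" for i
    using D(8) by (rule has_weak_pderiv_linear[OF _ L])
qed

lemma cw_conv_add:
  assumes p: "1 < p" and \<Omega>: "open \<Omega>" and u: "cw_conv p \<Omega> u u0" and v: "cw_conv p \<Omega> v v0"
  shows "cw_conv p \<Omega> (\<lambda>j x. u j x + v j x) (\<lambda>x. u0 x + v0 x)"
proof (rule cw_convI[OF \<Omega>, where h = "\<lambda>i j x. weak_pderiv \<Omega> i (u j) x + weak_pderiv \<Omega> i (v j) x"
      and hl = "\<lambda>i x. weak_pderiv \<Omega> i u0 x + weak_pderiv \<Omega> i v0 x"])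
  note D = cw_convD[OF u] and E = cw_convD[OF v]
  show "\<forall>\<^sub>F j in sequentially. continuous_on \<Omega> (\<lambda>x. u j x + v j x)"
    using D(1) E(1) by eventually_elim (rule continuous_on_add)
  show "continuous_on \<Omega> (\<lambda>x. u0 x + v0 x)" using D(2) E(2) by (rule continuous_on_add)
  show "weak_conv_Lp_loc p \<Omega> (\<lambda>j x. u j x + v j x) (\<lambda>x. u0 x + v0 x)"
    by (rule weak_conv_Lp_loc_add[OF p D(6) E(6)])
  fix i
  show "weak_conv_Lp_loc p \<Omega> (\<lambda>j x. weak_pderiv \<Omega> i (u j) x + weak_pderiv \<Omega> i (v j) x)
      (\<lambda>x. weak_pderiv \<Omega> i u0 x + weak_pderiv \<Omega> i v0 x)"
    by (rule weak_conv_Lp_loc_add[OF p cw_conv_weak_conv_pderiv[OF u] cw_conv_weak_conv_pderiv[OF v]])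
  show "\<forall>\<^sub>F j in sequentially. has_weak_pderiv \<Omega> i (\<lambda>x. u j x + v j x)
      (\<lambda>x. weak_pderiv \<Omega> i (u j) x + weak_pderiv \<Omega> i (v j) x)"
    using D(7)[of i] E(7)[of i] by eventually_elim (rule has_weak_pderiv_add)
  show "has_weak_pderiv \<Omega> i (\<lambda>x. u0 x + v0 x) (\<lambda>x. weak_pderiv \<Omega> i u0 x + weak_pderiv \<Omega> i v0 x)"
    using D(8) E(8) by (rule has_weak_pderiv_add)
qed

lemma cw_conv_sum:
  assumes p: "1 < p" and \<Omega>: "open \<Omega>" and I: "finite I" and u: "\<And>i. i \<in> I \<Longrightarrow> cw_conv p \<Omega> (u i) (u0 i)"
  shows "cw_conv p \<Omega> (\<lambda>j x. \<Sum>i\<in>I. u i j x) (\<lambda>x. \<Sum>i\<in>I. u0 i x)"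
  using I u
proof (induction I rule: finite_induct)
  case empty
  then show ?case using cw_conv_const[OF p \<Omega>, of 0] by simp
next
  case (insert i I)
  then show ?case using cw_conv_add[OF p \<Omega>, of "u i" "u0 i"] by simp
qed

text \<open>Every term of the product rule has one locally uniformly convergent factor and one
  weakly convergent derivative. A product of two weakly convergent sequences, which need not
  converge to the product of the limits, never occurs.\<close>

lemma cw_conv_mult:
  fixes u v :: "nat \<Rightarrow> real^'n \<Rightarrow> real"
  assumes p: "real CARD('n) < p" and \<Omega>: "open \<Omega>" and u: "cw_conv p \<Omega> u u0" and v: "cw_conv p \<Omega> v v0"
  shows "cw_conv p \<Omega> (\<lambda>j x. u j x * v j x) (\<lambda>x. u0 x * v0 x)"
proof (rule cw_convI[OF \<Omega>, where h = "\<lambda>i j x. u j x * weak_pderiv \<Omega> i (v j) x + v j x * weak_pderiv \<Omega> i (u j) x"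
      and hl = "\<lambda>i x. u0 x * weak_pderiv \<Omega> i v0 x + v0 x * weak_pderiv \<Omega> i u0 x"])
  note D = cw_convD[OF u] and E = cw_convD[OF v]
  have p1: "1 < p" using p by (rule dim_exponent_gt_1)
  show "\<forall>\<^sub>F j in sequentially. continuous_on \<Omega> (\<lambda>x. u j x * v j x)"
    using D(1) E(1) by eventually_elim (rule continuous_on_mult)
  show "continuous_on \<Omega> (\<lambda>x. u0 x * v0 x)" using D(2) E(2) by (rule continuous_on_mult)
  note Lu = weak_conv_Lp_loc_scaleR_uniform[OF p1 _ D(1,2) cw_conv_uniform_limit[OF p \<Omega> u]]
  note Lv = weak_conv_Lp_loc_scaleR_uniform[OF p1 _ E(1,2) cw_conv_uniform_limit[OF p \<Omega> v]]
  show "weak_conv_Lp_loc p \<Omega> (\<lambda>j x. u j x * v j x) (\<lambda>x. u0 x * v0 x)"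
    using Lv[OF D(6)] by simp
  fix i
  show "weak_conv_Lp_loc p \<Omega> (\<lambda>j x. u j x * weak_pderiv \<Omega> i (v j) x + v j x * weak_pderiv \<Omega> i (u j) x)
      (\<lambda>x. u0 x * weak_pderiv \<Omega> i v0 x + v0 x * weak_pderiv \<Omega> i u0 x)"
    using weak_conv_Lp_loc_add[OF p1 Lu[OF cw_conv_weak_conv_pderiv[OF v]] Lv[OF cw_conv_weak_conv_pderiv[OF u]], of i i]
    by (simp add: mult.commute)
  show "\<forall>\<^sub>F j in sequentially. has_weak_pderiv \<Omega> i (\<lambda>x. u j x * v j x)
      (\<lambda>x. u j x * weak_pderiv \<Omega> i (v j) x + v j x * weak_pderiv \<Omega> i (u j) x)"
    using D(1) E(1) D(7)[of i] E(7)[of i] by eventually_elim (intro has_weak_pderiv_mult \<Omega>)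
  show "has_weak_pderiv \<Omega> i (\<lambda>x. u0 x * v0 x) (\<lambda>x. u0 x * weak_pderiv \<Omega> i v0 x + v0 x * weak_pderiv \<Omega> i u0 x)"
    using D(2,8) E(2,8) by (intro has_weak_pderiv_mult \<Omega>)
qed

lemma cw_conv_prod:
  fixes u :: "'i \<Rightarrow> nat \<Rightarrow> real^'n \<Rightarrow> real"
  assumes p: "real CARD('n) < p" and \<Omega>: "open \<Omega>" and I: "finite I"
    and u: "\<And>i. i \<in> I \<Longrightarrow> cw_conv p \<Omega> (u i) (u0 i)"
  shows "cw_conv p \<Omega> (\<lambda>j x. \<Prod>i\<in>I. u i j x) (\<lambda>x. \<Prod>i\<in>I. u0 i x)"
  using I u
proof (induction I rule: finite_induct)
  case empty
  then show ?case using cw_conv_const[OF dim_exponent_gt_1[OF p] \<Omega>, of 1] by simp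
next
  case (insert i I)
  then show ?case using cw_conv_mult[OF p \<Omega>, of "u i" "u0 i"] by simp
qed

lemma cw_conv_det:
  fixes M :: "nat \<Rightarrow> real^'n \<Rightarrow> real^'d^'d"
  assumes p: "real CARD('n) < p" and \<Omega>: "open \<Omega>"
    and M: "\<And>l m. cw_conv p \<Omega> (\<lambda>j x. M j x $ l $ m) (\<lambda>x. M0 x $ l $ m)"
  shows "cw_conv p \<Omega> (\<lambda>j x. det (M j x)) (\<lambda>x. det (M0 x))"
  unfolding det_def
proof (rule cw_conv_sum[OF dim_exponent_gt_1[OF p] \<Omega>])
  show "finite {\<pi>. \<pi> permutes (UNIV :: 'd set)}" by (rule finite_permutations) simp
  fix \<pi> :: "'d \<Rightarrow> 'd"
  show "cw_conv p \<Omega> (\<lambda>j x. of_int (sign \<pi>) * (\<Prod>l\<in>UNIV. M j x $ l $ \<pi> l)) (\<lambda>x. of_int (sign \<pi>) * (\<Prod>l\<in>UNIV. M0 x $ l $ \<pi> l))"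
    by (intro cw_conv_mult[OF p \<Omega>] cw_conv_const[OF dim_exponent_gt_1[OF p] \<Omega>] cw_conv_prod[OF p \<Omega>] M) auto
qed

lemma cw_conv_vec:
  fixes w :: "'d::finite \<Rightarrow> nat \<Rightarrow> real^'n \<Rightarrow> 'b::euclidean_space"
  assumes p: "1 < p" and \<Omega>: "open \<Omega>" and w: "\<And>l. cw_conv p \<Omega> (w l) (w0 l)"
  shows "cw_conv p \<Omega> (\<lambda>j x. \<chi> l. w l j x) (\<lambda>x. \<chi> l. w0 l x)"
proof -
  have "cw_conv p \<Omega> (\<lambda>j x. \<Sum>l\<in>UNIV. axis l (w l j x)) (\<lambda>x. \<Sum>l\<in>UNIV. axis l (w0 l x))"
  proof (rule cw_conv_sum[OF p \<Omega>])
    fix l :: 'd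
    have "linear (axis l :: 'b \<Rightarrow> 'b^'d)" by (simp add: linear_iff vec_eq_iff axis_def)
    then show "cw_conv p \<Omega> (\<lambda>j x. axis l (w l j x)) (\<lambda>x. axis l (w0 l x))" by (rule cw_conv_linear[OF p \<Omega> w])
  qed simp
  moreover have "(\<Sum>l\<in>UNIV. axis l (v l)) = (\<chi> l. v l)" for v :: "'d \<Rightarrow> 'b"
    by (simp add: vec_eq_iff axis_def)
  ultimately show ?thesis by simp
qed

text \<open>The derivative that \<open>SOME\<close> selects over \<open>V\<close> need not be the
  one selected over \<Omega>; the latter still serves as a witness in
  \<open>cw_convI\<close>.\<close>

lemma cw_conv_subset:
  assumes u: "cw_conv p \<Omega> u u0" and V: "open V" "V \<subseteq> \<Omega>"
  shows "cw_conv p V u u0"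
proof (rule cw_convI[OF V(1), where h = "\<lambda>i j. weak_pderiv \<Omega> i (u j)" and hl = "\<lambda>i. weak_pderiv \<Omega> i u0"])
  note D = cw_convD[OF u]
  show "\<forall>\<^sub>F j in sequentially. continuous_on V (u j)" "continuous_on V u0"
    using D(1,2) V(2) by (auto elim!: eventually_mono intro: continuous_on_subset)
  show "weak_conv_Lp_loc p V u u0" using D(6) V(2) by (rule weak_conv_Lp_loc_subset)
  fix i
  show "weak_conv_Lp_loc p V (\<lambda>j. weak_pderiv \<Omega> i (u j)) (weak_pderiv \<Omega> i u0)"
    using cw_conv_weak_conv_pderiv[OF u] V(2) by (rule weak_conv_Lp_loc_subset)
  show "\<forall>\<^sub>F j in sequentially. has_weak_pderiv V i (u j) (weak_pderiv \<Omega> i (u j))"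
    using D(7) by (rule eventually_mono) (rule has_weak_pderiv_subset[OF _ V(2)])
  show "has_weak_pderiv V i u0 (weak_pderiv \<Omega> i u0)" using D(8) by (rule has_weak_pderiv_subset[OF _ V(2)])
qed

text \<open>Continuity of \<phi> near the compact image of \<open>u0\<close> is enough: from some
  index on, all values lie in a compact neighbourhood of this image, where \<phi> is uniformly
  continuous.\<close>

lemma uniform_limit_compose_continuous:
  fixes u :: "nat \<Rightarrow> 'a::topological_space \<Rightarrow> 'b::euclidean_space" and \<phi> :: "'b \<Rightarrow> 'c::euclidean_space"
  assumes K: "compact K" and u0: "continuous_on K u0" and lim: "uniform_limit K u u0 sequentially"
    and W: "open W" "u0 ` K \<subseteq> W" and \<phi>: "continuous_on W \<phi>"
  shows "uniform_limit K (\<lambda>j x. \<phi> (u j x)) (\<lambda>x. \<phi> (u0 x)) sequentially"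
proof (rule uniform_limitI)
  fix \<epsilon> :: real assume \<epsilon>: "\<epsilon> > 0"
  have cu: "compact (u0 ` K)" using u0 K by (rule compact_continuous_image)
  obtain e where e: "e > 0" "compact (\<Union>y\<in>u0 ` K. cball y e)" "(\<Union>y\<in>u0 ` K. cball y e) \<subseteq> W"
    using compact_neighbourhood[OF cu W] by blast
  define C where "C = (\<Union>y\<in>u0 ` K. cball y e)"
  have C: "compact C" "C \<subseteq> W" using e by (simp_all add: C_def)
  have "uniformly_continuous_on C \<phi>" using C \<phi> by (intro compact_uniformly_continuous) (auto intro: continuous_on_subset)
  then obtain d where d: "d > 0" "\<And>y y'. y \<in> C \<Longrightarrow> y' \<in> C \<Longrightarrow> dist y' y < d \<Longrightarrow> dist (\<phi> y') (\<phi> y) < \<epsilon>"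
    using \<epsilon> unfolding uniformly_continuous_on_def by metis
  have "\<forall>\<^sub>F j in sequentially. \<forall>x\<in>K. dist (u j x) (u0 x) < min d e"
    using lim d e by (intro uniform_limitD) auto
  then show "\<forall>\<^sub>F j in sequentially. \<forall>x\<in>K. dist (\<phi> (u j x)) (\<phi> (u0 x)) < \<epsilon>"
  proof (eventually_elim, intro ballI)
    fix j x assume *: "\<forall>x\<in>K. dist (u j x) (u0 x) < min d e" and x: "x \<in> K"
    have 1: "u0 x \<in> C" using x e(1) by (auto simp: C_def intro!: bexI[of _ x])
    have 2: "u j x \<in> C" using x * by (force simp: C_def dist_commute)
    show "dist (\<phi> (u j x)) (\<phi> (u0 x)) < \<epsilon>" using d(2)[OF 1 2] * x by auto
  qed
qed

section \<open>Inverse matrices as locally uniformly convergent factors\<close>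

lemma matrix_inv_inverse:
  assumes "invertible A"
  shows "A ** matrix_inv A = mat 1" "matrix_inv A ** A = mat 1"
  using someI_ex[OF assms[unfolded invertible_def]] by (auto simp: matrix_inv_def)

text \<open>Cramer's rule for the l-th column of the inverse. It shows the entries as quotients of
  polynomials, hence continuous where the determinant is nonzero, and it is the source of the
  adjugate rows used for normal frames.\<close>

lemma matrix_inv_entry:
  fixes A :: "real^'d^'d"
  assumes "det A \<noteq> 0"
  shows "matrix_inv A $ k $ l = det (\<chi> i j. if j = k then axis l 1 $ i else A $ i $ j) / det A"
proof -
  have inv: "invertible A" using assms by (simp add: invertible_det_nz)
  have "A *v (matrix_inv A *v axis l 1) = axis l 1"
    using matrix_inv_inverse(1)[OF inv] by (simp add: matrix_vector_mul_assoc)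
  then have "matrix_inv A *v axis l 1 = (\<chi> k. det (\<chi> i j. if j = k then axis l 1 $ i else A $ i $ j) / det A)"
    using cramer[OF assms] by blast
  then have "(matrix_inv A *v axis l 1) $ k = det (\<chi> i j. if j = k then axis l 1 $ i else A $ i $ j) / det A"
    by simp
  moreover have "(matrix_inv A *v axis l 1) $ k = matrix_inv A $ k $ l"
    by (simp add: matrix_vector_mult_basis column_def)
  ultimately show ?thesis by simp
qed

lemma continuous_on_det:
  fixes M :: "'a::topological_space \<Rightarrow> real^'d^'d"
  assumes "\<And>l m. continuous_on S (\<lambda>x. M x $ l $ m)"
  shows "continuous_on S (\<lambda>x. det (M x))"
  unfolding det_def by (intro continuous_intros assms)

lemma continuous_on_matrix_inv: "continuous_on {A :: real^'d^'d. det A \<noteq> 0} (\<lambda>A. matrix_inv A $ k $ l)"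
proof -
  have ent: "continuous_on UNIV (\<lambda>A :: real^'d^'d. A $ i $ j)" for i j
    by (intro continuous_intros)
  have "continuous_on {A :: real^'d^'d. det A \<noteq> 0}
      (\<lambda>A. det (\<chi> i j. if j = k then axis l 1 $ i else A $ i $ j) / det A)"
  proof (intro continuous_on_divide continuous_on_det)
    show "continuous_on {A :: real^'d^'d. det A \<noteq> 0} (\<lambda>A. (\<chi> i j. if j = k then axis l 1 $ i else A $ i $ j) $ i $ j)" for i j
      using continuous_on_subset[OF ent[of i j]] by (cases "j = k") auto
    show "continuous_on {A :: real^'d^'d. det A \<noteq> 0} (\<lambda>A. A $ i $ j)" for i j
      using continuous_on_subset[OF ent[of i j]] by auto
  qed auto
  then show ?thesis
    by (rule continuous_on_cong[THEN iffD1, rotated 2]) (auto simp: matrix_inv_entry)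
qed

lemma open_det_nz: "open {A :: real^'d^'d. det A \<noteq> 0}"
proof -
  have "continuous_on UNIV (\<lambda>A :: real^'d^'d. det A)" by (intro continuous_on_det continuous_intros)
  then have "open ((\<lambda>A :: real^'d^'d. det A) -` (- {0}))" by (intro open_vimage) auto
  then show ?thesis by (simp add: vimage_def)
qed

text \<open>Composition with the continuous inverse turns locally uniform convergence of the
  matrices into that of the inverse entries, so no weak derivative of an inverse has to be
  computed.\<close>

lemma weak_conv_Lp_loc_matrix_inv_mult:
  fixes M :: "nat \<Rightarrow> real^'n \<Rightarrow> real^'d^'d" and h :: "nat \<Rightarrow> real^'n \<Rightarrow> real"
  assumes p: "real CARD('n) < p" and \<Omega>: "open \<Omega>" and M: "cw_conv p \<Omega> M M0"
    and nz: "\<forall>\<^sub>F j in sequentially. \<forall>x\<in>\<Omega>. det (M j x) \<noteq> 0" and nz0: "\<And>x. x \<in> \<Omega> \<Longrightarrow> det (M0 x) \<noteq> 0"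
    and h: "weak_conv_Lp_loc p \<Omega> h h0"
  shows "weak_conv_Lp_loc p \<Omega> (\<lambda>j x. matrix_inv (M j x) $ k $ l * h j x) (\<lambda>x. matrix_inv (M0 x) $ k $ l * h0 x)"
proof -
  note D = cw_convD[OF M]
  have c: "continuous_on \<Omega> (\<lambda>x. matrix_inv (f x) $ k $ l)" if "continuous_on \<Omega> f" "\<forall>x\<in>\<Omega>. det (f x) \<noteq> 0" for f :: "real^'n \<Rightarrow> real^'d^'d"
    by (rule continuous_on_compose2[OF continuous_on_matrix_inv[of k l] that(1)]) (use that(2) in auto)
  have "weak_conv_Lp_loc p \<Omega> (\<lambda>j x. h j x *\<^sub>R (matrix_inv (M j x) $ k $ l)) (\<lambda>x. h0 x *\<^sub>R (matrix_inv (M0 x) $ k $ l))"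
  proof (rule weak_conv_Lp_loc_scaleR_uniform[OF dim_exponent_gt_1[OF p] h])
    show "\<forall>\<^sub>F j in sequentially. continuous_on \<Omega> (\<lambda>x. matrix_inv (M j x) $ k $ l)"
      using D(1) nz by eventually_elim (rule c)
    show "continuous_on \<Omega> (\<lambda>x. matrix_inv (M0 x) $ k $ l)" using D(2) nz0 by (intro c) auto
    fix K assume K: "compact K" "K \<subseteq> \<Omega>"
    show "uniform_limit K (\<lambda>j x. matrix_inv (M j x) $ k $ l) (\<lambda>x. matrix_inv (M0 x) $ k $ l) sequentially"
      by (rule uniform_limit_compose_continuous[OF K(1) continuous_on_subset[OF D(2) K(2)]
            cw_conv_uniform_limit[OF p \<Omega> M K] open_det_nz _ continuous_on_matrix_inv]) (use nz0 K in auto)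
  qed
  then show ?thesis by (simp add: mult.commute)
qed

subsection \<open>Linear algebra of normal frames\<close>

lemma normal_component_unique:
  fixes T :: "real^'n \<Rightarrow> real^'d"
  assumes T: "linear T" and w: "w \<in> orthogonal_comp (range T)" "v - w \<in> range T"
    and w': "w' \<in> orthogonal_comp (range T)" "v - w' \<in> range T"
  shows "w = w'"
proof -
  have sub: "subspace (range T)" "subspace (orthogonal_comp (range T))"
    using T by (auto intro: linear_subspace_image subspace_orthogonal_comp)
  have "w - w' \<in> orthogonal_comp (range T)" by (rule subspace_diff[OF sub(2) w(1) w'(1)])
  then have orth: "y \<bullet> (w - w') = 0" if "y \<in> range T" for y
    using that by (auto simp: orthogonal_comp_def orthogonal_def)
  have "(v - w') - (v - w) \<in> range T" by (rule subspace_diff[OF sub(1) w'(2) w(2)])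
  then have "w - w' \<in> range T" by simp
  then have "(w - w') \<bullet> (w - w') = 0" by (rule orth)
  then show ?thesis by simp
qed

lemma normal_component_eq:
  assumes "linear (differential F x)" "w \<in> normal_space F x" "v - w \<in> range (differential F x)"
  shows "normal_component F x v = w"
  unfolding normal_component_def
proof (rule the_equality)
  show "w \<in> normal_space F x \<and> v - w \<in> range (differential F x)" using assms by simp
  fix w' assume "w' \<in> normal_space F x \<and> v - w' \<in> range (differential F x)"
  then show "w' = w"
    using assms normal_component_unique[OF assms(1), of w' v w] by (simp add: normal_space_def)
qed

lemma linear_eq_sum_axis:
  fixes T :: "real^'n \<Rightarrow> 'b::real_vector"
  assumes "linear T"
  shows "T v = (\<Sum>a\<in>UNIV. v $ a *\<^sub>R T (axis a 1))"
proof -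
  have "T v = T (\<Sum>a\<in>UNIV. v $ a *\<^sub>R axis a 1)"
    using basis_expansion[of v] by (simp add: scalar_mult_eq_scaleR)
  also have "\<dots> = (\<Sum>a\<in>UNIV. v $ a *\<^sub>R T (axis a 1))"
    using assms by (simp add: linear_sum linear_scale)
  finally show ?thesis .
qed

text \<open>The numbering \<open>\<sigma>\<close> is needed because a square matrix has rows and columns of the same index type,
  whereas tangent and normal vectors are indexed by \<open>'n\<close> and by natural numbers below the codimension.\<close>

definition frame_matrix :: "('d \<Rightarrow> 'n + nat) \<Rightarrow> ('n \<Rightarrow> real^'d) \<Rightarrow> (nat \<Rightarrow> real^'d) \<Rightarrow> real^'d^'d" where
  "frame_matrix \<sigma> D N = (\<chi> l m. (case \<sigma> m of Inl a \<Rightarrow> D a | Inr \<alpha> \<Rightarrow> N \<alpha>) $ l)"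

abbreviation frame_indices :: "nat \<Rightarrow> ('n + nat) set" where
  "frame_indices k \<equiv> range Inl \<union> Inr ` {..<k}"

lemma frame_indices_bij:
  assumes "CARD('d::finite) = CARD('n::finite) + k"
  obtains \<sigma> :: "'d::finite \<Rightarrow> 'n::finite + nat" where "bij_betw \<sigma> UNIV (frame_indices k)"
proof -
  have "card (frame_indices k :: ('n + nat) set) = CARD('n) + k"
    by (subst card_Un_disjoint) (auto simp: card_image)
  then show ?thesis
    using assms that finite_same_card_bij[of "UNIV :: 'd set" "frame_indices k :: ('n + nat) set"] by auto
qed

lemma sum_frame_indices:
  fixes \<sigma> :: "'d::finite \<Rightarrow> 'n::finite + nat" and f :: "'n + nat \<Rightarrow> 'b::comm_monoid_add"
  assumes \<sigma>: "bij_betw \<sigma> UNIV (frame_indices k)"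
  shows "(\<Sum>m\<in>UNIV. f (\<sigma> m)) = (\<Sum>a\<in>UNIV. f (Inl a)) + (\<Sum>\<alpha><k. f (Inr \<alpha>))"
proof -
  have "(\<Sum>m\<in>UNIV. f (\<sigma> m)) = sum f (frame_indices k)" by (rule sum.reindex_bij_betw[OF \<sigma>])
  also have "\<dots> = sum f (range Inl) + sum f (Inr ` {..<k})" by (rule sum.union_disjoint) auto
  finally show ?thesis by (simp add: sum.reindex)
qed

lemma frame_matrix_mult:
  fixes \<sigma> :: "'d::finite \<Rightarrow> 'n::finite + nat"
  assumes \<sigma>: "bij_betw \<sigma> UNIV (frame_indices k)"
  shows "frame_matrix \<sigma> D N *v c = (\<Sum>a\<in>UNIV. c $ inv \<sigma> (Inl a) *\<^sub>R D a) + (\<Sum>\<alpha><k. c $ inv \<sigma> (Inr \<alpha>) *\<^sub>R N \<alpha>)"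
proof -
  have inj: "inj \<sigma>" using \<sigma> by (simp add: bij_betw_def)
  have "frame_matrix \<sigma> D N *v c = (\<Sum>m\<in>UNIV. c $ m *\<^sub>R (case \<sigma> m of Inl a \<Rightarrow> D a | Inr \<alpha> \<Rightarrow> N \<alpha>))"
    by (simp add: vec_eq_iff matrix_vector_mult_def frame_matrix_def mult.commute)
  also have "\<dots> = (\<Sum>m\<in>UNIV. c $ inv \<sigma> (\<sigma> m) *\<^sub>R (case \<sigma> m of Inl a \<Rightarrow> D a | Inr \<alpha> \<Rightarrow> N \<alpha>))"
    using inj by simp
  also have "\<dots> = (\<Sum>a\<in>UNIV. c $ inv \<sigma> (Inl a) *\<^sub>R D a) + (\<Sum>\<alpha><k. c $ inv \<sigma> (Inr \<alpha>) *\<^sub>R N \<alpha>)"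
    by (subst sum_frame_indices[OF \<sigma>, of "\<lambda>z. c $ inv \<sigma> z *\<^sub>R (case z of Inl a \<Rightarrow> D a | Inr \<alpha> \<Rightarrow> N \<alpha>)"]) simp
  finally show ?thesis .
qed

lemma independent_family_coeffs_eq_0:
  fixes N :: "nat \<Rightarrow> 'b::real_vector"
  assumes inj: "inj_on N {..<k}" and ind: "independent (N ` {..<k})" and sum: "(\<Sum>\<alpha><k. c \<alpha> *\<^sub>R N \<alpha>) = 0" and "\<beta> < k"
  shows "c \<beta> = 0"
proof -
  define u where "u b = c (the_inv_into {..<k} N b)" for b
  have u: "u (N \<alpha>) = c \<alpha>" if "\<alpha> < k" for \<alpha> using inj that by (simp add: u_def the_inv_into_f_f)
  have "(\<Sum>b\<in>N ` {..<k}. u b *\<^sub>R b) = (\<Sum>\<alpha><k. c \<alpha> *\<^sub>R N \<alpha>)"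
    using inj u by (subst sum.reindex) (auto intro: sum.cong)
  then have "u (N \<beta>) = 0"
    using ind sum \<open>\<beta> < k\<close> by (intro independentD[of "N ` {..<k}" "N ` {..<k}" u]) auto
  then show ?thesis using u \<open>\<beta> < k\<close> by simp
qed

text \<open>A vector in the kernel gives a tangent and a normal vector with sum 0. By orthogonality
  both vanish, and then so do all coefficients, by injectivity of \<open>T\<close> and by
  independence of the normal vectors.\<close>

lemma frame_matrix_det_nz:
  fixes \<sigma> :: "'d::finite \<Rightarrow> 'n::finite + nat" and T :: "real^'n \<Rightarrow> real^'d"
  assumes \<sigma>: "bij_betw \<sigma> UNIV (frame_indices k)" and T: "linear T" "inj T"
    and N: "inj_on N {..<k}" "independent (N ` {..<k})" "N ` {..<k} \<subseteq> orthogonal_comp (range T)"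
  shows "det (frame_matrix \<sigma> (\<lambda>a. T (axis a 1)) N) \<noteq> 0"
proof -
  let ?M = "frame_matrix \<sigma> (\<lambda>a. T (axis a 1)) N"
  have "c = 0" if c: "?M *v c = 0" for c
  proof -
    define t where "t = (\<chi> a. c $ inv \<sigma> (Inl a))"
    define w where "w = (\<Sum>\<alpha><k. c $ inv \<sigma> (Inr \<alpha>) *\<^sub>R N \<alpha>)"
    have "T t + w = 0"
      using c frame_matrix_mult[OF \<sigma>, of "\<lambda>a. T (axis a 1)" N c] linear_eq_sum_axis[OF T(1), of t]
      by (simp add: t_def w_def)
    moreover have "w \<in> orthogonal_comp (range T)"
      unfolding w_def using N(3) by (intro subspace_sum subspace_orthogonal_comp subspace_scale) auto
    then have "T t \<bullet> w = 0" by (auto simp: orthogonal_comp_def orthogonal_def)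
    ultimately have "w \<bullet> w = 0" by (metis add_eq_0_iff inner_minus_left neg_equal_0_iff_equal minus_equation_iff)
    then have w0: "w = 0" by simp
    then have "T t = T 0" using \<open>T t + w = 0\<close> linear_0[OF T(1)] by simp
    then have t0: "t = 0" using T(2) by (simp add: inj_eq)
    have "c $ m = 0" for m
    proof (cases "\<sigma> m")
      case (Inl a)
      then have "inv \<sigma> (Inl a) = m" using \<sigma> by (metis bij_betw_def inv_f_f)
      then show ?thesis using t0 by (metis t_def vec_lambda_beta zero_index)
    next
      case (Inr \<alpha>)
      then have "inv \<sigma> (Inr \<alpha>) = m" using \<sigma> by (metis bij_betw_def inv_f_f)
      moreover have "\<alpha> < k"
      proof -
        have "\<sigma> m \<in> frame_indices k" using \<sigma> by (auto simp: bij_betw_def)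
        then show ?thesis using Inr by auto
      qed
      ultimately show ?thesis
        using independent_family_coeffs_eq_0[OF N(1,2), of "\<lambda>\<alpha>. c $ inv \<sigma> (Inr \<alpha>)" \<alpha>] w0 by (simp add: w_def)
    qed
    then show ?thesis by (simp add: vec_eq_iff)
  qed
  then have "inj ((*v) ?M)" by (auto simp: linear_injective_0)
  then show ?thesis
    by (simp add: invertible_det_nz[symmetric] invertible_left_inverse matrix_left_invertible_injective)
qed

text \<open>Solving a linear system with the frame matrix splits \<open>v\<close> into its
  tangential and normal parts at once. The coefficient, defined through \<open>THE\<close> and
  \<open>representation\<close>, thereby becomes an entry of an inverse matrix applied to
  \<open>v\<close>, through which limits can pass.\<close>

lemma normal_component_representation:
  fixes \<sigma> :: "'d::finite \<Rightarrow> 'n::finite + nat" and F :: "real^'n \<Rightarrow> real^'d" and N :: "nat \<Rightarrow> real^'d"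
  assumes \<sigma>: "bij_betw \<sigma> UNIV (frame_indices k)"
    and T: "linear (differential F x)" "inj (differential F x)"
    and N: "inj_on N {..<k}" "independent (N ` {..<k})" "span (N ` {..<k}) = normal_space F x"
    and \<beta>: "\<beta> < k"
  shows "representation (N ` {..<k}) (normal_component F x v) (N \<beta>) =
    (matrix_inv (frame_matrix \<sigma> (\<lambda>a. differential F x (axis a 1)) N) *v v) $ inv \<sigma> (Inr \<beta>)"
proof -
  let ?M = "frame_matrix \<sigma> (\<lambda>a. differential F x (axis a 1)) N"
  have "N ` {..<k} \<subseteq> orthogonal_comp (range (differential F x))"
    using N(3) span_superset[of "N ` {..<k}"] by (simp add: normal_space_def)
  then have "det ?M \<noteq> 0" by (rule frame_matrix_det_nz[OF \<sigma> T N(1,2)])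
  then have inv: "invertible ?M" by (simp add: invertible_det_nz)
  define c where "c = matrix_inv ?M *v v"
  define t where "t = (\<chi> a. c $ inv \<sigma> (Inl a))"
  define w where "w = (\<Sum>\<alpha><k. c $ inv \<sigma> (Inr \<alpha>) *\<^sub>R N \<alpha>)"
  have "?M *v c = v" unfolding c_def using matrix_inv_inverse(1)[OF inv] by (simp add: matrix_vector_mul_assoc)
  then have v: "v = differential F x t + w"
    using frame_matrix_mult[OF \<sigma>, of "\<lambda>a. differential F x (axis a 1)" N c] linear_eq_sum_axis[OF T(1), of t]
    by (simp add: t_def w_def)
  have wN: "w \<in> normal_space F x"
    unfolding w_def N(3)[symmetric] by (intro span_sum span_scale span_base) auto
  have nc: "normal_component F x v = w"
    by (rule normal_component_eq[OF T(1) wN]) (simp add: v)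
  \<comment> \<open>\<open>representation\<close> vanishes off the basis, so the coefficients are
    extended by 0 in order to be identified with it.\<close>
  define u where "u b = (if b \<in> N ` {..<k} then c $ inv \<sigma> (Inr (the_inv_into {..<k} N b)) else 0)" for b
  have u: "u (N \<alpha>) = c $ inv \<sigma> (Inr \<alpha>)" if "\<alpha> < k" for \<alpha>
    using N(1) that by (simp add: u_def the_inv_into_f_f)
  have "representation (N ` {..<k}) w = u"
  proof (rule representation_eqI[OF N(2)])
    show "w \<in> span (N ` {..<k})" using wN N(3) by simp
    show fin: "finite {b. u b \<noteq> 0}" by (rule finite_subset[of _ "N ` {..<k}"]) (auto simp: u_def)
    show "b \<in> N ` {..<k}" if "u b \<noteq> 0" for b using that by (auto simp: u_def split: if_splits)
    have "(\<Sum>b | u b \<noteq> 0. u b *\<^sub>R b) = (\<Sum>b\<in>N ` {..<k}. u b *\<^sub>R b)"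
      by (rule sum.mono_neutral_left) (auto simp: u_def)
    also have "\<dots> = w" unfolding w_def using N(1) u by (subst sum.reindex) (auto intro: sum.cong)
    finally show "(\<Sum>b | u b \<noteq> 0. u b *\<^sub>R b) = w" .
  qed
  then show ?thesis unfolding nc using u[OF \<beta>] by (simp add: c_def)
qed

text \<open>Unlike Gram-Schmidt, the adjugate is polynomial in the columns; its rows are, up to the factor \<open>det M\<close>,
  dual to them.\<close>

definition adjugate_row :: "real^'d^'d \<Rightarrow> 'd \<Rightarrow> real^'d" where
  "adjugate_row M r = (\<chi> l. det (\<chi> i m. if m = r then axis l 1 $ i else M $ i $ m))"

lemma adjugate_row_inner_column:
  fixes M :: "real^'d^'d"
  assumes "det M \<noteq> 0"
  shows "adjugate_row M r \<bullet> column m M = (if m = r then det M else 0)"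
proof -
  have inv: "invertible M" using assms by (simp add: invertible_det_nz)
  have "adjugate_row M r $ l = det M * matrix_inv M $ r $ l" for l
    using matrix_inv_entry[OF assms, of r l] assms by (simp add: adjugate_row_def)
  then have "adjugate_row M r \<bullet> column m M = det M * (\<Sum>l\<in>UNIV. matrix_inv M $ r $ l * M $ l $ m)"
    by (simp add: inner_vec_def column_def sum_distrib_left mult.assoc)
  also have "(\<Sum>l\<in>UNIV. matrix_inv M $ r $ l * M $ l $ m) = (matrix_inv M ** M) $ r $ m"
    by (simp add: matrix_matrix_mult_def)
  finally show ?thesis using matrix_inv_inverse(2)[OF inv] by (simp add: mat_def)
qed

lemma dim_normal_space:
  fixes T :: "real^'n \<Rightarrow> real^'d"
  assumes "CARD('d) = CARD('n) + k" "linear T" "inj T"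
  shows "dim (orthogonal_comp (range T)) = k"
proof -
  have "dim (range T) = CARD('n)" using dim_image_eq[OF assms(2), of UNIV] assms(3) by simp
  moreover have "dim {y \<in> UNIV. \<forall>x\<in>range T. orthogonal x y} + dim (range T) = dim (UNIV :: (real^'d) set)"
    using assms(2) by (intro dim_subspace_orthogonal_to_vectors linear_subspace_image) auto
  ultimately show ?thesis using assms(1) by (simp add: orthogonal_comp_def orthogonal_commute)
qed

text \<open>The vectors \<open>b\<close> need not be normal: duality alone makes the rows with
  normal indices orthogonal to all tangent columns. Pairing with \<open>b\<close> gives a nonzero
  multiple of the Kronecker symbol, hence independence, and a dimension count gives the
  span.\<close>

lemma adjugate_rows_normal_frame:
  fixes \<sigma> :: "'d::finite \<Rightarrow> 'n::finite + nat" and T :: "real^'n \<Rightarrow> real^'d"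
  assumes card: "CARD('d) = CARD('n) + k" and \<sigma>: "bij_betw \<sigma> UNIV (frame_indices k)" and T: "linear T" "inj T"
    and nz: "det (frame_matrix \<sigma> (\<lambda>a. T (axis a 1)) b) \<noteq> 0"
  defines "\<nu> \<equiv> \<lambda>\<alpha>. adjugate_row (frame_matrix \<sigma> (\<lambda>a. T (axis a 1)) b) (inv \<sigma> (Inr \<alpha>))"
  shows "inj_on \<nu> {..<k}" "independent (\<nu> ` {..<k})" "span (\<nu> ` {..<k}) = orthogonal_comp (range T)"
proof -
  let ?M = "frame_matrix \<sigma> (\<lambda>a. T (axis a 1)) b"
  have s_inv: "\<sigma> (inv \<sigma> z) = z" if "z \<in> frame_indices k" for z
    using \<sigma> that by (metis bij_betw_def f_inv_into_f)
  have col: "column (inv \<sigma> (Inl a)) ?M = T (axis a 1)" for a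
    using s_inv[of "Inl a"] by (simp add: column_def frame_matrix_def vec_eq_iff)
  have colN: "column (inv \<sigma> (Inr \<alpha>)) ?M = b \<alpha>" if "\<alpha> < k" for \<alpha>
    using s_inv[of "Inr \<alpha>"] that by (simp add: column_def frame_matrix_def vec_eq_iff)
  have ne: "inv \<sigma> z \<noteq> inv \<sigma> z'" if "z \<in> frame_indices k" "z' \<in> frame_indices k" "z \<noteq> z'" for z z'
    using s_inv[OF that(1)] s_inv[OF that(2)] that(3) by metis
  have nT: "\<nu> \<alpha> \<bullet> T (axis a 1) = 0" if "\<alpha> < k" for \<alpha> a
    using adjugate_row_inner_column[OF nz, of "inv \<sigma> (Inr \<alpha>)" "inv \<sigma> (Inl a)"] ne[of "Inl a" "Inr \<alpha>"] that
    by (simp add: \<nu>_def col)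
  have nb: "\<nu> \<alpha> \<bullet> b \<beta> = (if \<alpha> = \<beta> then det ?M else 0)" if "\<alpha> < k" "\<beta> < k" for \<alpha> \<beta>
    using adjugate_row_inner_column[OF nz, of "inv \<sigma> (Inr \<alpha>)" "inv \<sigma> (Inr \<beta>)"] ne[of "Inr \<beta>" "Inr \<alpha>"] that
    by (auto simp: \<nu>_def colN)
  show inj: "inj_on \<nu> {..<k}"
  proof (rule inj_onI, rule ccontr)
    fix \<alpha> \<beta> assume *: "\<alpha> \<in> {..<k}" "\<beta> \<in> {..<k}" "\<nu> \<alpha> = \<nu> \<beta>" "\<alpha> \<noteq> \<beta>"
    then show False using nb[of \<alpha> \<alpha>] nb[of \<beta> \<alpha>] nz by simp
  qed
  show ind: "independent (\<nu> ` {..<k})"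
  proof (rule independent_if_scalars_zero)
    fix f x assume f: "(\<Sum>x\<in>\<nu> ` {..<k}. f x *\<^sub>R x) = 0" and "x \<in> \<nu> ` {..<k}"
    then obtain \<beta> where \<beta>: "\<beta> < k" "x = \<nu> \<beta>" by auto
    have "(\<Sum>\<alpha><k. f (\<nu> \<alpha>) *\<^sub>R \<nu> \<alpha>) = 0" using f inj by (simp add: sum.reindex)
    then have "(\<Sum>\<alpha><k. f (\<nu> \<alpha>) *\<^sub>R \<nu> \<alpha>) \<bullet> b \<beta> = 0" by simp
    moreover have "(\<Sum>\<alpha><k. f (\<nu> \<alpha>) *\<^sub>R \<nu> \<alpha>) \<bullet> b \<beta> = (\<Sum>\<alpha><k. f (\<nu> \<alpha>) * (if \<alpha> = \<beta> then det ?M else 0))"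
      unfolding inner_sum_left by (rule sum.cong) (use nb \<beta> in auto)
    ultimately have "(\<Sum>\<alpha><k. f (\<nu> \<alpha>) * (if \<alpha> = \<beta> then det ?M else 0)) = 0" by simp
    then have "f (\<nu> \<beta>) * det ?M = 0" using \<beta> by (simp add: if_distrib cong: if_cong)
    then show "f x = 0" using nz \<beta> by simp
  qed simp
  have sub: "\<nu> ` {..<k} \<subseteq> orthogonal_comp (range T)"
  proof
    fix y assume "y \<in> \<nu> ` {..<k}"
    then obtain \<alpha> where \<alpha>: "\<alpha> < k" "y = \<nu> \<alpha>" by auto
    have "\<nu> \<alpha> \<bullet> T v = 0" for v
      unfolding linear_eq_sum_axis[OF T(1), of v] inner_sum_right using nT[OF \<alpha>(1)] by simp
    then show "y \<in> orthogonal_comp (range T)"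
      using \<alpha> by (auto simp: orthogonal_comp_def orthogonal_def inner_commute)
  qed
  show "span (\<nu> ` {..<k}) = orthogonal_comp (range T)"
  proof
    show "span (\<nu> ` {..<k}) \<subseteq> orthogonal_comp (range T)"
      using sub by (intro span_minimal subspace_orthogonal_comp)
    show "orthogonal_comp (range T) \<subseteq> span (\<nu> ` {..<k})"
      using sub ind dim_normal_space[OF card T] inj by (intro card_ge_dim_independent) (auto simp: card_image)
  qed
qed

text \<open>A basis of the normal space will do. It is taken at one point, and its vectors are kept
  constant when the point moves.\<close>

lemma complementary_basis_exists:
  fixes \<sigma> :: "'d::finite \<Rightarrow> 'n::finite + nat" and T :: "real^'n \<Rightarrow> real^'d"
  assumes card: "CARD('d) = CARD('n) + k" and \<sigma>: "bij_betw \<sigma> UNIV (frame_indices k)" and T: "linear T" "inj T"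
  obtains b where "det (frame_matrix \<sigma> (\<lambda>a. T (axis a 1)) b) \<noteq> 0"
proof -
  obtain B where B: "B \<subseteq> orthogonal_comp (range T)" "independent B" "card B = k"
    using basis_exists[of "orthogonal_comp (range T)"] dim_normal_space[OF card T] by metis
  have "finite B" using B(2) by (rule independent_imp_finite)
  then obtain b where "bij_betw b {0..<card B} B" using ex_bij_betw_nat_finite by blast
  then have b: "inj_on b {..<k}" "b ` {..<k} = B" using B(3) by (auto simp: bij_betw_def atLeast0LessThan)
  then have "det (frame_matrix \<sigma> (\<lambda>a. T (axis a 1)) b) \<noteq> 0"
    using B by (intro frame_matrix_det_nz[OF \<sigma> T]) auto
  then show ?thesis by (rule that)
qed

subsection \<open>Limits of immersions\<close>

text \<open>The defining recursion peels off the derivative taken last; this peels off the one taken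
  first, so that second order statements about a map become first order statements about its partial
  derivatives.\<close>

lemma weak_pderivs_snoc: "weak_pderivs \<Omega> (is @ [i]) f = weak_pderivs \<Omega> is (weak_pderiv \<Omega> i f)"
  by (induction "is") auto

lemma weak_pderivs_cong_AE:
  assumes "AE x in lebesgue. x \<in> \<Omega> \<longrightarrow> f x = g x"
  shows "AE x in lebesgue. x \<in> \<Omega> \<longrightarrow> weak_pderivs \<Omega> is f x = weak_pderivs \<Omega> is g x"
proof (induction "is")
  case (Cons i "is")
  then show ?case using weak_pderiv_cong_AE[OF Cons.IH, of i] by simp
qed (use assms in simp)

lemma sobolev_loc_cong_AE:
  assumes f: "sobolev_loc k p \<Omega> f" and eq: "AE x in lebesgue. x \<in> \<Omega> \<longrightarrow> f x = g x"
  shows "sobolev_loc k p \<Omega> g"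
  unfolding sobolev_loc_def
proof (intro conjI allI impI)
  fix "is" :: "'a list" and i assume l: "length is < k"
  then obtain h where "has_weak_pderiv \<Omega> i (weak_pderivs \<Omega> is f) h" using f unfolding sobolev_loc_def by blast
  then have "has_weak_pderiv \<Omega> i (weak_pderivs \<Omega> is g) h"
    by (rule has_weak_pderiv_cong_AE[OF _ weak_pderivs_cong_AE[OF eq]]) simp
  then show "\<exists>h. has_weak_pderiv \<Omega> i (weak_pderivs \<Omega> is g) h" by blast
next
  fix "is" :: "'a list" assume "length is \<le> k"
  then have "Lp_loc p \<Omega> (weak_pderivs \<Omega> is f)" using f by (auto simp: sobolev_loc_def)
  then show "Lp_loc p \<Omega> (weak_pderivs \<Omega> is g)" by (rule Lp_loc_cong_AE[OF _ weak_pderivs_cong_AE[OF eq]])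
qed

lemma weak_conv_sobolev_loc_cong_AE:
  assumes wc: "weak_conv_sobolev_loc k p \<Omega> f f0"
    and eq: "\<forall>\<^sub>F j in sequentially. AE x in lebesgue. x \<in> \<Omega> \<longrightarrow> f j x = g j x"
    and eq0: "AE x in lebesgue. x \<in> \<Omega> \<longrightarrow> f0 x = g0 x"
  shows "weak_conv_sobolev_loc k p \<Omega> g g0"
  unfolding weak_conv_sobolev_loc_def
proof (intro conjI allI impI)
  have "\<forall>\<^sub>F j in sequentially. sobolev_loc k p \<Omega> (f j)" using wc by (simp add: weak_conv_sobolev_loc_def)
  then show "\<forall>\<^sub>F j in sequentially. sobolev_loc k p \<Omega> (g j)"
    using eq by eventually_elim (rule sobolev_loc_cong_AE)
  show "sobolev_loc k p \<Omega> g0"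
    by (rule sobolev_loc_cong_AE[OF _ eq0]) (use wc in \<open>simp add: weak_conv_sobolev_loc_def\<close>)
  fix "is" :: "'a list" assume "length is \<le> k"
  then have w: "weak_conv_Lp_loc p \<Omega> (\<lambda>j. weak_pderivs \<Omega> is (f j)) (weak_pderivs \<Omega> is f0)"
    using wc by (simp add: weak_conv_sobolev_loc_def)
  show "weak_conv_Lp_loc p \<Omega> (\<lambda>j. weak_pderivs \<Omega> is (g j)) (weak_pderivs \<Omega> is g0)"
  proof (rule weak_conv_Lp_loc_cong_AE[OF w _ weak_pderivs_cong_AE[OF eq0]])
    show "\<forall>\<^sub>F j in sequentially. AE x in lebesgue. x \<in> \<Omega> \<longrightarrow> weak_pderivs \<Omega> is (f j) x = weak_pderivs \<Omega> is (g j) x"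
      using eq by (rule eventually_mono) (rule weak_pderivs_cong_AE)
  qed
qed

lemma sobolev_loc_weak_pderiv:
  assumes "sobolev_loc (Suc k) p \<Omega> f"
  shows "sobolev_loc k p \<Omega> (weak_pderiv \<Omega> a f)"
  unfolding sobolev_loc_def
proof (intro conjI allI impI)
  fix "is" :: "'a list" and i assume "length is < k"
  then have "length (is @ [a]) < Suc k" by simp
  then have "\<exists>h. has_weak_pderiv \<Omega> i (weak_pderivs \<Omega> (is @ [a]) f) h"
    using assms unfolding sobolev_loc_def by blast
  then show "\<exists>h. has_weak_pderiv \<Omega> i (weak_pderivs \<Omega> is (weak_pderiv \<Omega> a f)) h" by (simp only: weak_pderivs_snoc)
next
  fix "is" :: "'a list" assume "length is \<le> k"
  then have "length (is @ [a]) \<le> Suc k" by simp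
  then have "Lp_loc p \<Omega> (weak_pderivs \<Omega> (is @ [a]) f)" using assms unfolding sobolev_loc_def by blast
  then show "Lp_loc p \<Omega> (weak_pderivs \<Omega> is (weak_pderiv \<Omega> a f))" by (simp only: weak_pderivs_snoc)
qed

lemma weak_conv_sobolev_loc_weak_pderiv:
  assumes wc: "weak_conv_sobolev_loc (Suc k) p \<Omega> f f0"
  shows "weak_conv_sobolev_loc k p \<Omega> (\<lambda>j. weak_pderiv \<Omega> a (f j)) (weak_pderiv \<Omega> a f0)"
  unfolding weak_conv_sobolev_loc_def
proof (intro conjI allI impI)
  show "\<forall>\<^sub>F j in sequentially. sobolev_loc k p \<Omega> (weak_pderiv \<Omega> a (f j))" "sobolev_loc k p \<Omega> (weak_pderiv \<Omega> a f0)"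
    using wc by (auto simp: weak_conv_sobolev_loc_def intro: sobolev_loc_weak_pderiv elim!: eventually_mono)
  fix "is" :: "'a list" assume "length is \<le> k"
  then have "length (is @ [a]) \<le> Suc k" by simp
  then have "weak_conv_Lp_loc p \<Omega> (\<lambda>j. weak_pderivs \<Omega> (is @ [a]) (f j)) (weak_pderivs \<Omega> (is @ [a]) f0)"
    using wc unfolding weak_conv_sobolev_loc_def by blast
  then show "weak_conv_Lp_loc p \<Omega> (\<lambda>j. weak_pderivs \<Omega> is (weak_pderiv \<Omega> a (f j))) (weak_pderivs \<Omega> is (weak_pderiv \<Omega> a f0))"
    by (simp only: weak_pderivs_snoc)
qed

lemma sobolev_loc_mono: "sobolev_loc k p \<Omega> f \<Longrightarrow> l \<le> k \<Longrightarrow> sobolev_loc l p \<Omega> f"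
  by (auto simp: sobolev_loc_def)

lemma weak_conv_sobolev_loc_mono:
  assumes "weak_conv_sobolev_loc k p \<Omega> f f0" "l \<le> k"
  shows "weak_conv_sobolev_loc l p \<Omega> f f0"
  using assms sobolev_loc_mono[OF _ assms(2)]
  by (auto simp: weak_conv_sobolev_loc_def elim!: eventually_mono)

lemma strong_imp_weak_conv_sobolev_loc:
  assumes p: "1 < p" and s: "strong_conv_sobolev_loc k p \<Omega> f f0"
  shows "weak_conv_sobolev_loc k p \<Omega> f f0"
  unfolding weak_conv_sobolev_loc_def
proof (intro conjI allI impI)
  show ev: "\<forall>\<^sub>F j in sequentially. sobolev_loc k p \<Omega> (f j)" and f0: "sobolev_loc k p \<Omega> f0"
    using s by (auto simp: strong_conv_sobolev_loc_def)
  fix "is" :: "'a list" assume l: "length is \<le> k"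
  show "weak_conv_Lp_loc p \<Omega> (\<lambda>j. weak_pderivs \<Omega> is (f j)) (weak_pderivs \<Omega> is f0)"
  proof (rule strong_imp_weak_conv_Lp_loc[OF p])
    show "\<forall>\<^sub>F j in sequentially. Lp_loc p \<Omega> (weak_pderivs \<Omega> is (f j))"
      using ev by (rule eventually_mono) (use l in \<open>simp add: sobolev_loc_def\<close>)
    show "Lp_loc p \<Omega> (weak_pderivs \<Omega> is f0)" using f0 l by (simp add: sobolev_loc_def)
    show "(\<lambda>j. LINT x:K|lebesgue. norm (weak_pderivs \<Omega> is (f j) x - weak_pderivs \<Omega> is f0 x) powr p) \<longlonglongrightarrow> 0"
      if "compact K" "K \<subseteq> \<Omega>" for K
      using s l that by (simp add: strong_conv_sobolev_loc_def)
  qed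
qed

lemma Ck_on_1D:
  assumes "Ck_on 1 \<Omega> F" "x \<in> \<Omega>"
  shows "(F has_derivative differential F x) (at x)" "linear (differential F x)"
    "differential F x v = (\<Sum>a\<in>UNIV. v $ a *\<^sub>R differential F x (axis a 1))"
proof -
  show "(F has_derivative differential F x) (at x)" using assms by (simp flip: frechet_derivative_works)
  then show lin: "linear (differential F x)" by (rule has_derivative_linear)
  show "differential F x v = (\<Sum>a\<in>UNIV. v $ a *\<^sub>R differential F x (axis a 1))"
    by (rule linear_eq_sum_axis[OF lin])
qed

text \<open>The partial derivatives converge locally uniformly, so the theorem on differentiating a
  convergent sequence applies on small balls and identifies their limits with the partial
  derivatives of \<open>F0\<close>.\<close>

theorem immersion_limit:
  fixes F :: "nat \<Rightarrow> real^'n \<Rightarrow> real^'d"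
  assumes p: "real CARD('n) < p" and \<Omega>: "open \<Omega>" and C1: "\<And>j. Ck_on 1 \<Omega> (F j)"
    and wc: "weak_conv_sobolev_loc 2 p \<Omega> F Fw"
  defines "F0 \<equiv> \<lambda>x. lim (\<lambda>j. F j x)"
  shows "weak_conv_sobolev_loc 2 p \<Omega> F F0" and "Ck_on 1 \<Omega> F0"
    and "\<And>a. cw_conv p \<Omega> (\<lambda>j x. differential (F j) x (axis a 1)) (\<lambda>x. differential F0 x (axis a 1))"
proof -
  have p1: "1 < p" using p by (rule dim_exponent_gt_1)
  have "continuous_on \<Omega> (F j)" for j using Ck_on_SucD[of 0 \<Omega> "F j"] C1[of j] by simp
  then have Fc: "\<forall>\<^sub>F j in sequentially. continuous_on \<Omega> (F j)" by simp
  have w1: "weak_conv_sobolev_loc 1 p \<Omega> F Fw" using wc by (rule weak_conv_sobolev_loc_mono) simp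
  note SF = sobolev_compactness[OF p \<Omega> Fc w1, folded F0_def]
  have F0_Fw: "AE x in lebesgue. x \<in> \<Omega> \<longrightarrow> Fw x = F0 x" using SF(3) by (rule eventually_mono) (auto simp: F0_def)
  show "weak_conv_sobolev_loc 2 p \<Omega> F F0"
    by (rule weak_conv_sobolev_loc_cong_AE[OF wc _ F0_Fw]) simp
  define D where "D a j x = differential (F j) x (axis a 1)" for a j x
  define U where "U a x = lim (\<lambda>j. D a j x)" for a x
  \<comment> \<open>The classical partial derivative represents the weak one and, unlike the
    representative chosen by \<open>SOME\<close>, is known to be continuous, as the compactness
    theorem demands.\<close>
  have wD: "weak_conv_sobolev_loc 1 p \<Omega> (D a) (weak_pderiv \<Omega> a Fw)" for a
  proof (rule weak_conv_sobolev_loc_cong_AE)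
    show "weak_conv_sobolev_loc 1 p \<Omega> (\<lambda>j. weak_pderiv \<Omega> a (F j)) (weak_pderiv \<Omega> a Fw)"
      by (rule weak_conv_sobolev_loc_weak_pderiv) (use wc in \<open>simp add: numeral_2_eq_2\<close>)
    show "\<forall>\<^sub>F j in sequentially. AE x in lebesgue. x \<in> \<Omega> \<longrightarrow> weak_pderiv \<Omega> a (F j) x = D a j x"
      using weak_pderiv_eq_AE[OF \<Omega> has_weak_pderiv_C1[OF \<Omega> C1]] by (simp add: D_def)
  qed simp
  have Dc: "\<forall>\<^sub>F j in sequentially. continuous_on \<Omega> (D a j)" for a
    unfolding D_def[abs_def] using C1 by simp
  have SD1: "uniform_limit K (D a) (U a) sequentially" if "compact K" "K \<subseteq> \<Omega>" for K a
    using sobolev_compactness(1)[OF p \<Omega> Dc[of a] wD[of a] that] by (simp add: U_def[abs_def])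
  have SD2: "continuous_on \<Omega> (U a)" for a
    using sobolev_compactness(2)[OF p \<Omega> Dc[of a] wD[of a]] by (simp add: U_def[abs_def])
  have SD3: "AE x in lebesgue. x \<in> \<Omega> \<longrightarrow> U a x = weak_pderiv \<Omega> a Fw x" for a
    using sobolev_compactness(3)[OF p \<Omega> Dc[of a] wD[of a]] by (simp add: U_def)
  define F' where "F' x v = (\<Sum>a\<in>UNIV. v $ a *\<^sub>R U a x)" for x v
  have F0': "(F0 has_derivative F' x) (at x)" if x: "x \<in> \<Omega>" for x
  proof -
    obtain e where e: "e > 0" "cball x e \<subseteq> \<Omega>" using \<Omega> x by (meson open_contains_cball)
    have lim: "(\<lambda>j. F j y) \<longlonglongrightarrow> F0 y" if "y \<in> \<Omega>" for y
      by (rule tendsto_uniform_limitI[OF SF(1)[of "{y}"]]) (use that in auto)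
    have "\<exists>G. \<forall>y\<in>ball x e. (\<lambda>j. F j y) \<longlonglongrightarrow> G y \<and> (G has_derivative F' y) (at y within ball x e)"
    proof (rule has_derivative_sequence)
      show "convex (ball x e)" by simp
      show "x \<in> ball x e" using e by simp
      show "(\<lambda>j. F j x) \<longlonglongrightarrow> F0 x" using x by (rule lim)
      show "(F j has_derivative differential (F j) y) (at y within ball x e)" if "y \<in> ball x e" for j y
        by (rule has_derivative_at_withinI, rule Ck_on_1D(1)[OF C1]) (use that e in auto)
      fix \<epsilon> :: real assume \<epsilon>: "\<epsilon> > 0"
      \<comment> \<open>The differential applied to v is a sum over the n coordinates of v, each
        bounded by the norm of v, so each partial derivative may contribute an n-th part of the
        error.\<close>
      define \<delta> where "\<delta> = \<epsilon> / CARD('n)"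
      have \<delta>: "\<delta> > 0" using \<epsilon> by (simp add: \<delta>_def)
      have "\<forall>\<^sub>F j in sequentially. \<forall>a. \<forall>y\<in>cball x e. dist (D a j y) (U a y) < \<delta>"
        using uniform_limitD[OF SD1[OF compact_cball e(2)] \<delta>] by (intro eventually_all_finite) auto
      then show "\<forall>\<^sub>F j in sequentially. \<forall>y\<in>ball x e. \<forall>v. norm (differential (F j) y v - F' y v) \<le> \<epsilon> * norm v"
      proof (eventually_elim, intro ballI allI)
        fix j y v assume *: "\<forall>a. \<forall>y\<in>cball x e. dist (D a j y) (U a y) < \<delta>" and y: "y \<in> ball x e"
        then have "y \<in> \<Omega>" using e by auto
        then have "differential (F j) y v - F' y v = (\<Sum>a\<in>UNIV. v $ a *\<^sub>R (D a j y - U a y))"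
          using Ck_on_1D(3)[OF C1, of y j v] by (simp add: F'_def D_def scaleR_diff_right sum_subtractf)
        also have "norm \<dots> \<le> (\<Sum>a\<in>(UNIV :: 'n set). norm v * \<delta>)"
        proof (rule sum_norm_le)
          fix a
          have "norm (D a j y - U a y) \<le> \<delta>" using * y by (auto simp: dist_norm less_imp_le)
          then show "norm (v $ a *\<^sub>R (D a j y - U a y)) \<le> norm v * \<delta>"
            unfolding norm_scaleR real_norm_def by (intro mult_mono component_le_norm_cart) auto
        qed
        also have "\<dots> = \<epsilon> * norm v" by (simp add: \<delta>_def)
        finally show "norm (differential (F j) y v - F' y v) \<le> \<epsilon> * norm v" .
      qed
    qed
    then obtain G where G: "\<And>y. y \<in> ball x e \<Longrightarrow> (\<lambda>j. F j y) \<longlonglongrightarrow> G y"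
      "\<And>y. y \<in> ball x e \<Longrightarrow> (G has_derivative F' y) (at y within ball x e)" by blast
    have "G y = F0 y" if "y \<in> ball x e" for y
    proof -
      have "y \<in> \<Omega>" using that e ball_subset_cball by blast
      then show ?thesis using LIMSEQ_unique[OF G(1)[OF that] lim] by simp
    qed
    moreover have "(G has_derivative F' x) (at x)"
      using G(2)[of x] e by (simp add: at_within_open[of x "ball x e"])
    ultimately show ?thesis
      by (intro has_derivative_transform_within_open[of G _ _ _ "ball x e" F0]) (use e in auto)
  qed
  have F0_diff: "differential F0 x = F' x" if "x \<in> \<Omega>" for x
    by (rule frechet_derivative_at[symmetric, OF F0'[OF that]])
  have F0_axis: "differential F0 x (axis a 1) = U a x" if "x \<in> \<Omega>" for x a
  proof -
    have "(\<Sum>b\<in>UNIV. axis a (1::real) $ b *\<^sub>R U b x) = (\<Sum>b\<in>UNIV. if b = a then U b x else 0)"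
      by (intro sum.cong) (auto simp: axis_def)
    then show ?thesis using F0_diff[OF that] by (simp add: F'_def)
  qed
  have F'c: "continuous_on \<Omega> (\<lambda>x. F' x v)" for v
    unfolding F'_def by (intro continuous_intros SD2)
  have "F0 differentiable at x" if "x \<in> \<Omega>" for x using F0'[OF that] differentiable_def by blast
  moreover have "continuous_on \<Omega> (\<lambda>x. differential F0 x v)" for v
    using F'c[of v] by (rule continuous_on_cong[THEN iffD1, rotated 2]) (auto simp: F0_diff)
  ultimately show "Ck_on 1 \<Omega> F0" by simp
  fix a
  show "cw_conv p \<Omega> (\<lambda>j x. differential (F j) x (axis a 1)) (\<lambda>x. differential F0 x (axis a 1))"
    unfolding cw_conv_def
  proof (intro conjI)
    show "\<forall>\<^sub>F j in sequentially. continuous_on \<Omega> (\<lambda>x. differential (F j) x (axis a 1))"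
      using Dc[of a] by (simp add: D_def[abs_def])
    show "continuous_on \<Omega> (\<lambda>x. differential F0 x (axis a 1))"
      using SD2[of a] by (rule continuous_on_cong[THEN iffD1, rotated 2]) (auto simp: F0_axis)
    have "weak_conv_sobolev_loc 1 p \<Omega> (D a) (\<lambda>x. differential F0 x (axis a 1))"
    proof (rule weak_conv_sobolev_loc_cong_AE[OF wD])
      show "AE x in lebesgue. x \<in> \<Omega> \<longrightarrow> weak_pderiv \<Omega> a Fw x = differential F0 x (axis a 1)"
        using SD3[of a] by (rule eventually_mono) (auto simp: F0_axis)
    qed simp
    then show "weak_conv_sobolev_loc 1 p \<Omega> (\<lambda>j x. differential (F j) x (axis a 1)) (\<lambda>x. differential F0 x (axis a 1))"
      by (simp add: D_def[abs_def])
  qed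
qed

subsection \<open>Convergence of the second fundamental forms\<close>

lemma flat_conn_coord_field: "flat_conn \<Omega> (coord_field a) V x = weak_pderiv \<Omega> a V x"
proof -
  have "(\<Sum>i\<in>UNIV. axis a (1::real) $ i *\<^sub>R weak_pderiv \<Omega> i V x) = (\<Sum>i\<in>UNIV. if i = a then weak_pderiv \<Omega> i V x else 0)"
    by (intro sum.cong) (auto simp: axis_def)
  then show ?thesis by (simp add: flat_conn_def)
qed

text \<open>Valid almost everywhere only, since the Levi-Civita derivative contains the weak
  derivative of a constant field, which is some representative of 0. The right side is split into a
  weak second derivative and Christoffel symbols times differentials, the form in which weak limits
  can be taken.\<close>

lemma second_fundamental_form_coord_AE:
  fixes F :: "real^'n \<Rightarrow> real^'d"
  assumes \<Omega>: "open \<Omega>" and F: "Ck_on 1 \<Omega> F"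
  shows "AE x in lebesgue. x \<in> \<Omega> \<longrightarrow> weak_pderiv \<Omega> a (\<lambda>y. differential F y (axis b 1)) x +
      (\<Sum>k\<in>UNIV. christoffel \<Omega> G k a b x *\<^sub>R (- differential F x (axis k 1))) =
    second_fundamental_form \<Omega> G F (coord_field a) (coord_field b) x"
  using weak_pderiv_eq_AE[OF \<Omega> has_weak_pderiv_const[OF \<Omega>, of a "axis b 1 :: real^'n"]]
proof (rule eventually_mono, intro impI)
  fix x assume *: "x \<in> \<Omega> \<longrightarrow> weak_pderiv \<Omega> a (\<lambda>x. axis b 1 :: real^'n) x = 0" and x: "x \<in> \<Omega>"
  have "(\<Sum>i\<in>UNIV. \<Sum>j\<in>UNIV. christoffel \<Omega> G k i j x * axis a 1 $ i * axis b 1 $ j) = christoffel \<Omega> G k a b x" for k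
  proof -
    have "(\<Sum>j\<in>UNIV. christoffel \<Omega> G k i j x * axis a 1 $ i * axis b 1 $ j) = (if i = a then christoffel \<Omega> G k i b x else 0)" for i
    proof -
      have "(\<Sum>j\<in>UNIV. christoffel \<Omega> G k i j x * axis a 1 $ i * axis b 1 $ j) =
          (\<Sum>j\<in>UNIV. if j = b then christoffel \<Omega> G k i j x * axis a 1 $ i else 0)"
        by (intro sum.cong) (auto simp: axis_def)
      then show ?thesis by (simp add: axis_def)
    qed
    then show ?thesis by simp
  qed
  then have "levi_civita \<Omega> G (coord_field a) (coord_field b) x = (\<chi> k. christoffel \<Omega> G k a b x)"
    using * x by (simp add: levi_civita_def flat_conn_coord_field)
  then have "differential F x (levi_civita \<Omega> G (coord_field a) (coord_field b) x) =
      (\<Sum>k\<in>UNIV. christoffel \<Omega> G k a b x *\<^sub>R differential F x (axis k 1))"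
    using Ck_on_1D(3)[OF F x, of "\<chi> k. christoffel \<Omega> G k a b x"] by simp
  then show "weak_pderiv \<Omega> a (\<lambda>y. differential F y (axis b 1)) x +
      (\<Sum>k\<in>UNIV. christoffel \<Omega> G k a b x *\<^sub>R (- differential F x (axis k 1))) =
    second_fundamental_form \<Omega> G F (coord_field a) (coord_field b) x"
    by (simp add: second_fundamental_form_def flat_conn_coord_field sum_negf)
qed

text \<open>The factor 1/2 is distributed over the sum, so that every summand is an inverse entry
  times a linear expression in first derivatives of the metric.\<close>

lemma weak_conv_christoffel:
  fixes G :: "nat \<Rightarrow> real^'n \<Rightarrow> real^'n^'n"
  assumes p: "real CARD('n) < p" and \<Omega>: "open \<Omega>" and G: "cw_conv p \<Omega> G G0"
    and nz: "\<And>j x. x \<in> \<Omega> \<Longrightarrow> det (G j x) \<noteq> 0" "\<And>x. x \<in> \<Omega> \<Longrightarrow> det (G0 x) \<noteq> 0"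
  shows "weak_conv_Lp_loc p \<Omega> (\<lambda>j. christoffel \<Omega> (G j) k a b) (christoffel \<Omega> G0 k a b)"
proof -
  have p1: "1 < p" using p by (rule dim_exponent_gt_1)
  have lin: "linear (\<lambda>A :: real^'n^'n. c * A $ i $ l)" for i l c by (simp add: linear_iff algebra_simps)
  have wG: "weak_conv_Lp_loc p \<Omega> (\<lambda>j x. c * weak_pderiv \<Omega> q (G j) x $ i $ l) (\<lambda>x. c * weak_pderiv \<Omega> q G0 x $ i $ l)" for q i l c
    by (rule weak_conv_Lp_loc_linear[OF p1 cw_conv_weak_conv_pderiv[OF G] lin])
  have "weak_conv_Lp_loc p \<Omega>
      (\<lambda>j x. \<Sum>l\<in>UNIV. matrix_inv (G j x) $ k $ l * (1 / 2 * weak_pderiv \<Omega> a (G j) x $ b $ l +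
         1 / 2 * weak_pderiv \<Omega> b (G j) x $ a $ l + (- (1 / 2)) * weak_pderiv \<Omega> l (G j) x $ a $ b))
      (\<lambda>x. \<Sum>l\<in>UNIV. matrix_inv (G0 x) $ k $ l * (1 / 2 * weak_pderiv \<Omega> a G0 x $ b $ l +
         1 / 2 * weak_pderiv \<Omega> b G0 x $ a $ l + (- (1 / 2)) * weak_pderiv \<Omega> l G0 x $ a $ b))"
    by (intro weak_conv_Lp_loc_sum[OF p1] weak_conv_Lp_loc_matrix_inv_mult[OF p \<Omega> G] weak_conv_Lp_loc_add[OF p1] wG)
      (use nz in auto)
  then show ?thesis
    unfolding christoffel_def[abs_def] by (simp add: sum_distrib_left algebra_simps)
qed

theorem weak_conv_second_fundamental_form:
  fixes F :: "nat \<Rightarrow> real^'n \<Rightarrow> real^'d" and G :: "nat \<Rightarrow> real^'n \<Rightarrow> real^'n^'n"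
  assumes p: "real CARD('n) < p" and \<Omega>: "open \<Omega>" and G: "cw_conv p \<Omega> G G0"
    and nz: "\<And>j x. x \<in> \<Omega> \<Longrightarrow> det (G j x) \<noteq> 0" "\<And>x. x \<in> \<Omega> \<Longrightarrow> det (G0 x) \<noteq> 0"
    and C1: "\<And>j. Ck_on 1 \<Omega> (F j)" "Ck_on 1 \<Omega> F0"
    and D: "\<And>a. cw_conv p \<Omega> (\<lambda>j x. differential (F j) x (axis a 1)) (\<lambda>x. differential F0 x (axis a 1))"
  shows "weak_conv_Lp_loc p \<Omega> (\<lambda>j. second_fundamental_form \<Omega> (G j) (F j) (coord_field a) (coord_field b))
    (second_fundamental_form \<Omega> G0 F0 (coord_field a) (coord_field b))"
proof (rule weak_conv_Lp_loc_cong_AE)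
  have p1: "1 < p" using p by (rule dim_exponent_gt_1)
  have mD: "cw_conv p \<Omega> (\<lambda>j x. - differential (F j) x (axis k 1)) (\<lambda>x. - differential F0 x (axis k 1))" for k
    by (rule cw_conv_linear[OF p1 \<Omega> D]) (simp add: linear_iff)
  show "weak_conv_Lp_loc p \<Omega> (\<lambda>j x. weak_pderiv \<Omega> a (\<lambda>y. differential (F j) y (axis b 1)) x +
      (\<Sum>k\<in>UNIV. christoffel \<Omega> (G j) k a b x *\<^sub>R (- differential (F j) x (axis k 1))))
    (\<lambda>x. weak_pderiv \<Omega> a (\<lambda>y. differential F0 y (axis b 1)) x +
      (\<Sum>k\<in>UNIV. christoffel \<Omega> G0 k a b x *\<^sub>R (- differential F0 x (axis k 1))))"
    by (intro weak_conv_Lp_loc_add[OF p1] weak_conv_Lp_loc_sum[OF p1] cw_conv_weak_conv_pderiv[OF D]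
        weak_conv_Lp_loc_scaleR_uniform[OF p1 weak_conv_christoffel[OF p \<Omega> G nz]]
        cw_convD(1,2)[OF mD] cw_conv_uniform_limit[OF p \<Omega> mD]) auto
qed (intro always_eventually allI second_fundamental_form_coord_AE[OF \<Omega>] C1)+

subsection \<open>Convergence of the normal connections\<close>

lemma cw_conv_frame_matrix:
  fixes \<sigma> :: "'d::finite \<Rightarrow> 'n::finite + nat" and D :: "'n \<Rightarrow> nat \<Rightarrow> real^'n \<Rightarrow> real^'d"
  assumes p: "1 < p" and \<Omega>: "open \<Omega>" and \<sigma>: "bij_betw \<sigma> UNIV (frame_indices k)"
    and D: "\<And>a. cw_conv p \<Omega> (D a) (Dl a)" and N: "\<And>\<alpha>. \<alpha> < k \<Longrightarrow> cw_conv p \<Omega> (N \<alpha>) (Nl \<alpha>)"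
  shows "cw_conv p \<Omega> (\<lambda>j x. frame_matrix \<sigma> (\<lambda>a. D a j x) (\<lambda>\<alpha>. N \<alpha> j x)) (\<lambda>x. frame_matrix \<sigma> (\<lambda>a. Dl a x) (\<lambda>\<alpha>. Nl \<alpha> x))"
  unfolding frame_matrix_def
proof (intro cw_conv_vec[OF p \<Omega>])
  fix l m
  have lin: "linear (\<lambda>v :: real^'d. v $ l)" by (simp add: linear_iff)
  show "cw_conv p \<Omega> (\<lambda>j x. (case \<sigma> m of Inl a \<Rightarrow> D a j x | Inr \<alpha> \<Rightarrow> N \<alpha> j x) $ l) (\<lambda>x. (case \<sigma> m of Inl a \<Rightarrow> Dl a x | Inr \<alpha> \<Rightarrow> Nl \<alpha> x) $ l)"
  proof (cases "\<sigma> m")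
    case (Inl a)
    then show ?thesis using cw_conv_linear[OF p \<Omega> D lin] by simp
  next
    case (Inr \<alpha>)
    moreover have "\<sigma> m \<in> frame_indices k" using \<sigma> by (auto simp: bij_betw_def)
    ultimately have "\<alpha> < k" by auto
    then show ?thesis using Inr cw_conv_linear[OF p \<Omega> N lin] by simp
  qed
qed

lemma cw_conv_adjugate_row:
  fixes M :: "nat \<Rightarrow> real^'n \<Rightarrow> real^'d^'d"
  assumes p: "real CARD('n) < p" and \<Omega>: "open \<Omega>" and M: "cw_conv p \<Omega> M Ml"
  shows "cw_conv p \<Omega> (\<lambda>j x. adjugate_row (M j x) r) (\<lambda>x. adjugate_row (Ml x) r)"
  unfolding adjugate_row_def
proof (rule cw_conv_vec[OF dim_exponent_gt_1[OF p] \<Omega>], rule cw_conv_det[OF p \<Omega>])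
  fix l i m
  have lin: "linear (\<lambda>A :: real^'d^'d. A $ i $ m)" by (simp add: linear_iff)
  show "cw_conv p \<Omega> (\<lambda>j x. (\<chi> i m. if m = r then axis l 1 $ i else M j x $ i $ m) $ i $ m)
      (\<lambda>x. (\<chi> i m. if m = r then axis l 1 $ i else Ml x $ i $ m) $ i $ m)"
    using cw_conv_linear[OF dim_exponent_gt_1[OF p] \<Omega> M lin] cw_conv_const[OF dim_exponent_gt_1[OF p] \<Omega>, of "axis l 1 $ i"]
    by (cases "m = r") auto
qed

lemma cw_conv_det_matrix:
  fixes M :: "nat \<Rightarrow> real^'n \<Rightarrow> real^'d^'d"
  assumes p: "real CARD('n) < p" and \<Omega>: "open \<Omega>" and M: "cw_conv p \<Omega> M Ml"
  shows "cw_conv p \<Omega> (\<lambda>j x. det (M j x)) (\<lambda>x. det (Ml x))"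
proof (rule cw_conv_det[OF p \<Omega>])
  fix l m
  have "linear (\<lambda>A :: real^'d^'d. A $ l $ m)" by (simp add: linear_iff)
  then show "cw_conv p \<Omega> (\<lambda>j x. M j x $ l $ m) (\<lambda>x. Ml x $ l $ m)"
    by (rule cw_conv_linear[OF dim_exponent_gt_1[OF p] \<Omega> M])
qed

text \<open>Constant vectors that complement the tangent space of \<open>Fl\<close> at x still do so
  on a closed ball around x and, by uniform convergence of the determinant, for all late
  \<open>F j\<close> on this same ball. The common neighbourhood is why frames for the sequence are
  asked for only from some index on.\<close>

theorem converging_normal_frames_exist:
  fixes F :: "nat \<Rightarrow> real^'n \<Rightarrow> real^'d"
  assumes card: "CARD('d) = CARD('n) + k" and p: "real CARD('n) < p" and \<Omega>: "open \<Omega>"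
    and C1: "\<And>j. Ck_on 1 \<Omega> (F j)" "Ck_on 1 \<Omega> Fl"
    and inj: "\<And>j x. x \<in> \<Omega> \<Longrightarrow> inj (differential (F j) x)" "\<And>x. x \<in> \<Omega> \<Longrightarrow> inj (differential Fl x)"
    and D: "\<And>a. cw_conv p \<Omega> (\<lambda>j x. differential (F j) x (axis a 1)) (\<lambda>x. differential Fl x (axis a 1))"
    and x: "x \<in> \<Omega>"
  shows "\<exists>V \<nu> \<nu>l. open V \<and> x \<in> V \<and> V \<subseteq> \<Omega> \<and> converging_normal_frames p k V F Fl \<nu> \<nu>l"
proof -
  have p1: "1 < p" using p by (rule dim_exponent_gt_1)
  obtain \<sigma> :: "'d \<Rightarrow> 'n + nat" where \<sigma>: "bij_betw \<sigma> UNIV (frame_indices k)"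
    using frame_indices_bij[OF card] by blast
  obtain b where b: "det (frame_matrix \<sigma> (\<lambda>a. differential Fl x (axis a 1)) b) \<noteq> 0"
    by (rule complementary_basis_exists[OF card \<sigma> Ck_on_1D(2)[OF C1(2) x] inj(2)[OF x]])
  define M where "M H y = frame_matrix \<sigma> (\<lambda>a. differential H y (axis a 1)) b" for H :: "real^'n \<Rightarrow> real^'d" and y
  define \<nu> where "\<nu> H \<alpha> y = adjugate_row (M H y) (inv \<sigma> (Inr \<alpha>))" for H :: "real^'n \<Rightarrow> real^'d" and \<alpha> :: nat and y
  have M: "cw_conv p \<Omega> (\<lambda>j. M (F j)) (M Fl)"
    unfolding M_def by (rule cw_conv_frame_matrix[OF p1 \<Omega> \<sigma> D cw_conv_const[OF p1 \<Omega>]])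
  have detM: "cw_conv p \<Omega> (\<lambda>j y. det (M (F j) y)) (\<lambda>y. det (M Fl y))" by (rule cw_conv_det_matrix[OF p \<Omega> M])
  have "open (\<Omega> \<inter> (\<lambda>y. det (M Fl y)) -` (- {0}))"
    using cw_convD(2)[OF detM] \<Omega> by (rule continuous_open_preimage) auto
  moreover have "x \<in> \<Omega> \<inter> (\<lambda>y. det (M Fl y)) -` (- {0})" using b x by (simp add: M_def)
  ultimately obtain e where e: "e > 0" "cball x e \<subseteq> \<Omega> \<inter> (\<lambda>y. det (M Fl y)) -` (- {0})"
    by (meson open_contains_cball)
  then have sub: "cball x e \<subseteq> \<Omega>" and nz: "\<And>y. y \<in> cball x e \<Longrightarrow> det (M Fl y) \<noteq> 0" by auto
  have "continuous_on (cball x e) (\<lambda>y. \<bar>det (M Fl y)\<bar>)"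
    using cw_convD(2)[OF detM] sub by (intro continuous_on_rabs) (rule continuous_on_subset)
  \<comment> \<open>The least absolute value of the limit determinant on the closed ball is the
    margin that the determinants of the sequence must respect.\<close>
  then obtain z where z: "z \<in> cball x e" "\<And>y. y \<in> cball x e \<Longrightarrow> \<bar>det (M Fl z)\<bar> \<le> \<bar>det (M Fl y)\<bar>"
    using continuous_attains_inf[of "cball x e" "\<lambda>y. \<bar>det (M Fl y)\<bar>"] e(1) by auto
  have "\<forall>\<^sub>F j in sequentially. \<forall>y\<in>cball x e. dist (det (M (F j) y)) (det (M Fl y)) < \<bar>det (M Fl z)\<bar>"
    using nz[OF z(1)] by (intro uniform_limitD[OF cw_conv_uniform_limit[OF p \<Omega> detM compact_cball sub]]) simp
  then have ev_nz: "\<forall>\<^sub>F j in sequentially. \<forall>y\<in>cball x e. det (M (F j) y) \<noteq> 0"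
  proof (rule eventually_mono, intro ballI notI)
    fix j y assume *: "\<forall>y\<in>cball x e. dist (det (M (F j) y)) (det (M Fl y)) < \<bar>det (M Fl z)\<bar>"
      and y: "y \<in> cball x e" and "det (M (F j) y) = 0"
    with bspec[OF * y] have "\<bar>det (M Fl y)\<bar> < \<bar>det (M Fl z)\<bar>" by (simp add: dist_real_def)
    then show False using z(2)[OF y] by simp
  qed
  \<comment> \<open>The closed ball provided compactness; Sobolev functions and frames live on an
    open set.\<close>
  let ?V = "ball x e"
  have V: "open ?V" "?V \<subseteq> \<Omega>" and Vc: "?V \<subseteq> cball x e" using sub by auto
  have \<nu>: "cw_conv p ?V (\<lambda>j. \<nu> (F j) \<alpha>) (\<nu> Fl \<alpha>)" for \<alpha>
    unfolding \<nu>_def by (rule cw_conv_subset[OF cw_conv_adjugate_row[OF p \<Omega> M] V])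
  have frame: "normal_frame p k ?V H (\<nu> H)"
    if "Ck_on 1 \<Omega> H" "\<And>y. y \<in> \<Omega> \<Longrightarrow> inj (differential H y)" "\<And>y. y \<in> cball x e \<Longrightarrow> det (M H y) \<noteq> 0"
      "\<And>\<alpha>. \<alpha> < k \<Longrightarrow> continuous_on ?V (\<nu> H \<alpha>) \<and> sobolev_loc 1 p ?V (\<nu> H \<alpha>)" for H
    unfolding normal_frame_def
  proof (intro conjI allI impI ballI)
    fix y assume "y \<in> ?V"
    then have y: "y \<in> \<Omega>" "y \<in> cball x e" using V Vc by auto
    note fr = adjugate_rows_normal_frame[OF card \<sigma> Ck_on_1D(2)[OF that(1) y(1)] that(2)[OF y(1)] that(3)[OF y(2), unfolded M_def]]
    show "inj_on (\<lambda>\<alpha>. \<nu> H \<alpha> y) {..<k}" "independent ((\<lambda>\<alpha>. \<nu> H \<alpha> y) ` {..<k})"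
      "span ((\<lambda>\<alpha>. \<nu> H \<alpha> y) ` {..<k}) = normal_space H y"
      using fr by (simp_all add: \<nu>_def M_def normal_space_def)
  qed (use that(4) in auto)
  have "\<forall>\<^sub>F j in sequentially. \<forall>\<alpha>\<in>{..<k}. continuous_on ?V (\<nu> (F j) \<alpha>) \<and> sobolev_loc 1 p ?V (\<nu> (F j) \<alpha>)"
    using cw_convD(1,4)[OF \<nu>] by (intro eventually_ball_finite) (auto intro: eventually_conj)
  then have "\<forall>\<^sub>F j in sequentially. normal_frame p k ?V (F j) (\<nu> (F j))"
    using ev_nz by eventually_elim (intro frame C1 inj, auto)
  moreover have "normal_frame p k ?V Fl (\<nu> Fl)"
    using cw_convD(2,5)[OF \<nu>] nz by (intro frame C1 inj) auto
  ultimately have "converging_normal_frames p k ?V F Fl (\<lambda>j. \<nu> (F j)) (\<nu> Fl)"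
    using cw_convD(3)[OF \<nu>] by (simp add: converging_normal_frames_def)
  then show ?thesis using V e(1) by (intro exI[of _ ?V] exI conjI) auto
qed

lemma normal_conn_coeff_eq:
  fixes \<sigma> :: "'d::finite \<Rightarrow> 'n::finite + nat" and F :: "real^'n \<Rightarrow> real^'d"
  assumes \<sigma>: "bij_betw \<sigma> UNIV (frame_indices k)" and F: "linear (differential F x)" "inj (differential F x)"
    and \<nu>: "normal_frame p k V F \<nu>" and x: "x \<in> V" and \<beta>: "\<beta> < k"
  shows "normal_conn_coeff k V F \<nu> i \<alpha> \<beta> x =
    (\<Sum>l\<in>UNIV. matrix_inv (frame_matrix \<sigma> (\<lambda>a. differential F x (axis a 1)) (\<lambda>\<gamma>. \<nu> \<gamma> x)) $ inv \<sigma> (Inr \<beta>) $ l *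
      weak_pderiv V i (\<nu> \<alpha>) x $ l)"
proof -
  have N: "inj_on (\<lambda>\<alpha>. \<nu> \<alpha> x) {..<k}" "independent ((\<lambda>\<alpha>. \<nu> \<alpha> x) ` {..<k})"
    "span ((\<lambda>\<alpha>. \<nu> \<alpha> x) ` {..<k}) = normal_space F x" using \<nu> x by (auto simp: normal_frame_def)
  show ?thesis
    unfolding normal_conn_coeff_def normal_conn_def flat_conn_coord_field
      normal_component_representation[OF \<sigma> F N \<beta>] matrix_vector_mult_def by simp
qed

text \<open>The given frames are arbitrary, not the adjugate ones. Together with the tangent vectors
  they form frame matrices that converge and are invertible, and these turn the coefficients into
  inverse entries times weak derivatives of the frame vectors.\<close>

theorem weak_conv_normal_conn_coeff:
  fixes F :: "nat \<Rightarrow> real^'n \<Rightarrow> real^'d"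
  assumes card: "CARD('d) = CARD('n) + k" and p: "real CARD('n) < p" and V: "open V"
    and lin: "\<And>j x. x \<in> V \<Longrightarrow> linear (differential (F j) x)" "\<And>x. x \<in> V \<Longrightarrow> linear (differential Fl x)"
    and inj: "\<And>j x. x \<in> V \<Longrightarrow> inj (differential (F j) x)" "\<And>x. x \<in> V \<Longrightarrow> inj (differential Fl x)"
    and D: "\<And>a. cw_conv p V (\<lambda>j x. differential (F j) x (axis a 1)) (\<lambda>x. differential Fl x (axis a 1))"
    and fr: "converging_normal_frames p k V F Fl \<nu> \<nu>l" and \<alpha>: "\<alpha> < k" and \<beta>: "\<beta> < k"
  shows "weak_conv_Lp_loc p V (\<lambda>j. normal_conn_coeff k V (F j) (\<nu> j) i \<alpha> \<beta>) (normal_conn_coeff k V Fl \<nu>l i \<alpha> \<beta>)"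
proof -
  have p1: "1 < p" using p by (rule dim_exponent_gt_1)
  obtain \<sigma> :: "'d \<Rightarrow> 'n + nat" where \<sigma>: "bij_betw \<sigma> UNIV (frame_indices k)"
    using frame_indices_bij[OF card] by blast
  have nf: "\<forall>\<^sub>F j in sequentially. normal_frame p k V (F j) (\<nu> j)" "normal_frame p k V Fl \<nu>l"
    using fr by (auto simp: converging_normal_frames_def)
  have N: "cw_conv p V (\<lambda>j. \<nu> j \<gamma>) (\<nu>l \<gamma>)" if "\<gamma> < k" for \<gamma>
    unfolding cw_conv_def using fr that
    by (auto simp: converging_normal_frames_def normal_frame_def elim!: eventually_mono)
  define M where "M H N x = frame_matrix \<sigma> (\<lambda>a. differential H x (axis a 1)) (\<lambda>\<gamma>. N \<gamma> x)"
    for H :: "real^'n \<Rightarrow> real^'d" and N :: "nat \<Rightarrow> real^'n \<Rightarrow> real^'d" and x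
  have M: "cw_conv p V (\<lambda>j. M (F j) (\<nu> j)) (M Fl \<nu>l)"
    unfolding M_def by (rule cw_conv_frame_matrix[OF p1 V \<sigma> D N])
  have nz: "det (M H N x) \<noteq> 0"
    if "normal_frame p k V H N" "linear (differential H x)" "inj (differential H x)" "x \<in> V" for H N x
  proof -
    have N': "inj_on (\<lambda>\<alpha>. N \<alpha> x) {..<k}" "independent ((\<lambda>\<alpha>. N \<alpha> x) ` {..<k})"
      "span ((\<lambda>\<alpha>. N \<alpha> x) ` {..<k}) = normal_space H x" using that by (auto simp: normal_frame_def)
    have "(\<lambda>\<alpha>. N \<alpha> x) ` {..<k} \<subseteq> orthogonal_comp (range (differential H x))"
      using N'(3) span_superset[of "(\<lambda>\<alpha>. N \<alpha> x) ` {..<k}"] by (simp add: normal_space_def)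
    then show ?thesis
      unfolding M_def by (rule frame_matrix_det_nz[OF \<sigma> that(2,3) N'(1,2)])
  qed
  have ev_nz: "\<forall>\<^sub>F j in sequentially. \<forall>x\<in>V. det (M (F j) (\<nu> j) x) \<noteq> 0"
    using nf(1) by (rule eventually_mono) (use nz lin inj in blast)
  have nzl: "det (M Fl \<nu>l x) \<noteq> 0" if "x \<in> V" for x using nz[OF nf(2)] lin inj that by blast
  have lin_l: "linear (\<lambda>v :: real^'d. v $ l)" for l by (simp add: linear_iff)
  have "weak_conv_Lp_loc p V
      (\<lambda>j x. \<Sum>l\<in>UNIV. matrix_inv (M (F j) (\<nu> j) x) $ inv \<sigma> (Inr \<beta>) $ l * weak_pderiv V i (\<nu> j \<alpha>) x $ l)
      (\<lambda>x. \<Sum>l\<in>UNIV. matrix_inv (M Fl \<nu>l x) $ inv \<sigma> (Inr \<beta>) $ l * weak_pderiv V i (\<nu>l \<alpha>) x $ l)"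
    by (intro weak_conv_Lp_loc_sum[OF p1] weak_conv_Lp_loc_matrix_inv_mult[OF p V M ev_nz nzl]
        weak_conv_Lp_loc_linear[OF p1 cw_conv_weak_conv_pderiv[OF N[OF \<alpha>]] lin_l]) simp
  then show ?thesis
  proof (rule weak_conv_Lp_loc_cong_AE)
    have eq: "AE x in lebesgue. x \<in> V \<longrightarrow>
      (\<Sum>l\<in>UNIV. matrix_inv (M H N x) $ inv \<sigma> (Inr \<beta>) $ l * weak_pderiv V i (N \<alpha>) x $ l) = normal_conn_coeff k V H N i \<alpha> \<beta> x"
      if "normal_frame p k V H N" "\<And>x. x \<in> V \<Longrightarrow> linear (differential H x)" "\<And>x. x \<in> V \<Longrightarrow> inj (differential H x)" for H N
      using normal_conn_coeff_eq[OF \<sigma> that(2,3,1) _ \<beta>, of _ i \<alpha>] by (simp add: M_def)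
    show "\<forall>\<^sub>F j in sequentially. AE x in lebesgue. x \<in> V \<longrightarrow>
      (\<Sum>l\<in>UNIV. matrix_inv (M (F j) (\<nu> j) x) $ inv \<sigma> (Inr \<beta>) $ l * weak_pderiv V i (\<nu> j \<alpha>) x $ l) =
        normal_conn_coeff k V (F j) (\<nu> j) i \<alpha> \<beta> x"
      using nf(1) by (rule eventually_mono) (rule eq[OF _ lin(1) inj(1)])
    show "AE x in lebesgue. x \<in> V \<longrightarrow>
      (\<Sum>l\<in>UNIV. matrix_inv (M Fl \<nu>l x) $ inv \<sigma> (Inr \<beta>) $ l * weak_pderiv V i (\<nu>l \<alpha>) x $ l) = normal_conn_coeff k V Fl \<nu>l i \<alpha> \<beta> x"
      using nf(2) lin(2) inj(2) by (rule eq)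
  qed
qed

lemma positive_definite_det_nz:
  fixes A :: "real^'n^'n"
  assumes "\<And>v. v \<noteq> 0 \<Longrightarrow> v \<bullet> (A *v v) > 0"
  shows "det A \<noteq> 0"
proof -
  have "v = 0" if "A *v v = 0" for v using assms[of v] that by force
  then have "inj ((*v) A)" by (auto simp: linear_injective_0)
  then show ?thesis
    by (simp add: invertible_det_nz[symmetric] invertible_left_inverse matrix_left_invertible_injective)
qed

theorem theorem7p1:
  fixes A :: "('m::{t2_space, second_countable_topology}, 'n::finite) chart set"
    and g :: "nat \<Rightarrow> ('m, 'n) tensor2" and g0 :: "('m, 'n) tensor2"
    and f :: "nat \<Rightarrow> 'm \<Rightarrow> real^'d::finite"
    and p :: real and k :: nat
  assumes "CARD('d) = CARD('n) + k"
    and "p > real CARD('n)"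
    and "smooth_atlas A"
    and "simply_connected (UNIV :: 'm set)"
    and "\<And>j. riemannian_metric A (g j)"
    and "\<And>j. sobolev_loc_tensor2 1 p A (g j)"
    and "riemannian_metric A g0"
    and "strong_conv_sobolev_loc_tensor2 1 p A g g0"
    and "\<And>j. isometric_immersion A (g j) (f j)"
    and "\<And>j. sobolev_loc_map 2 p A (f j)"
    and "\<exists>F. weak_conv_sobolev_loc_map 2 p A f F"
  shows "\<exists>r fbar. strict_mono (r :: nat \<Rightarrow> nat) \<and>
           weak_conv_sobolev_loc_map 2 p A (\<lambda>j. f (r j)) fbar \<and>
           isometric_immersion A g0 fbar \<and>
           weak_conv_second_fundamental_forms p A (\<lambda>j. g (r j)) (\<lambda>j. f (r j)) g0 fbar \<and>
           weak_conv_normal_conns p k A (\<lambda>j. f (r j)) fbar"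
proof -
  note card = assms(1) and p = assms(2)
  have p1: "1 < p" using p by (rule dim_exponent_gt_1)
  obtain Fw where Fw: "weak_conv_sobolev_loc_map 2 p A f Fw" using assms(11) by blast
  \<comment> \<open>Being independent of the chart, this limit reads in every chart as the pointwise
    limit that \<open>immersion_limit\<close> produces.\<close>
  define fbar where "fbar m = lim (\<lambda>j. f j m)" for m
  have \<Omega>: "open (chart_im c)" if "c \<in> A" for c using assms(3) that by (auto simp: smooth_atlas_def)
  have C1: "Ck_on 1 (chart_im c) (in_chart c (f j))" if "c \<in> A" for c j
    using assms(9)[of j] that by (auto simp: isometric_immersion_def)
  have inj: "inj (differential (in_chart c (f j)) x)" if "c \<in> A" "x \<in> chart_im c" for c j x
    using assms(9)[of j] that by (auto simp: isometric_immersion_def)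
  have iso: "differential (in_chart c (f j)) x u \<bullet> differential (in_chart c (f j)) x v = u \<bullet> (g j c x *v v)"
    if "c \<in> A" "x \<in> chart_im c" for c j x u v
    using assms(9)[of j] that by (auto simp: isometric_immersion_def)
  have G: "cw_conv p (chart_im c) (\<lambda>j. g j c) (g0 c)" if "c \<in> A" for c
    unfolding cw_conv_def
  proof (intro conjI strong_imp_weak_conv_sobolev_loc[OF p1])
    show "\<forall>\<^sub>F j in sequentially. continuous_on (chart_im c) (g j c)"
      using assms(5) that by (simp add: riemannian_metric_def)
    show "continuous_on (chart_im c) (g0 c)" using assms(7) that by (simp add: riemannian_metric_def)
    show "strong_conv_sobolev_loc 1 p (chart_im c) (\<lambda>j. g j c) (g0 c)"
      using assms(8) that by (simp add: strong_conv_sobolev_loc_tensor2_def)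
  qed
  have pos: "v \<bullet> (g0 c x *v v) > 0" if "c \<in> A" "x \<in> chart_im c" "v \<noteq> 0" for c x v
    using assms(7) that by (simp add: riemannian_metric_def)
  have nz0: "det (g0 c x) \<noteq> 0" if "c \<in> A" "x \<in> chart_im c" for c x
    using pos that by (intro positive_definite_det_nz) auto
  have nz: "det (g j c x) \<noteq> 0" if "c \<in> A" "x \<in> chart_im c" for j c x
    using assms(5)[of j] that by (intro positive_definite_det_nz) (simp add: riemannian_metric_def)
  have fbar: "in_chart c fbar = (\<lambda>x. lim (\<lambda>j. in_chart c (f j) x))" for c :: "('m, 'n) chart"
    by (simp add: in_chart_def fbar_def o_def)
  have wc: "weak_conv_sobolev_loc 2 p (chart_im c) (\<lambda>j. in_chart c (f j)) (in_chart c Fw)" if "c \<in> A" for c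
    using Fw that by (simp add: weak_conv_sobolev_loc_map_def)
  have W2: "weak_conv_sobolev_loc 2 p (chart_im c) (\<lambda>j. in_chart c (f j)) (in_chart c fbar)" if "c \<in> A" for c
    unfolding fbar by (rule immersion_limit(1)[OF p \<Omega>[OF that] C1[OF that] wc[OF that]])
  have C1bar: "Ck_on 1 (chart_im c) (in_chart c fbar)" if "c \<in> A" for c
    unfolding fbar by (rule immersion_limit(2)[OF p \<Omega>[OF that] C1[OF that] wc[OF that]])
  have D: "cw_conv p (chart_im c) (\<lambda>j x. differential (in_chart c (f j)) x (axis a 1))
      (\<lambda>x. differential (in_chart c fbar) x (axis a 1))" if "c \<in> A" for c a
    unfolding fbar by (rule immersion_limit(3)[OF p \<Omega>[OF that] C1[OF that] wc[OF that]])
  have Dlim: "(\<lambda>j. differential (in_chart c (f j)) x v) \<longlonglongrightarrow> differential (in_chart c fbar) x v"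
    if c: "c \<in> A" and x: "x \<in> chart_im c" for c x v
  proof -
    have "(\<lambda>j. differential (in_chart c (f j)) x (axis a 1)) \<longlonglongrightarrow> differential (in_chart c fbar) x (axis a 1)" for a
      by (rule tendsto_uniform_limitI[OF cw_conv_uniform_limit[OF p \<Omega>[OF c] D[OF c], of "{x}"]]) (use x in auto)
    then show ?thesis
      unfolding Ck_on_1D(3)[OF C1[OF c] x, of _ v] Ck_on_1D(3)[OF C1bar[OF c] x, of v] by (intro tendsto_intros)
  qed
  have isobar: "differential (in_chart c fbar) x u \<bullet> differential (in_chart c fbar) x v = u \<bullet> (g0 c x *v v)"
    if c: "c \<in> A" and x: "x \<in> chart_im c" for c x u v
  proof (rule LIMSEQ_unique)
    show "(\<lambda>j. differential (in_chart c (f j)) x u \<bullet> differential (in_chart c (f j)) x v) \<longlonglongrightarrow>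
        differential (in_chart c fbar) x u \<bullet> differential (in_chart c fbar) x v"
      by (intro tendsto_inner Dlim c x)
    have "(\<lambda>j. g j c x) \<longlonglongrightarrow> g0 c x"
      by (rule tendsto_uniform_limitI[OF cw_conv_uniform_limit[OF p \<Omega>[OF c] G[OF c], of "{x}"]]) (use x in auto)
    then have "(\<lambda>j. \<chi> i. \<Sum>l\<in>UNIV. g j c x $ i $ l * v $ l) \<longlonglongrightarrow> (\<chi> i. \<Sum>l\<in>UNIV. g0 c x $ i $ l * v $ l)"
      by (intro tendsto_intros)
    then have "(\<lambda>j. u \<bullet> (g j c x *v v)) \<longlonglongrightarrow> u \<bullet> (g0 c x *v v)"
      unfolding matrix_vector_mult_def by (rule tendsto_inner[OF tendsto_const])
    then show "(\<lambda>j. differential (in_chart c (f j)) x u \<bullet> differential (in_chart c (f j)) x v) \<longlonglongrightarrow> u \<bullet> (g0 c x *v v)"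
      by (simp add: iso c x)
  qed
  \<comment> \<open>A limit of injective linear maps may degenerate; here the isometry relation and
    the positivity of \<open>g0\<close> exclude a kernel.\<close>
  have injbar: "inj (differential (in_chart c fbar) x)" if c: "c \<in> A" and x: "x \<in> chart_im c" for c x
    unfolding linear_injective_0[OF Ck_on_1D(2)[OF C1bar[OF c] x]]
  proof (intro allI impI)
    fix v assume "differential (in_chart c fbar) x v = 0"
    then have "v \<bullet> (g0 c x *v v) = 0" using isobar[OF c x, of v v] by simp
    then show "v = 0" using pos[OF c x, of v] by force
  qed
  have "weak_conv_sobolev_loc_map 2 p A f fbar"
    using W2 by (simp add: weak_conv_sobolev_loc_map_def)
  moreover have "isometric_immersion A g0 fbar"
    unfolding isometric_immersion_def using C1bar injbar isobar by blast
  moreover have "weak_conv_second_fundamental_forms p A g f g0 fbar"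
    unfolding weak_conv_second_fundamental_forms_def
    by (intro ballI allI weak_conv_second_fundamental_form[OF p] \<Omega> G nz nz0 C1 C1bar D)
  moreover have "weak_conv_normal_conns p k A f fbar"
    unfolding weak_conv_normal_conns_def
  proof (intro ballI conjI allI impI)
    fix c x assume "c \<in> A" "x \<in> chart_im c"
    then show "\<exists>V \<nu> \<nu>0. open V \<and> x \<in> V \<and> V \<subseteq> chart_im c \<and>
        converging_normal_frames p k V (\<lambda>j. in_chart c (f j)) (in_chart c fbar) \<nu> \<nu>0"
      by (intro converging_normal_frames_exist[OF card p] \<Omega> C1 C1bar inj injbar D)
  next
    fix c V \<nu> \<nu>0 a \<alpha> \<beta>
    assume c: "c \<in> A" and V: "open V \<and> V \<subseteq> chart_im c \<and>
        converging_normal_frames p k V (\<lambda>j. in_chart c (f j)) (in_chart c fbar) \<nu> \<nu>0" and "\<alpha> < k" "\<beta> < k"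
    then have V': "open V" "V \<subseteq> chart_im c" by auto
    show "weak_conv_Lp_loc p V (\<lambda>j. normal_conn_coeff k V (in_chart c (f j)) (\<nu> j) a \<alpha> \<beta>)
        (normal_conn_coeff k V (in_chart c fbar) \<nu>0 a \<alpha> \<beta>)"
    proof (rule weak_conv_normal_conn_coeff[OF card p V'(1)])
      fix x j assume "x \<in> V"
      then have x: "x \<in> chart_im c" using V' by blast
      show "linear (differential (in_chart c (f j)) x)" "linear (differential (in_chart c fbar) x)"
        using Ck_on_1D(2) C1[OF c] C1bar[OF c] x by blast+
      show "inj (differential (in_chart c (f j)) x)" "inj (differential (in_chart c fbar) x)"
        using inj injbar c x by blast+
    next
      show "cw_conv p V (\<lambda>j x. differential (in_chart c (f j)) x (axis b 1)) (\<lambda>x. differential (in_chart c fbar) x (axis b 1))" for b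
        by (rule cw_conv_subset[OF D[OF c] V'])
    qed (use V \<open>\<alpha> < k\<close> \<open>\<beta> < k\<close> in auto)
  qed
  ultimately show ?thesis
    by (intro exI[of _ "\<lambda>j. j"] exI[of _ fbar]) (simp add: strict_mono_def)
qed

end
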